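(* Let $a \ge 0$ and $b > 0$. If $\gamma > 2^*/2$ and \[ a^{\gamma-2^*/2}\, b^{2^*/2-1} > \frac{(\gamma - 2^*/2)^{\gamma-2^*/2}\, (2^*/2 - 1)^{2^*/2-1}}{(\gamma - 1)^{\gamma-1}}\, S^{-(2^*/2)(\gamma-1)}, \] then for any $\lambda > 0$ the functional \[ J(u) = \frac{a}{2} \int_\Omega |\nabla u|^2\, dx + \frac{b}{2\gamma} \left(\int_\Omega |\nabla u|^2\, dx\right)^\gamma - \frac{\lambda}{2} \int_\Omega u^2\, dx - \frac{1}{2^*} \int_\Omega |u|^{2^*} dx, \quad u \in H^1_0(\Omega), \] satisfies the $(\mathrm{PS})_c$ condition for all $c \in \mathbb{R}$.
   Context: $\Omega$ is a bounded domain in $\mathbb{R}^N$, $N \ge 3$, and $2^* = 2N/(N-2)$. $H^1_0(\Omega)$ is normed by $\|u\|^2 = \int_\Omega |\nabla u|^2\, dx$. The best Sobolev constant is $S = \inf_{u \in H^1_0(\Omega) \setminus \{0\}} \int_\Omega |\nabla u|^2\, dx \big/ \left(\int_\Omega |u|^{2^*} dx\right)^{2/2^*}$. A $C^1$-functional $J$ on $H^1_0(\Omega)$ satisfies the $(\mathrm{PS})_c$ condition ($c \in \mathbb{R}$) if every sequence $(u_j)$ in $H^1_0(\Omega)$ with $J(u_j) \to c$ and $J'(u_j) \to 0$ has a strongly convergent subsequence. *)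

theory Defs
  imports "HOL-Analysis.Analysis"
begin

text \<open>
  Elements of the function spaces on an open set \<open>\<Omega>\<close> are represented by functions on the whole
  space of which only the values on \<open>\<Omega>\<close>, up to Lebesgue null sets, matter. Thus equality in
  the spaces is equality almost everywhere on \<open>\<Omega>\<close>, and the norms below are seminorms on
  representatives.
\<close>

primrec Ck :: "nat \<Rightarrow> ('a::euclidean_space \<Rightarrow> real) \<Rightarrow> bool" where
  "Ck 0 f \<longleftrightarrow> continuous_on UNIV f"
| "Ck (Suc k) f \<longleftrightarrow> f differentiable_on UNIV \<and>
     (\<forall>i\<in>Basis. Ck k (\<lambda>x. frechet_derivative f (at x) i))"

definition test_functions :: "'a::euclidean_space set \<Rightarrow> ('a \<Rightarrow> real) set" where
  "test_functions \<Omega> =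
     {\<phi>. (\<forall>k. Ck k \<phi>) \<and> compact (closure {x. \<phi> x \<noteq> 0}) \<and> closure {x. \<phi> x \<noteq> 0} \<subseteq> \<Omega>}"

definition L2 :: "'a::euclidean_space set \<Rightarrow> ('a \<Rightarrow> 'b::euclidean_space) set" where
  "L2 \<Omega> = {f. f \<in> borel_measurable (lebesgue_on \<Omega>) \<and>
              integrable (lebesgue_on \<Omega>) (\<lambda>x. (norm (f x))\<^sup>2)}"

definition locally_integrable ::
    "'a::euclidean_space set \<Rightarrow> ('a \<Rightarrow> 'b::euclidean_space) \<Rightarrow> bool" where
  "locally_integrable \<Omega> f \<longleftrightarrow>
     (\<forall>K. compact K \<and> K \<subseteq> \<Omega> \<longrightarrow> integrable (lebesgue_on K) f)"

definition has_weak_gradient ::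
    "'a::euclidean_space set \<Rightarrow> ('a \<Rightarrow> real) \<Rightarrow> ('a \<Rightarrow> 'a) \<Rightarrow> bool" where
  "has_weak_gradient \<Omega> u G \<longleftrightarrow> locally_integrable \<Omega> u \<and> locally_integrable \<Omega> G \<and>
     (\<forall>\<phi>\<in>test_functions \<Omega>. \<forall>i\<in>Basis.
        (\<integral>x. u x * frechet_derivative \<phi> (at x) i \<partial>lebesgue_on \<Omega>)
        = - (\<integral>x. (G x \<bullet> i) * \<phi> x \<partial>lebesgue_on \<Omega>))"

text \<open>For open \<open>\<Omega>\<close> the weak gradient is unique up to a null set, so the choice is immaterial.\<close>

definition weak_gradient :: "'a::euclidean_space set \<Rightarrow> ('a \<Rightarrow> real) \<Rightarrow> 'a \<Rightarrow> 'a" where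
  "weak_gradient \<Omega> u = (SOME G. has_weak_gradient \<Omega> u G)"

definition dirichlet_integral :: "'a::euclidean_space set \<Rightarrow> ('a \<Rightarrow> real) \<Rightarrow> real" where
  "dirichlet_integral \<Omega> u = (\<integral>x. (norm (weak_gradient \<Omega> u x))\<^sup>2 \<partial>lebesgue_on \<Omega>)"

definition H1 :: "'a::euclidean_space set \<Rightarrow> ('a \<Rightarrow> real) set" where
  "H1 \<Omega> = {u \<in> L2 \<Omega>. \<exists>G\<in>L2 \<Omega>. has_weak_gradient \<Omega> u G}"

definition H1_norm :: "'a::euclidean_space set \<Rightarrow> ('a \<Rightarrow> real) \<Rightarrow> real" where
  "H1_norm \<Omega> u = sqrt ((\<integral>x. (u x)\<^sup>2 \<partial>lebesgue_on \<Omega>) + dirichlet_integral \<Omega> u)"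

text \<open>The closure of the test functions in \<open>H1 \<Omega>\<close>.\<close>

definition H10 :: "'a::euclidean_space set \<Rightarrow> ('a \<Rightarrow> real) set" where
  "H10 \<Omega> = {u \<in> H1 \<Omega>. \<exists>\<phi>::nat \<Rightarrow> 'a \<Rightarrow> real. (\<forall>n. \<phi> n \<in> test_functions \<Omega>) \<and>
               (\<lambda>n. H1_norm \<Omega> (\<lambda>x. u x - \<phi> n x)) \<longlonglongrightarrow> 0}"

definition H10_norm :: "'a::euclidean_space set \<Rightarrow> ('a \<Rightarrow> real) \<Rightarrow> real" where
  "H10_norm \<Omega> u = sqrt (dirichlet_integral \<Omega> u)"

text \<open>Boundedness makes the functionals respect almost everywhere equality.\<close>

definition H10_dual :: "'a::euclidean_space set \<Rightarrow> (('a \<Rightarrow> real) \<Rightarrow> real) set" where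
  "H10_dual \<Omega> = {L.
     (\<forall>u\<in>H10 \<Omega>. \<forall>v\<in>H10 \<Omega>. L (\<lambda>x. u x + v x) = L u + L v) \<and>
     (\<forall>c. \<forall>u\<in>H10 \<Omega>. L (\<lambda>x. c * u x) = c * L u) \<and>
     (\<exists>K. \<forall>u\<in>H10 \<Omega>. \<bar>L u\<bar> \<le> K * H10_norm \<Omega> u)}"

definition H10_dual_norm ::
    "'a::euclidean_space set \<Rightarrow> (('a \<Rightarrow> real) \<Rightarrow> real) \<Rightarrow> real" where
  "H10_dual_norm \<Omega> L = Sup {\<bar>L v\<bar> | v. v \<in> H10 \<Omega> \<and> H10_norm \<Omega> v \<le> 1}"

definition H10_has_derivative ::
    "'a::euclidean_space set \<Rightarrow> (('a \<Rightarrow> real) \<Rightarrow> real) \<Rightarrow> (('a \<Rightarrow> real) \<Rightarrow> real) \<Rightarrow>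
     ('a \<Rightarrow> real) \<Rightarrow> bool" where
  "H10_has_derivative \<Omega> J L u \<longleftrightarrow> L \<in> H10_dual \<Omega> \<and>
     (\<forall>\<epsilon>>0. \<exists>\<delta>>0. \<forall>v\<in>H10 \<Omega>. H10_norm \<Omega> v < \<delta> \<longrightarrow>
        \<bar>J (\<lambda>x. u x + v x) - J u - L v\<bar> \<le> \<epsilon> * H10_norm \<Omega> v)"

text \<open>The Frechet derivative is unique as a functional on \<open>H10 \<Omega>\<close>.\<close>

definition H10_derivative ::
    "'a::euclidean_space set \<Rightarrow> (('a \<Rightarrow> real) \<Rightarrow> real) \<Rightarrow> ('a \<Rightarrow> real) \<Rightarrow>
     ('a \<Rightarrow> real) \<Rightarrow> real" where
  "H10_derivative \<Omega> J u = (SOME L. H10_has_derivative \<Omega> J L u)"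

definition H10_C1 :: "'a::euclidean_space set \<Rightarrow> (('a \<Rightarrow> real) \<Rightarrow> real) \<Rightarrow> bool" where
  "H10_C1 \<Omega> J \<longleftrightarrow>
     (\<forall>u\<in>H10 \<Omega>. \<exists>L. H10_has_derivative \<Omega> J L u) \<and>
     (\<forall>u\<in>H10 \<Omega>. \<forall>\<epsilon>>0. \<exists>\<delta>>0. \<forall>w\<in>H10 \<Omega>. H10_norm \<Omega> (\<lambda>x. w x - u x) < \<delta> \<longrightarrow>
        H10_dual_norm \<Omega> (\<lambda>v. H10_derivative \<Omega> J w v - H10_derivative \<Omega> J u v) < \<epsilon>)"

text \<open>
  The condition is a notion for \<open>C\<^sup>1\<close> functionals only; \<open>H10_C1\<close> is made part of it, since
  without differentiability the convergence of the derivatives would be meaningless.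
\<close>

definition PS_condition ::
    "'a::euclidean_space set \<Rightarrow> (('a \<Rightarrow> real) \<Rightarrow> real) \<Rightarrow> real \<Rightarrow> bool" where
  "PS_condition \<Omega> J c \<longleftrightarrow> H10_C1 \<Omega> J \<and>
     (\<forall>u::nat \<Rightarrow> 'a \<Rightarrow> real.
        (\<forall>j. u j \<in> H10 \<Omega>) \<and> (\<lambda>j. J (u j)) \<longlonglongrightarrow> c \<and>
        (\<lambda>j. H10_dual_norm \<Omega> (H10_derivative \<Omega> J (u j))) \<longlonglongrightarrow> 0 \<longrightarrow>
        (\<exists>w\<in>H10 \<Omega>. \<exists>r. strict_mono r \<and>
           (\<lambda>j. H10_norm \<Omega> (\<lambda>x. u (r j) x - w x)) \<longlonglongrightarrow> 0))"

definition crit_exp :: "nat \<Rightarrow> real" where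
  "crit_exp N = 2 * real N / (real N - 2)"

definition sobolev_const :: "'a::euclidean_space set \<Rightarrow> real" where
  "sobolev_const \<Omega> =
     Inf {dirichlet_integral \<Omega> u /
            (\<integral>x. \<bar>u x\<bar> powr crit_exp DIM('a) \<partial>lebesgue_on \<Omega>) powr (2 / crit_exp DIM('a))
          | u. u \<in> H10 \<Omega> \<and> \<not> (AE x in lebesgue_on \<Omega>. u x = 0)}"

definition kirchhoff_functional ::
    "'a::euclidean_space set \<Rightarrow> real \<Rightarrow> real \<Rightarrow> real \<Rightarrow> real \<Rightarrow> ('a \<Rightarrow> real) \<Rightarrow> real" where
  "kirchhoff_functional \<Omega> a b \<gamma> lam u =
     a / 2 * dirichlet_integral \<Omega> u
     + b / (2 * \<gamma>) * dirichlet_integral \<Omega> u powr \<gamma>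
     - lam / 2 * (\<integral>x. (u x)\<^sup>2 \<partial>lebesgue_on \<Omega>)
     - 1 / crit_exp DIM('a) * (\<integral>x. \<bar>u x\<bar> powr crit_exp DIM('a) \<partial>lebesgue_on \<Omega>)"

end

theory Submission
  imports Defs "HOL-Library.Diagonal_Subsequence"
begin

text \<open>
  Write \<open>p\<close> for the critical exponent, \<open>\<parallel>u\<parallel>\<^sup>2\<close> for the Dirichlet integral and \<open>S\<close> for the Sobolev
  constant. Since \<open>\<gamma> > p / 2 > 1\<close>, the functional is coercive, so a Palais--Smale sequence is bounded.
  By Rellich's theorem a subsequence \<open>u j\<close> converges in \<open>L\<^sup>2\<close>, almost everywhere and weakly to some
  \<open>v\<close>; put \<open>w j = u j - v\<close> and let \<open>X\<close> be the limit of \<open>\<parallel>w j\<parallel>\<^sup>2\<close> along a further subsequence. Testing the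
  derivative at \<open>u j\<close> with \<open>w j\<close> and splitting the critical term as in the Brezis--Lieb lemma gives
  \<open>(a + b * (X + \<parallel>v\<parallel>\<^sup>2) powr (\<gamma> - 1)) * X \<le> S powr (- p / 2) * X powr (p / 2)\<close>. By the weighted
  inequality of arithmetic and geometric means the hypothesis on \<open>a\<close> and \<open>b\<close> says exactly that
  \<open>S powr (- p / 2) * X powr (p / 2) < (a + b * X powr (\<gamma> - 1)) * X\<close> for all \<open>X > 0\<close>, so \<open>X = 0\<close>.

  Both the positivity of \<open>S\<close> and Rellich's theorem rest on one estimate: on a partition of space into
  cubes of side \<open>\<epsilon>\<close>, the \<open>L\<^sup>2\<close> distance of a function to its cell averages is at most a constant times
  \<open>\<epsilon> * \<parallel>u\<parallel>\<close>. It contains Nash's inequality, from which the Sobolev inequality follows by truncation.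
\<close>

subsection \<open>Square-integrable functions\<close>

text \<open>The obstacle is the nonlocal coefficient
  \<open>a + b * ((hnorm u)\<^sup>2) powr (\<gamma> - 1)\<close>. Along the sequence it tends to its
  value for the squared norm \<open>X + (hnorm v)\<^sup>2\<close>, not to its value at v, so the
  weak limit v need not solve the equation that the \<open>u j\<close> nearly solve, and an energy
  splitting at a critical point is not at hand. The derivative is therefore tested with
  \<open>u j - v\<close> only, and of the coefficient nothing but its monotonicity in the Dirichlet
  integral is used, which discards the share of v. The constant in the hypothesis comes from the
  weights: with \<open>q = p / 2\<close>, the weights \<open>(\<gamma> - q) / (\<gamma> - 1)\<close>
  and \<open>(q - 1) / (\<gamma> - 1)\<close> on \<open>a\<close> and
  \<open>b * X powr (\<gamma> - 1)\<close> produce the power \<open>X powr (q - 1)\<close>, so X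
  cancels. A second concern runs through the whole development: functions are representatives and
  gradients are chosen by \<open>SOME\<close>, so identities between gradients hold almost
  everywhere only.\<close>

definition square_integrable :: "'m measure \<Rightarrow> ('m \<Rightarrow> 'b::euclidean_space) \<Rightarrow> bool" where
  "square_integrable M f \<longleftrightarrow>
     f \<in> borel_measurable M \<and> integrable M (\<lambda>x. (norm (f x))\<^sup>2)"

definition l2inner :: "'m measure \<Rightarrow> ('m \<Rightarrow> 'b::euclidean_space) \<Rightarrow> ('m \<Rightarrow> 'b) \<Rightarrow> real" where
  "l2inner M f g = (\<integral>x. f x \<bullet> g x \<partial>M)"

definition l2norm :: "'m measure \<Rightarrow> ('m \<Rightarrow> 'b::euclidean_space) \<Rightarrow> real" where
  "l2norm M f = sqrt (\<integral>x. (norm (f x))\<^sup>2 \<partial>M)"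

lemma square_integrableD:
  assumes "square_integrable M f"
  shows "f \<in> borel_measurable M" "integrable M (\<lambda>x. (norm (f x))\<^sup>2)"
  using assms by (auto simp: square_integrable_def)

lemma l2norm_nonneg [simp]: "0 \<le> l2norm M f"
  by (simp add: l2norm_def)

lemma l2norm_squared: "(l2norm M f)\<^sup>2 = (\<integral>x. (norm (f x))\<^sup>2 \<partial>M)"
  by (simp add: l2norm_def)

lemma l2inner_self: "l2inner M f f = (l2norm M f)\<^sup>2"
  by (simp add: l2inner_def l2norm_squared power2_norm_eq_inner)

lemma abs_inner_le_sum_squares: "\<bar>x \<bullet> y\<bar> \<le> (norm x)\<^sup>2 + (norm y)\<^sup>2"
proof -
  have "\<bar>x \<bullet> y\<bar> \<le> norm x * norm y" by (rule Cauchy_Schwarz_ineq2)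
  also have "\<dots> \<le> (norm x)\<^sup>2 + (norm y)\<^sup>2"
    using sum_squares_bound[of "norm x" "norm y"] mult_nonneg_nonneg[of "norm x" "norm y"]
    by (simp del: mult_nonneg_nonneg zero_le_mult_iff)
  finally show ?thesis .
qed

lemma square_integrable_inner:
  assumes "square_integrable M f" "square_integrable M g"
  shows "integrable M (\<lambda>x. f x \<bullet> g x)"
proof (rule Bochner_Integration.integrable_bound)
  show "integrable M (\<lambda>x. (norm (f x))\<^sup>2 + (norm (g x))\<^sup>2)"
    using assms by (auto simp: square_integrable_def)
  show "(\<lambda>x. f x \<bullet> g x) \<in> borel_measurable M"
    using assms by (auto simp: square_integrable_def)
  show "AE x in M. norm (f x \<bullet> g x) \<le> norm ((norm (f x))\<^sup>2 + (norm (g x))\<^sup>2)"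
    using abs_inner_le_sum_squares[of "f _" "g _"] by (auto intro!: AE_I2)
qed

lemma square_integrable_scaleR:
  assumes "square_integrable M f"
  shows "square_integrable M (\<lambda>x. c *\<^sub>R f x)"
proof -
  have "(\<lambda>x. c *\<^sub>R f x) \<in> borel_measurable M"
    using assms by (auto simp: square_integrable_def)
  with assms show ?thesis by (simp add: square_integrable_def power_mult_distrib)
qed

lemma norm_add_squared: "(norm (x + y))\<^sup>2 = (norm x)\<^sup>2 + 2 * (x \<bullet> y) + (norm (y::'b::real_inner))\<^sup>2"
  by (simp add: power2_norm_eq_inner inner_add_left inner_add_right inner_commute[of y x])

lemma square_integrable_add:
  assumes "square_integrable M f" "square_integrable M g"
  shows "square_integrable M (\<lambda>x. f x + g x)"
  using assms square_integrable_inner[OF assms]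
  by (auto simp: square_integrable_def norm_add_squared)

lemma square_integrable_diff:
  assumes "square_integrable M f" "square_integrable M g"
  shows "square_integrable M (\<lambda>x. f x - g x)"
  using square_integrable_add[OF assms(1) square_integrable_scaleR[OF assms(2), of "-1"]] by simp

lemma l2inner_commute: "l2inner M f g = l2inner M g f"
  by (simp add: l2inner_def inner_commute)

lemma l2inner_add_left:
  assumes "square_integrable M f" "square_integrable M g" "square_integrable M h"
  shows "l2inner M (\<lambda>x. f x + g x) h = l2inner M f h + l2inner M g h"
  using square_integrable_inner[OF assms(1,3)] square_integrable_inner[OF assms(2,3)]
  by (simp add: l2inner_def inner_add_left)

lemma l2inner_diff_left:
  assumes "square_integrable M f" "square_integrable M g" "square_integrable M h"
  shows "l2inner M (\<lambda>x. f x - g x) h = l2inner M f h - l2inner M g h"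
  using square_integrable_inner[OF assms(1,3)] square_integrable_inner[OF assms(2,3)]
  by (simp add: l2inner_def inner_diff_left)

lemma l2inner_add_right:
  assumes "square_integrable M f" "square_integrable M g" "square_integrable M h"
  shows "l2inner M h (\<lambda>x. f x + g x) = l2inner M h f + l2inner M h g"
  using l2inner_add_left[OF assms] by (simp add: l2inner_commute)

lemma l2inner_scaleR_left: "l2inner M (\<lambda>x. c *\<^sub>R f x) g = c * l2inner M f g"
  by (simp add: l2inner_def)

lemma l2inner_scaleR_right: "l2inner M g (\<lambda>x. c *\<^sub>R f x) = c * l2inner M g f"
  by (simp add: l2inner_def)

lemma l2norm_scaleR: "l2norm M (\<lambda>x. c *\<^sub>R f x) = \<bar>c\<bar> * l2norm M f"
  by (simp add: l2norm_def power_mult_distrib real_sqrt_mult)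

lemma l2norm_add_squared:
  assumes "square_integrable M f" "square_integrable M g"
  shows "(l2norm M (\<lambda>x. f x + g x))\<^sup>2 = (l2norm M f)\<^sup>2 + 2 * l2inner M f g + (l2norm M g)\<^sup>2"
  using assms square_integrable_inner[OF assms]
  by (simp add: l2norm_squared l2inner_def norm_add_squared square_integrable_def)

lemma l2norm_minus_commute: "l2norm M (\<lambda>x. f x - g x) = l2norm M (\<lambda>x. g x - f x)"
  by (simp add: l2norm_def norm_minus_commute)

lemma l2norm_diff_squared:
  assumes "square_integrable M f" "square_integrable M g"
  shows "(l2norm M (\<lambda>x. f x - g x))\<^sup>2 = (l2norm M f)\<^sup>2 - 2 * l2inner M f g + (l2norm M g)\<^sup>2"
  using l2norm_add_squared[OF assms(1) square_integrable_scaleR[OF assms(2), of "-1"]]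
    l2inner_scaleR_right[of M f "-1" g] l2norm_scaleR[of M "-1" g]
  by simp

lemma l2norm_parallelogram:
  assumes "square_integrable M f" "square_integrable M g"
  shows "(l2norm M (\<lambda>x. f x - g x))\<^sup>2 =
    2 * (l2norm M f)\<^sup>2 + 2 * (l2norm M g)\<^sup>2 - (l2norm M (\<lambda>x. f x + g x))\<^sup>2"
  using assms by (simp add: l2norm_add_squared l2norm_diff_squared)

text \<open>Discriminant of the nonnegative quadratic that sends t to the squared norm of
  \<open>f + t * g\<close>. Where \<open>C = 0\<close> it is affine in t, and its value -1 at
  \<open>t = - (A + 1) / (2 * B)\<close> rules out \<open>B \<noteq> 0\<close>.\<close>

lemma l2_Cauchy_Schwarz:
  assumes f: "square_integrable M f" and g: "square_integrable M g"
  shows "\<bar>l2inner M f g\<bar> \<le> l2norm M f * l2norm M g"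
proof -
  define A B C where "A = (l2norm M f)\<^sup>2" and "B = l2inner M f g" and "C = (l2norm M g)\<^sup>2"
  have quad: "0 \<le> A + 2 * t * B + t\<^sup>2 * C" for t
    using l2norm_add_squared[OF f square_integrable_scaleR[OF g, of t]]
    by (simp add: A_def B_def C_def l2inner_scaleR_right l2norm_scaleR power_mult_distrib)
      (metis mult.assoc zero_le_power2)
  have "B\<^sup>2 \<le> A * C"
  proof (cases "C = 0")
    case True
    have "B = 0"
    proof (rule ccontr)
      assume "B \<noteq> 0"
      then have "2 * (- (A + 1) / (2 * B)) * B = - (A + 1)" by simp
      with quad[of "- (A + 1) / (2 * B)"] True show False by simp
    qed
    with True show ?thesis by simp
  next
    case False
    then have "C > 0" by (simp add: C_def)
    with quad[of "- B / C"] show ?thesis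
      by (simp add: field_simps power2_eq_square)
  qed
  then have "B\<^sup>2 \<le> (l2norm M f * l2norm M g)\<^sup>2"
    by (simp add: A_def C_def power_mult_distrib)
  then show ?thesis
    unfolding B_def by (rule abs_le_square_iff[THEN iffD2, THEN order_trans]) simp
qed

lemma l2norm_triangle:
  assumes f: "square_integrable M f" and g: "square_integrable M g"
  shows "l2norm M (\<lambda>x. f x + g x) \<le> l2norm M f + l2norm M g"
proof (rule power2_le_imp_le)
  show "(l2norm M (\<lambda>x. f x + g x))\<^sup>2 \<le> (l2norm M f + l2norm M g)\<^sup>2"
    using l2norm_add_squared[OF f g] l2_Cauchy_Schwarz[OF f g]
    by (simp add: power2_sum)
qed simp

lemma l2norm_triangle_diff:
  assumes f: "square_integrable M f" and g: "square_integrable M g" and h: "square_integrable M h"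
  shows "l2norm M (\<lambda>x. f x - h x) \<le> l2norm M (\<lambda>x. f x - g x) + l2norm M (\<lambda>x. g x - h x)"
  using l2norm_triangle[OF square_integrable_diff[OF f g] square_integrable_diff[OF g h]] by simp

lemma l2norm_le_diff:
  assumes f: "square_integrable M f" and g: "square_integrable M g"
  shows "\<bar>l2norm M f - l2norm M g\<bar> \<le> l2norm M (\<lambda>x. f x - g x)"
  using l2norm_triangle[OF square_integrable_diff[OF f g] g]
    l2norm_triangle[OF square_integrable_diff[OF g f] f] l2norm_minus_commute[of M f g]
  by simp

lemma square_integrable_cong_AE:
  assumes "square_integrable M f" "g \<in> borel_measurable M" "AE x in M. f x = g x"
  shows "square_integrable M g"
proof -
  have "integrable M (\<lambda>x. (norm (f x))\<^sup>2) \<longleftrightarrow> integrable M (\<lambda>x. (norm (g x))\<^sup>2)"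
    using assms by (intro integrable_cong_AE) (auto simp: square_integrable_def)
  with assms show ?thesis by (auto simp: square_integrable_def)
qed

lemma l2norm_cong_AE:
  assumes "f \<in> borel_measurable M" "g \<in> borel_measurable M" "AE x in M. f x = g x"
  shows "l2norm M f = l2norm M g"
proof -
  have "(\<integral>x. (norm (f x))\<^sup>2 \<partial>M) = (\<integral>x. (norm (g x))\<^sup>2 \<partial>M)"
    using assms by (intro integral_cong_AE) auto
  then show ?thesis by (simp add: l2norm_def)
qed

lemma l2inner_cong_AE:
  assumes "f \<in> borel_measurable M" "g \<in> borel_measurable M" "AE x in M. f x = g x"
    "f' \<in> borel_measurable M" "g' \<in> borel_measurable M" "AE x in M. f' x = g' x"
  shows "l2inner M f f' = l2inner M g g'"
  unfolding l2inner_def using assms by (intro integral_cong_AE) auto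

text \<open>Cauchy--Schwarz against the constant function 1, which is square integrable because the
  measure is finite.\<close>

lemma (in finite_measure) square_integrable_imp_integrable:
  assumes "square_integrable M f"
  shows "integrable M f" and "(\<integral>x. norm (f x) \<partial>M) \<le> sqrt (measure M (space M)) * l2norm M f"
proof -
  have one: "square_integrable M (\<lambda>x. 1::real)"
    by (simp add: square_integrable_def)
  have nf: "square_integrable M (\<lambda>x. norm (f x))"
    using assms by (auto simp: square_integrable_def)
  have "integrable M (\<lambda>x. 1 \<bullet> norm (f x))"
    by (rule square_integrable_inner[OF one nf])
  then show "integrable M f"
    using assms by (simp add: square_integrable_def integrable_norm_iff)
  have "\<bar>l2inner M (\<lambda>x. 1) (\<lambda>x. norm (f x))\<bar> \<le> l2norm M (\<lambda>x. 1::real) * l2norm M (\<lambda>x. norm (f x))"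
    by (rule l2_Cauchy_Schwarz[OF one nf])
  then show "(\<integral>x. norm (f x) \<partial>M) \<le> sqrt (measure M (space M)) * l2norm M f"
    by (simp add: l2inner_def l2norm_def)
qed

text \<open>Riesz--Fischer. A subsequence whose L2 increments lie below \<open>(1/2)^k\<close> has
  summable L1 increments, since the measure is finite; hence it converges almost everywhere, and
  Fatou's lemma turns the Cauchy bounds into L2 convergence.\<close>

lemma (in finite_measure) l2_complete:
  fixes f :: "nat \<Rightarrow> 'a \<Rightarrow> 'b::euclidean_space"
  assumes f: "\<And>n. square_integrable M (f n)"
    and Cauchy: "\<And>e. e > 0 \<Longrightarrow> \<exists>N. \<forall>m\<ge>N. \<forall>n\<ge>N. l2norm M (\<lambda>x. f m x - f n x) < e"
  obtains g where "square_integrable M g" "(\<lambda>n. l2norm M (\<lambda>x. f n x - g x)) \<longlonglongrightarrow> 0"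
proof -
  have "\<exists>N. \<forall>m\<ge>N. \<forall>n\<ge>N. l2norm M (\<lambda>x. f m x - f n x) < (1/2)^k" for k :: nat
    by (rule Cauchy) simp
  then obtain N where N: "\<And>k m n. m \<ge> N k \<Longrightarrow> n \<ge> N k \<Longrightarrow> l2norm M (\<lambda>x. f m x - f n x) < (1/2)^k"
    by metis
  \<comment> \<open>Partial sums dominate all earlier thresholds at once:
    \<open>r k' \<ge> N k\<close> whenever \<open>k \<le> k'\<close>.\<close>
  define r where "r = (\<lambda>k. \<Sum>i\<le>k. N i)"
  have rN: "N k \<le> r k'" if "k \<le> k'" for k k'
    unfolding r_def using that by (intro member_le_sum) auto
  have bf: "f n \<in> borel_measurable M" for n
    using f by (simp add: square_integrable_def)
  have step: "(\<integral>\<^sup>+x. ennreal (norm (f (r (Suc k)) x - f (r k) x)) \<partial>M)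
      \<le> ennreal (sqrt (measure M (space M)) * (1/2)^k)" for k
  proof -
    note d = square_integrable_imp_integrable[OF square_integrable_diff[OF f[of "r (Suc k)"] f[of "r k"]]]
    have "(\<integral>x. norm (f (r (Suc k)) x - f (r k) x) \<partial>M)
        \<le> sqrt (measure M (space M)) * l2norm M (\<lambda>x. f (r (Suc k)) x - f (r k) x)"
      by (rule d(2))
    also have "\<dots> \<le> sqrt (measure M (space M)) * (1/2)^k"
      using N[OF rN rN, of k "Suc k" k] by (intro mult_left_mono) auto
    finally show ?thesis
      by (subst nn_integral_eq_integral) (use d(1) in \<open>auto simp: ennreal_leI\<close>)
  qed
  have "(\<integral>\<^sup>+x. (\<Sum>k. ennreal (norm (f (r (Suc k)) x - f (r k) x))) \<partial>M)
      = (\<Sum>k. \<integral>\<^sup>+x. ennreal (norm (f (r (Suc k)) x - f (r k) x)) \<partial>M)"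
    using bf by (intro nn_integral_suminf) auto
  also have "\<dots> \<le> (\<Sum>k. ennreal (sqrt (measure M (space M)) * (1/2)^k))"
    by (intro suminf_le step) auto
  also have "\<dots> = ennreal (\<Sum>k. sqrt (measure M (space M)) * (1/2)^k)"
    by (intro suminf_ennreal_eq) (auto intro!: summable_sums summable_mult summable_geometric)
  also have "\<dots> < \<infinity>" by simp
  finally have "AE x in M. (\<Sum>k. ennreal (norm (f (r (Suc k)) x - f (r k) x))) \<noteq> \<infinity>"
    using bf by (intro nn_integral_PInf_AE) auto
  then have AEc: "AE x in M. convergent (\<lambda>k. f (r k) x)"
  proof (eventually_elim)
    case (elim x)
    then have "summable (\<lambda>k. norm (f (r (Suc k)) x - f (r k) x))"
      by (intro summable_suminf_not_top) auto
    then have "summable (\<lambda>k. f (r (Suc k)) x - f (r k) x)"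
      by (rule summable_norm_cancel)
    then have "convergent (\<lambda>n. \<Sum>k<n. f (r (Suc k)) x - f (r k) x)"
      by (simp add: summable_iff_convergent)
    then have "convergent (\<lambda>n. f (r n) x - f (r 0) x)"
      using sum_lessThan_telescope[of "\<lambda>k. f (r k) x"] by simp
    then obtain l where "(\<lambda>n. f (r n) x - f (r 0) x) \<longlonglongrightarrow> l"
      by (auto simp: convergent_def)
    from tendsto_add[OF this tendsto_const[of "f (r 0) x"]] show ?case
      by (auto simp: convergent_def)
  qed
  define g where "g x = lim (\<lambda>k. f (r k) x)" for x
  have bg: "g \<in> borel_measurable M"
    unfolding g_def using bf by (intro borel_measurable_lim_metric)
  have lim: "AE x in M. (\<lambda>k. f (r k) x) \<longlonglongrightarrow> g x"
    using AEc by eventually_elim (simp add: g_def convergent_LIMSEQ_iff)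
  \<comment> \<open>Fatou's lemma in the index j: the distance of \<open>f m\<close> to the limit
    inherits the bound that holds for its distances to all late \<open>f (r j)\<close>.\<close>
  have Fatou: "(\<integral>\<^sup>+x. ennreal ((norm (f m x - g x))\<^sup>2) \<partial>M) \<le> ennreal (((1/2)^k)\<^sup>2)" if "m \<ge> N k" for m k
  proof -
    have "(\<integral>\<^sup>+x. ennreal ((norm (f m x - g x))\<^sup>2) \<partial>M)
        = (\<integral>\<^sup>+x. liminf (\<lambda>j. ennreal ((norm (f m x - f (r j) x))\<^sup>2)) \<partial>M)"
    proof (rule nn_integral_cong_AE, use lim in eventually_elim)
      case (elim x)
      have "(\<lambda>j. ennreal ((norm (f m x - f (r j) x))\<^sup>2)) \<longlonglongrightarrow> ennreal ((norm (f m x - g x))\<^sup>2)"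
        using elim by (intro tendsto_ennrealI tendsto_intros)
      from lim_imp_Liminf[OF sequentially_bot this] show ?case by simp
    qed
    also have "\<dots> \<le> liminf (\<lambda>j. \<integral>\<^sup>+x. ennreal ((norm (f m x - f (r j) x))\<^sup>2) \<partial>M)"
      using bf by (intro nn_integral_liminf) auto
    also have "\<dots> \<le> liminf (\<lambda>j::nat. ennreal (((1/2)^k)\<^sup>2))"
    proof (rule Liminf_mono, rule eventually_sequentiallyI[of k])
      fix j assume "k \<le> j"
      have "(\<integral>\<^sup>+x. ennreal ((norm (f m x - f (r j) x))\<^sup>2) \<partial>M) = ennreal ((l2norm M (\<lambda>x. f m x - f (r j) x))\<^sup>2)"
        using square_integrable_diff[OF f f]
        by (subst nn_integral_eq_integral) (auto simp: square_integrable_def l2norm_squared)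
      also have "\<dots> \<le> ennreal (((1/2)^k)\<^sup>2)"
        using N[OF that rN[OF \<open>k \<le> j\<close>]] by (intro ennreal_leI power_mono) auto
      finally show "(\<integral>\<^sup>+x. ennreal ((norm (f m x - f (r j) x))\<^sup>2) \<partial>M) \<le> ennreal (((1/2)^k)\<^sup>2)" .
    qed
    also have "\<dots> = ennreal (((1/2)^k)\<^sup>2)" by (simp add: Liminf_const)
    finally show ?thesis .
  qed
  have sd: "square_integrable M (\<lambda>x. f m x - g x)" if "m \<ge> N k" for m k
    unfolding square_integrable_def
    using bf bg Fatou[OF that] by (auto intro!: integrableI_bounded simp: power2_eq_square[symmetric] abs_of_nonneg intro: le_less_trans)
  have "square_integrable M (\<lambda>x. f (N 0) x - (f (N 0) x - g x))"
    by (intro square_integrable_diff f sd[of 0]) simp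
  then have g: "square_integrable M g" by simp
  have bound: "l2norm M (\<lambda>x. f m x - g x) \<le> (1/2)^k" if "m \<ge> N k" for m k
  proof -
    have "ennreal ((l2norm M (\<lambda>x. f m x - g x))\<^sup>2) \<le> ennreal (((1/2)^k)\<^sup>2)"
      using Fatou[OF that] sd[OF that]
      by (subst (asm) nn_integral_eq_integral) (auto simp: square_integrable_def l2norm_squared)
    then have "(l2norm M (\<lambda>x. f m x - g x))\<^sup>2 \<le> ((1/2)^k)\<^sup>2"
      by (simp add: ennreal_le_iff)
    then show ?thesis by (rule power2_le_imp_le) simp
  qed
  have "(\<lambda>n. l2norm M (\<lambda>x. f n x - g x)) \<longlonglongrightarrow> 0"
  proof (rule LIMSEQ_I)
    fix e :: real assume "e > 0"
    then obtain k where "(1/2)^k < e"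
      using real_arch_pow_inv[of e "1/2"] by auto
    with bound[of k] show "\<exists>no. \<forall>n\<ge>no. norm (l2norm M (\<lambda>x. f n x - g x) - 0) < e"
      by (intro exI[of _ "N k"]) (auto intro: le_less_trans)
  qed
  with g show ?thesis by (rule that)
qed

text \<open>The squared distances tend to 0 in L1, so the subsequence theorem for L1 applies to
  them.\<close>

lemma l2_AE_subseq:
  assumes "\<And>n. square_integrable M (f n)" "square_integrable M g"
    "(\<lambda>n. l2norm M (\<lambda>x. f n x - g x)) \<longlonglongrightarrow> 0"
  obtains r :: "nat \<Rightarrow> nat" where "strict_mono r" "AE x in M. (\<lambda>n. f (r n) x) \<longlonglongrightarrow> g x"
proof -
  have d: "square_integrable M (\<lambda>x. f n x - g x)" for n
    using assms by (intro square_integrable_diff)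
  have "(\<lambda>n. (l2norm M (\<lambda>x. f n x - g x))\<^sup>2) \<longlonglongrightarrow> 0\<^sup>2"
    by (intro tendsto_intros assms)
  then have "(\<lambda>n. \<integral>x. norm ((norm (f n x - g x))\<^sup>2) \<partial>M) \<longlonglongrightarrow> 0"
    by (simp add: l2norm_squared)
  then obtain r :: "nat \<Rightarrow> nat" where r: "strict_mono r" "AE x in M. (\<lambda>n. (norm (f (r n) x - g x))\<^sup>2) \<longlonglongrightarrow> 0"
    using tendsto_L1_AE_subseq[of M "\<lambda>n x. (norm (f n x - g x))\<^sup>2"] d
    by (auto simp: square_integrable_def)
  have "AE x in M. (\<lambda>n. f (r n) x) \<longlonglongrightarrow> g x"
    using r(2)
  proof eventually_elim
    case (elim x)
    then have "(\<lambda>n. norm (f (r n) x - g x)) \<longlonglongrightarrow> 0"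
      using tendsto_real_sqrt[OF elim] by simp
    then show ?case by (simp add: LIM_zero_iff tendsto_norm_zero_iff)
  qed
  with r(1) show ?thesis by (rule that)
qed

text \<open>Bolzano--Weierstrass row by row, then Cantor's diagonal. It later makes countably many
  cell integrals converge at once.\<close>

lemma diagonal_subsequence:
  fixes x :: "nat \<Rightarrow> nat \<Rightarrow> real"
  assumes "\<And>m. \<exists>B. \<forall>j. \<bar>x m j\<bar> \<le> B"
  obtains r :: "nat \<Rightarrow> nat" where "strict_mono r" "\<And>m. convergent (\<lambda>j. x m (r j))"
proof -
  interpret subseqs "\<lambda>m r. convergent (\<lambda>j. x m (r j))"
  proof
    fix m and s :: "nat \<Rightarrow> nat"
    obtain B where "\<forall>j. \<bar>x m j\<bar> \<le> B" using assms by blast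
    then have "bounded (range (\<lambda>j. x m (s j)))"
      by (auto simp: bounded_iff)
    then obtain l r where "strict_mono r" "((\<lambda>j. x m (s j)) \<circ> r) \<longlonglongrightarrow> l"
      using bounded_imp_convergent_subsequence by blast
    then show "\<exists>r'. strict_mono r' \<and> convergent (\<lambda>j. x m ((s \<circ> r') j))"
      by (auto simp: convergent_def o_def)
  qed
  show ?thesis
  proof (rule that[OF subseq_diagseq])
    fix m
    \<comment> \<open>Only the diagonal from position \<open>Suc m\<close> on is a subsequence of
      the m-th selection; the finitely many earlier terms do not affect convergence.\<close>
    have "convergent (\<lambda>j. x m ((diagseq \<circ> ((+) (Suc m))) j))"
    proof (rule diagseq_holds)
      fix n and s :: "nat \<Rightarrow> nat" and r :: "nat \<Rightarrow> nat"
      assume "strict_mono r" "convergent (\<lambda>j. x n (s j))"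
      then show "convergent (\<lambda>j. x n ((s \<circ> r) j))"
        using convergent_subseq_convergent[of "\<lambda>j. x n (s j)" r] by (simp add: o_def)
    qed
    then have "convergent (\<lambda>j. (\<lambda>j. x m (diagseq j)) (j + Suc m))"
      by (simp add: o_def add.commute)
    then show "convergent (\<lambda>j. x m (diagseq j))"
      by (rule convergent_ignore_initial_segment[THEN iffD1])
  qed
qed

subsection \<open>Compactly supported functions of class C1\<close>

text \<open>The gradient is carried as a second argument. The class is C1 rather than smooth because
  the truncations of the Sobolev proof compose with a cutoff that is only C1, and the cell estimate
  must apply to them.\<close>

definition C1_compact :: "('a::euclidean_space \<Rightarrow> real) \<Rightarrow> ('a \<Rightarrow> 'a) \<Rightarrow> bool" where
  "C1_compact w G \<longleftrightarrow>
     (\<forall>x. (w has_derivative (\<lambda>h. G x \<bullet> h)) (at x)) \<and> continuous_on UNIV G \<and>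
     bounded {x. w x \<noteq> 0}"

lemma C1_compact_continuous:
  assumes "C1_compact w G"
  shows "continuous_on UNIV w" "continuous_on UNIV G"
  using assms by (auto simp: C1_compact_def continuous_on_eq_continuous_at intro: has_derivative_continuous)

lemma C1_compact_support:
  assumes "C1_compact w G"
  obtains R where "R > 0" "\<forall>x. norm x > R \<longrightarrow> w x = 0" "\<forall>x. norm x > R \<longrightarrow> G x = 0"
proof -
  obtain R where R: "R > 0" "\<And>x. w x \<noteq> 0 \<Longrightarrow> norm x \<le> R"
    using assms bounded_pos[of "{x. w x \<noteq> 0}"] by (auto simp: C1_compact_def)
  have w0: "w x = 0" if "norm x > R" for x using R(2)[of x] that by force
  have "G x = 0" if x: "norm x > R" for x
  proof -
    have op: "open {x::'a. norm x > R}"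
      by (intro open_Collect_less continuous_intros)
    have "(w has_derivative (\<lambda>h. 0)) (at x)"
      by (rule has_derivative_transform_within_open[OF has_derivative_const[of 0] op])
        (use w0 x in auto)
    moreover have "(w has_derivative (\<lambda>h. G x \<bullet> h)) (at x)"
      using assms by (simp add: C1_compact_def)
    ultimately have "(\<lambda>h. 0) = (\<lambda>h. G x \<bullet> h)"
      by (rule has_derivative_unique)
    from fun_cong[OF this, of "G x"] show ?thesis by simp
  qed
  with R(1) w0 that show ?thesis by blast
qed

lemma integrable_lborel_compact_support:
  fixes f :: "'a::euclidean_space \<Rightarrow> 'b::{banach, second_countable_topology}"
  assumes "continuous_on UNIV f" "\<forall>x. norm x > R \<longrightarrow> f x = 0"
  shows "integrable lborel f"
proof -
  have "integrable lborel (\<lambda>x. indicator (cball 0 R) x *\<^sub>R f x)"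
    by (rule borel_integrable_compact) (auto intro: continuous_on_subset[OF assms(1)])
  moreover have "(\<lambda>x. indicator (cball 0 R) x *\<^sub>R f x) = f"
    using assms(2) by (auto simp: fun_eq_iff indicator_def)
  ultimately show ?thesis by simp
qed

section \<open>Translation invariance and difference quotients\<close>

lemma nn_integral_lborel_translation:
  fixes f :: "'a::euclidean_space \<Rightarrow> ennreal"
  assumes "f \<in> borel_measurable borel"
  shows "(\<integral>\<^sup>+x. f (c + x) \<partial>lborel) = (\<integral>\<^sup>+x. f x \<partial>lborel)"
proof -
  have "(\<integral>\<^sup>+x. f x \<partial>lborel) = (\<integral>\<^sup>+x. f x \<partial>distr lborel borel ((+) c))"
    by (simp add: lborel_distr_plus)
  also have "\<dots> = (\<integral>\<^sup>+x. f (c + x) \<partial>lborel)"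
    using assms by (subst nn_integral_distr) auto
  finally show ?thesis by simp
qed

lemma integral_lborel_translation:
  fixes f :: "'a::euclidean_space \<Rightarrow> 'b::{banach, second_countable_topology}"
  assumes "f \<in> borel_measurable borel"
  shows "(\<integral>x. f (c + x) \<partial>lborel) = (\<integral>x. f x \<partial>lborel)"
proof -
  have "(\<integral>x. f x \<partial>lborel) = (\<integral>x. f x \<partial>distr lborel borel ((+) c))"
    by (simp add: lborel_distr_plus)
  also have "\<dots> = (\<integral>x. f (c + x) \<partial>lborel)"
    using assms by (subst integral_distr) auto
  finally show ?thesis by simp
qed

lemma C1_compact_bounded:
  assumes "C1_compact w G"
  obtains B where "B > 0" "\<forall>x. \<bar>w x\<bar> \<le> B" "\<forall>x. norm (G x) \<le> B"
proof -
  obtain R where R: "R > 0" "\<forall>x. norm x > R \<longrightarrow> w x = 0" "\<forall>x. norm x > R \<longrightarrow> G x = 0"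
    by (rule C1_compact_support[OF assms])
  have "bounded (w ` cball 0 R)" "bounded (G ` cball 0 R)"
    using C1_compact_continuous[OF assms]
    by (auto intro!: compact_imp_bounded compact_continuous_image intro: continuous_on_subset)
  then obtain B1 B2 where "\<forall>x\<in>cball 0 R. \<bar>w x\<bar> \<le> B1" "\<forall>x\<in>cball 0 R. norm (G x) \<le> B2"
    by (auto simp: bounded_iff)
  then have "\<bar>w x\<bar> \<le> max 1 (max B1 B2)" "norm (G x) \<le> max 1 (max B1 B2)" for x
    using R by (cases "norm x \<le> R"; force)+
  then show ?thesis by (intro that[of "max 1 (max B1 B2)"]) auto
qed

lemma C1_compact_difference_quotient:
  assumes w: "C1_compact w G"
  shows "(\<lambda>n. real (Suc n) * (w (h /\<^sub>R real (Suc n) + x) - w x)) \<longlonglongrightarrow> G x \<bullet> h"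
proof -
  have "((\<lambda>t. w (t *\<^sub>R h + x)) has_derivative (\<lambda>t. G x \<bullet> (t *\<^sub>R h))) (at 0)"
    by (rule has_derivative_compose[of "\<lambda>t. t *\<^sub>R h + x", where g = w])
      (use w in \<open>auto simp: C1_compact_def intro!: derivative_eq_intros\<close>)
  then have "((\<lambda>t. w (t *\<^sub>R h + x)) has_real_derivative (G x \<bullet> h)) (at 0)"
    by (simp add: has_field_derivative_def mult.commute[of _ "G x \<bullet> h"])
  then have lim: "((\<lambda>t. (w (t *\<^sub>R h + x) - w x) / t) \<longlongrightarrow> G x \<bullet> h) (at 0)"
    by (simp add: DERIV_def)
  have "filterlim (\<lambda>n. inverse (real (Suc n))) (at 0) sequentially"
    using LIMSEQ_inverse_real_of_nat by (auto simp: filterlim_at)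
  from filterlim_compose[OF lim this] show ?thesis
    by (simp add: divide_inverse mult.commute)
qed

text \<open>Majorant for dominated convergence. The quotients are bounded through the Lipschitz
  constant of w, and their supports stay in one ball because every step \<open>h / (n + 1)\<close>
  is at most as long as h.\<close>

lemma C1_compact_difference_quotient_bound:
  fixes w :: "'a::euclidean_space \<Rightarrow> real"
  assumes w: "C1_compact w G"
  obtains B R where "B > 0" "R > 0"
    "\<forall>n x. \<bar>real (Suc n) * (w (h /\<^sub>R real (Suc n) + x) - w x)\<bar> \<le> B * indicator (cball 0 R) x"
proof -
  obtain R where R: "R > 0" "\<forall>x. norm x > R \<longrightarrow> w x = 0" "\<forall>x. norm x > R \<longrightarrow> G x = 0"
    by (rule C1_compact_support[OF w])
  obtain B where B: "B > 0" "\<forall>x. \<bar>w x\<bar> \<le> B" "\<forall>x. norm (G x) \<le> B"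
    by (rule C1_compact_bounded[OF w])
  have lip: "\<bar>w y - w x\<bar> \<le> B * norm (y - x)" for x y
  proof -
    have "norm (w y - w x) \<le> B * norm (y - x)"
    proof (rule differentiable_bound[of UNIV w "\<lambda>z h. G z \<bullet> h"])
      show "onorm (\<lambda>h. G z \<bullet> h) \<le> B" for z
        using B(1) by (intro onorm_bound)
          (auto intro!: order_trans[OF Cauchy_Schwarz_ineq2] mult_right_mono B(3)[rule_format])
    qed (use w in \<open>auto simp: C1_compact_def\<close>)
    then show ?thesis by simp
  qed
  \<comment> \<open>The summand 1 keeps the constant positive when \<open>h = 0\<close>.\<close>
  have "\<bar>real (Suc n) * (w (h /\<^sub>R real (Suc n) + x) - w x)\<bar> \<le> (B * norm h + 1) * indicator (cball 0 (R + norm h)) x" for n x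
  proof (cases "norm x \<le> R + norm h")
    case True
    have "\<bar>real (Suc n) * (w (h /\<^sub>R real (Suc n) + x) - w x)\<bar> \<le> real (Suc n) * (B * norm (h /\<^sub>R real (Suc n)))"
      using lip[of "h /\<^sub>R real (Suc n) + x" x] by (simp add: abs_mult del: of_nat_Suc)
    also have "\<dots> = B * norm h" by simp
    finally show ?thesis using True by simp
  next
    case False
    have "norm (h /\<^sub>R real (Suc n)) \<le> norm h"
      by (simp add: divide_simps del: of_nat_Suc) (simp add: mult_le_cancel_left1)
    then have "norm (h /\<^sub>R real (Suc n) + x) > R"
      using False norm_triangle_ineq2[of x "- (h /\<^sub>R real (Suc n))"] by (simp add: add.commute)
    moreover have "norm x > R" using False norm_ge_zero[of h] by linarith
    ultimately show ?thesis using R False by simp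
  qed
  moreover have "B * norm h + 1 > 0" using B by (simp add: add_nonneg_pos)
  moreover have "R + norm h > 0" using R by (simp add: add_pos_nonneg)
  ultimately show ?thesis using that by blast
qed

lemma integrable_lborel_indicator_cball: "integrable lborel (indicator (cball (0::'a::euclidean_space) R) :: 'a \<Rightarrow> real)"
  by (intro integrable_real_indicator)
    (use emeasure_bounded_finite[of "cball (0::'a) R"] in \<open>auto simp: less_top[symmetric]\<close>)

text \<open>Each difference quotient has integral zero by translation invariance; dominated
  convergence passes this on to the directional derivative.\<close>

lemma C1_compact_integral_gradient:
  fixes w :: "'a::euclidean_space \<Rightarrow> real"
  assumes w: "C1_compact w G"
  shows "(\<integral>x. G x \<bullet> h \<partial>lborel) = 0"
proof -
  obtain B R where "B > 0" "R > 0" and B: "\<forall>n x. \<bar>real (Suc n) * (w (h /\<^sub>R real (Suc n) + x) - w x)\<bar> \<le> B * indicator (cball 0 R) x"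
    using C1_compact_difference_quotient_bound[OF w, of h] by blast
  have bw [measurable]: "w \<in> borel_measurable borel" "G \<in> borel_measurable borel"
    using C1_compact_continuous[OF w] by (auto intro: borel_measurable_continuous_onI)
  obtain R' where "R' > 0" and R': "\<forall>x. norm x > R' \<longrightarrow> w x = 0" "\<forall>x. norm x > R' \<longrightarrow> G x = 0"
    by (rule C1_compact_support[OF w])
  have iw: "integrable lborel w"
    by (rule integrable_lborel_compact_support[OF C1_compact_continuous(1)[OF w] R'(1)])
  have it: "integrable lborel (\<lambda>x. w (c + x))" for c
  proof (rule integrable_lborel_compact_support)
    show "\<forall>x. norm x > R' + norm c \<longrightarrow> w (c + x) = 0"
    proof (intro allI impI)
      fix x :: 'a assume that: "norm x > R' + norm c"
      have "norm (c + x) > R'"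
        using that norm_triangle_ineq2[of x "- c"] by (simp add: add.commute)
      then show "w (c + x) = 0" by (simp add: R')
    qed
    show "continuous_on UNIV (\<lambda>x. w (c + x))"
      by (intro continuous_intros continuous_on_compose2[OF C1_compact_continuous(1)[OF w]]) auto
  qed
  have "(\<integral>x. real (Suc n) * (w (h /\<^sub>R real (Suc n) + x) - w x) \<partial>lborel) = 0" for n
    using it iw integral_lborel_translation[of w "h /\<^sub>R real (Suc n)"] by (simp del: of_nat_Suc)
  moreover have "(\<lambda>n. \<integral>x. real (Suc n) * (w (h /\<^sub>R real (Suc n) + x) - w x) \<partial>lborel)
      \<longlonglongrightarrow> (\<integral>x. G x \<bullet> h \<partial>lborel)"
    by (rule integral_dominated_convergence[where w = "\<lambda>x. B * indicator (cball 0 R) x"])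
      (use B in \<open>auto simp del: of_nat_Suc intro!: integrable_mult_right integrable_lborel_indicator_cball C1_compact_difference_quotient[OF w]\<close>)
  ultimately show ?thesis by (simp add: LIMSEQ_const_iff)
qed

lemma C1_compact_integrable:
  assumes w: "C1_compact w G"
  shows "integrable lborel w" "integrable lborel (\<lambda>x. (w x)\<^sup>2)"
    "integrable lborel (\<lambda>x. \<bar>w x\<bar>)" "integrable lborel (\<lambda>x. (norm (G x))\<^sup>2)"
proof -
  obtain R where "R > 0" and R: "\<forall>x. norm x > R \<longrightarrow> w x = 0" "\<forall>x. norm x > R \<longrightarrow> G x = 0"
    by (rule C1_compact_support[OF w])
  note cont = C1_compact_continuous[OF w]
  show "integrable lborel w" "integrable lborel (\<lambda>x. (w x)\<^sup>2)"
    "integrable lborel (\<lambda>x. \<bar>w x\<bar>)" "integrable lborel (\<lambda>x. (norm (G x))\<^sup>2)"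
    by (rule integrable_lborel_compact_support[of _ R];
        use cont R in \<open>auto intro!: continuous_intros\<close>)+
qed

lemma C1_compact_integrable_translation:
  fixes w :: "'a::euclidean_space \<Rightarrow> real"
  assumes w: "C1_compact w G"
  shows "integrable lborel (\<lambda>x. (w (c + x) - w (d + x))\<^sup>2)"
proof -
  obtain R' where "R' > 0" and R': "\<forall>x. norm x > R' \<longrightarrow> w x = 0" "\<forall>x. norm x > R' \<longrightarrow> G x = 0"
    by (rule C1_compact_support[OF w])
  show ?thesis
  proof (rule integrable_lborel_compact_support)
    show "\<forall>x. norm x > R' + norm c + norm d \<longrightarrow> (w (c + x) - w (d + x))\<^sup>2 = 0"
    proof (intro allI impI)
      fix x :: 'a assume that: "norm x > R' + norm c + norm d"
      have "norm x - norm c \<le> norm (c + x)" "norm x - norm d \<le> norm (d + x)"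
        using norm_diff_ineq[of x c] norm_diff_ineq[of x d] by (simp_all add: add.commute)
      then have "norm (c + x) > R'" "norm (d + x) > R'"
        using that norm_ge_zero[of c] norm_ge_zero[of d] by linarith+
      then show "(w (c + x) - w (d + x))\<^sup>2 = 0" by (simp add: R')
    qed
    show "continuous_on UNIV (\<lambda>x. (w (c + x) - w (d + x))\<^sup>2)"
      by (intro continuous_intros continuous_on_compose2[OF C1_compact_continuous(1)[OF w]]) auto
  qed
qed

text \<open>Telescoping \<open>w (x + h) - w x\<close> over \<open>n\<close> equal steps and letting \<open>n\<close> tend to infinity
  replaces the fundamental theorem of calculus and Tonelli's theorem.\<close>

lemma C1_compact_translation_estimate:
  fixes w :: "'a::euclidean_space \<Rightarrow> real"
  assumes w: "C1_compact w G"
  shows "(\<integral>x. (w (h + x) - w x)\<^sup>2 \<partial>lborel) \<le> (norm h)\<^sup>2 * (\<integral>x. (norm (G x))\<^sup>2 \<partial>lborel)"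
proof -
  obtain B R where B: "B > 0" "R > 0" "\<forall>n x. \<bar>real (Suc n) * (w (h /\<^sub>R real (Suc n) + x) - w x)\<bar> \<le> B * indicator (cball 0 R) x"
    using C1_compact_difference_quotient_bound[OF w, of h] by blast
  have bw [measurable]: "w \<in> borel_measurable borel" "G \<in> borel_measurable borel"
    using C1_compact_continuous[OF w] by (auto intro: borel_measurable_continuous_onI)
  obtain R' where "R' > 0" and R': "\<forall>x. norm x > R' \<longrightarrow> w x = 0" "\<forall>x. norm x > R' \<longrightarrow> G x = 0"
    by (rule C1_compact_support[OF w])
  note it = C1_compact_integrable_translation[OF w]
  have step: "(\<integral>x. (w (h + x) - w x)\<^sup>2 \<partial>lborel)
      \<le> (\<integral>x. (real (Suc n) * (w (h /\<^sub>R real (Suc n) + x) - w x))\<^sup>2 \<partial>lborel)" for n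
  proof -
    define m where "m = real (Suc n)"
    define c where "c k = (real k / m) *\<^sub>R h" for k
    have m: "m > 0" by (simp add: m_def)
    have "(\<integral>x. (w (h + x) - w x)\<^sup>2 \<partial>lborel)
        \<le> (\<integral>x. (\<Sum>k<Suc n. m * (w (c (Suc k) + x) - w (c k + x))\<^sup>2) \<partial>lborel)"
    proof (rule integral_mono)
      show "integrable lborel (\<lambda>x. (w (h + x) - w x)\<^sup>2)"
        using it[of h 0] by simp
      show "integrable lborel (\<lambda>x. \<Sum>k<Suc n. m * (w (c (Suc k) + x) - w (c k + x))\<^sup>2)"
        by (intro Bochner_Integration.integrable_sum integrable_mult_right it)
      fix x
      have "w (h + x) - w x = (\<Sum>k<Suc n. w (c (Suc k) + x) - w (c k + x))"
        using sum_lessThan_telescope[of "\<lambda>k. w (c k + x)" "Suc n"] m by (simp add: c_def m_def)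
      then have "(w (h + x) - w x)\<^sup>2 = (\<Sum>k<Suc n. 1 * (w (c (Suc k) + x) - w (c k + x)))\<^sup>2" by simp
      \<comment> \<open>Cauchy--Schwarz costs a factor m; the m summands have equal integrals by
        translation invariance, which gives a second one. Together \<open>m\<^sup>2\<close> turns
        increments into difference quotients.\<close>
      also have "\<dots> \<le> (\<Sum>k<Suc n. 1\<^sup>2) * (\<Sum>k<Suc n. (w (c (Suc k) + x) - w (c k + x))\<^sup>2)"
        by (rule Cauchy_Schwarz_ineq_sum)
      also have "\<dots> = (\<Sum>k<Suc n. m * (w (c (Suc k) + x) - w (c k + x))\<^sup>2)"
        by (simp add: m_def sum_distrib_left del: sum.lessThan_Suc)
      finally show "(w (h + x) - w x)\<^sup>2 \<le> (\<Sum>k<Suc n. m * (w (c (Suc k) + x) - w (c k + x))\<^sup>2)" .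
    qed
    also have "\<dots> = (\<Sum>k<Suc n. m * (\<integral>x. (w (c (Suc k) + x) - w (c k + x))\<^sup>2 \<partial>lborel))"
      using it by (subst Bochner_Integration.integral_sum) (auto simp del: sum.lessThan_Suc)
    also have "\<dots> = (\<Sum>k<Suc n. m * (\<integral>x. (w (h /\<^sub>R m + x) - w x)\<^sup>2 \<partial>lborel))"
    proof (rule sum.cong[OF refl], rule arg_cong[where f = "(*) m"])
      fix k
      have "(\<integral>x. (\<lambda>x. (w (h /\<^sub>R m + x) - w x)\<^sup>2) (c k + x) \<partial>lborel) = (\<integral>x. (w (h /\<^sub>R m + x) - w x)\<^sup>2 \<partial>lborel)"
        by (rule integral_lborel_translation) measurable
      moreover have "h /\<^sub>R m + (c k + x) = c (Suc k) + x" for x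
        by (simp add: c_def add_divide_distrib scaleR_add_left inverse_eq_divide)
      ultimately show "(\<integral>x. (w (c (Suc k) + x) - w (c k + x))\<^sup>2 \<partial>lborel) = (\<integral>x. (w (h /\<^sub>R m + x) - w x)\<^sup>2 \<partial>lborel)"
        by simp
    qed
    also have "\<dots> = m\<^sup>2 * (\<integral>x. (w (h /\<^sub>R m + x) - w x)\<^sup>2 \<partial>lborel)"
      by (simp add: m_def power2_eq_square del: sum.lessThan_Suc)
    also have "\<dots> = (\<integral>x. (m * (w (h /\<^sub>R m + x) - w x))\<^sup>2 \<partial>lborel)"
      by (simp add: power_mult_distrib)
    finally show ?thesis by (simp add: m_def)
  qed
  have "(\<lambda>n. \<integral>x. (real (Suc n) * (w (h /\<^sub>R real (Suc n) + x) - w x))\<^sup>2 \<partial>lborel)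
      \<longlonglongrightarrow> (\<integral>x. (G x \<bullet> h)\<^sup>2 \<partial>lborel)"
  proof (rule integral_dominated_convergence[where w = "\<lambda>x. B\<^sup>2 * indicator (cball 0 R) x"])
    show "AE x in lborel. norm ((real (Suc n) * (w (h /\<^sub>R real (Suc n) + x) - w x))\<^sup>2) \<le> B\<^sup>2 * indicator (cball 0 R) x" for n
    proof (rule AE_I2)
      fix x
      have "\<bar>real (Suc n) * (w (h /\<^sub>R real (Suc n) + x) - w x)\<bar>\<^sup>2 \<le> (B * indicator (cball 0 R) x)\<^sup>2"
        using B(3)[rule_format, of n x] by (intro power_mono) auto
      also have "\<dots> = B\<^sup>2 * indicator (cball 0 R) x" by (simp add: indicator_def)
      finally show "norm ((real (Suc n) * (w (h /\<^sub>R real (Suc n) + x) - w x))\<^sup>2) \<le> B\<^sup>2 * indicator (cball 0 R) x"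
        by (simp del: of_nat_Suc)
    qed
    show "AE x in lborel. (\<lambda>n. (real (Suc n) * (w (h /\<^sub>R real (Suc n) + x) - w x))\<^sup>2) \<longlonglongrightarrow> (G x \<bullet> h)\<^sup>2"
      by (intro AE_I2 tendsto_power C1_compact_difference_quotient[OF w])
  qed (auto intro!: integrable_mult_right integrable_lborel_indicator_cball)
  then have "(\<integral>x. (w (h + x) - w x)\<^sup>2 \<partial>lborel) \<le> (\<integral>x. (G x \<bullet> h)\<^sup>2 \<partial>lborel)"
    by (rule LIMSEQ_le_const) (use step in blast)
  also have "\<dots> \<le> (\<integral>x. (norm h)\<^sup>2 * (norm (G x))\<^sup>2 \<partial>lborel)"
  proof (rule integral_mono)
    show "(G x \<bullet> h)\<^sup>2 \<le> (norm h)\<^sup>2 * (norm (G x))\<^sup>2" for x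
      using power_mono[OF Cauchy_Schwarz_ineq2[of "G x" h], of 2]
      by (simp add: power_mult_distrib mult.commute)
    show "integrable lborel (\<lambda>x. (G x \<bullet> h)\<^sup>2)"
      by (rule integrable_lborel_compact_support[of _ R'])
        (use C1_compact_continuous(2)[OF w] R' in \<open>auto intro!: continuous_intros\<close>)
    show "integrable lborel (\<lambda>x. (norm h)\<^sup>2 * (norm (G x))\<^sup>2)"
      by (intro integrable_mult_right C1_compact_integrable(4)[OF w])
  qed
  also have "\<dots> = (norm h)\<^sup>2 * (\<integral>x. (norm (G x))\<^sup>2 \<partial>lborel)" by simp
  finally show ?thesis .
qed

subsection \<open>Averages over cells and Nash's inequality\<close>

text \<open>Integer label, in units of \<open>\<epsilon>\<close>, of the half-open grid cube
  containing x. The cubes themselves are the fibres of this map, so they partition the space and are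
  told apart by their labels.\<close>

definition cell :: "real \<Rightarrow> 'a::euclidean_space \<Rightarrow> 'a" where
  "cell \<epsilon> x = (\<Sum>i\<in>Basis. of_int \<lfloor>x \<bullet> i / \<epsilon>\<rfloor> *\<^sub>R i)"

lemma inner_cell: "i \<in> Basis \<Longrightarrow> cell \<epsilon> x \<bullet> i = of_int \<lfloor>x \<bullet> i / \<epsilon>\<rfloor>"
  by (simp add: cell_def inner_sum_left inner_Basis if_distrib sum.delta cong: if_cong)

lemma cell_eq_iff:
  assumes "\<epsilon> > 0"
  shows "cell \<epsilon> y = cell \<epsilon> x \<longleftrightarrow>
    (\<forall>i\<in>Basis. \<epsilon> * (cell \<epsilon> x \<bullet> i) \<le> y \<bullet> i \<and> y \<bullet> i < \<epsilon> * (cell \<epsilon> x \<bullet> i) + \<epsilon>)"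
proof -
  have "cell \<epsilon> y = cell \<epsilon> x \<longleftrightarrow> (\<forall>i\<in>Basis. \<lfloor>y \<bullet> i / \<epsilon>\<rfloor> = \<lfloor>x \<bullet> i / \<epsilon>\<rfloor>)"
    by (subst euclidean_eq_iff) (simp add: inner_cell)
  also have "\<dots> \<longleftrightarrow> (\<forall>i\<in>Basis. \<epsilon> * (cell \<epsilon> x \<bullet> i) \<le> y \<bullet> i \<and> y \<bullet> i < \<epsilon> * (cell \<epsilon> x \<bullet> i) + \<epsilon>)"
    using assms by (intro ball_cong refl) (simp add: inner_cell floor_eq_iff field_simps)
  finally show ?thesis .
qed

lemma cell_borel_set [measurable]:
  fixes k :: "'a::euclidean_space"
  shows "{x. cell \<epsilon> x = k} \<in> sets borel"
proof -
  have [measurable]: "(\<lambda>x::'a. cell \<epsilon> x) \<in> borel_measurable borel"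
    unfolding cell_def by measurable
  have "{x \<in> space borel. cell \<epsilon> x = k} \<in> sets borel"
    by measurable
  then show ?thesis by simp
qed

text \<open>The half-open cube is squeezed between the open and the closed box with the same
  corners, which have equal measure.\<close>

lemma cell_measure:
  fixes x :: "'a::euclidean_space"
  assumes "\<epsilon> > 0"
  shows "emeasure lborel {y. cell \<epsilon> y = cell \<epsilon> x} = ennreal (\<epsilon> ^ DIM('a))"
proof -
  define a where "a = \<epsilon> *\<^sub>R cell \<epsilon> x"
  define b where "b = a + \<epsilon> *\<^sub>R One"
  have ab: "b \<bullet> i = a \<bullet> i + \<epsilon>" if "i \<in> Basis" for i
    using that by (simp add: b_def inner_add_left)
  have eq: "{y. cell \<epsilon> y = cell \<epsilon> x} = {y. \<forall>i\<in>Basis. a \<bullet> i \<le> y \<bullet> i \<and> y \<bullet> i < b \<bullet> i}"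
    by (simp add: cell_eq_iff[OF assms] a_def[symmetric] ab) (simp add: a_def)
  have "emeasure lborel {y. cell \<epsilon> y = cell \<epsilon> x} \<le> emeasure lborel (cbox a b)"
    by (rule emeasure_mono) (auto simp: eq mem_box less_imp_le)
  moreover have "emeasure lborel (box a b) \<le> emeasure lborel {y. cell \<epsilon> y = cell \<epsilon> x}"
  proof (rule emeasure_mono)
    show "box a b \<subseteq> {y. cell \<epsilon> y = cell \<epsilon> x}"
      unfolding eq by (auto simp: mem_box less_imp_le)
  qed (simp add: cell_borel_set)
  moreover have "emeasure lborel (cbox a b) = ennreal (\<epsilon> ^ DIM('a))"
    using assms by (subst emeasure_lborel_cbox) (auto simp: ab inner_diff_left)
  moreover have "emeasure lborel (box a b) = ennreal (\<epsilon> ^ DIM('a))"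
    using assms by (subst emeasure_lborel_box) (auto simp: ab inner_diff_left)
  ultimately show ?thesis by (intro antisym) auto
qed

lemma finite_cells:
  fixes S :: "'a::euclidean_space set"
  assumes "bounded S" "\<epsilon> > 0"
  shows "finite (cell \<epsilon> ` S)"
proof -
  obtain R where R: "R > 0" "\<forall>x\<in>S. norm x \<le> R"
    using assms(1) bounded_pos by blast
  define F where "F = (\<Pi>\<^sub>E i\<in>(Basis::'a set). {- \<lceil>R / \<epsilon>\<rceil> - 1 .. \<lceil>R / \<epsilon>\<rceil>})"
  have "cell \<epsilon> ` S \<subseteq> (\<lambda>f. \<Sum>i\<in>Basis. of_int (f i) *\<^sub>R i) ` F"
  proof (rule image_subsetI)
    fix x assume "x \<in> S"
    define f where "f = restrict (\<lambda>i. \<lfloor>x \<bullet> i / \<epsilon>\<rfloor>) (Basis::'a set)"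
    have "f \<in> F"
    proof (unfold F_def, rule PiE_I)
      fix i :: 'a assume i: "i \<in> Basis"
      have "\<bar>x \<bullet> i\<bar> \<le> R"
        using Basis_le_norm[OF i, of x] R(2) \<open>x \<in> S\<close> by fastforce
      then have "\<bar>x \<bullet> i / \<epsilon>\<bar> \<le> R / \<epsilon>" using assms(2) by (simp add: divide_right_mono)
      then have "x \<bullet> i / \<epsilon> \<le> R / \<epsilon>" "- (R / \<epsilon>) \<le> x \<bullet> i / \<epsilon>" by linarith+
      then show "f i \<in> {- \<lceil>R / \<epsilon>\<rceil> - 1 .. \<lceil>R / \<epsilon>\<rceil>}"
        using i unfolding f_def by simp linarith
    qed (simp add: f_def)
    moreover have "cell \<epsilon> x = (\<Sum>i\<in>Basis. of_int (f i) *\<^sub>R i)"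
      by (simp add: cell_def f_def)
    ultimately show "cell \<epsilon> x \<in> (\<lambda>f. \<Sum>i\<in>Basis. of_int (f i) *\<^sub>R i) ` F" by blast
  qed
  moreover have "finite F" unfolding F_def by (intro finite_PiE) auto
  ultimately show ?thesis by (meson finite_surj)
qed

lemma same_cell_imp_cbox:
  fixes x y :: "'a::euclidean_space"
  assumes "\<epsilon> > 0" "cell \<epsilon> (h + x) = cell \<epsilon> x"
  shows "h \<in> cbox (- \<epsilon> *\<^sub>R One) (\<epsilon> *\<^sub>R One)"
proof -
  have "\<epsilon> * (cell \<epsilon> x \<bullet> i) \<le> (h + x) \<bullet> i \<and> (h + x) \<bullet> i < \<epsilon> * (cell \<epsilon> x \<bullet> i) + \<epsilon>" 
       "\<epsilon> * (cell \<epsilon> x \<bullet> i) \<le> x \<bullet> i \<and> x \<bullet> i < \<epsilon> * (cell \<epsilon> x \<bullet> i) + \<epsilon>" if "i \<in> Basis" for i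
    using cell_eq_iff[OF assms(1), of "h + x" x] cell_eq_iff[OF assms(1), of x x] assms(2) that by auto
  then have "- \<epsilon> \<le> h \<bullet> i \<and> h \<bullet> i \<le> \<epsilon>" if "i \<in> Basis" for i
    using that by (force simp: inner_add_left)
  then show ?thesis by (auto simp: mem_box)
qed

lemma norm_cbox_One_le:
  fixes h :: "'a::euclidean_space"
  assumes "h \<in> cbox (- \<epsilon> *\<^sub>R One) (\<epsilon> *\<^sub>R One)"
  shows "(norm h)\<^sup>2 \<le> real DIM('a) * \<epsilon>\<^sup>2"
proof -
  have "(norm h)\<^sup>2 = (\<Sum>i\<in>Basis. (h \<bullet> i)\<^sup>2)"
    using euclidean_inner[of h h] by (simp only: power2_norm_eq_inner) (simp only: power2_eq_square)
  also have "\<dots> \<le> (\<Sum>i\<in>(Basis::'a set). \<epsilon>\<^sup>2)"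
  proof (rule sum_mono)
    fix i :: 'a assume "i \<in> Basis"
    then have "\<bar>h \<bullet> i\<bar> \<le> \<epsilon>" using assms by (auto simp: mem_box abs_le_iff minus_le_iff)
    then show "(h \<bullet> i)\<^sup>2 \<le> \<epsilon>\<^sup>2" by (simp add: abs_le_square_iff[symmetric])
  qed
  finally show ?thesis by simp
qed

text \<open>The variance of \<open>w\<close> on a cell of side \<open>\<epsilon>\<close> is an average of \<open>(w x - w y)\<^sup>2\<close> over pairs of points
  of the cell, whose differences lie in a cube of side \<open>2 * \<epsilon>\<close>.\<close>

lemma C1_compact_cell_estimate:
  fixes w :: "'a::euclidean_space \<Rightarrow> real"
  assumes w: "C1_compact w G" and \<epsilon>: "\<epsilon> > 0" and K: "finite K" "cell \<epsilon> ` {x. w x \<noteq> 0} \<subseteq> K" "K \<subseteq> range (cell \<epsilon>)"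
  shows "(\<integral>x. (w x)\<^sup>2 \<partial>lborel) \<le> 2 ^ DIM('a) * real DIM('a) * \<epsilon>\<^sup>2 * (\<integral>x. (norm (G x))\<^sup>2 \<partial>lborel)
     + (\<Sum>k\<in>K. (\<integral>x. indicator {y. cell \<epsilon> y = k} x * w x \<partial>lborel)\<^sup>2) / \<epsilon> ^ DIM('a)"
proof -
  define D where "D = (\<integral>x. (norm (G x))\<^sup>2 \<partial>lborel)"
  define I where "I k x = (indicator {y. cell \<epsilon> y = k} x :: real)" for k and x :: 'a
  define A where "A k = (\<integral>x. I k x * (w x)\<^sup>2 \<partial>lborel)" for k
  define B where "B k = (\<integral>x. I k x * w x \<partial>lborel)" for k
  define Q where "Q = cbox (- \<epsilon> *\<^sub>R One) (\<epsilon> *\<^sub>R One :: 'a)"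
  have Q [measurable]: "Q \<in> sets borel" by (simp add: Q_def)
  define E where "E = \<epsilon> ^ DIM('a)"
  define Z where "Z = 2 ^ DIM('a) * real DIM('a) * \<epsilon>\<^sup>2 * D"
  have E: "E > 0" using \<epsilon> by (simp add: E_def)
  have D: "D \<ge> 0" by (simp add: D_def)
  have [measurable]: "w \<in> borel_measurable borel"
    using C1_compact_continuous[OF w] by (auto intro: borel_measurable_continuous_onI)
  have [measurable]: "I k \<in> borel_measurable borel" for k
    unfolding I_def by measurable
  have I01: "0 \<le> I k x" "I k x \<le> 1" for k x by (auto simp: I_def indicator_def)
  have intA: "integrable lborel (\<lambda>x. I k x * (w x)\<^sup>2)" for k
    unfolding I_def using integrable_mult_indicator[OF _ C1_compact_integrable(2)[OF w], of "{y. cell \<epsilon> y = k}"] by simp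
  have intB: "integrable lborel (\<lambda>x. I k x * w x)" for k
    unfolding I_def using integrable_mult_indicator[OF _ C1_compact_integrable(1)[OF w], of "{y. cell \<epsilon> y = k}"] by simp
  have mI: "emeasure lborel {y. cell \<epsilon> y = k} = ennreal E" if "k \<in> K" for k
    using that K(3) cell_measure[OF \<epsilon>] by (auto simp: E_def)
  have intI: "integrable lborel (I k)" and IE: "(\<integral>x. I k x \<partial>lborel) = E" if "k \<in> K" for k
    unfolding I_def using mI[OF that] E by (auto intro!: integrable_real_indicator simp: measure_def)
  define J where "J k x = (\<integral>y. I k y * (w x - w y)\<^sup>2 \<partial>lborel)" for k x
  have exp: "I k y * (w x - w y)\<^sup>2 = (w x)\<^sup>2 * I k y - 2 * w x * (I k y * w y) + I k y * (w y)\<^sup>2" for k x y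
    by (simp add: power2_diff algebra_simps)
  have hA: "has_bochner_integral lborel (\<lambda>x. I k x * (w x)\<^sup>2) (A k)"
    and hB: "has_bochner_integral lborel (\<lambda>x. I k x * w x) (B k)" for k
    using intA[of k] intB[of k] by (simp_all add: has_bochner_integral_iff A_def B_def)
  have hI: "has_bochner_integral lborel (I k) E" if "k \<in> K" for k
    using intI[OF that] IE[OF that] by (simp add: has_bochner_integral_iff)
  have hJ: "has_bochner_integral lborel (\<lambda>y. I k y * (w x - w y)\<^sup>2) ((w x)\<^sup>2 * E - 2 * w x * B k + A k)"
    if "k \<in> K" for k x
    unfolding exp
    by (intro has_bochner_integral_add has_bochner_integral_diff has_bochner_integral_mult_right hA hB hI that)
  have J: "J k x = (w x)\<^sup>2 * E - 2 * w x * B k + A k"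
    and intJ': "integrable lborel (\<lambda>y. I k y * (w x - w y)\<^sup>2)" if "k \<in> K" for k x
    using hJ[OF that, of x] unfolding J_def has_bochner_integral_iff by auto
  have J0: "J k x \<ge> 0" for k x unfolding J_def using I01 by (intro integral_nonneg_AE AE_I2) auto
  have IJ: "I k x * J k x = E * (I k x * (w x)\<^sup>2) - 2 * B k * (I k x * w x) + A k * I k x" if "k \<in> K" for k x
    by (simp add: J[OF that] algebra_simps)
  have hIJ: "has_bochner_integral lborel (\<lambda>x. I k x * J k x) (E * A k - 2 * B k * B k + A k * E)" if "k \<in> K" for k
    unfolding IJ[OF that]
    by (intro has_bochner_integral_add has_bochner_integral_diff has_bochner_integral_mult_right hA hB hI that)
  have intJ: "integrable lborel (\<lambda>x. I k x * J k x)"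
    and eqJ: "(\<integral>x. I k x * J k x \<partial>lborel) = 2 * E * A k - 2 * (B k)\<^sup>2" if "k \<in> K" for k
    using hIJ[OF that] unfolding has_bochner_integral_iff by (auto simp: power2_eq_square)
  \<comment> \<open>\<open>E * A k - (B k)\<^sup>2\<close> is \<open>E\<^sup>2\<close> times the
    variance of w on the cell k, and \<open>eqJ\<close> writes twice that quantity as a double
    integral of \<open>(w x - w y)\<^sup>2\<close> over the cell. The change to nonnegative
    integrals allows the order of integration to be exchanged freely.\<close>
  have "ennreal (\<Sum>k\<in>K. 2 * E * A k - 2 * (B k)\<^sup>2) = (\<Sum>k\<in>K. ennreal (\<integral>x. I k x * J k x \<partial>lborel))"
    by (subst sum_ennreal) (auto simp: eqJ[symmetric] intro!: integral_nonneg_AE AE_I2 mult_nonneg_nonneg I01 J0)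
  also have "\<dots> = (\<Sum>k\<in>K. \<integral>\<^sup>+x. \<integral>\<^sup>+y. ennreal (I k x * (I k y * (w x - w y)\<^sup>2)) \<partial>lborel \<partial>lborel)"
  proof (rule sum.cong[OF refl])
    fix k assume k: "k \<in> K"
    have "ennreal (\<integral>x. I k x * J k x \<partial>lborel) = (\<integral>\<^sup>+x. ennreal (I k x * J k x) \<partial>lborel)"
      by (rule nn_integral_eq_integral[symmetric, OF intJ[OF k]]) (auto intro!: AE_I2 mult_nonneg_nonneg I01 J0)
    also have "\<dots> = (\<integral>\<^sup>+x. \<integral>\<^sup>+y. ennreal (I k x * (I k y * (w x - w y)\<^sup>2)) \<partial>lborel \<partial>lborel)"
    proof (rule nn_integral_cong)
      fix x
      have "(\<integral>\<^sup>+y. ennreal (I k x * (I k y * (w x - w y)\<^sup>2)) \<partial>lborel) = ennreal (\<integral>y. I k x * (I k y * (w x - w y)\<^sup>2) \<partial>lborel)"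
        by (rule nn_integral_eq_integral) (auto intro!: AE_I2 mult_nonneg_nonneg I01 integrable_mult_right intJ'[OF k])
      then show "ennreal (I k x * J k x) = (\<integral>\<^sup>+y. ennreal (I k x * (I k y * (w x - w y)\<^sup>2)) \<partial>lborel)"
        by (simp add: J_def)
    qed
    finally show "ennreal (\<integral>x. I k x * J k x \<partial>lborel) = (\<integral>\<^sup>+x. \<integral>\<^sup>+y. ennreal (I k x * (I k y * (w x - w y)\<^sup>2)) \<partial>lborel \<partial>lborel)" .
  qed
  \<comment> \<open>Substitution \<open>y = x + h\<close>: pairs of points are now indexed by base
    point and difference, the form in which the translation estimate applies.\<close>
  also have "\<dots> = (\<Sum>k\<in>K. \<integral>\<^sup>+x. \<integral>\<^sup>+h. ennreal (I k x * (I k (x + h) * (w x - w (x + h))\<^sup>2)) \<partial>lborel \<partial>lborel)"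
    by (intro sum.cong refl nn_integral_cong nn_integral_lborel_translation[symmetric]) measurable
  also have "\<dots> = (\<integral>\<^sup>+x. \<integral>\<^sup>+h. (\<Sum>k\<in>K. ennreal (I k x * (I k (x + h) * (w x - w (x + h))\<^sup>2))) \<partial>lborel \<partial>lborel)"
    by (subst nn_integral_sum; (subst nn_integral_sum)?) measurable
  also have "\<dots> \<le> (\<integral>\<^sup>+x. \<integral>\<^sup>+h. indicator Q h * ennreal ((w (h + x) - w x)\<^sup>2) \<partial>lborel \<partial>lborel)"
  proof (intro nn_integral_mono)
    fix x h :: 'a
    \<comment> \<open>At most one cell contains both points, and if one does, then h lies in the
      cube Q.\<close>
    have "(\<Sum>k\<in>K. I k x * I k (x + h)) \<le> indicator Q h"
    proof (cases "cell \<epsilon> (h + x) = cell \<epsilon> x")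
      case True
      have "(\<Sum>k\<in>K. I k x * I k (x + h)) \<le> (\<Sum>k\<in>K. if k = cell \<epsilon> x then 1 else 0)"
        by (rule sum_mono) (auto simp: I_def indicator_def)
      also have "\<dots> \<le> 1" using K(1) by (simp add: sum.delta')
      finally show ?thesis using same_cell_imp_cbox[OF \<epsilon> True] by (simp add: Q_def)
    next
      case False
      then have "(\<Sum>k\<in>K. I k x * I k (x + h)) = 0"
        by (intro sum.neutral) (auto simp: I_def indicator_def add.commute)
      then show ?thesis by simp
    qed
    then have "(\<Sum>k\<in>K. I k x * I k (x + h)) * (w (h + x) - w x)\<^sup>2
        \<le> indicator Q h * (w (h + x) - w x)\<^sup>2"
      by (rule mult_right_mono) simp
    moreover have "(\<Sum>k\<in>K. I k x * (I k (x + h) * (w x - w (x + h))\<^sup>2)) = (\<Sum>k\<in>K. I k x * I k (x + h)) * (w (h + x) - w x)\<^sup>2"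
      by (simp add: sum_distrib_right power2_commute add.commute mult.assoc)
    ultimately have "ennreal (\<Sum>k\<in>K. I k x * (I k (x + h) * (w x - w (x + h))\<^sup>2))
      \<le> ennreal (indicator Q h * (w (h + x) - w x)\<^sup>2)"
      by (intro ennreal_leI) simp
    then show "(\<Sum>k\<in>K. ennreal (I k x * (I k (x + h) * (w x - w (x + h))\<^sup>2)))
      \<le> indicator Q h * ennreal ((w (h + x) - w x)\<^sup>2)"
      by (subst sum_ennreal) (auto simp: I01 indicator_def ennreal_neg)
  qed
  also have "\<dots> = (\<integral>\<^sup>+h. \<integral>\<^sup>+x. indicator Q h * ennreal ((w (h + x) - w x)\<^sup>2) \<partial>lborel \<partial>lborel)"
    by (rule lborel_pair.Fubini') measurable
  also have "\<dots> \<le> (\<integral>\<^sup>+h. indicator Q h * ennreal (real DIM('a) * \<epsilon>\<^sup>2 * D) \<partial>(lborel::'a measure))"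
  proof (rule nn_integral_mono)
    fix h :: 'a
    have "(\<integral>\<^sup>+x. ennreal ((w (h + x) - w x)\<^sup>2) \<partial>lborel) \<le> ennreal (real DIM('a) * \<epsilon>\<^sup>2 * D)" if "h \<in> Q"
    proof -
      have "(\<integral>x. (w (h + x) - w x)\<^sup>2 \<partial>lborel) \<le> (norm h)\<^sup>2 * D"
        unfolding D_def by (rule C1_compact_translation_estimate[OF w])
      also have "\<dots> \<le> real DIM('a) * \<epsilon>\<^sup>2 * D"
        by (intro mult_right_mono norm_cbox_One_le that[unfolded Q_def] D)
      finally show ?thesis
        by (subst nn_integral_eq_integral) (auto intro!: ennreal_leI C1_compact_integrable_translation[OF w, of _ 0, simplified])
    qed
    then show "(\<integral>\<^sup>+x. indicator Q h * ennreal ((w (h + x) - w x)\<^sup>2) \<partial>lborel)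
       \<le> indicator Q h * ennreal (real DIM('a) * \<epsilon>\<^sup>2 * D)"
      by (simp add: indicator_def)
  qed
  also have "\<dots> = ennreal (real DIM('a) * \<epsilon>\<^sup>2 * D) * ennreal ((2 * \<epsilon>) ^ DIM('a))"
  proof -
    have "emeasure lborel Q = ennreal (\<Prod>b\<in>Basis. (\<epsilon> *\<^sub>R One - - \<epsilon> *\<^sub>R One :: 'a) \<bullet> b)"
      unfolding Q_def
    proof (rule emeasure_lborel_cbox)
      fix b :: 'a assume "b \<in> Basis"
      with \<epsilon> show "- \<epsilon> *\<^sub>R One \<bullet> b \<le> \<epsilon> *\<^sub>R One \<bullet> b" by simp
    qed
    also have "(\<Prod>b\<in>Basis. (\<epsilon> *\<^sub>R One - - \<epsilon> *\<^sub>R One :: 'a) \<bullet> b) = (\<Prod>b\<in>(Basis :: 'a set). 2 * \<epsilon>)"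
      by (rule prod.cong) (auto simp: inner_diff_left inner_add_left)
    also have "\<dots> = (2 * \<epsilon>) ^ DIM('a)" by simp
    finally have "emeasure lborel Q = ennreal ((2 * \<epsilon>) ^ DIM('a))" .
    moreover have "(\<integral>\<^sup>+h. indicator Q h * ennreal (real DIM('a) * \<epsilon>\<^sup>2 * D) \<partial>(lborel::'a measure))
        = (\<integral>\<^sup>+h. indicator Q h \<partial>lborel) * ennreal (real DIM('a) * \<epsilon>\<^sup>2 * D)"
      by (rule nn_integral_multc) simp
    moreover have "(\<integral>\<^sup>+h. indicator Q h \<partial>lborel) = emeasure lborel Q"
      by (rule nn_integral_indicator) simp
    ultimately show ?thesis by (simp only: mult.commute)
  qed
  also have "\<dots> = ennreal (real DIM('a) * \<epsilon>\<^sup>2 * D * (2 * \<epsilon>) ^ DIM('a))"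
    using D \<epsilon> by (simp add: ennreal_mult)
  finally have "(\<Sum>k\<in>K. 2 * E * A k - 2 * (B k)\<^sup>2) \<le> real DIM('a) * \<epsilon>\<^sup>2 * D * (2 * \<epsilon>) ^ DIM('a)"
    using D \<epsilon> by (simp add: ennreal_le_iff)
  moreover have "real DIM('a) * \<epsilon>\<^sup>2 * D * (2 * \<epsilon>) ^ DIM('a) = Z * E"
    unfolding Z_def E_def power_mult_distrib by (simp only: mult_ac)
  moreover have "(\<Sum>k\<in>K. 2 * E * A k - 2 * (B k)\<^sup>2) = 2 * (E * (\<Sum>k\<in>K. A k)) - 2 * (\<Sum>k\<in>K. (B k)\<^sup>2)"
    by (simp only: sum_subtractf sum_distrib_left mult.assoc)
  \<comment> \<open>The double integrals bound twice the wanted difference by \<open>Z * E\<close>;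
    since \<open>Z * E\<close> is nonnegative, the factor 2 may be dropped.\<close>
  moreover have "0 \<le> Z * E" using D E by (simp add: Z_def)
  ultimately have "E * (\<Sum>k\<in>K. A k) \<le> Z * E + (\<Sum>k\<in>K. (B k)\<^sup>2)"
    by linarith
  then have "(\<Sum>k\<in>K. A k) \<le> (Z * E + (\<Sum>k\<in>K. (B k)\<^sup>2)) / E"
    using E by (simp add: pos_le_divide_eq mult.commute)
  also have "\<dots> = Z + (\<Sum>k\<in>K. (B k)\<^sup>2) / E"
    using E by (simp add: add_divide_distrib)
  finally have "(\<Sum>k\<in>K. A k) \<le> Z + (\<Sum>k\<in>K. (B k)\<^sup>2) / E" .
  moreover have "(\<integral>x. (w x)\<^sup>2 \<partial>lborel) = (\<Sum>k\<in>K. A k)"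
  proof -
    have "(w x)\<^sup>2 = (\<Sum>k\<in>K. I k x * (w x)\<^sup>2)" for x
    proof (cases "w x = 0")
      case False
      then have "cell \<epsilon> x \<in> K" using K(2) by auto
      moreover have "(\<Sum>k\<in>K. I k x * (w x)\<^sup>2) = (\<Sum>k\<in>K. if k = cell \<epsilon> x then (w x)\<^sup>2 else 0)"
        by (intro sum.cong) (auto simp: I_def indicator_def)
      ultimately show ?thesis using K(1) by (simp add: sum.delta')
    qed simp
    then have "(\<integral>x. (w x)\<^sup>2 \<partial>lborel) = (\<integral>x. (\<Sum>k\<in>K. I k x * (w x)\<^sup>2) \<partial>lborel)" by presburger
    also have "\<dots> = (\<Sum>k\<in>K. A k)" using intA by (simp add: A_def)
    finally show ?thesis .
  qed
  ultimately have "(\<integral>x. (w x)\<^sup>2 \<partial>lborel) \<le> Z + (\<Sum>k\<in>K. (B k)\<^sup>2) / E" by simp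
  then show ?thesis unfolding B_def I_def D_def E_def Z_def .
qed

text \<open>The sum of the squared cell integrals is at most the square of the sum of their absolute
  values, hence of the L1 norm. The scale \<open>\<epsilon>\<close> stays free: optimising it gives
  Nash's inequality in its usual form, while the truncation argument picks it level by
  level.\<close>

lemma C1_compact_Nash:
  fixes w :: "'a::euclidean_space \<Rightarrow> real"
  assumes w: "C1_compact w G" and \<epsilon>: "\<epsilon> > 0"
  shows "(\<integral>x. (w x)\<^sup>2 \<partial>lborel) \<le> 2 ^ DIM('a) * real DIM('a) * \<epsilon>\<^sup>2 * (\<integral>x. (norm (G x))\<^sup>2 \<partial>lborel)
     + (\<integral>x. \<bar>w x\<bar> \<partial>lborel)\<^sup>2 / \<epsilon> ^ DIM('a)"
proof -
  define K where "K = cell \<epsilon> ` {x. w x \<noteq> 0}"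
  have K: "finite K"
    unfolding K_def by (rule finite_cells[OF _ \<epsilon>]) (use w in \<open>simp add: C1_compact_def\<close>)
  define B where "B k = (\<integral>x. indicator {y. cell \<epsilon> y = k} x * w x \<partial>lborel)" for k
  define C where "C k = (\<integral>x. indicator {y. cell \<epsilon> y = k} x * \<bar>w x\<bar> \<partial>lborel)" for k
  have int: "integrable lborel (\<lambda>x. indicator {y. cell \<epsilon> y = k} x * \<bar>w x\<bar>)" for k
    using integrable_mult_indicator[OF _ C1_compact_integrable(3)[OF w], of "{y. cell \<epsilon> y = k}"] by simp
  have C0: "0 \<le> C k" for k unfolding C_def by (intro integral_nonneg_AE AE_I2) auto
  have BC: "\<bar>B k\<bar> \<le> C k" for k
    using integral_norm_bound[of lborel "\<lambda>x. indicator {y. cell \<epsilon> y = k} x * w x"]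
    unfolding B_def C_def by (simp add: abs_mult)
  have "(\<Sum>k\<in>K. (B k)\<^sup>2) \<le> (\<Sum>k\<in>K. (C k)\<^sup>2)"
  proof (rule sum_mono)
    fix k
    show "(B k)\<^sup>2 \<le> (C k)\<^sup>2"
      using power_mono[OF BC[of k], of 2] by simp
  qed
  also have "\<dots> \<le> (\<Sum>k\<in>K. C k)\<^sup>2"
  proof -
    have "(\<Sum>k\<in>K. (C k)\<^sup>2) \<le> (\<Sum>k\<in>K. C k * (\<Sum>k\<in>K. C k))"
    proof (rule sum_mono)
      fix k assume "k \<in> K"
      with K C0 have "C k \<le> (\<Sum>k\<in>K. C k)" by (intro member_le_sum)
      then show "(C k)\<^sup>2 \<le> C k * (\<Sum>k\<in>K. C k)"
        unfolding power2_eq_square using C0 by (rule mult_left_mono)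
    qed
    also have "\<dots> = (\<Sum>k\<in>K. C k)\<^sup>2"
      by (simp only: sum_distrib_right[symmetric] power2_eq_square)
    finally show ?thesis .
  qed
  finally have BC2: "(\<Sum>k\<in>K. (B k)\<^sup>2) \<le> (\<Sum>k\<in>K. C k)\<^sup>2" .
  have "(\<Sum>k\<in>K. C k) \<le> (\<integral>x. \<bar>w x\<bar> \<partial>lborel)"
  proof -
    have "(\<Sum>k\<in>K. C k) = (\<integral>x. (\<Sum>k\<in>K. indicator {y. cell \<epsilon> y = k} x * \<bar>w x\<bar>) \<partial>lborel)"
      unfolding C_def by (rule Bochner_Integration.integral_sum[symmetric]) (rule int)
    also have "\<dots> \<le> (\<integral>x. \<bar>w x\<bar> \<partial>lborel)"
    proof (rule integral_mono)
      fix x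
      have "(\<Sum>k\<in>K. indicator {y. cell \<epsilon> y = k} x * \<bar>w x\<bar>) = (\<Sum>k\<in>K. if k = cell \<epsilon> x then \<bar>w x\<bar> else 0)"
        by (intro sum.cong) (auto simp: indicator_def)
      also have "\<dots> \<le> \<bar>w x\<bar>" using K by (simp add: sum.delta')
      finally show "(\<Sum>k\<in>K. indicator {y. cell \<epsilon> y = k} x * \<bar>w x\<bar>) \<le> \<bar>w x\<bar>" .
    qed (auto intro!: Bochner_Integration.integrable_sum int C1_compact_integrable(3)[OF w])
    finally show ?thesis .
  qed
  then have "(\<Sum>k\<in>K. C k)\<^sup>2 \<le> (\<integral>x. \<bar>w x\<bar> \<partial>lborel)\<^sup>2"
    by (rule power_mono) (simp add: C0 sum_nonneg)
  with BC2 have "(\<Sum>k\<in>K. (B k)\<^sup>2) \<le> (\<integral>x. \<bar>w x\<bar> \<partial>lborel)\<^sup>2" by simp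
  then have "(\<Sum>k\<in>K. (B k)\<^sup>2) / \<epsilon> ^ DIM('a) \<le> (\<integral>x. \<bar>w x\<bar> \<partial>lborel)\<^sup>2 / \<epsilon> ^ DIM('a)"
    using \<epsilon> by (intro divide_right_mono) auto
  moreover have "(\<integral>x. (w x)\<^sup>2 \<partial>lborel) \<le> 2 ^ DIM('a) * real DIM('a) * \<epsilon>\<^sup>2 * (\<integral>x. (norm (G x))\<^sup>2 \<partial>lborel)
     + (\<Sum>k\<in>K. (B k)\<^sup>2) / \<epsilon> ^ DIM('a)"
    unfolding B_def by (rule C1_compact_cell_estimate[OF w \<epsilon> K]) (auto simp: K_def)
  ultimately show ?thesis by linarith
qed

subsection \<open>The Sobolev inequality\<close>

text \<open>The cubic smoothstep, rising from 0 at 1 to 1 at 2; both end slopes vanish, so it is C1.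
  Hence \<open>2 ^ k * cutoff (w / 2 ^ k)\<close> is 0 where \<open>w \<le> 2 ^ k\<close> and equals
  \<open>2 ^ k\<close> where \<open>w \<ge> 2 ^ (k + 1)\<close>.\<close>

definition cutoff :: "real \<Rightarrow> real" where
  "cutoff s = (let c = max 0 (min 1 (s - 1)) in 3 * c\<^sup>2 - 2 * c ^ 3)"

definition cutoff' :: "real \<Rightarrow> real" where
  "cutoff' s = (let c = max 0 (min 1 (s - 1)) in 6 * c * (1 - c))"

lemma cutoff_simps:
  "s \<le> 1 \<Longrightarrow> cutoff s = 0" "s \<ge> 2 \<Longrightarrow> cutoff s = 1"
  "1 \<le> s \<Longrightarrow> s \<le> 2 \<Longrightarrow> cutoff s = 3 * (s - 1)\<^sup>2 - 2 * (s - 1) ^ 3"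
  by (auto simp: cutoff_def Let_def max_def min_def)

lemma cutoff'_eq_0: "s \<le> 1 \<Longrightarrow> cutoff' s = 0" "s \<ge> 2 \<Longrightarrow> cutoff' s = 0"
  by (auto simp: cutoff'_def Let_def max_def min_def)

lemma cutoff'_bounds: "0 \<le> cutoff' s" "cutoff' s \<le> 3/2"
proof -
  define c where "c = max 0 (min 1 (s - 1))"
  have c: "0 \<le> c" "c \<le> 1" by (auto simp: c_def)
  have "cutoff' s = 6 * c * (1 - c)" by (simp add: cutoff'_def c_def Let_def)
  moreover have "0 \<le> 6 * c * (1 - c)" using c by simp
  moreover have "6 * c * (1 - c) \<le> 3/2"
    using zero_le_power2[of "c - 1/2"] by (simp add: power2_eq_square algebra_simps)
  ultimately show "0 \<le> cutoff' s" "cutoff' s \<le> 3/2" by auto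
qed

lemma cutoff_bounds: "0 \<le> cutoff s" "cutoff s \<le> 1"
proof -
  define c where "c = max 0 (min 1 (s - 1))"
  have c: "0 \<le> c" "c \<le> 1" by (auto simp: c_def)
  have e: "cutoff s = 3 * c\<^sup>2 - 2 * c ^ 3" by (simp add: cutoff_def c_def Let_def)
  have "3 * c\<^sup>2 - 2 * c ^ 3 = c\<^sup>2 * (3 - 2 * c)"
    by (simp add: power2_eq_square power3_eq_cube algebra_simps)
  with c e show "0 \<le> cutoff s" by simp
  have "1 - (3 * c\<^sup>2 - 2 * c ^ 3) = (1 - c)\<^sup>2 * (1 + 2 * c)"
    by (simp add: power2_eq_square power3_eq_cube algebra_simps)
  moreover have "(1 - c)\<^sup>2 * (1 + 2 * c) \<ge> 0" using c by simp
  ultimately show "cutoff s \<le> 1" using e by linarith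
qed

text \<open>One-sided derivatives glued along the two closed half-lines; needed at the break points
  1 and 2 of the cutoff.\<close>

lemma has_real_derivative_join:
  fixes f g h :: "real \<Rightarrow> real"
  assumes "(f has_real_derivative D) (at a)" "(g has_real_derivative D) (at a)"
    and "e > 0"
    and "\<And>x. a - e < x \<Longrightarrow> x \<le> a \<Longrightarrow> h x = f x" "\<And>x. a \<le> x \<Longrightarrow> x < a + e \<Longrightarrow> h x = g x"
  shows "(h has_real_derivative D) (at a)"
proof -
  have "(h has_real_derivative D) (at a within {..a})"
  proof (rule has_field_derivative_transform_within[of f D a "{..a}" e])
    show "(f has_real_derivative D) (at a within {..a})"
      using assms(1) by (rule has_field_derivative_at_within)
  qed (use assms(3,4) in \<open>auto simp: dist_real_def abs_if split: if_splits\<close>)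
  moreover have "(h has_real_derivative D) (at a within {a..})"
  proof (rule has_field_derivative_transform_within[of g D a "{a..}" e])
    show "(g has_real_derivative D) (at a within {a..})"
      using assms(2) by (rule has_field_derivative_at_within)
  qed (use assms(3,5) in \<open>auto simp: dist_real_def abs_if split: if_splits\<close>)
  ultimately have "(h has_real_derivative D) (at a within {..a} \<union> {a..})"
    unfolding has_field_derivative_iff by (rule Lim_Un)
  moreover have "{..a} \<union> {a..} = UNIV" by auto
  ultimately show ?thesis by simp
qed

lemma cutoff_deriv: "(cutoff has_real_derivative cutoff' s) (at s)"
proof -
  define P where "P s = 3 * (s - 1)\<^sup>2 - 2 * (s - 1) ^ 3" for s :: real
  have P: "(P has_real_derivative 6 * (s - 1) * (1 - (s - 1))) (at s)" for s
    unfolding P_def by (auto intro!: derivative_eq_intros simp: power2_eq_square algebra_simps)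
  have const: "((\<lambda>s. c) has_real_derivative 0) (at s)" for c s :: real by simp
  consider "s < 1" | "s = 1" | "1 < s" "s < 2" | "s = 2" | "s > 2" by linarith
  then show ?thesis
  proof cases
    case 1
    have "(cutoff has_real_derivative 0) (at s)"
      by (rule has_field_derivative_transform_within_open[OF const[of 0] open_lessThan[of 1]])
        (use 1 in \<open>auto simp: cutoff_simps\<close>)
    with 1 show ?thesis by (simp add: cutoff'_eq_0)
  next
    case 2
    have "(cutoff has_real_derivative 0) (at 1)"
      by (rule has_real_derivative_join[where f = "\<lambda>_. 0" and g = P and e = 1])
        (use P[of 1] in \<open>auto simp: cutoff_simps P_def\<close>)
    with 2 show ?thesis by (simp add: cutoff'_eq_0)
  next
    case 3
    have "(cutoff has_real_derivative 6 * (s - 1) * (1 - (s - 1))) (at s)"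
      by (rule has_field_derivative_transform_within_open[OF P open_greaterThanLessThan[of 1 2]])
        (use 3 in \<open>auto simp: cutoff_simps P_def\<close>)
    with 3 show ?thesis by (simp add: cutoff'_def)
  next
    case 4
    have "(cutoff has_real_derivative 0) (at 2)"
      by (rule has_real_derivative_join[where f = P and g = "\<lambda>_. 1" and e = 1])
        (use P[of 2] in \<open>auto simp: cutoff_simps P_def\<close>)
    with 4 show ?thesis by (simp add: cutoff'_eq_0)
  next
    case 5
    have "(cutoff has_real_derivative 0) (at s)"
      by (rule has_field_derivative_transform_within_open[OF const[of 1] open_greaterThan[of 2]])
        (use 5 in \<open>auto simp: cutoff_simps\<close>)
    with 5 show ?thesis by (simp add: cutoff'_eq_0)
  qed
qed

lemma continuous_on_cutoff': "continuous_on UNIV cutoff'"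
  unfolding cutoff'_def Let_def by (intro continuous_intros)

section \<open>Truncation of C1 functions at dyadic heights\<close>

lemma C1_compact_cutoff:
  fixes w :: "'a::euclidean_space \<Rightarrow> real"
  assumes w: "C1_compact w G" and t: "t > 0"
  shows "C1_compact (\<lambda>x. t * cutoff (w x / t)) (\<lambda>x. cutoff' (w x / t) *\<^sub>R G x)"
  unfolding C1_compact_def
proof (intro conjI allI)
  note cont = C1_compact_continuous[OF w]
  show "((\<lambda>x. t * cutoff (w x / t)) has_derivative (\<bullet>) (cutoff' (w x / t) *\<^sub>R G x)) (at x)" for x
  proof -
    have "((\<lambda>x. w x / t) has_derivative (\<lambda>h. (G x \<bullet> h) / t)) (at x)"
      using w t by (auto simp: C1_compact_def intro!: derivative_eq_intros)
    then have "((\<lambda>x. cutoff (w x / t)) has_derivative (\<lambda>h. cutoff' (w x / t) * ((G x \<bullet> h) / t))) (at x)"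
      using cutoff_deriv[unfolded has_field_derivative_def]
      by (rule has_derivative_compose)
    then have "((\<lambda>x. t * cutoff (w x / t)) has_derivative (\<lambda>h. t * (cutoff' (w x / t) * ((G x \<bullet> h) / t)))) (at x)"
      by (rule has_derivative_mult_right)
    moreover have "(\<lambda>h. t * (cutoff' (w x / t) * ((G x \<bullet> h) / t))) = (\<bullet>) (cutoff' (w x / t) *\<^sub>R G x)"
      using t by (auto simp: fun_eq_iff)
    ultimately show ?thesis by simp
  qed
  show "continuous_on UNIV (\<lambda>x. cutoff' (w x / t) *\<^sub>R G x)"
    using t by (intro continuous_intros cont continuous_on_compose2[OF continuous_on_cutoff']) auto
  have "{x. t * cutoff (w x / t) \<noteq> 0} \<subseteq> {x. w x \<noteq> 0}"
    by (auto simp: cutoff_simps)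
  then show "bounded {x. t * cutoff (w x / t) \<noteq> 0}"
    using w bounded_subset by (auto simp: C1_compact_def)
qed

text \<open>Beyond \<open>T = (2 * K1) powr (1 / (1 - \<theta>))\<close> the sublinear term is at
  most \<open>A / 2\<close> and can be absorbed. This turns a self-referential estimate into an
  explicit bound.\<close>

lemma sublinear_bound:
  fixes \<theta> :: real
  assumes "0 < \<theta>" "\<theta> < 1" "K1 \<ge> 0" "K2 \<ge> 0"
  obtains K3 where "K3 \<ge> 0" "\<forall>A\<ge>0. A \<le> K1 * A powr \<theta> + K2 \<longrightarrow> A \<le> K3"
proof
  define T where "T = (2 * K1) powr (1 / (1 - \<theta>))"
  show "max (2 * K2) T \<ge> 0" using assms by auto
  show "\<forall>A\<ge>0. A \<le> K1 * A powr \<theta> + K2 \<longrightarrow> A \<le> max (2 * K2) T"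
  proof (intro allI impI)
    fix A :: real assume A: "A \<ge> 0" "A \<le> K1 * A powr \<theta> + K2"
    show "A \<le> max (2 * K2) T"
    proof (cases "A \<le> T")
      case False
      have T0: "T \<ge> 0" by (simp add: T_def)
      with False have A0: "A > 0" by linarith
      have "T powr (1 - \<theta>) = 2 * K1"
        using assms by (simp add: T_def powr_powr)
      moreover have "T powr (1 - \<theta>) \<le> A powr (1 - \<theta>)"
        using False T0 assms by (intro powr_mono2) auto
      ultimately have "2 * K1 * A powr \<theta> \<le> A powr (1 - \<theta>) * A powr \<theta>"
        by (intro mult_right_mono) auto
      also have "\<dots> = A" using A0 by (simp add: powr_add[symmetric])
      finally show ?thesis using A by simp
    qed auto
  qed
qed

lemma superlevel_borel [measurable]:
  assumes "C1_compact w G"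
  shows "{x. w x > t} \<in> sets borel"
proof -
  have "open {x. w x > t}"
    using C1_compact_continuous(1)[OF assms] by (intro open_Collect_less continuous_intros)
  then show ?thesis by simp
qed

text \<open>The truncations \<open>2 ^ k * cutoff (w / 2 ^ k)\<close> have gradients with disjoint supports, and Nash's
  inequality for each of them, at a scale \<open>\<epsilon>\<close> adapted to \<open>k\<close>, controls the distribution function
  of \<open>w\<close> (the truncation method of Bakry, Coulhon, Ledoux and Saloff-Coste).\<close>

lemma C1_compact_Sobolev_positive_part:
  fixes B :: "'a::euclidean_space set"
  assumes N: "DIM('a) \<ge> 3" and B: "bounded B" "B \<in> sets borel"
  obtains C where "C \<ge> 0" "\<forall>w G. C1_compact w G \<and> {x. w x \<noteq> 0} \<subseteq> B \<and> (\<integral>x. (norm (G x))\<^sup>2 \<partial>lborel) \<le> 1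
    \<longrightarrow> (\<integral>x. (max 0 (w x)) powr crit_exp DIM('a) \<partial>lborel) \<le> C"
proof -
  define N where "N = real DIM('a)"
  define p where "p = crit_exp DIM('a)"
  have N3: "N \<ge> 3" using N by (simp add: N_def)
  have p: "p = 2 * N / (N - 2)" by (simp add: p_def N_def crit_exp_def)
  have p2: "p > 2" using N3 by (simp add: p field_simps)
  define \<theta> where "\<theta> = 2 / N"
  have \<theta>: "0 < \<theta>" "\<theta> < 1" using N3 by (auto simp: \<theta>_def)
  \<comment> \<open>The scaling identity of the critical exponent: it makes the powers of 2 in the
    recursion below match exactly.\<close>
  have p\<theta>: "p * \<theta> = p - 2" using N3 by (simp add: p \<theta>_def field_simps)
  define m where "m = measure lborel B"
  have m0: "m \<ge> 0" by (simp add: m_def)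
  have Bfin: "emeasure lborel B < \<infinity>" using emeasure_bounded_finite[OF B(1)] by (simp add: less_top)
  define P where "P = 2 powr p"
  have P1: "P \<ge> 1" using p2 by (simp add: P_def ge_one_powr_ge_zero)
  \<comment> \<open>Chosen so that the factor \<open>P\<close> lost between consecutive levels
    leaves the coefficient \<open>P * \<delta> = 1 / 2\<close>, and the term can be
    absorbed.\<close>
  define \<delta> where "\<delta> = 1 / (2 * P)"
  have \<delta>: "\<delta> > 0" using P1 by (simp add: \<delta>_def)
  define c where "c = 2 ^ DIM('a) * N * (1 / \<delta>) powr \<theta>"
  have c0: "c \<ge> 0" using N3 by (simp add: c_def)
  obtain K3 where K3: "K3 \<ge> 0" "\<forall>A\<ge>0. A \<le> (2 * P * c * (9/4)) * A powr \<theta> + 2 * m \<longrightarrow> A \<le> K3"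
    using sublinear_bound[OF \<theta>, of "2 * P * c * (9/4)" "2 * m"] c0 P1 m0 by auto
  have main: "(\<integral>x. (max 0 (w x)) powr p \<partial>lborel) \<le> m + P * K3"
    if w: "C1_compact w G" and supp: "{x. w x \<noteq> 0} \<subseteq> B" and D1: "(\<integral>x. (norm (G x))\<^sup>2 \<partial>lborel) \<le> 1" for w G
  proof -
    have [measurable]: "w \<in> borel_measurable borel" "G \<in> borel_measurable borel"
      using C1_compact_continuous[OF w] by (auto intro: borel_measurable_continuous_onI)
    define S where "S k = {x. w x > 2 ^ k}" for k :: nat
    define \<mu> where "\<mu> k = measure lborel (S k)" for k
    have SB: "S k \<subseteq> B" for k
    proof
      fix x assume "x \<in> S k"
      then have "w x > 2 ^ k" by (simp add: S_def)
      then have "w x > 0" using zero_less_power[of "2::real" k] by linarith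
      with supp show "x \<in> B" by auto
    qed
    have S_sets: "S k \<in> sets borel" for k unfolding S_def by (rule superlevel_borel[OF w])
    have S_fin: "emeasure lborel (S k) < \<infinity>" for k
      using emeasure_mono[OF SB, of lborel k] B Bfin by (auto intro: le_less_trans)
    have intS: "integrable lborel (indicator (S k) :: 'a \<Rightarrow> real)" for k
      using S_sets S_fin by (intro integrable_real_indicator) auto
    have \<mu>_int: "(\<integral>x. indicator (S k) x \<partial>lborel) = \<mu> k" for k
      by (simp add: \<mu>_def)
    have \<mu>0: "\<mu> k \<ge> 0" for k by (simp add: \<mu>_def)
    have \<mu>m: "\<mu> k \<le> m" for k
      unfolding \<mu>_def m_def using S_sets B(2) Bfin
      by (intro measure_mono_fmeasurable SB) (auto simp: fmeasurable_def)
    define T where "T k x = 2 ^ k * cutoff (w x / 2 ^ k)" for k :: nat and x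
    define H where "H k x = cutoff' (w x / 2 ^ k) *\<^sub>R G x" for k :: nat and x
    have TH: "C1_compact (T k) (H k)" for k
      unfolding T_def H_def by (rule C1_compact_cutoff[OF w]) simp
    define D where "D k = (\<integral>x. (norm (H k x))\<^sup>2 \<partial>lborel)" for k
    have D0: "D k \<ge> 0" for k by (simp add: D_def)
    \<comment> \<open>Every point lies in the transition zone of at most one level, so the energies
      of all truncations add up to at most \<open>(3/2)\<^sup>2\<close> times the energy of
      w.\<close>
    have sumD: "(\<Sum>k<n. D k) \<le> 9/4" for n
    proof -
      have pt: "(\<Sum>k<n. (norm (H k x))\<^sup>2) \<le> 9/4 * (norm (G x))\<^sup>2" for x
      proof -
        have sq: "(cutoff' s)\<^sup>2 \<le> 9/4" for s
          using power_mono[OF cutoff'_bounds(2) cutoff'_bounds(1), of s 2] by (simp add: power2_eq_square)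
        have "(\<Sum>k<n. (cutoff' (w x / 2 ^ k))\<^sup>2) \<le> 9/4"
        proof (cases "\<exists>k. 2 ^ k < w x \<and> w x < 2 * 2 ^ k")
          case True
          then obtain k0 where k0: "2 ^ k0 < w x" "w x < 2 * 2 ^ k0" by blast
          have z: "cutoff' (w x / 2 ^ k) = 0" if "k \<noteq> k0" for k
          proof (cases "k < k0")
            case True
            then have "(2::real) * 2 ^ k \<le> 2 ^ k0"
              using power_increasing[of "Suc k" k0 "2::real"] by simp
            then have "w x / 2 ^ k \<ge> 2" using k0 by (simp add: field_simps)
            then show ?thesis by (rule cutoff'_eq_0)
          next
            case False
            then have "(2::real) * 2 ^ k0 \<le> 2 ^ k"
              using that power_increasing[of "Suc k0" k "2::real"] by simp
            then have "w x / 2 ^ k \<le> 1" using k0 by (simp add: field_simps)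
            then show ?thesis by (rule cutoff'_eq_0)
          qed
          have "(\<Sum>k<n. (cutoff' (w x / 2 ^ k))\<^sup>2) = (\<Sum>k<n. if k = k0 then (cutoff' (w x / 2 ^ k0))\<^sup>2 else 0)"
            using z by (intro sum.cong) auto
          also have "\<dots> \<le> 9/4" using sq by (simp add: sum.delta)
          finally show ?thesis .
        next
          case False
          have "cutoff' (w x / 2 ^ k) = 0" for k
          proof (cases "2 ^ k < w x")
            case True
            with False have "w x \<ge> 2 * 2 ^ k" by (meson not_le)
            then have "w x / 2 ^ k \<ge> 2" by (simp add: field_simps)
            then show ?thesis by (rule cutoff'_eq_0)
          next
            case False
            then have "w x / 2 ^ k \<le> 1" by (simp add: field_simps)
            then show ?thesis by (rule cutoff'_eq_0)
          qed
          then show ?thesis by simp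
        qed
        then have "(\<Sum>k<n. (cutoff' (w x / 2 ^ k))\<^sup>2) * (norm (G x))\<^sup>2 \<le> 9/4 * (norm (G x))\<^sup>2"
          by (rule mult_right_mono) simp
        then show ?thesis by (simp add: H_def power_mult_distrib sum_distrib_right)
      qed
      have "(\<Sum>k<n. D k) = (\<integral>x. (\<Sum>k<n. (norm (H k x))\<^sup>2) \<partial>lborel)"
        unfolding D_def by (rule Bochner_Integration.integral_sum[symmetric]) (rule C1_compact_integrable(4)[OF TH])
      also have "\<dots> \<le> (\<integral>x. 9/4 * (norm (G x))\<^sup>2 \<partial>lborel)"
        by (intro integral_mono pt Bochner_Integration.integrable_sum integrable_mult_right
            C1_compact_integrable(4)[OF TH] C1_compact_integrable(4)[OF w])
      also have "\<dots> \<le> 9/4" using D1 by simp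
      finally show ?thesis .
    qed
    \<comment> \<open>\<open>T k\<close> equals \<open>2 ^ k\<close> on \<open>S (Suc k)\<close>,
      and it lives on \<open>S k\<close> with values at most \<open>2 ^ k\<close>. Nash's inequality
      thus becomes a relation between consecutive level sets.\<close>
    have Nash: "2 ^ (2 * k) * \<mu> (Suc k) \<le> 2 ^ DIM('a) * N * \<epsilon>\<^sup>2 * D k + (2 ^ k * \<mu> k)\<^sup>2 / \<epsilon> ^ DIM('a)"
      if "\<epsilon> > 0" for \<epsilon> k
    proof -
      have "2 ^ (2 * k) * \<mu> (Suc k) = (\<integral>x. 2 ^ (2 * k) * indicator (S (Suc k)) x \<partial>lborel)"
        by (simp add: \<mu>_def)
      also have "\<dots> \<le> (\<integral>x. (T k x)\<^sup>2 \<partial>lborel)"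
      proof (rule integral_mono)
        fix x
        show "2 ^ (2 * k) * indicator (S (Suc k)) x \<le> (T k x)\<^sup>2"
        proof (cases "x \<in> S (Suc k)")
          case True
          then have "w x / 2 ^ k \<ge> 2" by (simp add: S_def field_simps)
          with True show ?thesis by (simp add: T_def cutoff_simps power_even_eq)
        qed simp
      qed (auto intro!: integrable_mult_right intS C1_compact_integrable(2)[OF TH])
      also have "\<dots> \<le> 2 ^ DIM('a) * real DIM('a) * \<epsilon>\<^sup>2 * D k + (\<integral>x. \<bar>T k x\<bar> \<partial>lborel)\<^sup>2 / \<epsilon> ^ DIM('a)"
        unfolding D_def by (rule C1_compact_Nash[OF TH that])
      also have "(\<integral>x. \<bar>T k x\<bar> \<partial>lborel)\<^sup>2 / \<epsilon> ^ DIM('a) \<le> (2 ^ k * \<mu> k)\<^sup>2 / \<epsilon> ^ DIM('a)"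
      proof (intro divide_right_mono power_mono)
        have "(\<integral>x. \<bar>T k x\<bar> \<partial>lborel) \<le> (\<integral>x. 2 ^ k * indicator (S k) x \<partial>lborel)"
        proof (rule integral_mono)
          fix x
          show "\<bar>T k x\<bar> \<le> 2 ^ k * indicator (S k) x"
          proof (cases "x \<in> S k")
            case True
            then show ?thesis using cutoff_bounds[of "w x / 2 ^ k"] by (simp add: T_def abs_mult)
          next
            case False
            then have "w x / 2 ^ k \<le> 1" by (simp add: S_def field_simps)
            then show ?thesis using False by (simp add: T_def cutoff_simps)
          qed
        qed (auto intro!: integrable_mult_right intS C1_compact_integrable(3)[OF TH])
        then show "(\<integral>x. \<bar>T k x\<bar> \<partial>lborel) \<le> 2 ^ k * \<mu> k" by (simp add: \<mu>_def)
        show "0 \<le> (\<integral>x. \<bar>T k x\<bar> \<partial>lborel)" by (intro integral_nonneg_AE AE_I2) simp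
      qed (use that in auto)
      finally show ?thesis by (simp add: N_def)
    qed
    \<comment> \<open>With \<open>P = 2 powr p\<close> these are the dyadic layers of the integral
      of the p-th power of w.\<close>
    define a where "a k = P ^ k * \<mu> k" for k
    have a0: "a k \<ge> 0" for k using P1 \<mu>0 by (simp add: a_def)
    have rec: "a (Suc k) \<le> P * c * (a k) powr \<theta> * D k + a k / 2" for k
    proof (cases "\<mu> k = 0")
      case True
      have "S (Suc k) \<subseteq> S k" by (auto simp: S_def intro: le_less_trans[rotated])
      then have "\<mu> (Suc k) \<le> \<mu> k"
        unfolding \<mu>_def using S_sets S_fin by (intro measure_mono_fmeasurable) (auto simp: fmeasurable_def)
      with True \<mu>0[of "Suc k"] have "\<mu> (Suc k) = 0" by simp
      then show ?thesis using P1 c0 D0 a0 by (simp add: a_def)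
    next
      case False
      then have mk: "\<mu> k > 0" using \<mu>0[of k] by simp
      \<comment> \<open>The scale at which one cell has measure \<open>\<mu> k / \<delta>\<close>;
        the L1 term of Nash's inequality then equals
        \<open>\<delta> * 2 ^ (2 * k) * \<mu> k\<close>. The case \<open>\<mu> k = 0\<close>, where
        this scale degenerates, has been treated apart.\<close>
      define \<epsilon> where "\<epsilon> = (\<mu> k / \<delta>) powr (1 / N)"
      have \<epsilon>: "\<epsilon> > 0" using mk \<delta> by (simp add: \<epsilon>_def)
      have \<epsilon>N: "\<epsilon> ^ DIM('a) = \<mu> k / \<delta>"
        using mk \<delta> N3 by (simp add: \<epsilon>_def powr_realpow[symmetric] powr_powr N_def[symmetric])
      have \<epsilon>2: "\<epsilon>\<^sup>2 = (1 / \<delta>) powr \<theta> * \<mu> k powr \<theta>"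
        using mk \<delta> by (simp add: \<epsilon>_def powr_realpow[symmetric] powr_powr \<theta>_def powr_divide powr_one_eq_one)
      \<comment> \<open>The scaling identity enters here: the weight \<open>P ^ k\<close> splits
        into the factor \<open>2 ^ (2 * k)\<close> of Nash's inequality and the power with exponent
        \<open>\<theta>\<close> of \<open>P ^ k\<close>.\<close>
      have pw: "(2 ^ (2 * k)) * P powr (\<theta> * real k) = P ^ k"
      proof -
        have "(2::real) ^ (2 * k) = 2 powr (2 * real k)" by (simp add: powr_realpow[symmetric])
        moreover have "P powr (\<theta> * real k) = 2 powr (p * \<theta> * real k)" by (simp add: P_def powr_powr mult.assoc)
        moreover have "P ^ k = 2 powr (p * real k)" by (simp add: P_def powr_powr powr_realpow[symmetric])
        moreover have "2 * real k + p * \<theta> * real k = p * real k"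
          by (simp only: p\<theta>) (simp add: algebra_simps)
        ultimately show ?thesis by (simp only: powr_add[symmetric])
      qed
      have ak: "(a k) powr \<theta> = P powr (\<theta> * real k) * \<mu> k powr \<theta>"
        using P1 mk by (simp add: a_def powr_mult powr_realpow[symmetric] powr_powr mult.commute)
      have "2 ^ (2 * k) * \<mu> (Suc k) \<le> 2 ^ DIM('a) * N * ((1 / \<delta>) powr \<theta> * \<mu> k powr \<theta>) * D k + (2 ^ k * \<mu> k)\<^sup>2 / (\<mu> k / \<delta>)"
        using Nash[OF \<epsilon>, of k] by (simp only: \<epsilon>N \<epsilon>2)
      also have "(2 ^ k * \<mu> k)\<^sup>2 / (\<mu> k / \<delta>) = \<delta> * (2 ^ (2 * k) * \<mu> k)"
        using mk \<delta> by (simp add: power_mult_distrib power_even_eq) (simp add: power2_eq_square)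
      finally have "2 ^ (2 * k) * \<mu> (Suc k) \<le> c * \<mu> k powr \<theta> * D k + \<delta> * (2 ^ (2 * k) * \<mu> k)"
        by (simp add: c_def mult_ac)
      then have "P * P powr (\<theta> * real k) * (2 ^ (2 * k) * \<mu> (Suc k)) \<le> P * P powr (\<theta> * real k) * (c * \<mu> k powr \<theta> * D k + \<delta> * (2 ^ (2 * k) * \<mu> k))"
        using P1 by (intro mult_left_mono) auto
      moreover have "P * P powr (\<theta> * real k) * (2 ^ (2 * k) * \<mu> (Suc k)) = a (Suc k)"
        by (simp add: a_def pw[symmetric] mult_ac)
      moreover have "P * P powr (\<theta> * real k) * (c * \<mu> k powr \<theta> * D k + \<delta> * (2 ^ (2 * k) * \<mu> k))
          = P * c * (a k) powr \<theta> * D k + (P * \<delta>) * a k"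
        unfolding ak by (simp add: a_def pw[symmetric] algebra_simps)
      moreover have "P * \<delta> = 1 / 2" using P1 by (simp add: \<delta>_def)
      ultimately show ?thesis by simp
    qed
    \<comment> \<open>Summing the recursion puts \<open>A / 2\<close> on the right; once it is
      absorbed, the sublinear inequality that defined \<open>K3\<close> remains. The bound does not
      depend on n.\<close>
    have A_le: "(\<Sum>k<n. a k) \<le> K3" for n
    proof -
      define A where "A = (\<Sum>k<n. a k)"
      have A0: "A \<ge> 0" using a0 by (simp add: A_def sum_nonneg)
      have "A \<le> (2 * P * c * (9/4)) * A powr \<theta> + 2 * m"
      proof (cases n)
        case 0
        then show ?thesis using m0 by (simp add: A_def)
      next
        case (Suc n')
        have aA: "a k \<le> A" if "k < n'" for k
          unfolding A_def using that a0 Suc by (intro member_le_sum) auto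
        have "A = a 0 + (\<Sum>k<n'. a (Suc k))"
          unfolding A_def Suc by (rule sum.lessThan_Suc_shift)
        also have "\<dots> \<le> m + (\<Sum>k<n'. P * c * A powr \<theta> * D k + a k / 2)"
        proof (intro add_mono sum_mono)
          show "a 0 \<le> m" using \<mu>m[of 0] by (simp add: a_def)
          fix k assume "k \<in> {..<n'}"
          then have "(a k) powr \<theta> \<le> A powr \<theta>" using aA a0 \<theta> by (intro powr_mono2) auto
          then have "P * c * (a k) powr \<theta> * D k \<le> P * c * A powr \<theta> * D k"
            using P1 c0 D0 by (intro mult_right_mono mult_left_mono) auto
          with rec[of k] show "a (Suc k) \<le> P * c * A powr \<theta> * D k + a k / 2" by linarith
        qed
        also have "\<dots> = m + P * c * A powr \<theta> * (\<Sum>k<n'. D k) + (\<Sum>k<n'. a k) / 2"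
          by (simp add: sum.distrib sum_distrib_left sum_divide_distrib)
        also have "\<dots> \<le> m + P * c * A powr \<theta> * (9/4) + A / 2"
        proof (intro add_mono order_refl mult_left_mono sumD divide_right_mono)
          show "(\<Sum>k<n'. a k) \<le> A" unfolding A_def Suc using a0[of n'] by simp
        qed (use P1 c0 in auto)
        finally show ?thesis by simp
      qed
      with K3(2) A0 show ?thesis unfolding A_def by blast
    qed
    obtain Bd where Bd: "Bd > 0" "\<forall>x. \<bar>w x\<bar> \<le> Bd" "\<forall>x. norm (G x) \<le> Bd"
      by (rule C1_compact_bounded[OF w])
    obtain n where n: "Bd < 2 ^ n" using real_arch_pow[of 2 Bd] by auto
    \<comment> \<open>Layer bound: where \<open>0 < w x \<le> 1\<close> the indicator of B suffices,
      and above height 1 the value is caught by the dyadic layer that contains it.\<close>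
    have pt: "(max 0 (w x)) powr p \<le> indicator B x + (\<Sum>k<n. P ^ Suc k * indicator (S k) x)" for x
    proof (cases "w x \<le> 0")
      case True
      then show ?thesis using P1 by (simp add: sum_nonneg)
    next
      case False
      then have xB: "x \<in> B" using supp by auto
      show ?thesis
      proof (cases "w x \<le> 1")
        case True
        then have "w x powr p \<le> 1" using False p2 powr_mono2[of p "w x" 1] by simp
        moreover have "0 \<le> (\<Sum>k<n. P ^ Suc k * indicator (S k) x)" using P1 by (intro sum_nonneg) auto
        ultimately show ?thesis using False xB by simp
      next
        case w1: False
        \<comment> \<open>With \<open>k = Suc j\<close> this is the layer
          \<open>2 ^ j < w x \<le> 2 ^ Suc j\<close>; boundedness of w supplies the top level
          n.\<close>
        define k where "k = (LEAST k. w x \<le> 2 ^ k)"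
        have wn: "w x \<le> 2 ^ n" using Bd(2) n by (meson abs_le_D1 less_imp_le order_trans)
        have k: "w x \<le> 2 ^ k" unfolding k_def using wn by (rule LeastI[where P = "\<lambda>k. w x \<le> 2 ^ k"])
        have "k \<le> n" unfolding k_def using wn by (rule Least_le[where P = "\<lambda>k. w x \<le> 2 ^ k"])
        have "k \<noteq> 0" using k w1 by (cases k) auto
        then obtain j where j: "k = Suc j" by (cases k) auto
        have "\<not> w x \<le> 2 ^ j" using not_less_Least[of j "\<lambda>k. w x \<le> 2 ^ k"] j k_def by auto
        then have xS: "x \<in> S j" by (simp add: S_def)
        have "w x powr p \<le> (2 ^ Suc j) powr p" using k j w1 p2 by (intro powr_mono2) auto
        also have "\<dots> = P ^ Suc j"
          unfolding P_def by (subst powr_realpow[symmetric], simp)+ (simp add: powr_powr mult.commute)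
        also have "\<dots> = P ^ Suc j * indicator (S j) x" using xS by simp
        also have "\<dots> \<le> (\<Sum>k<n. P ^ Suc k * indicator (S k) x)"
          using \<open>k \<le> n\<close> j P1 by (intro member_le_sum[of j "{..<n}" "\<lambda>k. P ^ Suc k * indicator (S k) x"]) auto
        finally show ?thesis using False by (simp add: add_increasing)
      qed
    qed
    have intB: "integrable lborel (indicator B :: 'a \<Rightarrow> real)"
      using B Bfin by (intro integrable_real_indicator) auto
    have "(\<integral>x. (max 0 (w x)) powr p \<partial>lborel) \<le> (\<integral>x. indicator B x + (\<Sum>k<n. P ^ Suc k * indicator (S k) x) \<partial>lborel)"
    proof (rule integral_mono_AE')
      show "integrable lborel (\<lambda>x. indicator B x + (\<Sum>k<n. P ^ Suc k * indicator (S k) x))"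
        by (intro Bochner_Integration.integrable_add Bochner_Integration.integrable_sum integrable_mult_right intB intS)
      show "AE x in lborel. 0 \<le> indicator B x + (\<Sum>k<n. P ^ Suc k * indicator (S k) x)"
        using P1 by (intro AE_I2 add_nonneg_nonneg sum_nonneg mult_nonneg_nonneg) auto
    qed (use pt in blast)
    also have "\<dots> = m + (\<integral>x. (\<Sum>k<n. P ^ Suc k * indicator (S k) x) \<partial>lborel)"
      by (subst Bochner_Integration.integral_add)
        (auto simp: m_def intro!: intB Bochner_Integration.integrable_sum integrable_mult_right intS simp del: power_Suc sum_mult_indicator)
    also have "(\<integral>x. (\<Sum>k<n. P ^ Suc k * indicator (S k) x) \<partial>lborel) = (\<Sum>k<n. P ^ Suc k * \<mu> k)"
      by (subst Bochner_Integration.integral_sum)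
        (auto simp: \<mu>_def intro!: integrable_mult_right intS simp del: power_Suc)
    also have "(\<Sum>k<n. P ^ Suc k * \<mu> k) = P * (\<Sum>k<n. a k)"
      by (simp add: a_def sum_distrib_left mult.assoc)
    also have "m + \<dots> \<le> m + P * K3" using A_le[of n] P1 by simp
    finally show ?thesis .
  qed
  show ?thesis
    by (rule that[of "m + P * K3"]) (use main m0 P1 K3(1) in \<open>auto simp: p_def\<close>)
qed

section \<open>Scaling, and the Sobolev inequality for functions of both signs\<close>

lemma C1_compact_cmult:
  assumes "C1_compact w G"
  shows "C1_compact (\<lambda>x. c * w x) (\<lambda>x. c *\<^sub>R G x)"
proof -
  have "bounded {x. c * w x \<noteq> 0}"
    by (rule bounded_subset[of "{x. w x \<noteq> 0}"]) (use assms in \<open>auto simp: C1_compact_def\<close>)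
  then show ?thesis
    using assms by (auto simp: C1_compact_def intro!: derivative_eq_intros continuous_intros)
qed

lemma C1_compact_integrable_powr:
  assumes "C1_compact w G" "p > 0"
  shows "integrable lborel (\<lambda>x. \<bar>w x\<bar> powr p)" "integrable lborel (\<lambda>x. (max 0 (w x)) powr p)"
proof -
  obtain R where "R > 0" and R: "\<forall>x. norm x > R \<longrightarrow> w x = 0" "\<forall>x. norm x > R \<longrightarrow> G x = 0"
    by (rule C1_compact_support[OF assms(1)])
  note cont = C1_compact_continuous[OF assms(1)]
  show "integrable lborel (\<lambda>x. \<bar>w x\<bar> powr p)" "integrable lborel (\<lambda>x. (max 0 (w x)) powr p)"
    by (rule integrable_lborel_compact_support[of _ R];
        use cont R assms(2) in \<open>auto intro!: continuous_intros continuous_on_powr'\<close>)+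
qed

text \<open>The positive parts of w and of \<open>- w\<close> are treated separately, and
  homogeneity removes the normalisation of the gradient: both sides have degree p in w.\<close>

lemma C1_compact_Sobolev:
  fixes B :: "'a::euclidean_space set"
  assumes N: "DIM('a) \<ge> 3" and B: "bounded B" "B \<in> sets borel"
  obtains C where "C \<ge> 0" "\<forall>w G. C1_compact w G \<and> {x. w x \<noteq> 0} \<subseteq> B
    \<longrightarrow> (\<integral>x. \<bar>w x\<bar> powr crit_exp DIM('a) \<partial>lborel)
      \<le> C * (\<integral>x. (norm (G x))\<^sup>2 \<partial>lborel) powr (crit_exp DIM('a) / 2)"
proof -
  define p where "p = crit_exp DIM('a)"
  have p2: "p > 2" using N by (simp add: p_def crit_exp_def field_simps)
  obtain C0 where C0: "C0 \<ge> 0" "\<forall>w G. C1_compact w G \<and> {x. w x \<noteq> 0} \<subseteq> B \<and> (\<integral>x. (norm (G x))\<^sup>2 \<partial>lborel) \<le> 1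
    \<longrightarrow> (\<integral>x. (max 0 (w x)) powr p \<partial>lborel) \<le> C0"
    unfolding p_def by (rule C1_compact_Sobolev_positive_part[OF N B]) blast
  have unit: "(\<integral>x. \<bar>w x\<bar> powr p \<partial>lborel) \<le> 2 * C0"
    if w: "C1_compact w G" "{x. w x \<noteq> 0} \<subseteq> B" "(\<integral>x. (norm (G x))\<^sup>2 \<partial>lborel) \<le> 1" for w G
  proof -
    have m: "C1_compact (\<lambda>x. - w x) (\<lambda>x. - G x)"
      using C1_compact_cmult[OF w(1), of "-1"] by simp
    have eq: "\<bar>w x\<bar> powr p = (max 0 (w x)) powr p + (max 0 (- w x)) powr p" for x
      using p2 by (cases "w x \<ge> 0") auto
    have "(\<integral>x. \<bar>w x\<bar> powr p \<partial>lborel) = (\<integral>x. (max 0 (w x)) powr p \<partial>lborel) + (\<integral>x. (max 0 (- w x)) powr p \<partial>lborel)"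
      unfolding eq using p2
      by (intro Bochner_Integration.integral_add C1_compact_integrable_powr(2)[OF w(1)] C1_compact_integrable_powr(2)[OF m]) auto
    moreover have "(\<integral>x. (max 0 (w x)) powr p \<partial>lborel) \<le> C0"
      using C0(2) w by blast
    moreover have "(\<integral>x. (max 0 (- w x)) powr p \<partial>lborel) \<le> C0"
      using C0(2)[rule_format, of "\<lambda>x. - w x" "\<lambda>x. - G x"] w(2,3) m by simp
    ultimately show ?thesis by linarith
  qed
  have main: "(\<integral>x. \<bar>w x\<bar> powr p \<partial>lborel) \<le> 2 * C0 * (\<integral>x. (norm (G x))\<^sup>2 \<partial>lborel) powr (p / 2)"
    if w: "C1_compact w G" "{x. w x \<noteq> 0} \<subseteq> B" for w G
  proof -
    define D where "D = (\<integral>x. (norm (G x))\<^sup>2 \<partial>lborel)"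
    define I where "I = (\<integral>x. \<bar>w x\<bar> powr p \<partial>lborel)"
    have D0: "D \<ge> 0" by (simp add: D_def)
    have scaled: "t powr p * I \<le> 2 * C0" if t: "t > 0" "t\<^sup>2 * D \<le> 1" for t
    proof -
      have "(\<integral>x. \<bar>t * w x\<bar> powr p \<partial>lborel) \<le> 2 * C0"
        by (rule unit[OF C1_compact_cmult[OF w(1)]])
          (use w(2) t in \<open>auto simp: power_mult_distrib D_def\<close>)
      then show ?thesis using t by (simp add: abs_mult powr_mult I_def)
    qed
    have "I \<le> 2 * C0 * D powr (p / 2)"
    \<comment> \<open>If the gradient has norm zero, all multiples of w are admissible, and a
      positive \<open>I\<close> would break the uniform bound.\<close>
    proof (cases "D = 0")
      case True
      have "\<not> I > 0"
      proof
        assume I: "I > 0"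
        define t where "t = ((2 * C0 + 1) / I) powr (1 / p)"
        have "t > 0" using I C0(1) by (simp add: t_def)
        moreover have "t powr p = (2 * C0 + 1) / I"
          using p2 I C0(1) by (simp add: t_def powr_powr)
        ultimately show False using scaled[of t] True I by simp
      qed
      then show ?thesis using True by simp
    next
      case False
      with D0 have D: "D > 0" by simp
      define t where "t = D powr (- 1 / 2)"
      have "t\<^sup>2 * D = 1"
      proof -
        have "t * t = D powr (- 1)"
          unfolding t_def by (simp flip: powr_add)
        then show ?thesis using D by (simp add: power2_eq_square powr_minus)
      qed
      moreover have t: "t > 0" using D by (simp add: t_def)
      ultimately have "t powr p * I \<le> 2 * C0" by (intro scaled) auto
      moreover have "t powr p * D powr (p / 2) = 1"
        using D by (simp add: t_def powr_powr powr_add[symmetric])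
      moreover have "t powr p * I * D powr (p / 2) \<le> 2 * C0 * D powr (p / 2)"
        using calculation(1) by (rule mult_right_mono) simp
      moreover have "t powr p * I * D powr (p / 2) = (t powr p * D powr (p / 2)) * I"
        by (simp only: mult_ac)
      ultimately show ?thesis by simp
    qed
    then show ?thesis by (simp add: I_def D_def)
  qed
  show ?thesis
    by (rule that[of "2 * C0"]) (use main C0(1) in \<open>auto simp: p_def\<close>)
qed

subsection \<open>Test functions\<close>

lemma Ck_const: "Ck k (\<lambda>x. c)"
  by (induction k arbitrary: c) auto

lemma Ck_Suc_imp: "Ck (Suc k) f \<Longrightarrow> Ck k f"
  by (induction k arbitrary: f) (auto simp: differentiable_imp_continuous_on)

lemma Ck_add: "Ck k f \<Longrightarrow> Ck k g \<Longrightarrow> Ck k (\<lambda>x. f x + g x)"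
proof (induction k arbitrary: f g)
  case (Suc k)
  have "frechet_derivative (\<lambda>x. f x + g x) (at x) = (\<lambda>h. frechet_derivative f (at x) h + frechet_derivative g (at x) h)" for x
    using Suc.prems
    by (intro frechet_derivative_at[symmetric] has_derivative_add)
      (auto simp: differentiable_on_def frechet_derivative_works[symmetric])
  with Suc show ?case by (auto intro!: differentiable_on_add)
qed (auto intro: continuous_on_add)

lemma Ck_mult: "Ck k f \<Longrightarrow> Ck k g \<Longrightarrow> Ck k (\<lambda>x. f x * g x)"
proof (induction k arbitrary: f g)
  case (Suc k)
  have "frechet_derivative (\<lambda>x. f x * g x) (at x)
      = (\<lambda>h. f x * frechet_derivative g (at x) h + frechet_derivative f (at x) h * g x)" for x
    using Suc.prems
    by (intro frechet_derivative_at[symmetric] has_derivative_mult)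
      (auto simp: differentiable_on_def frechet_derivative_works[symmetric])
  moreover have "Ck k f" "Ck k g" using Suc.prems Ck_Suc_imp by blast+
  ultimately show ?case using Suc by (auto intro!: differentiable_on_mult Ck_add)
qed (auto intro: continuous_on_mult)

lemma Ck_prod: "finite I \<Longrightarrow> (\<And>i. i \<in> I \<Longrightarrow> Ck k (f i)) \<Longrightarrow> Ck k (\<lambda>x. \<Prod>i\<in>I. f i x)"
  by (induction I rule: finite_induct) (auto intro: Ck_const Ck_mult)

text \<open>The hypothesis provides a whole tower of derivatives, so that the induction on k can
  move from \<open>h n\<close> to \<open>h (Suc n)\<close>.\<close>

lemma Ck_affine_coordinate:
  fixes h :: "nat \<Rightarrow> real \<Rightarrow> real" and i :: "'a::euclidean_space"
  assumes h: "\<And>n s. (h n has_real_derivative h (Suc n) s) (at s)"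
  shows "Ck k (\<lambda>x. h n (c * (x \<bullet> i) + d))"
proof (induction k arbitrary: n)
  case 0
  have "continuous_on UNIV (h n)"
    using h by (meson DERIV_continuous continuous_at_imp_continuous_on)
  then have "continuous_on UNIV (\<lambda>x. h n (c * (x \<bullet> i) + d))"
    by (rule continuous_on_compose2) (auto intro!: continuous_intros)
  then show ?case by simp
next
  case (Suc k)
  have d: "((\<lambda>x. h n (c * (x \<bullet> i) + d)) has_derivative (\<lambda>v. h (Suc n) (c * (x \<bullet> i) + d) * (c * (v \<bullet> i)))) (at x)" for x
    by (rule has_derivative_compose[of "\<lambda>x. c * (x \<bullet> i) + d", where g = "h n"])
      (auto intro!: derivative_eq_intros h[unfolded has_field_derivative_def])
  have "frechet_derivative (\<lambda>x. h n (c * (x \<bullet> i) + d)) (at x) = (\<lambda>v. h (Suc n) (c * (x \<bullet> i) + d) * (c * (v \<bullet> i)))" for x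
    by (rule frechet_derivative_at[symmetric, OF d])
  moreover have "(\<lambda>x. h n (c * (x \<bullet> i) + d)) differentiable_on UNIV"
    using d by (auto simp: differentiable_on_def differentiable_def intro: has_derivative_at_withinI)
  ultimately show ?case using Suc by (auto intro!: Ck_mult Ck_const)
qed

text \<open>The derivatives of \<open>exp (- (1 / x))\<close> have the form
  \<open>P (1 / x) * exp (- (1 / x))\<close>. In terms of \<open>y = 1 / x\<close> the chain rule
  sends P to \<open>y\<^sup>2 * (P - P')\<close>, and \<open>[:0, 0, 1:]\<close> is
  \<open>y\<^sup>2\<close>.\<close>

primrec flat_poly :: "nat \<Rightarrow> real poly" where
  "flat_poly 0 = 1"
| "flat_poly (Suc n) = [:0, 0, 1:] * (flat_poly n - pderiv (flat_poly n))"

definition flat :: "nat \<Rightarrow> real \<Rightarrow> real" where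
  "flat n x = (if x \<le> 0 then 0 else poly (flat_poly n) (1 / x) * exp (- (1 / x)))"

lemma poly_times_exp_tendsto_0:
  "((\<lambda>y. poly q y * exp (- y)) \<longlongrightarrow> 0) (at_top :: real filter)"
proof -
  have "((\<lambda>y. \<Sum>i\<le>degree q. coeff q i * (y ^ i / exp y)) \<longlongrightarrow> (\<Sum>i\<le>degree q. coeff q i * 0)) (at_top :: real filter)"
    by (intro tendsto_sum tendsto_mult tendsto_const tendsto_power_div_exp_0)
  moreover have "(\<Sum>i\<le>degree q. coeff q i * (y ^ i / exp y)) = poly q y * exp (- y)" for y :: real
    by (simp add: poly_altdef sum_distrib_right exp_minus divide_inverse mult.assoc)
  ultimately show ?thesis by simp
qed

lemma flat_DERIV: "(flat n has_real_derivative flat (Suc n) x) (at x)"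
proof -
  consider "x < 0" | "x = 0" | "x > 0" by linarith
  then show ?thesis
  proof cases
    case 1
    have "((\<lambda>x. 0) has_real_derivative 0) (at x)" by simp
    then have "(flat n has_real_derivative 0) (at x)"
      by (rule has_field_derivative_transform_within_open[OF _ open_lessThan[of 0]])
        (use 1 in \<open>auto simp: flat_def\<close>)
    with 1 show ?thesis by (simp add: flat_def)
  next
    case 3
    define P where "P = flat_poly n"
    have a: "((\<lambda>x. 1 / x) has_real_derivative - (1 / x\<^sup>2)) (at x)"
      using 3 by (auto intro!: derivative_eq_intros simp: power2_eq_square)
    have "((\<lambda>x. poly P (1 / x) * exp (- (1 / x))) has_real_derivative
        poly (pderiv P) (1 / x) * (- (1 / x\<^sup>2)) * exp (- (1 / x)) + exp (- (1 / x)) * (- (- (1 / x\<^sup>2))) * poly P (1 / x)) (at x)"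
      by (rule DERIV_mult[OF DERIV_chain2[OF poly_DERIV a] DERIV_chain2[OF DERIV_exp DERIV_minus[OF a]]])
    moreover have "poly (pderiv P) (1 / x) * (- (1 / x\<^sup>2)) * exp (- (1 / x)) + exp (- (1 / x)) * (- (- (1 / x\<^sup>2))) * poly P (1 / x)
        = flat (Suc n) x"
      using 3 by (simp add: flat_def P_def[symmetric] power2_eq_square algebra_simps)
    ultimately have "((\<lambda>x. poly P (1 / x) * exp (- (1 / x))) has_real_derivative flat (Suc n) x) (at x)" by simp
    then show ?thesis
      by (rule has_field_derivative_transform_within_open[OF _ open_greaterThan[of 0]])
        (use 3 in \<open>auto simp: flat_def P_def\<close>)
  next
    case 2
    \<comment> \<open>Division by y only adds one more power of \<open>1 / y\<close> to the
      polynomial factor, and the exponential still wins.\<close>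
    have "((\<lambda>y. (flat n y - flat n 0) / (y - 0)) \<longlongrightarrow> 0) (at_right 0)"
    proof (rule Lim_transform_eventually)
      show "((\<lambda>y. poly ([:0, 1:] * flat_poly n) (1 / y) * exp (- (1 / y))) \<longlongrightarrow> 0) (at_right 0)"
        by (rule filterlim_compose[OF poly_times_exp_tendsto_0])
          (use filterlim_inverse_at_top_right in \<open>simp add: inverse_eq_divide\<close>)
      show "\<forall>\<^sub>F y in at_right 0. poly ([:0, 1:] * flat_poly n) (1 / y) * exp (- (1 / y)) = (flat n y - flat n 0) / (y - 0)"
        by (rule eventually_at_rightI[of 0 1]) (auto simp: flat_def)
    qed
    moreover have "((\<lambda>y. (flat n y - flat n 0) / (y - 0)) \<longlongrightarrow> 0) (at_left 0)"
    proof (rule Lim_transform_eventually[OF tendsto_const])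
      show "\<forall>\<^sub>F y in at_left 0. 0 = (flat n y - flat n 0) / (y - 0)"
        by (rule eventually_at_leftI[of "-1" 0]) (auto simp: flat_def)
    qed
    ultimately have "((\<lambda>y. (flat n y - flat n 0) / (y - 0)) \<longlongrightarrow> 0) (at 0)"
      by (simp add: filterlim_split_at)
    with 2 show ?thesis by (simp add: has_field_derivative_iff flat_def)
  qed
qed

section \<open>Smooth bumps on boxes\<close>

lemma flat_0_bounds: "0 \<le> flat 0 x" "flat 0 x \<le> 1"
  by (auto simp: flat_def)

lemma flat_0_pos_iff: "flat 0 x = 0 \<longleftrightarrow> x \<le> 0"
  by (auto simp: flat_def)

lemma flat_0_scaled_tendsto: "(\<lambda>n. flat 0 (real (Suc n) * x)) \<longlonglongrightarrow> (if x > 0 then 1 else 0)"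
proof (cases "x > 0")
  case True
  have "(\<lambda>n. exp (- (inverse (real (Suc n)) * (1 / x)))) \<longlonglongrightarrow> exp (- (0 * (1 / x)))"
    by (intro tendsto_intros LIMSEQ_inverse_real_of_nat)
  moreover have "flat 0 (real (Suc n) * x) = exp (- (inverse (real (Suc n)) * (1 / x)))" for n
  proof -
    have "real (Suc n) * x > 0" using True by simp
    then show ?thesis by (simp add: flat_def divide_inverse del: of_nat_Suc)
  qed
  ultimately show ?thesis using True by simp
next
  case False
  then have "real (Suc n) * x \<le> 0" for n by (simp add: mult_nonneg_nonpos)
  with False show ?thesis by (simp add: flat_def del: of_nat_Suc)
qed

text \<open>Nonzero exactly on the open box for every n, with values tending to its indicator: a
  test function that can take the place of that indicator under an integral.\<close>

definition box_bump :: "'a::euclidean_space \<Rightarrow> 'a \<Rightarrow> nat \<Rightarrow> 'a \<Rightarrow> real" where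
  "box_bump a b n x =
     (\<Prod>i\<in>Basis. flat 0 (real (Suc n) * (x \<bullet> i - a \<bullet> i)) * flat 0 (real (Suc n) * (b \<bullet> i - x \<bullet> i)))"

lemma Ck_box_bump: "Ck k (box_bump a b n)"
proof -
  have 1: "flat 0 (real (Suc n) * (x \<bullet> i - a \<bullet> i)) = flat 0 (real (Suc n) * (x \<bullet> i) + - (real (Suc n) * (a \<bullet> i)))" 
    and 2: "flat 0 (real (Suc n) * (b \<bullet> i - x \<bullet> i)) = flat 0 ((- real (Suc n)) * (x \<bullet> i) + real (Suc n) * (b \<bullet> i))" for x i
    by (rule arg_cong[where f = "flat 0"], simp add: algebra_simps)+
  show ?thesis
    unfolding box_bump_def 1 2
    by (intro Ck_prod Ck_mult Ck_affine_coordinate flat_DERIV) auto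
qed

lemma box_bump_bounds: "0 \<le> box_bump a b n x" "box_bump a b n x \<le> 1"
  unfolding box_bump_def
  by (auto intro!: prod_nonneg prod_le_1 mult_nonneg_nonneg mult_le_one flat_0_bounds)

lemma box_bump_eq_0_iff: "box_bump a b n x = 0 \<longleftrightarrow> x \<notin> box a b"
proof -
  have "real (Suc n) * t \<le> 0 \<longleftrightarrow> t \<le> 0" for t by (simp add: mult_le_0_iff)
  then show ?thesis
    by (auto simp: box_bump_def flat_0_pos_iff mem_box not_less simp del: of_nat_Suc)
qed

lemma box_bump_tendsto: "(\<lambda>n. box_bump a b n x) \<longlonglongrightarrow> indicator (box a b) x"
proof -
  have "(\<lambda>n. box_bump a b n x) \<longlonglongrightarrow>
    (\<Prod>i\<in>Basis. (if x \<bullet> i - a \<bullet> i > 0 then 1 else 0) * (if b \<bullet> i - x \<bullet> i > 0 then 1 else 0))"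
    unfolding box_bump_def by (intro tendsto_prod tendsto_mult flat_0_scaled_tendsto)
  moreover have "(\<Prod>i\<in>Basis. (if x \<bullet> i - a \<bullet> i > 0 then 1 else 0) * (if b \<bullet> i - x \<bullet> i > 0 then 1 else 0)) = (indicator (box a b) x :: real)"
    by (cases "x \<in> box a b") (auto simp: mem_box prod_zero_iff)
  ultimately show ?thesis by simp
qed

lemma box_bump_test_function:
  assumes "cbox a b \<subseteq> \<Omega>"
  shows "box_bump a b n \<in> test_functions \<Omega>"
proof -
  have sub: "closure {x. box_bump a b n x \<noteq> 0} \<subseteq> cbox a b"
    by (rule closure_minimal) (use box_subset_cbox in \<open>auto simp: box_bump_eq_0_iff\<close>)
  moreover have "compact (closure {x. box_bump a b n x \<noteq> 0})"
    using sub by (intro compact_closure[THEN iffD2]) (meson bounded_cbox bounded_subset closure_subset order_trans)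
  ultimately show ?thesis
    using assms by (auto simp: test_functions_def Ck_box_bump)
qed

section \<open>Gradients and algebra of test functions\<close>

definition grad :: "('a::euclidean_space \<Rightarrow> real) \<Rightarrow> 'a \<Rightarrow> 'a" where
  "grad \<phi> x = (\<Sum>i\<in>Basis. frechet_derivative \<phi> (at x) i *\<^sub>R i)"

lemma grad_inner_Basis: "i \<in> Basis \<Longrightarrow> grad \<phi> x \<bullet> i = frechet_derivative \<phi> (at x) i"
  by (simp add: grad_def inner_sum_left inner_Basis if_distrib sum.delta cong: if_cong)

lemma Ck_1_has_derivative:
  assumes "Ck (Suc 0) \<phi>"
  shows "(\<phi> has_derivative (\<lambda>h. grad \<phi> x \<bullet> h)) (at x)" "continuous_on UNIV (grad \<phi>)"
proof -
  have d: "(\<phi> has_derivative frechet_derivative \<phi> (at x)) (at x)"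
    using assms by (auto simp: differentiable_on_def frechet_derivative_works[symmetric])
  have "frechet_derivative \<phi> (at x) = (\<lambda>h. grad \<phi> x \<bullet> h)"
  proof
    fix h
    have lin: "linear (frechet_derivative \<phi> (at x))"
      using d by (rule has_derivative_linear)
    have "frechet_derivative \<phi> (at x) h = frechet_derivative \<phi> (at x) (\<Sum>i\<in>Basis. (h \<bullet> i) *\<^sub>R i)"
      by (simp add: euclidean_representation)
    also have "\<dots> = (\<Sum>i\<in>Basis. (h \<bullet> i) * frechet_derivative \<phi> (at x) i)"
      by (simp add: linear_sum[OF lin] linear_scale[OF lin])
    also have "\<dots> = grad \<phi> x \<bullet> h"
      by (subst euclidean_inner) (simp add: grad_inner_Basis mult.commute)
    finally show "frechet_derivative \<phi> (at x) h = grad \<phi> x \<bullet> h" .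
  qed
  with d show "(\<phi> has_derivative (\<lambda>h. grad \<phi> x \<bullet> h)) (at x)" by simp
  show "continuous_on UNIV (grad \<phi>)"
    unfolding grad_def using assms by (auto intro!: continuous_intros)
qed

lemma test_functions_C1_compact:
  assumes "\<phi> \<in> test_functions \<Omega>"
  shows "C1_compact \<phi> (grad \<phi>)"
proof -
  have "bounded {x. \<phi> x \<noteq> 0}"
    using assms closure_subset by (auto simp: test_functions_def intro: bounded_subset[OF compact_imp_bounded])
  moreover have "Ck (Suc 0) \<phi>" using assms unfolding test_functions_def by blast
  ultimately show ?thesis using Ck_1_has_derivative unfolding C1_compact_def by blast
qed

lemma test_functions_outside:
  assumes "\<phi> \<in> test_functions \<Omega>"
  shows "{x. \<phi> x \<noteq> 0} \<subseteq> \<Omega>" "{x. grad \<phi> x \<noteq> 0} \<subseteq> closure {x. \<phi> x \<noteq> 0}"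
proof -
  show "{x. \<phi> x \<noteq> 0} \<subseteq> \<Omega>"
    using assms closure_subset by (force simp: test_functions_def)
  show "{x. grad \<phi> x \<noteq> 0} \<subseteq> closure {x. \<phi> x \<noteq> 0}"
  proof (rule subsetI, rule ccontr)
    fix x assume x: "x \<in> {x. grad \<phi> x \<noteq> 0}" "x \<notin> closure {x. \<phi> x \<noteq> 0}"
    have "(\<phi> has_derivative (\<lambda>h. 0)) (at x)"
      by (rule has_derivative_transform_within_open[OF has_derivative_const[of 0], of "- closure {x. \<phi> x \<noteq> 0}"])
        (use x closure_subset[of "{x. \<phi> x \<noteq> 0}"] in auto)
    moreover have "(\<phi> has_derivative (\<lambda>h. grad \<phi> x \<bullet> h)) (at x)"
      using test_functions_C1_compact[OF assms] by (simp add: C1_compact_def)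
    ultimately have "(\<lambda>h. 0) = (\<lambda>h. grad \<phi> x \<bullet> h)"
      by (rule has_derivative_unique)
    from fun_cong[OF this, of "grad \<phi> x"] x show False by simp
  qed
qed

lemma compact_closure_support_mono:
  fixes \<psi> :: "'a::euclidean_space \<Rightarrow> real"
  assumes "{x. \<psi> x \<noteq> 0} \<subseteq> K" "compact K" "K \<subseteq> \<Omega>"
  shows "compact (closure {x. \<psi> x \<noteq> 0})" "closure {x. \<psi> x \<noteq> 0} \<subseteq> \<Omega>"
proof -
  have "closure {x. \<psi> x \<noteq> 0} \<subseteq> K"
    using assms by (intro closure_minimal compact_imp_closed)
  then show "compact (closure {x. \<psi> x \<noteq> 0})" "closure {x. \<psi> x \<noteq> 0} \<subseteq> \<Omega>"
    using assms(3) bounded_subset[OF compact_imp_bounded[OF assms(2)] assms(1)]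
    by (auto simp: compact_closure)
qed

lemma test_functions_mult:
  assumes "\<phi> \<in> test_functions \<Omega>" "\<psi> \<in> test_functions \<Omega>"
  shows "(\<lambda>x. \<phi> x * \<psi> x) \<in> test_functions \<Omega>"
proof -
  have "{x. \<phi> x * \<psi> x \<noteq> 0} \<subseteq> closure {x. \<phi> x \<noteq> 0}" using closure_subset by fastforce
  with compact_closure_support_mono[of "\<lambda>x. \<phi> x * \<psi> x" "closure {x. \<phi> x \<noteq> 0}" \<Omega>] assms show ?thesis
    by (auto simp: test_functions_def intro: Ck_mult)
qed

lemma test_functions_cmult:
  assumes "\<phi> \<in> test_functions \<Omega>"
  shows "(\<lambda>x. c * \<phi> x) \<in> test_functions \<Omega>"
proof -
  have "{x. c * \<phi> x \<noteq> 0} \<subseteq> closure {x. \<phi> x \<noteq> 0}" using closure_subset by fastforce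
  with compact_closure_support_mono[of "\<lambda>x. c * \<phi> x" "closure {x. \<phi> x \<noteq> 0}" \<Omega>] assms show ?thesis
    by (auto simp: test_functions_def intro: Ck_mult Ck_const)
qed

lemma test_functions_add:
  assumes "\<phi> \<in> test_functions \<Omega>" "\<psi> \<in> test_functions \<Omega>"
  shows "(\<lambda>x. \<phi> x + \<psi> x) \<in> test_functions \<Omega>"
proof -
  have "{x. \<phi> x + \<psi> x \<noteq> 0} \<subseteq> closure {x. \<phi> x \<noteq> 0} \<union> closure {x. \<psi> x \<noteq> 0}"
  proof -
    have "{x. \<phi> x + \<psi> x \<noteq> 0} \<subseteq> {x. \<phi> x \<noteq> 0} \<union> {x. \<psi> x \<noteq> 0}" by auto
    also have "\<dots> \<subseteq> closure {x. \<phi> x \<noteq> 0} \<union> closure {x. \<psi> x \<noteq> 0}"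
      by (intro Un_mono closure_subset)
    finally show ?thesis .
  qed
  moreover have "compact (closure {x. \<phi> x \<noteq> 0} \<union> closure {x. \<psi> x \<noteq> 0})"
    "closure {x. \<phi> x \<noteq> 0} \<union> closure {x. \<psi> x \<noteq> 0} \<subseteq> \<Omega>"
    using assms by (auto simp: test_functions_def)
  ultimately show ?thesis
    using compact_closure_support_mono[of "\<lambda>x. \<phi> x + \<psi> x"] assms
    by (auto simp: test_functions_def intro: Ck_add)
qed

lemma test_functions_deriv:
  assumes "\<phi> \<in> test_functions \<Omega>" "i \<in> Basis"
  shows "(\<lambda>x. frechet_derivative \<phi> (at x) i) \<in> test_functions \<Omega>"
proof -
  have "{x. frechet_derivative \<phi> (at x) i \<noteq> 0} \<subseteq> {x. grad \<phi> x \<noteq> 0}"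
    using grad_inner_Basis[OF assms(2), of \<phi>] by auto (metis inner_zero_left)
  also have "\<dots> \<subseteq> closure {x. \<phi> x \<noteq> 0}" by (rule test_functions_outside(2)[OF assms(1)])
  finally have "{x. frechet_derivative \<phi> (at x) i \<noteq> 0} \<subseteq> closure {x. \<phi> x \<noteq> 0}" .
  from compact_closure_support_mono[OF this, of \<Omega>] assms(1)
  have "compact (closure {x. frechet_derivative \<phi> (at x) i \<noteq> 0})" "closure {x. frechet_derivative \<phi> (at x) i \<noteq> 0} \<subseteq> \<Omega>"
    by (auto simp: test_functions_def)
  moreover have "Ck k (\<lambda>x. frechet_derivative \<phi> (at x) i)" for k
  proof -
    have "Ck (Suc k) \<phi>" using assms(1) unfolding test_functions_def by blast
    then show ?thesis using assms(2) by simp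
  qed
  ultimately show ?thesis by (simp add: test_functions_def)
qed

text \<open>The gradient of the product of two test functions has integral zero, and the product
  rule splits that integral.\<close>

lemma test_functions_integration_by_parts:
  fixes \<phi> \<psi> :: "'a::euclidean_space \<Rightarrow> real"
  assumes "\<phi> \<in> test_functions \<Omega>" "\<psi> \<in> test_functions \<Omega>" "i \<in> Basis"
  shows "(\<integral>x. \<phi> x * frechet_derivative \<psi> (at x) i \<partial>lborel) = - (\<integral>x. (grad \<phi> x \<bullet> i) * \<psi> x \<partial>lborel)"
proof -
  have C: "C1_compact (\<lambda>x. \<phi> x * \<psi> x) (grad (\<lambda>x. \<phi> x * \<psi> x))"
    by (rule test_functions_C1_compact[OF test_functions_mult[OF assms(1,2)]])
  have d\<phi>: "(\<phi> has_derivative (\<lambda>h. grad \<phi> x \<bullet> h)) (at x)" and d\<psi>: "(\<psi> has_derivative (\<lambda>h. grad \<psi> x \<bullet> h)) (at x)" for x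
    using test_functions_C1_compact[OF assms(1)] test_functions_C1_compact[OF assms(2)] by (auto simp: C1_compact_def)
  have "grad (\<lambda>x. \<phi> x * \<psi> x) x \<bullet> i = \<phi> x * frechet_derivative \<psi> (at x) i + (grad \<phi> x \<bullet> i) * \<psi> x" for x
    using frechet_derivative_at[OF has_derivative_mult[OF d\<phi> d\<psi>], of x, THEN fun_cong, of i] assms(3)
    by (simp add: grad_inner_Basis)
  then have "(\<integral>x. \<phi> x * frechet_derivative \<psi> (at x) i + (grad \<phi> x \<bullet> i) * \<psi> x \<partial>lborel) = 0"
    using C1_compact_integral_gradient[OF C, of i] by simp
  moreover have "integrable lborel (\<lambda>x. \<phi> x * frechet_derivative \<psi> (at x) i)"
    using C1_compact_integrable(1)[OF test_functions_C1_compact[OF test_functions_mult[OF assms(1) test_functions_deriv[OF assms(2,3)]]]] .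
  moreover have "integrable lborel (\<lambda>x. (grad \<phi> x \<bullet> i) * \<psi> x)"
    using C1_compact_integrable(1)[OF test_functions_C1_compact[OF test_functions_mult[OF test_functions_deriv[OF assms(1,3)] assms(2)]]]
      assms(3) by (simp add: grad_inner_Basis)
  ultimately show ?thesis by (simp add: add_eq_0_iff)
qed

subsection \<open>Weak gradients\<close>

lemma l2inner_tendsto:
  assumes "\<And>n. square_integrable M (f n)" "square_integrable M g" "square_integrable M h"
    "(\<lambda>n. l2norm M (\<lambda>x. f n x - g x)) \<longlonglongrightarrow> 0"
  shows "(\<lambda>n. l2inner M (f n) h) \<longlonglongrightarrow> l2inner M g h"
proof -
  have "\<bar>l2inner M (f n) h - l2inner M g h\<bar> \<le> l2norm M (\<lambda>x. f n x - g x) * l2norm M h" for n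
    using l2_Cauchy_Schwarz[OF square_integrable_diff[OF assms(1)[of n] assms(2)] assms(3)]
      l2inner_diff_left[OF assms(1)[of n] assms(2,3)] by simp
  moreover have "(\<lambda>n. l2norm M (\<lambda>x. f n x - g x) * l2norm M h) \<longlonglongrightarrow> 0 * l2norm M h"
    by (intro tendsto_intros assms(4))
  ultimately have "(\<lambda>n. l2inner M (f n) h - l2inner M g h) \<longlonglongrightarrow> 0"
    by (intro Lim_null_comparison[of "\<lambda>n. l2inner M (f n) h - l2inner M g h"]) auto
  then show ?thesis by (simp add: LIM_zero_iff)
qed

lemma l2norm_tendsto:
  assumes "\<And>n. square_integrable M (f n)" "square_integrable M g"
    "(\<lambda>n. l2norm M (\<lambda>x. f n x - g x)) \<longlonglongrightarrow> 0"
  shows "(\<lambda>n. l2norm M (f n)) \<longlonglongrightarrow> l2norm M g"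
proof -
  have "(\<lambda>n. l2norm M (f n) - l2norm M g) \<longlonglongrightarrow> 0"
    by (rule Lim_null_comparison[OF _ assms(3)]) (use l2norm_le_diff[OF assms(1,2)] in auto)
  then show ?thesis by (simp add: LIM_zero_iff)
qed

lemma integrable_lebesgue_on_iff:
  fixes f :: "'a::euclidean_space \<Rightarrow> 'b::euclidean_space"
  assumes "S \<in> sets lebesgue"
  shows "integrable (lebesgue_on S) f \<longleftrightarrow> integrable lebesgue (\<lambda>x. indicator S x *\<^sub>R f x)"
  using assms by (simp add: integrable_restrict_space)

lemma integrable_lebesgue_on_subset:
  fixes f :: "'a::euclidean_space \<Rightarrow> 'b::euclidean_space"
  assumes "integrable (lebesgue_on S) f" "K \<subseteq> S" "S \<in> sets lebesgue" "K \<in> sets lebesgue"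
  shows "integrable (lebesgue_on K) f"
proof -
  have "integrable lebesgue (\<lambda>x. indicator K x *\<^sub>R (indicator S x *\<^sub>R f x))"
    by (rule integrable_mult_indicator) (use assms in \<open>simp_all add: integrable_lebesgue_on_iff\<close>)
  moreover have "(\<lambda>x. indicator K x *\<^sub>R (indicator S x *\<^sub>R f x)) = (\<lambda>x. indicator K x *\<^sub>R f x)"
    using assms(2) by (auto simp: indicator_def fun_eq_iff)
  ultimately show ?thesis using assms(4) by (simp add: integrable_lebesgue_on_iff)
qed

section \<open>Lebesgue measure on a bounded open set\<close>

locale bounded_open =
  fixes \<Omega> :: "'a::euclidean_space set"
  assumes open_domain: "open \<Omega>" and bounded_domain: "bounded \<Omega>"
begin

abbreviation M where "M \<equiv> lebesgue_on \<Omega>"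

lemma domain_sets [simp, measurable]: "\<Omega> \<in> sets lebesgue" "\<Omega> \<in> sets borel"
  using open_domain by auto

sublocale M: finite_measure M
  using open_domain bounded_domain
  by (intro finite_measure_lebesgue_on) (auto intro: bounded_set_imp_lmeasurable)

lemma L2_iff: "f \<in> L2 \<Omega> \<longleftrightarrow> square_integrable M f"
  by (simp add: L2_def square_integrable_def)

lemma borel_measurable_M: "f \<in> borel_measurable borel \<Longrightarrow> f \<in> borel_measurable M"
  by (intro measurable_restrict_space1 measurable_completion) simp

text \<open>Bridge between two measures: the C1 estimates concern Borel functions on the whole
  space, while Sobolev functions live on the completed measure of the domain.\<close>

lemma integral_M_eq_lborel:
  fixes f :: "'a \<Rightarrow> 'b::euclidean_space"
  assumes [measurable]: "f \<in> borel_measurable borel" and "{x. f x \<noteq> 0} \<subseteq> \<Omega>"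
  shows "integral\<^sup>L M f = integral\<^sup>L lborel f" "integrable M f \<longleftrightarrow> integrable lborel f"
proof -
  have eq: "(\<lambda>x. indicator \<Omega> x *\<^sub>R f x) = f"
    using assms(2) by (auto simp: fun_eq_iff indicator_def)
  have "integral\<^sup>L M f = integral\<^sup>L lebesgue f"
    by (subst integral_restrict_space) (simp_all add: eq)
  then show "integral\<^sup>L M f = integral\<^sup>L lborel f" by (simp add: integral_completion)
  have "integrable M f \<longleftrightarrow> integrable lebesgue f"
    by (subst integrable_restrict_space) (simp_all add: eq)
  then show "integrable M f \<longleftrightarrow> integrable lborel f" by (simp add: integrable_completion)
qed

lemma test_function_borel:
  assumes "\<phi> \<in> test_functions \<Omega>"
  shows "\<phi> \<in> borel_measurable borel" "grad \<phi> \<in> borel_measurable borel"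
  using C1_compact_continuous[OF test_functions_C1_compact[OF assms]]
  by (auto intro: borel_measurable_continuous_onI)

lemma test_function_support:
  assumes "\<phi> \<in> test_functions \<Omega>"
  shows "{x. \<phi> x \<noteq> 0} \<subseteq> \<Omega>" "{x. grad \<phi> x \<noteq> 0} \<subseteq> \<Omega>"
  using test_functions_outside[OF assms] assms by (auto simp: test_functions_def)

lemma test_function_l2:
  assumes "\<phi> \<in> test_functions \<Omega>"
  shows "square_integrable M \<phi>" "square_integrable M (grad \<phi>)"
    "(l2norm M \<phi>)\<^sup>2 = (\<integral>x. (\<phi> x)\<^sup>2 \<partial>lborel)" "(l2norm M (grad \<phi>))\<^sup>2 = (\<integral>x. (norm (grad \<phi> x))\<^sup>2 \<partial>lborel)"
proof -
  note b [measurable] = test_function_borel[OF assms]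
  have "integrable M (\<lambda>x. (norm (\<phi> x))\<^sup>2) \<longleftrightarrow> integrable lborel (\<lambda>x. (norm (\<phi> x))\<^sup>2)"
    "integrable M (\<lambda>x. (norm (grad \<phi> x))\<^sup>2) \<longleftrightarrow> integrable lborel (\<lambda>x. (norm (grad \<phi> x))\<^sup>2)"
    by (rule integral_M_eq_lborel; use test_function_support[OF assms] in auto)+
  then show "square_integrable M \<phi>" "square_integrable M (grad \<phi>)"
    using C1_compact_integrable[OF test_functions_C1_compact[OF assms]] b
    by (auto simp: square_integrable_def intro: borel_measurable_M)
  have "integral\<^sup>L M (\<lambda>x. (norm (\<phi> x))\<^sup>2) = integral\<^sup>L lborel (\<lambda>x. (norm (\<phi> x))\<^sup>2)"
    "integral\<^sup>L M (\<lambda>x. (norm (grad \<phi> x))\<^sup>2) = integral\<^sup>L lborel (\<lambda>x. (norm (grad \<phi> x))\<^sup>2)"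
    by (rule integral_M_eq_lborel; use test_function_support[OF assms] in auto)+
  then show "(l2norm M \<phi>)\<^sup>2 = (\<integral>x. (\<phi> x)\<^sup>2 \<partial>lborel)" "(l2norm M (grad \<phi>))\<^sup>2 = (\<integral>x. (norm (grad \<phi> x))\<^sup>2 \<partial>lborel)"
    by (simp_all add: l2norm_squared)
qed

lemma square_integrable_locally_integrable:
  fixes f :: "'a \<Rightarrow> 'b::euclidean_space"
  assumes "square_integrable M f"
  shows "locally_integrable \<Omega> f"
  unfolding locally_integrable_def
proof (intro allI impI)
  fix K :: "'a set" assume K: "compact K \<and> K \<subseteq> \<Omega>"
  show "integrable (lebesgue_on K) f"
    using M.square_integrable_imp_integrable(1)[OF assms] K
    by (intro integrable_lebesgue_on_subset[of \<Omega> f K]) (auto intro: fmeasurableD[OF lmeasurable_compact])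
qed

text \<open>A test function is bounded with compact support in the domain, so integrability of g on
  that support is enough. It ensures that the integrals in the weak gradient identity are genuine
  and not the default value 0.\<close>

lemma locally_integrable_mult_test:
  fixes g :: "'a \<Rightarrow> 'b::euclidean_space"
  assumes g: "locally_integrable \<Omega> g" and \<phi>: "\<phi> \<in> test_functions \<Omega>"
  shows "integrable M (\<lambda>x. \<phi> x *\<^sub>R g x)"
proof -
  define K where "K = closure {x. \<phi> x \<noteq> 0}"
  have K: "compact K" "K \<subseteq> \<Omega>"
    using \<phi> by (auto simp: test_functions_def K_def)
  have K0: "\<phi> x = 0" if "x \<notin> K" for x
    using that closure_subset[of "{x. \<phi> x \<noteq> 0}"] by (auto simp: K_def)
  have "integrable (lebesgue_on K) g" using g K by (auto simp: locally_integrable_def)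
  then have i: "integrable lebesgue (\<lambda>x. indicator K x *\<^sub>R g x)"
    using K by (subst integrable_lebesgue_on_iff[symmetric]) (auto intro: fmeasurableD[OF lmeasurable_compact])
  obtain B where B: "B > 0" "\<forall>x. \<bar>\<phi> x\<bar> \<le> B" "\<forall>x. norm (grad \<phi> x) \<le> B"
    by (rule C1_compact_bounded[OF test_functions_C1_compact[OF \<phi>]])
  have "integrable lebesgue (\<lambda>x. \<phi> x *\<^sub>R (indicator K x *\<^sub>R g x))"
  proof (rule Bochner_Integration.integrable_bound)
    show "integrable lebesgue (\<lambda>x. B * norm (indicator K x *\<^sub>R g x))"
      by (intro integrable_mult_right integrable_norm i)
    have "\<phi> \<in> borel_measurable lebesgue"
      using test_function_borel(1)[OF \<phi>] by (intro measurable_completion) simp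
    then show "(\<lambda>x. \<phi> x *\<^sub>R (indicator K x *\<^sub>R g x)) \<in> borel_measurable lebesgue"
      by (rule borel_measurable_scaleR[OF _ borel_measurable_integrable[OF i]])
    show "AE x in lebesgue. norm (\<phi> x *\<^sub>R (indicator K x *\<^sub>R g x)) \<le> norm (B * norm (indicator K x *\<^sub>R g x))"
    proof (rule AE_I2)
      fix x
      have "norm (\<phi> x *\<^sub>R v) \<le> norm (B * norm v)" for v :: 'b
        using B(1) mult_right_mono[OF B(2)[rule_format, of x] norm_ge_zero[of v]] by (simp add: abs_mult)
      then show "norm (\<phi> x *\<^sub>R (indicator K x *\<^sub>R g x)) \<le> norm (B * norm (indicator K x *\<^sub>R g x))" .
    qed
  qed
  moreover have "(\<lambda>x. \<phi> x *\<^sub>R (indicator K x *\<^sub>R g x)) = (\<lambda>x. indicator \<Omega> x *\<^sub>R (\<phi> x *\<^sub>R g x))"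
    using K K0 by (auto simp: fun_eq_iff indicator_def)
  ultimately show ?thesis by (simp add: integrable_lebesgue_on_iff)
qed

text \<open>Bumps recover the integral of g over every closed box in the domain; Lebesgue
  differentiation over shrinking cubes then gives \<open>g = 0\<close> almost everywhere on each
  box, and countably many boxes cover the domain.\<close>

lemma fundamental_lemma_calculus_of_variations:
  fixes g :: "'a \<Rightarrow> real"
  assumes g: "locally_integrable \<Omega> g" and zero: "\<And>\<phi>. \<phi> \<in> test_functions \<Omega> \<Longrightarrow> (\<integral>x. g x * \<phi> x \<partial>M) = 0"
  shows "AE x in M. g x = 0"
proof -
  have box0: "integral (cbox a b) g = 0" if ab: "cbox a b \<subseteq> \<Omega>" for a b
  proof -
    have i: "integrable (lebesgue_on (cbox a b)) g" using g ab by (auto simp: locally_integrable_def)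
    then have ib: "integrable (lebesgue_on (box a b)) g"
      by (rule integrable_lebesgue_on_subset) (auto intro: box_subset_cbox[THEN subsetD])
    have iM: "integrable M (\<lambda>x. indicator (cbox a b) x * g x)"
    proof -
      have "(\<lambda>x. indicator \<Omega> x *\<^sub>R (indicator (cbox a b) x * g x)) = (\<lambda>x. indicator (cbox a b) x *\<^sub>R g x)"
        using ab by (auto simp: fun_eq_iff indicator_def)
      with i show ?thesis by (simp add: integrable_lebesgue_on_iff)
    qed
    have lim: "(\<lambda>n. \<integral>x. (indicator (cbox a b) x * g x) * box_bump a b n x \<partial>M)
        \<longlonglongrightarrow> (\<integral>x. (indicator (cbox a b) x * g x) * indicator (box a b) x \<partial>M)"
    proof (rule integral_dominated_convergence[where w = "\<lambda>x. norm (indicator (cbox a b) x * g x)"])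
      show "integrable M (\<lambda>x. norm (indicator (cbox a b) x * g x))" using iM by (rule integrable_norm)
      have mi: "(\<lambda>x. indicator (cbox a b) x * g x) \<in> borel_measurable M" using iM by (rule borel_measurable_integrable)
      show "(\<lambda>x. (indicator (cbox a b) x * g x) * indicator (box a b) x) \<in> borel_measurable M"
        by (intro borel_measurable_times mi borel_measurable_M) auto
      show "(\<lambda>x. (indicator (cbox a b) x * g x) * box_bump a b n x) \<in> borel_measurable M" for n
        by (intro borel_measurable_times mi borel_measurable_M test_function_borel box_bump_test_function ab)
      show "AE x in M. norm ((indicator (cbox a b) x * g x) * box_bump a b n x) \<le> norm (indicator (cbox a b) x * g x)" for n
        using box_bump_bounds[of a b n] by (intro AE_I2) (auto simp: abs_mult intro!: mult_left_le)
    qed (intro AE_I2 tendsto_mult tendsto_const box_bump_tendsto)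
    have "(indicator (cbox a b) x * g x) * box_bump a b n x = g x * box_bump a b n x" for x n
      using box_bump_eq_0_iff[of a b n x] box_subset_cbox[of a b] by (auto simp: indicator_def)
    then have "(\<integral>x. (indicator (cbox a b) x * g x) * box_bump a b n x \<partial>M) = 0" for n
      using zero[OF box_bump_test_function[OF ab], of n] by (simp only:)
    with lim have "(\<integral>x. (indicator (cbox a b) x * g x) * indicator (box a b) x \<partial>M) = 0"
      by (simp only: LIMSEQ_const_iff)
    also have "(\<integral>x. (indicator (cbox a b) x * g x) * indicator (box a b) x \<partial>M)
        = integral\<^sup>L lebesgue (\<lambda>x. indicator (box a b) x *\<^sub>R g x)"
      using ab box_subset_cbox[of a b]
      by (subst integral_restrict_space) (auto simp: indicator_def intro!: Bochner_Integration.integral_cong)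
    also have "\<dots> = integral\<^sup>L (lebesgue_on (box a b)) g"
      by (subst integral_restrict_space) auto
    also have "\<dots> = integral (box a b) g"
      by (rule lebesgue_integral_eq_integral[OF ib]) simp
    also have "\<dots> = integral (cbox a b) g" by (simp add: integral_open_interval)
    finally show ?thesis .
  qed
  have AEbox: "AE x in lebesgue. x \<in> cbox a b \<longrightarrow> g x = 0" if ab: "cbox a b \<subseteq> \<Omega>" for a b
  proof -
    \<comment> \<open>g is integrable only on compact parts of the domain, whereas the
      differentiation theorem asks for integrability on every cube; hence the extension by
      zero.\<close>
    define f where "f x = (if x \<in> cbox a b then g x else 0)" for x
    have i: "integrable (lebesgue_on (cbox a b)) g" using g ab by (auto simp: locally_integrable_def)
    then have "g integrable_on cbox a b" by (intro integrable_on_lebesgue_on) auto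
    then have "f integrable_on UNIV" unfolding f_def by (simp add: integrable_restrict_UNIV)
    then have "f integrable_on cbox c d" for c d by (rule integrable_on_subcbox) simp
    then obtain N where N: "negligible N" "\<And>x e. x \<notin> N \<Longrightarrow> 0 < e \<Longrightarrow>
      \<exists>d>0. \<forall>h. 0 < h \<and> h < d \<longrightarrow> norm (integral (cbox x (x + h *\<^sub>R One)) f /\<^sub>R h ^ DIM('a) - f x) < e"
      using integrable_ccontinuous_explicit[of f] by blast
    have gz: "g x = 0" if x: "x \<in> box a b" "x \<notin> N" for x
    proof (rule ccontr)
      assume "g x \<noteq> 0"
      then have "\<bar>g x\<bar> > 0" by simp
      with N(2)[OF x(2)] obtain d where d: "d > 0"
        "\<And>h. 0 < h \<Longrightarrow> h < d \<Longrightarrow> norm (integral (cbox x (x + h *\<^sub>R One)) f /\<^sub>R h ^ DIM('a) - f x) < \<bar>g x\<bar>"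
        by blast
      obtain r where r: "r > 0" "cball x r \<subseteq> box a b"
        using x(1) open_box open_contains_cball by blast
      \<comment> \<open>Since the norm is at most the sum of the coordinates, the cube of side h
        with corner x fits into the ball of radius r once
        \<open>h * DIM('a) \<le> r\<close>.\<close>
      define h where "h = min (d / 2) (r / real (DIM('a)))"
      have h: "0 < h" "h < d" using d(1) r(1) by (auto simp: h_def)
      have sub: "cbox x (x + h *\<^sub>R One) \<subseteq> cball x r"
      proof
        fix y assume y: "y \<in> cbox x (x + h *\<^sub>R One)"
        have "norm (y - x) \<le> (\<Sum>i\<in>Basis. \<bar>(y - x) \<bullet> i\<bar>)" by (rule norm_le_l1)
        also have "\<dots> \<le> (\<Sum>i\<in>(Basis::'a set). h)"
          using y by (intro sum_mono) (auto simp: mem_box inner_add_left inner_diff_left)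
        also have "\<dots> \<le> r" using r(1) by (simp add: h_def field_simps min_def)
        finally show "y \<in> cball x r" by (simp add: dist_norm norm_minus_commute)
      qed
      have sub': "cbox x (x + h *\<^sub>R One) \<subseteq> cbox a b" using sub r(2) box_subset_cbox by blast
      have "integral (cbox x (x + h *\<^sub>R One)) f = integral (cbox x (x + h *\<^sub>R One)) g"
        using sub' by (intro integral_cong) (auto simp: f_def)
      also have "\<dots> = 0" using sub' ab by (intro box0) auto
      finally have "norm (- f x) < \<bar>g x\<bar>" using d(2)[OF h] by simp
      moreover have "f x = g x" using x(1) box_subset_cbox by (auto simp: f_def)
      ultimately show False by simp
    qed
    have "negligible (N \<union> (cbox a b - box a b))"
      using N(1) negligible_frontier_interval by (rule negligible_Un)
    then have "N \<union> (cbox a b - box a b) \<in> null_sets lebesgue" by (simp add: negligible_iff_null_sets)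
    then show ?thesis
      by (rule AE_I') (use gz in auto)
  qed
  obtain \<D> where \<D>: "countable \<D>" "\<D> \<subseteq> Pow \<Omega>" "\<And>X. X \<in> \<D> \<Longrightarrow> \<exists>a b. X = cbox a b" "\<Union>\<D> = \<Omega>"
    using open_countable_Union_open_cbox[OF open_domain] by metis
  have "AE x in lebesgue. \<forall>X\<in>\<D>. x \<in> X \<longrightarrow> g x = 0"
  proof (rule AE_ball_countable')
    fix X assume "X \<in> \<D>"
    with \<D>(2,3) obtain a b where "X = cbox a b" "cbox a b \<subseteq> \<Omega>" by fastforce
    then show "AE x in lebesgue. x \<in> X \<longrightarrow> g x = 0" using AEbox by simp
  qed (rule \<D>(1))
  then have "AE x in lebesgue. x \<in> \<Omega> \<longrightarrow> g x = 0"
    using \<D>(4) by (auto elim!: eventually_mono)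
  then show ?thesis by (subst AE_restrict_space_iff) auto
qed


section \<open>Uniqueness and algebra of weak gradients\<close>

lemma locally_integrable_add:
  fixes f g :: "'a \<Rightarrow> 'b::euclidean_space"
  shows "locally_integrable \<Omega> f \<Longrightarrow> locally_integrable \<Omega> g \<Longrightarrow> locally_integrable \<Omega> (\<lambda>x. f x + g x)"
  by (auto simp: locally_integrable_def)

lemma locally_integrable_scaleR:
  fixes f :: "'a \<Rightarrow> 'b::euclidean_space"
  shows "locally_integrable \<Omega> f \<Longrightarrow> locally_integrable \<Omega> (\<lambda>x. c *\<^sub>R f x)"
  by (auto simp: locally_integrable_def)

lemma locally_integrable_inner:
  fixes f :: "'a \<Rightarrow> 'b::euclidean_space"
  shows "locally_integrable \<Omega> f \<Longrightarrow> locally_integrable \<Omega> (\<lambda>x. f x \<bullet> i)"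
  by (auto simp: locally_integrable_def)

lemma integrable_mult_test:
  assumes "locally_integrable \<Omega> g" "\<phi> \<in> test_functions \<Omega>"
  shows "integrable M (\<lambda>x. g x * \<phi> x)"
  using locally_integrable_mult_test[OF assms] by (simp add: mult.commute)

lemma integrable_mult_test_deriv:
  assumes "locally_integrable \<Omega> u" "\<phi> \<in> test_functions \<Omega>" "i \<in> Basis"
  shows "integrable M (\<lambda>x. u x * frechet_derivative \<phi> (at x) i)"
  using integrable_mult_test[OF assms(1) test_functions_deriv[OF assms(2,3)]] .

lemma integrable_inner_mult_test:
  assumes "locally_integrable \<Omega> G" "\<phi> \<in> test_functions \<Omega>"
  shows "integrable M (\<lambda>x. (G x \<bullet> i) * \<phi> x)"
  using integrable_mult_test[OF locally_integrable_inner[OF assms(1)] assms(2)] .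

text \<open>Justifies the \<open>SOME\<close> in \<open>weak_gradient\<close>: each component of the
  difference of two candidates integrates to zero against all test functions.\<close>

lemma has_weak_gradient_unique:
  assumes G: "has_weak_gradient \<Omega> u G" and H: "has_weak_gradient \<Omega> u H"
  shows "AE x in M. G x = H x"
proof -
  have lG: "locally_integrable \<Omega> G" and lH: "locally_integrable \<Omega> H"
    using G H by (auto simp: has_weak_gradient_def)
  have "AE x in M. G x \<bullet> i + - 1 *\<^sub>R (H x \<bullet> i) = 0" if i: "i \<in> Basis" for i
  proof (rule fundamental_lemma_calculus_of_variations)
    show "locally_integrable \<Omega> (\<lambda>x. G x \<bullet> i + - 1 *\<^sub>R (H x \<bullet> i))"
      by (intro locally_integrable_add locally_integrable_scaleR locally_integrable_inner lG lH)
    fix \<phi> assume \<phi>: "\<phi> \<in> test_functions \<Omega>"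
    have "(\<integral>x. u x * frechet_derivative \<phi> (at x) i \<partial>M) = - (\<integral>x. (G x \<bullet> i) * \<phi> x \<partial>M)"
      "(\<integral>x. u x * frechet_derivative \<phi> (at x) i \<partial>M) = - (\<integral>x. (H x \<bullet> i) * \<phi> x \<partial>M)"
      using G H \<phi> i unfolding has_weak_gradient_def by blast+
    then have "(\<integral>x. (G x \<bullet> i) * \<phi> x \<partial>M) = (\<integral>x. (H x \<bullet> i) * \<phi> x \<partial>M)"
      by linarith
    then show "(\<integral>x. (G x \<bullet> i + - 1 *\<^sub>R (H x \<bullet> i)) * \<phi> x \<partial>M) = 0"
      using integrable_inner_mult_test[OF lG \<phi>, of i] integrable_inner_mult_test[OF lH \<phi>, of i]
      by (simp add: left_diff_distrib)
  qed
  then have "AE x in M. \<forall>i\<in>Basis. G x \<bullet> i + - 1 *\<^sub>R (H x \<bullet> i) = 0"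
    by (intro AE_finite_allI) auto
  then show ?thesis
    by eventually_elim (auto simp: euclidean_eq_iff[where 'a = 'a])
qed

lemma has_weak_gradient_add:
  assumes u: "has_weak_gradient \<Omega> u G" and v: "has_weak_gradient \<Omega> v H"
  shows "has_weak_gradient \<Omega> (\<lambda>x. u x + v x) (\<lambda>x. G x + H x)"
  unfolding has_weak_gradient_def
proof (intro conjI ballI)
  have l: "locally_integrable \<Omega> u" "locally_integrable \<Omega> v" "locally_integrable \<Omega> G" "locally_integrable \<Omega> H"
    using u v by (auto simp: has_weak_gradient_def)
  show "locally_integrable \<Omega> (\<lambda>x. u x + v x)" "locally_integrable \<Omega> (\<lambda>x. G x + H x)"
    by (intro locally_integrable_add l)+
  fix \<phi> and i :: 'a assume \<phi>: "\<phi> \<in> test_functions \<Omega>" and i: "i \<in> Basis"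
  show "(\<integral>x. (u x + v x) * frechet_derivative \<phi> (at x) i \<partial>M) = - (\<integral>x. ((G x + H x) \<bullet> i) * \<phi> x \<partial>M)"
    using u v \<phi> i integrable_mult_test_deriv[OF l(1) \<phi> i] integrable_mult_test_deriv[OF l(2) \<phi> i]
      integrable_inner_mult_test[OF l(3) \<phi>, of i] integrable_inner_mult_test[OF l(4) \<phi>, of i]
    by (simp add: has_weak_gradient_def inner_add_left distrib_right)
qed

lemma has_weak_gradient_cmult:
  assumes u: "has_weak_gradient \<Omega> u G"
  shows "has_weak_gradient \<Omega> (\<lambda>x. c * u x) (\<lambda>x. c *\<^sub>R G x)"
  using u locally_integrable_scaleR[of u c] locally_integrable_scaleR[of G c]
  by (simp add: has_weak_gradient_def mult.assoc)

lemma has_weak_gradient_test: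
  assumes \<phi>: "\<phi> \<in> test_functions \<Omega>"
  shows "has_weak_gradient \<Omega> \<phi> (grad \<phi>)"
  unfolding has_weak_gradient_def
proof (intro conjI ballI)
  show "locally_integrable \<Omega> \<phi>" "locally_integrable \<Omega> (grad \<phi>)"
    using test_function_l2[OF \<phi>] by (auto intro: square_integrable_locally_integrable)
  fix \<psi> and i :: 'a assume \<psi>: "\<psi> \<in> test_functions \<Omega>" and i: "i \<in> Basis"
  note [measurable] = test_function_borel[OF \<phi>] test_function_borel[OF \<psi>]
    test_function_borel[OF test_functions_deriv[OF \<psi> i]]
  have "(\<integral>x. \<phi> x * frechet_derivative \<psi> (at x) i \<partial>M) = (\<integral>x. \<phi> x * frechet_derivative \<psi> (at x) i \<partial>lborel)"
    by (rule integral_M_eq_lborel) (use test_function_support[OF \<phi>] in auto)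
  moreover have "(\<integral>x. (grad \<phi> x \<bullet> i) * \<psi> x \<partial>M) = (\<integral>x. (grad \<phi> x \<bullet> i) * \<psi> x \<partial>lborel)"
    by (rule integral_M_eq_lborel) (use test_function_support[OF \<psi>] in auto)
  ultimately show "(\<integral>x. \<phi> x * frechet_derivative \<psi> (at x) i \<partial>M) = - (\<integral>x. (grad \<phi> x \<bullet> i) * \<psi> x \<partial>M)"
    using test_functions_integration_by_parts[OF \<phi> \<psi> i] by simp
qed

text \<open>Rests on the completeness of Lebesgue measure. The chosen \<open>weak_gradient\<close>
  agrees only almost everywhere with a square-integrable one and must inherit its
  measurability.\<close>

lemma borel_measurable_M_cong_AE:
  fixes f g :: "'a \<Rightarrow> 'b::euclidean_space"
  assumes f: "f \<in> borel_measurable M" and eq: "AE x in M. f x = g x"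
  shows "g \<in> borel_measurable M"
proof -
  have "(\<lambda>x. indicator \<Omega> x *\<^sub>R f x) \<in> borel_measurable lebesgue"
    using f by (simp add: borel_measurable_restrict_space_iff)
  moreover have "AE x in lebesgue. indicator \<Omega> x *\<^sub>R f x = indicator \<Omega> x *\<^sub>R g x"
    using eq by (subst (asm) AE_restrict_space_iff) (auto elim!: eventually_mono simp: indicator_def)
  ultimately have "(\<lambda>x. indicator \<Omega> x *\<^sub>R g x) \<in> borel_measurable lebesgue"
    by (rule borel_measurable_AE)
  then show ?thesis by (simp add: borel_measurable_restrict_space_iff)
qed

section \<open>The space H1\<close>

abbreviation wgrad where "wgrad \<equiv> weak_gradient \<Omega>"

text \<open>The gateway for concrete gradients: a candidate found by calculation replaces the chosen
  one up to a null set.\<close>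

lemma H1I:
  assumes u: "square_integrable M u" and G: "square_integrable M G" "has_weak_gradient \<Omega> u G"
  shows "u \<in> H1 \<Omega>" "AE x in M. wgrad u x = G x"
proof -
  show "u \<in> H1 \<Omega>" using assms by (auto simp: H1_def L2_iff)
  have "has_weak_gradient \<Omega> u (wgrad u)"
    unfolding weak_gradient_def using G(2) by (rule someI[where P = "has_weak_gradient \<Omega> u"])
  then show "AE x in M. wgrad u x = G x" using G(2) by (rule has_weak_gradient_unique)
qed

lemma H1D:
  assumes "u \<in> H1 \<Omega>"
  shows "square_integrable M u" "square_integrable M (wgrad u)" "has_weak_gradient \<Omega> u (wgrad u)"
proof -
  obtain G where G: "square_integrable M G" "has_weak_gradient \<Omega> u G"
    using assms by (auto simp: H1_def L2_iff)
  show u: "square_integrable M u" using assms by (simp add: H1_def L2_iff)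
  show "has_weak_gradient \<Omega> u (wgrad u)"
    unfolding weak_gradient_def using G(2) by (rule someI[where P = "has_weak_gradient \<Omega> u"])
  have eq: "AE x in M. G x = wgrad u x"
    using H1I(2)[OF u G] by eventually_elim simp
  show "square_integrable M (wgrad u)"
    using G(1) borel_measurable_M_cong_AE[OF square_integrableD(1)[OF G(1)] eq] eq
    by (rule square_integrable_cong_AE)
qed

lemma H1_measurable:
  assumes "u \<in> H1 \<Omega>"
  shows "u \<in> borel_measurable M" "wgrad u \<in> borel_measurable M"
  using H1D[OF assms] by (auto simp: square_integrable_def)

lemma H1_add:
  assumes u: "u \<in> H1 \<Omega>" and v: "v \<in> H1 \<Omega>"
  shows "(\<lambda>x. u x + v x) \<in> H1 \<Omega>" "AE x in M. wgrad (\<lambda>x. u x + v x) x = wgrad u x + wgrad v x"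
proof -
  note * = square_integrable_add[OF H1D(1)[OF u] H1D(1)[OF v]] square_integrable_add[OF H1D(2)[OF u] H1D(2)[OF v]]
    has_weak_gradient_add[OF H1D(3)[OF u] H1D(3)[OF v]]
  show "(\<lambda>x. u x + v x) \<in> H1 \<Omega>" "AE x in M. wgrad (\<lambda>x. u x + v x) x = wgrad u x + wgrad v x"
    using H1I[OF *] .
qed

lemma H1_cmult:
  assumes u: "u \<in> H1 \<Omega>"
  shows "(\<lambda>x. c * u x) \<in> H1 \<Omega>" "AE x in M. wgrad (\<lambda>x. c * u x) x = c *\<^sub>R wgrad u x"
proof -
  note * = square_integrable_scaleR[OF H1D(1)[OF u], of c, unfolded real_scaleR_def]
    square_integrable_scaleR[OF H1D(2)[OF u], of c] has_weak_gradient_cmult[OF H1D(3)[OF u], of c]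
  show "(\<lambda>x. c * u x) \<in> H1 \<Omega>" "AE x in M. wgrad (\<lambda>x. c * u x) x = c *\<^sub>R wgrad u x"
    using H1I[OF *] .
qed

lemma H1_diff:
  assumes u: "u \<in> H1 \<Omega>" and v: "v \<in> H1 \<Omega>"
  shows "(\<lambda>x. u x - v x) \<in> H1 \<Omega>" "AE x in M. wgrad (\<lambda>x. u x - v x) x = wgrad u x - wgrad v x"
proof -
  have eq: "(\<lambda>x. u x - v x) = (\<lambda>x. u x + (- 1) * v x)" by (simp add: fun_eq_iff)
  show "(\<lambda>x. u x - v x) \<in> H1 \<Omega>"
    unfolding eq by (rule H1_add(1)[OF u H1_cmult(1)[OF v]])
  show "AE x in M. wgrad (\<lambda>x. u x - v x) x = wgrad u x - wgrad v x"
    unfolding eq using H1_add(2)[OF u H1_cmult(1)[OF v, of "- 1"]] H1_cmult(2)[OF v, of "- 1"]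
    by eventually_elim simp
qed

lemma H1_test:
  assumes "\<phi> \<in> test_functions \<Omega>"
  shows "\<phi> \<in> H1 \<Omega>" "AE x in M. wgrad \<phi> x = grad \<phi> x"
  using H1I[OF test_function_l2(1,2)[OF assms] has_weak_gradient_test[OF assms]] by auto

text \<open>Closedness of the weak gradient: both sides of the defining identity are L2 inner
  products with functions that depend on the test function only, so they pass to the limit.\<close>

lemma has_weak_gradient_limit:
  assumes u: "\<And>n. u n \<in> H1 \<Omega>" and sq: "square_integrable M v" "square_integrable M G"
    and lim: "(\<lambda>n. l2norm M (\<lambda>x. u n x - v x)) \<longlonglongrightarrow> 0" "(\<lambda>n. l2norm M (\<lambda>x. wgrad (u n) x - G x)) \<longlonglongrightarrow> 0"
  shows "has_weak_gradient \<Omega> v G"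
  unfolding has_weak_gradient_def
proof (intro conjI ballI)
  show "locally_integrable \<Omega> v" "locally_integrable \<Omega> G"
    using sq by (auto intro: square_integrable_locally_integrable)
  fix \<phi> and i :: 'a assume \<phi>: "\<phi> \<in> test_functions \<Omega>" and i: "i \<in> Basis"
  have s1: "square_integrable M (\<lambda>x. frechet_derivative \<phi> (at x) i)"
    by (rule test_function_l2[OF test_functions_deriv[OF \<phi> i]])
  have s2: "square_integrable M (\<lambda>x. \<phi> x *\<^sub>R i)"
    using test_function_l2(1)[OF \<phi>] i by (auto simp: square_integrable_def intro!: borel_measurable_scaleR)
  have "(\<lambda>n. l2inner M (u n) (\<lambda>x. frechet_derivative \<phi> (at x) i)) \<longlonglongrightarrow> l2inner M v (\<lambda>x. frechet_derivative \<phi> (at x) i)"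
    using H1D(1)[OF u] sq(1) s1 lim(1) by (rule l2inner_tendsto)
  moreover have "(\<lambda>n. - l2inner M (wgrad (u n)) (\<lambda>x. \<phi> x *\<^sub>R i)) \<longlonglongrightarrow> - l2inner M G (\<lambda>x. \<phi> x *\<^sub>R i)"
    using H1D(2)[OF u] sq(2) s2 lim(2) by (intro tendsto_minus l2inner_tendsto)
  moreover have "l2inner M (u n) (\<lambda>x. frechet_derivative \<phi> (at x) i) = - l2inner M (wgrad (u n)) (\<lambda>x. \<phi> x *\<^sub>R i)" for n
    using H1D(3)[OF u[of n]] \<phi> i by (simp add: has_weak_gradient_def l2inner_def mult.commute)
  ultimately have "l2inner M v (\<lambda>x. frechet_derivative \<phi> (at x) i) = - l2inner M G (\<lambda>x. \<phi> x *\<^sub>R i)"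
    by (simp add: LIMSEQ_unique)
  then show "(\<integral>x. v x * frechet_derivative \<phi> (at x) i \<partial>M) = - (\<integral>x. (G x \<bullet> i) * \<phi> x \<partial>M)"
    by (simp add: l2inner_def mult.commute)
qed

section \<open>The Dirichlet form and its seminorm\<close>

definition hinner where "hinner u v = l2inner M (wgrad u) (wgrad v)"

abbreviation hnorm where "hnorm \<equiv> H10_norm \<Omega>"

lemma hnorm_eq: "hnorm u = l2norm M (wgrad u)"
  by (simp add: H10_norm_def dirichlet_integral_def l2norm_def)

lemma hnorm_nonneg [simp]: "0 \<le> hnorm u"
  by (simp add: hnorm_eq)

lemma dirichlet_integral_eq: "dirichlet_integral \<Omega> u = (hnorm u)\<^sup>2"
  by (simp add: hnorm_eq l2norm_squared dirichlet_integral_def)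

lemma H1_norm_eq: "H1_norm \<Omega> u = sqrt ((l2norm M u)\<^sup>2 + (hnorm u)\<^sup>2)"
  by (simp add: H1_norm_def l2norm_squared dirichlet_integral_eq)

lemma hnorm_diff_eq:
  assumes u: "u \<in> H1 \<Omega>" and v: "v \<in> H1 \<Omega>"
  shows "hnorm (\<lambda>x. u x - v x) = l2norm M (\<lambda>x. wgrad u x - wgrad v x)"
  unfolding hnorm_eq
  by (rule l2norm_cong_AE) (use H1_diff[OF u v] H1_measurable u v in auto)

lemma hnorm_add_eq:
  assumes u: "u \<in> H1 \<Omega>" and v: "v \<in> H1 \<Omega>"
  shows "hnorm (\<lambda>x. u x + v x) = l2norm M (\<lambda>x. wgrad u x + wgrad v x)"
  unfolding hnorm_eq
  by (rule l2norm_cong_AE) (use H1_add[OF u v] H1_measurable u v in auto)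

lemma hnorm_cmult:
  assumes u: "u \<in> H1 \<Omega>"
  shows "hnorm (\<lambda>x. c * u x) = \<bar>c\<bar> * hnorm u"
proof -
  have "hnorm (\<lambda>x. c * u x) = l2norm M (\<lambda>x. c *\<^sub>R wgrad u x)"
    unfolding hnorm_eq
    by (rule l2norm_cong_AE) (use H1_cmult[OF u] H1_measurable u in auto)
  then show ?thesis by (simp add: l2norm_scaleR hnorm_eq)
qed

lemma hinner_commute: "hinner u v = hinner v u"
  by (simp add: hinner_def l2inner_commute)

lemma hinner_self: "hinner u u = (hnorm u)\<^sup>2"
  by (simp add: hinner_def l2inner_self hnorm_eq)

lemma hinner_add_left:
  assumes u: "u \<in> H1 \<Omega>" and v: "v \<in> H1 \<Omega>" and w: "w \<in> H1 \<Omega>"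
  shows "hinner (\<lambda>x. u x + v x) w = hinner u w + hinner v w"
proof -
  have "hinner (\<lambda>x. u x + v x) w = l2inner M (\<lambda>x. wgrad u x + wgrad v x) (wgrad w)"
    unfolding hinner_def
    by (rule l2inner_cong_AE) (use H1_add[OF u v] H1_measurable u v w in auto)
  then show ?thesis using H1D[OF u] H1D[OF v] H1D[OF w] by (simp add: hinner_def l2inner_add_left)
qed

lemma hinner_cmult_left:
  assumes u: "u \<in> H1 \<Omega>" and w: "w \<in> H1 \<Omega>"
  shows "hinner (\<lambda>x. c * u x) w = c * hinner u w"
proof -
  have "hinner (\<lambda>x. c * u x) w = l2inner M (\<lambda>x. c *\<^sub>R wgrad u x) (wgrad w)"
    unfolding hinner_def
    by (rule l2inner_cong_AE) (use H1_cmult[OF u] H1_measurable u w in auto)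
  then show ?thesis by (simp add: hinner_def l2inner_scaleR_left)
qed

lemma hinner_diff_left:
  assumes u: "u \<in> H1 \<Omega>" and v: "v \<in> H1 \<Omega>" and w: "w \<in> H1 \<Omega>"
  shows "hinner (\<lambda>x. u x - v x) w = hinner u w - hinner v w"
  using hinner_add_left[OF u H1_cmult(1)[OF v, of "- 1"] w] hinner_cmult_left[OF v w, of "- 1"]
  by simp

lemma hinner_add_right:
  assumes "u \<in> H1 \<Omega>" "v \<in> H1 \<Omega>" "w \<in> H1 \<Omega>"
  shows "hinner w (\<lambda>x. u x + v x) = hinner w u + hinner w v"
  using hinner_add_left[OF assms] by (simp add: hinner_commute)

lemma hinner_diff_right:
  assumes "u \<in> H1 \<Omega>" "v \<in> H1 \<Omega>" "w \<in> H1 \<Omega>"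
  shows "hinner w (\<lambda>x. u x - v x) = hinner w u - hinner w v"
  using hinner_diff_left[OF assms] by (simp add: hinner_commute)

lemma hinner_cmult_right:
  assumes "u \<in> H1 \<Omega>" "w \<in> H1 \<Omega>"
  shows "hinner w (\<lambda>x. c * u x) = c * hinner w u"
  using hinner_cmult_left[OF assms] by (simp add: hinner_commute)

lemma hinner_Cauchy_Schwarz:
  assumes "u \<in> H1 \<Omega>" "v \<in> H1 \<Omega>"
  shows "\<bar>hinner u v\<bar> \<le> hnorm u * hnorm v"
  using l2_Cauchy_Schwarz H1D(2)[OF assms(1)] H1D(2)[OF assms(2)]
  by (auto simp: hinner_def hnorm_eq)

lemma hnorm_add_squared:
  assumes "u \<in> H1 \<Omega>" "v \<in> H1 \<Omega>"
  shows "(hnorm (\<lambda>x. u x + v x))\<^sup>2 = (hnorm u)\<^sup>2 + 2 * hinner u v + (hnorm v)\<^sup>2"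
  using l2norm_add_squared[OF H1D(2)[OF assms(1)] H1D(2)[OF assms(2)]]
  by (simp add: hnorm_add_eq[OF assms] hnorm_eq hinner_def)

lemma hnorm_triangle:
  assumes "u \<in> H1 \<Omega>" "v \<in> H1 \<Omega>"
  shows "hnorm (\<lambda>x. u x + v x) \<le> hnorm u + hnorm v"
  using l2norm_triangle[OF H1D(2)[OF assms(1)] H1D(2)[OF assms(2)]]
  by (simp add: hnorm_add_eq[OF assms] hnorm_eq)

lemma hnorm_le_diff:
  assumes "u \<in> H1 \<Omega>" "v \<in> H1 \<Omega>"
  shows "\<bar>hnorm u - hnorm v\<bar> \<le> hnorm (\<lambda>x. u x - v x)"
  using l2norm_le_diff[OF H1D(2)[OF assms(1)] H1D(2)[OF assms(2)]]
  by (simp add: hnorm_diff_eq[OF assms] hnorm_eq)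

lemma hnorm_minus_commute:
  assumes "u \<in> H1 \<Omega>" "v \<in> H1 \<Omega>"
  shows "hnorm (\<lambda>x. u x - v x) = hnorm (\<lambda>x. v x - u x)"
  using l2norm_minus_commute[of M "wgrad u" "wgrad v"]
  by (simp add: hnorm_diff_eq assms)

lemma hnorm_tendsto:
  assumes "\<And>n. u n \<in> H1 \<Omega>" "v \<in> H1 \<Omega>" "(\<lambda>n. hnorm (\<lambda>x. u n x - v x)) \<longlonglongrightarrow> 0"
  shows "(\<lambda>n. hnorm (u n)) \<longlonglongrightarrow> hnorm v"
proof -
  have "(\<lambda>n. l2norm M (\<lambda>x. wgrad (u n) x - wgrad v x)) \<longlonglongrightarrow> 0"
    using assms(3) by (simp add: hnorm_diff_eq assms(1,2))
  from l2norm_tendsto[OF H1D(2)[OF assms(1)] H1D(2)[OF assms(2)] this] show ?thesis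
    by (simp add: hnorm_eq)
qed

lemma H1_norm_bounds:
  "l2norm M u \<le> H1_norm \<Omega> u" "hnorm u \<le> H1_norm \<Omega> u" "H1_norm \<Omega> u \<le> l2norm M u + hnorm u"
proof -
  show "l2norm M u \<le> H1_norm \<Omega> u" "hnorm u \<le> H1_norm \<Omega> u"
    unfolding H1_norm_eq by (rule real_le_rsqrt; simp)+
  show "H1_norm \<Omega> u \<le> l2norm M u + hnorm u"
    unfolding H1_norm_eq by (rule real_le_lsqrt) (auto simp: power2_sum)
qed

section \<open>The closure of the test functions\<close>

lemma H10_imp_H1: "u \<in> H10 \<Omega> \<Longrightarrow> u \<in> H1 \<Omega>"
  by (simp add: H10_def)

lemma H10_iff:
  "u \<in> H10 \<Omega> \<longleftrightarrow> u \<in> H1 \<Omega> \<and> (\<forall>e>0. \<exists>\<phi>\<in>test_functions \<Omega>. l2norm M (\<lambda>x. u x - \<phi> x) < e \<and> hnorm (\<lambda>x. u x - \<phi> x) < e)"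
  (is "_ \<longleftrightarrow> ?R")
proof
  assume u: "u \<in> H10 \<Omega>"
  then obtain \<phi> where \<phi>: "\<And>n. \<phi> n \<in> test_functions \<Omega>" "(\<lambda>n. H1_norm \<Omega> (\<lambda>x. u x - \<phi> n x)) \<longlonglongrightarrow> 0"
    by (auto simp: H10_def)
  have "\<exists>\<psi>\<in>test_functions \<Omega>. l2norm M (\<lambda>x. u x - \<psi> x) < e \<and> hnorm (\<lambda>x. u x - \<psi> x) < e" if "e > 0" for e
  proof -
    have "\<forall>\<^sub>F n in sequentially. H1_norm \<Omega> (\<lambda>x. u x - \<phi> n x) < e"
      using \<phi>(2) that by (rule order_tendstoD)
    then obtain n where "H1_norm \<Omega> (\<lambda>x. u x - \<phi> n x) < e"
      by (auto simp: eventually_sequentially)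
    with \<phi>(1)[of n] H1_norm_bounds show ?thesis by (meson le_less_trans)
  qed
  with u show ?R by (auto simp: H10_def)
next
  assume R: ?R
  then have "\<forall>n. \<exists>\<phi>\<in>test_functions \<Omega>. l2norm M (\<lambda>x. u x - \<phi> x) < inverse (real (Suc n)) \<and> hnorm (\<lambda>x. u x - \<phi> x) < inverse (real (Suc n))"
    by simp
  then obtain \<phi> where \<phi>: "\<And>n. \<phi> n \<in> test_functions \<Omega>" "\<And>n. l2norm M (\<lambda>x. u x - \<phi> n x) < inverse (real (Suc n))"
     "\<And>n. hnorm (\<lambda>x. u x - \<phi> n x) < inverse (real (Suc n))"
    by metis
  have "(\<lambda>n. H1_norm \<Omega> (\<lambda>x. u x - \<phi> n x)) \<longlonglongrightarrow> 0"
  proof (rule Lim_null_comparison)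
    show "\<forall>\<^sub>F n in sequentially. norm (H1_norm \<Omega> (\<lambda>x. u x - \<phi> n x)) \<le> inverse (real (Suc n)) + inverse (real (Suc n))"
    proof (rule always_eventually, rule allI)
      fix n
      have "0 \<le> H1_norm \<Omega> (\<lambda>x. u x - \<phi> n x)" using H1_norm_bounds(2) hnorm_nonneg order_trans by blast
      then show "norm (H1_norm \<Omega> (\<lambda>x. u x - \<phi> n x)) \<le> inverse (real (Suc n)) + inverse (real (Suc n))"
        using H1_norm_bounds(3)[of "\<lambda>x. u x - \<phi> n x"] \<phi>(2,3)[of n] by simp
    qed
    show "(\<lambda>n. inverse (real (Suc n)) + inverse (real (Suc n))) \<longlonglongrightarrow> 0"
      using tendsto_add[OF LIMSEQ_inverse_real_of_nat LIMSEQ_inverse_real_of_nat] by simp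
  qed
  with R \<phi>(1) show "u \<in> H10 \<Omega>" by (auto simp: H10_def)
qed

lemma H10_test: "\<phi> \<in> test_functions \<Omega> \<Longrightarrow> \<phi> \<in> H10 \<Omega>"
proof -
  assume \<phi>: "\<phi> \<in> test_functions \<Omega>"
  have "hnorm (\<lambda>x. \<phi> x - \<phi> x) = 0"
    using hnorm_diff_eq[OF H1_test(1)[OF \<phi>] H1_test(1)[OF \<phi>]] by (simp add: l2norm_def)
  moreover have "l2norm M (\<lambda>x. \<phi> x - \<phi> x) = 0" by (simp add: l2norm_def)
  ultimately show "\<phi> \<in> H10 \<Omega>"
    unfolding H10_iff using \<phi> H1_test(1) by metis
qed

lemma H1_triangle_diff:
  assumes "u \<in> H1 \<Omega>" "v \<in> H1 \<Omega>" "w \<in> H1 \<Omega>"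
  shows "l2norm M (\<lambda>x. u x - w x) \<le> l2norm M (\<lambda>x. u x - v x) + l2norm M (\<lambda>x. v x - w x)"
    "hnorm (\<lambda>x. u x - w x) \<le> hnorm (\<lambda>x. u x - v x) + hnorm (\<lambda>x. v x - w x)"
  using l2norm_triangle_diff[OF H1D(1)[OF assms(1)] H1D(1)[OF assms(2)] H1D(1)[OF assms(3)]]
    l2norm_triangle_diff[OF H1D(2)[OF assms(1)] H1D(2)[OF assms(2)] H1D(2)[OF assms(3)]]
  by (simp_all add: hnorm_diff_eq assms)

text \<open>An approximant in \<open>H10\<close> is itself replaced by a test function, with half of
  the tolerance spent on each step.\<close>

lemma H10_closed:
  assumes u: "u \<in> H1 \<Omega>" and v: "\<And>e. e > 0 \<Longrightarrow> \<exists>v\<in>H10 \<Omega>. l2norm M (\<lambda>x. u x - v x) < e \<and> hnorm (\<lambda>x. u x - v x) < e"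
  shows "u \<in> H10 \<Omega>"
  unfolding H10_iff
proof (intro conjI u allI impI)
  fix e :: real assume "e > 0"
  then obtain v where v: "v \<in> H10 \<Omega>" "l2norm M (\<lambda>x. u x - v x) < e / 2" "hnorm (\<lambda>x. u x - v x) < e / 2"
    using assms(2)[of "e / 2"] by auto
  obtain \<phi> where \<phi>: "\<phi> \<in> test_functions \<Omega>" "l2norm M (\<lambda>x. v x - \<phi> x) < e / 2" "hnorm (\<lambda>x. v x - \<phi> x) < e / 2"
    using v(1) \<open>e > 0\<close> unfolding H10_iff by (meson half_gt_zero)
  show "\<exists>\<phi>\<in>test_functions \<Omega>. l2norm M (\<lambda>x. u x - \<phi> x) < e \<and> hnorm (\<lambda>x. u x - \<phi> x) < e"
    using H1_triangle_diff[OF u H10_imp_H1[OF v(1)] H1_test(1)[OF \<phi>(1)]] v \<phi>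
    by (intro bexI[of _ \<phi>]) auto
qed

lemma H10_add:
  assumes u: "u \<in> H10 \<Omega>" and v: "v \<in> H10 \<Omega>"
  shows "(\<lambda>x. u x + v x) \<in> H10 \<Omega>"
proof (rule H10_closed)
  show H: "(\<lambda>x. u x + v x) \<in> H1 \<Omega>" using u v by (intro H1_add H10_imp_H1)
  fix e :: real assume "e > 0"
  then obtain \<phi> \<psi> where \<phi>: "\<phi> \<in> test_functions \<Omega>" "l2norm M (\<lambda>x. u x - \<phi> x) < e / 2" "hnorm (\<lambda>x. u x - \<phi> x) < e / 2"
    and \<psi>: "\<psi> \<in> test_functions \<Omega>" "l2norm M (\<lambda>x. v x - \<psi> x) < e / 2" "hnorm (\<lambda>x. v x - \<psi> x) < e / 2"
    using u v unfolding H10_iff by (meson half_gt_zero)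
  have d: "(\<lambda>x. u x - \<phi> x) \<in> H1 \<Omega>" "(\<lambda>x. v x - \<psi> x) \<in> H1 \<Omega>"
    using u v \<phi> \<psi> by (auto intro: H1_diff H10_imp_H1 H1_test)
  have eq: "(\<lambda>x. u x + v x - (\<phi> x + \<psi> x)) = (\<lambda>x. (u x - \<phi> x) + (v x - \<psi> x))" by auto
  show "\<exists>w\<in>H10 \<Omega>. l2norm M (\<lambda>x. u x + v x - w x) < e \<and> hnorm (\<lambda>x. u x + v x - w x) < e"
  proof (intro bexI[of _ "\<lambda>x. \<phi> x + \<psi> x"] conjI)
    show "(\<lambda>x. \<phi> x + \<psi> x) \<in> H10 \<Omega>" using \<phi> \<psi> by (intro H10_test test_functions_add)
    show "l2norm M (\<lambda>x. u x + v x - (\<phi> x + \<psi> x)) < e"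
      unfolding eq using l2norm_triangle[OF H1D(1)[OF d(1)] H1D(1)[OF d(2)]] \<phi> \<psi> by simp
    show "hnorm (\<lambda>x. u x + v x - (\<phi> x + \<psi> x)) < e"
      unfolding eq using hnorm_triangle[OF d] \<phi> \<psi> by simp
  qed
qed

lemma H10_cmult:
  assumes u: "u \<in> H10 \<Omega>"
  shows "(\<lambda>x. c * u x) \<in> H10 \<Omega>"
proof (rule H10_closed)
  show H: "(\<lambda>x. c * u x) \<in> H1 \<Omega>" using u by (intro H1_cmult H10_imp_H1)
  fix e :: real assume e: "e > 0"
  define d where "d = e / (\<bar>c\<bar> + 1)"
  have d: "d > 0" "\<bar>c\<bar> * d < e" using e by (auto simp: d_def field_simps)
  obtain \<phi> where \<phi>: "\<phi> \<in> test_functions \<Omega>" "l2norm M (\<lambda>x. u x - \<phi> x) < d" "hnorm (\<lambda>x. u x - \<phi> x) < d"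
    using u d(1) unfolding H10_iff by meson
  have h: "(\<lambda>x. u x - \<phi> x) \<in> H1 \<Omega>" using u \<phi> by (auto intro: H1_diff H10_imp_H1 H1_test)
  have eq: "(\<lambda>x. c * u x - c * \<phi> x) = (\<lambda>x. c * (u x - \<phi> x))" by (auto simp: algebra_simps)
  show "\<exists>w\<in>H10 \<Omega>. l2norm M (\<lambda>x. c * u x - w x) < e \<and> hnorm (\<lambda>x. c * u x - w x) < e"
  proof (intro bexI[of _ "\<lambda>x. c * \<phi> x"] conjI)
    show "(\<lambda>x. c * \<phi> x) \<in> H10 \<Omega>" using \<phi> by (intro H10_test test_functions_cmult)
    have "\<bar>c\<bar> * l2norm M (\<lambda>x. u x - \<phi> x) \<le> \<bar>c\<bar> * d" "\<bar>c\<bar> * hnorm (\<lambda>x. u x - \<phi> x) \<le> \<bar>c\<bar> * d"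
      using \<phi> by (auto intro: mult_left_mono)
    then show "l2norm M (\<lambda>x. c * u x - c * \<phi> x) < e" "hnorm (\<lambda>x. c * u x - c * \<phi> x) < e"
      unfolding eq using l2norm_scaleR[of M c "\<lambda>x. u x - \<phi> x"] hnorm_cmult[OF h, of c] d by auto
  qed
qed

lemma H10_diff:
  assumes "u \<in> H10 \<Omega>" "v \<in> H10 \<Omega>"
  shows "(\<lambda>x. u x - v x) \<in> H10 \<Omega>"
  using H10_add[OF assms(1) H10_cmult[OF assms(2), of "- 1"]] by simp

end

subsection \<open>Sobolev and Poincare inequalities\<close>

locale sobolev_domain = bounded_open +
  assumes dim: "DIM('a) \<ge> 3" and nonempty: "\<Omega> \<noteq> {}"
begin

definition p where "p = crit_exp DIM('a)"

lemma p_gt_2: "p > 2"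
  using dim by (simp add: p_def crit_exp_def field_simps)

lemma hnorm_test:
  assumes "\<phi> \<in> test_functions \<Omega>"
  shows "hnorm \<phi> = l2norm M (grad \<phi>)"
  unfolding hnorm_eq
  by (rule l2norm_cong_AE)
    (use H1_test[OF assms] H1_measurable test_function_l2[OF assms] in \<open>auto simp: square_integrable_def\<close>)

lemma powr_hnorm: "((hnorm u)\<^sup>2) powr (p / 2) = hnorm u powr p"
proof (cases "hnorm u = 0")
  case False
  then have "(hnorm u)\<^sup>2 = hnorm u powr 2" by (simp add: order_less_le)
  then show ?thesis by (simp only: powr_powr) simp
qed simp

text \<open>Prepares Fatou's lemma: along a subsequence the approximating test functions converge
  pointwise as well as in norm.\<close>

lemma H10_approx_AE:
  assumes u: "u \<in> H10 \<Omega>"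
  obtains \<phi> :: "nat \<Rightarrow> 'a \<Rightarrow> real" where "\<forall>n. \<phi> n \<in> test_functions \<Omega>" "(\<lambda>n. hnorm (\<phi> n)) \<longlonglongrightarrow> hnorm u"
    "AE x in M. (\<lambda>n. \<phi> n x) \<longlonglongrightarrow> u x"
proof -
  obtain \<phi> where \<phi>: "\<And>n. \<phi> n \<in> test_functions \<Omega>" "(\<lambda>n. H1_norm \<Omega> (\<lambda>x. u x - \<phi> n x)) \<longlonglongrightarrow> 0"
    using u by (auto simp: H10_def)
  have uH: "u \<in> H1 \<Omega>" using u by (rule H10_imp_H1)
  have l: "(\<lambda>n. l2norm M (\<lambda>x. \<phi> n x - u x)) \<longlonglongrightarrow> 0"
  proof (rule Lim_null_comparison[OF always_eventually \<phi>(2)], rule allI)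
    fix n show "norm (l2norm M (\<lambda>x. \<phi> n x - u x)) \<le> H1_norm \<Omega> (\<lambda>x. u x - \<phi> n x)"
      using H1_norm_bounds(1)[of "\<lambda>x. u x - \<phi> n x"] l2norm_minus_commute[of M u "\<phi> n"] by simp
  qed
  have h: "(\<lambda>n. hnorm (\<lambda>x. \<phi> n x - u x)) \<longlonglongrightarrow> 0"
  proof (rule Lim_null_comparison[OF always_eventually \<phi>(2)], rule allI)
    fix n show "norm (hnorm (\<lambda>x. \<phi> n x - u x)) \<le> H1_norm \<Omega> (\<lambda>x. u x - \<phi> n x)"
      using H1_norm_bounds(2)[of "\<lambda>x. u x - \<phi> n x"] hnorm_minus_commute[OF uH H1_test(1)[OF \<phi>(1)[of n]]] by simp
  qed
  have hl: "(\<lambda>n. hnorm (\<phi> n)) \<longlonglongrightarrow> hnorm u"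
    by (rule hnorm_tendsto[OF H1_test(1)[OF \<phi>(1)] uH h])
  obtain r :: "nat \<Rightarrow> nat" where r: "strict_mono r" "AE x in M. (\<lambda>n. \<phi> (r n) x) \<longlonglongrightarrow> u x"
    using l2_AE_subseq[OF test_function_l2(1)[OF \<phi>(1)] H1D(1)[OF uH] l] by blast
  show ?thesis
  proof (rule that[of "\<lambda>n. \<phi> (r n)"])
    show "(\<lambda>n. hnorm (\<phi> (r n))) \<longlonglongrightarrow> hnorm u"
      using LIMSEQ_subseq_LIMSEQ[OF hl r(1)] by (simp add: o_def)
  qed (use \<phi>(1) r(2) in auto)
qed

text \<open>Fatou's lemma carries the inequality over from test functions. It is run with
  nonnegative integrals, since integrability of the p-th power is part of the claim.\<close>

lemma H10_Sobolev:
  obtains C where "C \<ge> 0" "\<forall>u\<in>H10 \<Omega>. integrable M (\<lambda>x. \<bar>u x\<bar> powr p) \<and> (\<integral>x. \<bar>u x\<bar> powr p \<partial>M) \<le> C * hnorm u powr p"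
proof -
  obtain C where C: "C \<ge> 0" "\<forall>w G. C1_compact w G \<and> {x. w x \<noteq> 0} \<subseteq> \<Omega>
    \<longrightarrow> (\<integral>x. \<bar>w x\<bar> powr p \<partial>lborel) \<le> C * (\<integral>x. (norm (G x))\<^sup>2 \<partial>lborel) powr (p / 2)"
    unfolding p_def by (rule C1_compact_Sobolev[OF dim bounded_domain domain_sets(2)]) blast
  have test: "(\<integral>\<^sup>+x. ennreal (\<bar>\<phi> x\<bar> powr p) \<partial>M) \<le> ennreal (C * hnorm \<phi> powr p)" if \<phi>: "\<phi> \<in> test_functions \<Omega>" for \<phi>
  proof -
    note CC = test_functions_C1_compact[OF \<phi>]
    have [measurable]: "\<phi> \<in> borel_measurable borel" by (rule test_function_borel[OF \<phi>])
    have s: "{x. \<bar>\<phi> x\<bar> powr p \<noteq> 0} \<subseteq> \<Omega>" using test_function_support[OF \<phi>] by auto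
    have b: "(\<lambda>x. \<bar>\<phi> x\<bar> powr p) \<in> borel_measurable borel" by measurable
    have i: "integrable M (\<lambda>x. \<bar>\<phi> x\<bar> powr p)"
      using integral_M_eq_lborel(2)[OF b s] C1_compact_integrable_powr(1)[OF CC, of p] p_gt_2 by simp
    have "(\<integral>x. \<bar>\<phi> x\<bar> powr p \<partial>M) = (\<integral>x. \<bar>\<phi> x\<bar> powr p \<partial>lborel)"
      by (rule integral_M_eq_lborel(1)[OF b s])
    also have "\<dots> \<le> C * (\<integral>x. (norm (grad \<phi> x))\<^sup>2 \<partial>lborel) powr (p / 2)"
      using C(2) CC test_function_support(1)[OF \<phi>] by blast
    also have "\<dots> = C * hnorm \<phi> powr p"
      by (simp add: test_function_l2(4)[OF \<phi>, symmetric] hnorm_test[OF \<phi>, symmetric] powr_hnorm)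
    finally show ?thesis
      by (subst nn_integral_eq_integral[OF i]) (auto intro: ennreal_leI)
  qed
  have main: "integrable M (\<lambda>x. \<bar>u x\<bar> powr p) \<and> (\<integral>x. \<bar>u x\<bar> powr p \<partial>M) \<le> C * hnorm u powr p" if u: "u \<in> H10 \<Omega>" for u
  proof -
    obtain \<phi> where \<phi>: "\<forall>n. \<phi> n \<in> test_functions \<Omega>" "(\<lambda>n. hnorm (\<phi> n)) \<longlonglongrightarrow> hnorm u"
      "AE x in M. (\<lambda>n. \<phi> n x) \<longlonglongrightarrow> u x"
      by (rule H10_approx_AE[OF u])
    have um [measurable]: "u \<in> borel_measurable M" using H1_measurable[OF H10_imp_H1[OF u]] by simp
    have [measurable]: "\<phi> n \<in> borel_measurable M" for n
      using \<phi>(1) test_function_borel borel_measurable_M by blast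
    have "(\<integral>\<^sup>+x. ennreal (\<bar>u x\<bar> powr p) \<partial>M) = (\<integral>\<^sup>+x. liminf (\<lambda>n. ennreal (\<bar>\<phi> n x\<bar> powr p)) \<partial>M)"
    proof (rule nn_integral_cong_AE, use \<phi>(3) in eventually_elim)
      case (elim x)
      have "(\<lambda>n. ennreal (\<bar>\<phi> n x\<bar> powr p)) \<longlonglongrightarrow> ennreal (\<bar>u x\<bar> powr p)"
        using p_gt_2 by (intro tendsto_ennrealI tendsto_powr' tendsto_rabs elim tendsto_const) auto
      from lim_imp_Liminf[OF sequentially_bot this] show ?case by simp
    qed
    also have "\<dots> \<le> liminf (\<lambda>n. \<integral>\<^sup>+x. ennreal (\<bar>\<phi> n x\<bar> powr p) \<partial>M)"
      by (rule nn_integral_liminf) measurable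
    also have "\<dots> \<le> liminf (\<lambda>n. ennreal (C * hnorm (\<phi> n) powr p))"
      by (rule Liminf_mono) (use test \<phi>(1) in auto)
    also have "\<dots> = ennreal (C * hnorm u powr p)"
    proof (rule lim_imp_Liminf[OF sequentially_bot])
      show "(\<lambda>n. ennreal (C * hnorm (\<phi> n) powr p)) \<longlonglongrightarrow> ennreal (C * hnorm u powr p)"
        using p_gt_2 by (intro tendsto_ennrealI tendsto_mult tendsto_powr' \<phi>(2) tendsto_const) auto
    qed
    finally have le: "(\<integral>\<^sup>+x. ennreal (\<bar>u x\<bar> powr p) \<partial>M) \<le> ennreal (C * hnorm u powr p)" .
    then have i: "integrable M (\<lambda>x. \<bar>u x\<bar> powr p)"
      by (intro integrableI_nonneg) (auto intro: le_less_trans)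
    moreover have "(\<integral>x. \<bar>u x\<bar> powr p \<partial>M) \<le> C * hnorm u powr p"
      using le C(1) by (subst (asm) nn_integral_eq_integral[OF i]) (auto simp: ennreal_le_iff)
    ultimately show ?thesis by simp
  qed
  show ?thesis by (rule that[OF C(1)]) (use main in blast)
qed

lemma H10_integrable_powr:
  assumes "u \<in> H10 \<Omega>"
  shows "integrable M (\<lambda>x. \<bar>u x\<bar> powr p)"
  using H10_Sobolev assms by blast

text \<open>Keeps the set behind the infimum in \<open>sobolev_const\<close> nonempty.\<close>

lemma not_AE_zero_test: "\<exists>\<phi>\<in>test_functions \<Omega>. \<not> (AE x in M. \<phi> x = 0)"
proof -
  obtain x where "x \<in> \<Omega>" using nonempty by blast
  then obtain a b where ab: "x \<in> box a b" "cbox a b \<subseteq> \<Omega>"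
    using open_contains_cbox[of \<Omega>] open_domain by (metis)
  have "\<not> (AE x in M. box_bump a b 0 x = 0)"
  proof
    assume "AE x in M. box_bump a b 0 x = 0"
    then have "AE y in lebesgue. y \<notin> box a b"
      using ab(2) box_subset_cbox[of a b]
      by (subst (asm) AE_restrict_space_iff) (auto simp: box_bump_eq_0_iff elim!: eventually_mono)
    then have "negligible (box a b)"
      by (simp add: completion.AE_iff_null_sets negligible_iff_null_sets)
    then show False using ab(1) by (auto simp: negligible_interval)
  qed
  with box_bump_test_function[OF ab(2)] show ?thesis by blast
qed

text \<open>The Sobolev inequality bounds all quotients from below by
  \<open>C powr (- 2 / p)\<close>. Together with nonemptiness this makes the real infimum
  meaningful, and positive.\<close>

lemma sobolev_const_pos: "sobolev_const \<Omega> > 0"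
  and sobolev_const_le: "u \<in> H10 \<Omega> \<Longrightarrow> sobolev_const \<Omega> * (\<integral>x. \<bar>u x\<bar> powr p \<partial>M) powr (2 / p) \<le> (hnorm u)\<^sup>2"
proof -
  define I where "I u = (\<integral>x. \<bar>u x\<bar> powr p \<partial>M)" for u :: "'a \<Rightarrow> real"
  define X where "X = {(hnorm u)\<^sup>2 / I u powr (2 / p) | u. u \<in> H10 \<Omega> \<and> \<not> (AE x in M. u x = 0)}"
  have S: "sobolev_const \<Omega> = Inf X"
    by (simp add: sobolev_const_def X_def I_def p_def dirichlet_integral_eq)
  obtain C0 where C0: "C0 \<ge> 0" "\<forall>u\<in>H10 \<Omega>. integrable M (\<lambda>x. \<bar>u x\<bar> powr p) \<and> (\<integral>x. \<bar>u x\<bar> powr p \<partial>M) \<le> C0 * hnorm u powr p"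
    by (rule H10_Sobolev)
  \<comment> \<open>The shift by 1 guarantees a positive constant, as its negative power is about to
    be taken.\<close>
  define C where "C = C0 + 1"
  have C: "C > 0" using C0 by (simp add: C_def)
  have IC: "I u \<le> C * hnorm u powr p" if "u \<in> H10 \<Omega>" for u
  proof -
    have "I u \<le> C0 * hnorm u powr p" using C0(2) that by (simp add: I_def)
    also have "\<dots> \<le> C * hnorm u powr p" by (rule mult_right_mono) (auto simp: C_def)
    finally show ?thesis .
  qed
  have I0: "I u \<ge> 0" for u unfolding I_def by simp
  have Ipos: "I u > 0" if "u \<in> H10 \<Omega>" "\<not> (AE x in M. u x = 0)" for u
  proof -
    have "I u \<noteq> 0"
    proof
      assume "I u = 0"
      then have "AE x in M. \<bar>u x\<bar> powr p = 0"
        unfolding I_def using C0(2) that(1) by (subst (asm) integral_nonneg_eq_0_iff_AE) auto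
      then have "AE x in M. u x = 0" by eventually_elim simp
      with that(2) show False by simp
    qed
    with I0[of u] show ?thesis by simp
  qed
  have lower: "C powr (- 2 / p) \<le> x" if x: "x \<in> X" for x
  proof -
    from x obtain u where u: "u \<in> H10 \<Omega>" "\<not> (AE x in M. u x = 0)" "x = (hnorm u)\<^sup>2 / I u powr (2 / p)"
      by (auto simp: X_def)
    note ip = Ipos[OF u(1,2)]
    have "I u powr (2 / p) \<le> (C * hnorm u powr p) powr (2 / p)"
      using IC[OF u(1)] ip p_gt_2 by (intro powr_mono2) auto
    also have "\<dots> = C powr (2 / p) * (hnorm u)\<^sup>2"
      using C p_gt_2 by (cases "hnorm u = 0") (auto simp: powr_mult powr_powr order_less_le)
    finally have "I u powr (2 / p) \<le> C powr (2 / p) * (hnorm u)\<^sup>2" .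
    then have "C powr (- 2 / p) * I u powr (2 / p) \<le> C powr (- 2 / p) * (C powr (2 / p) * (hnorm u)\<^sup>2)"
      by (rule mult_left_mono) simp
    also have "\<dots> = (hnorm u)\<^sup>2"
      using C by (simp add: mult.assoc[symmetric] powr_add[symmetric])
    finally show ?thesis using ip by (simp add: u(3) field_simps)
  qed
  have ne: "X \<noteq> {}" using not_AE_zero_test H10_test unfolding X_def by blast
  have bdd: "bdd_below X" using lower by (auto simp: bdd_below_def)
  have "C powr (- 2 / p) \<le> Inf X" using ne lower by (rule cInf_greatest)
  moreover have "C powr (- 2 / p) > 0" using C by simp
  ultimately show "sobolev_const \<Omega> > 0" unfolding S by linarith
  assume u: "u \<in> H10 \<Omega>"
  show "sobolev_const \<Omega> * (\<integral>x. \<bar>u x\<bar> powr p \<partial>M) powr (2 / p) \<le> (hnorm u)\<^sup>2"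
  proof (cases "AE x in M. u x = 0")
    case True
    then have "AE x in M. \<bar>u x\<bar> powr p = 0" by eventually_elim simp
    then have "I u = 0"
      unfolding I_def by (rule integral_eq_zero_AE)
    then show ?thesis by (simp add: I_def[symmetric])
  next
    case False
    have "Inf X \<le> (hnorm u)\<^sup>2 / I u powr (2 / p)"
      using u False by (intro cInf_lower bdd) (auto simp: X_def)
    then show ?thesis using Ipos[OF u False] by (simp add: S I_def[symmetric] field_simps)
  qed
qed

lemma H10_Sobolev_const:
  assumes u: "u \<in> H10 \<Omega>"
  shows "(\<integral>x. \<bar>u x\<bar> powr p \<partial>M) \<le> sobolev_const \<Omega> powr (- p / 2) * hnorm u powr p"
proof -
  define S where "S = sobolev_const \<Omega>"
  define I where "I = (\<integral>x. \<bar>u x\<bar> powr p \<partial>M)"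
  have S: "S > 0" using sobolev_const_pos by (simp add: S_def)
  have I: "I \<ge> 0" by (simp add: I_def)
  have "I powr (2 / p) \<le> (hnorm u)\<^sup>2 / S"
    using sobolev_const_le[OF u] S by (simp add: S_def I_def field_simps)
  then have "(I powr (2 / p)) powr (p / 2) \<le> ((hnorm u)\<^sup>2 / S) powr (p / 2)"
    using p_gt_2 by (intro powr_mono2) auto
  moreover have "(I powr (2 / p)) powr (p / 2) = I" using I p_gt_2 by (simp add: powr_powr)
  moreover have "((hnorm u)\<^sup>2 / S) powr (p / 2) = S powr (- p / 2) * hnorm u powr p"
    using S powr_hnorm[of u] by (simp add: powr_divide powr_minus_divide)
  ultimately show ?thesis by (simp add: I_def S_def)
qed

text \<open>After normalisation to \<open>hnorm v = 1\<close> the pointwise bound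
  \<open>s\<^sup>2 \<le> 1 + \<bar>s\<bar> powr p\<close> and the finite measure of the domain
  reduce the claim to the Sobolev inequality.\<close>

lemma H10_Poincare:
  obtains C where "C > 0" "\<forall>u\<in>H10 \<Omega>. l2norm M u \<le> C * hnorm u"
proof -
  define K where "K = sobolev_const \<Omega> powr (- p / 2)"
  define m where "m = measure M (space M)"
  define C where "C = sqrt (m + K) + 1"
  have mK: "m \<ge> 0" "K \<ge> 0" by (simp_all add: m_def K_def)
  have "l2norm M u \<le> C * hnorm u" if u: "u \<in> H10 \<Omega>" for u
  \<comment> \<open>Normalisation fails for norm zero; there the Sobolev inequality makes u vanish
    almost everywhere.\<close>
  proof (cases "hnorm u = 0")
    case True
    have um: "u \<in> borel_measurable M" using H1_measurable[OF H10_imp_H1[OF u]] by simp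
    have "(\<integral>x. \<bar>u x\<bar> powr p \<partial>M) = 0"
    proof (rule antisym)
      show "(\<integral>x. \<bar>u x\<bar> powr p \<partial>M) \<le> 0" using H10_Sobolev_const[OF u] True by simp
    qed simp
    then have "AE x in M. \<bar>u x\<bar> powr p = 0"
      using H10_integrable_powr[OF u] by (subst (asm) integral_nonneg_eq_0_iff_AE) auto
    then have "AE x in M. u x = 0" by eventually_elim simp
    then have "l2norm M u = l2norm M (\<lambda>x. 0 :: real)"
      using um by (intro l2norm_cong_AE) auto
    then show ?thesis using True by (simp add: l2norm_def)
  next
    case False
    then have h: "hnorm u > 0" by (simp add: order_less_le)
    define v where "v x = (1 / hnorm u) * u x" for x
    have v: "v \<in> H10 \<Omega>" unfolding v_def by (rule H10_cmult[OF u])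
    have hv: "hnorm v = 1" unfolding v_def using h hnorm_cmult[OF H10_imp_H1[OF u], of "1 / hnorm u"] by simp
    have "(l2norm M v)\<^sup>2 = (\<integral>x. (v x)\<^sup>2 \<partial>M)" by (simp add: l2norm_squared)
    also have "\<dots> \<le> (\<integral>x. 1 + \<bar>v x\<bar> powr p \<partial>M)"
    proof (rule integral_mono)
      show "integrable M (\<lambda>x. (v x)\<^sup>2)" using H1D(1)[OF H10_imp_H1[OF v]] by (simp add: square_integrable_def)
      show "integrable M (\<lambda>x. 1 + \<bar>v x\<bar> powr p)" using H10_integrable_powr[OF v] by auto
      fix x
      show "(v x)\<^sup>2 \<le> 1 + \<bar>v x\<bar> powr p"
      proof (cases "\<bar>v x\<bar> \<le> 1")
        case True
        then have "(v x)\<^sup>2 \<le> 1" by (simp add: abs_square_le_1)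
        then show ?thesis by (simp add: add_increasing2)
      next
        case False
        then have "\<bar>v x\<bar> powr 2 \<le> \<bar>v x\<bar> powr p" using p_gt_2 by (intro powr_mono) auto
        then show ?thesis using False by (simp add: powr_numeral)
      qed
    qed
    also have "\<dots> = m + (\<integral>x. \<bar>v x\<bar> powr p \<partial>M)"
      using H10_integrable_powr[OF v] by (simp add: m_def)
    also have "\<dots> \<le> m + K" using H10_Sobolev_const[OF v] by (simp add: hv K_def)
    finally have "l2norm M v \<le> sqrt (m + K)" by (rule real_le_rsqrt)
    moreover have "l2norm M v = l2norm M u / hnorm u"
      unfolding v_def using l2norm_scaleR[of M "1 / hnorm u" u] h by simp
    ultimately have "l2norm M u \<le> sqrt (m + K) * hnorm u" using h by (simp add: field_simps)
    also have "\<dots> \<le> C * hnorm u" using h by (intro mult_right_mono) (auto simp: C_def)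
    finally show ?thesis .
  qed
  moreover have "C > 0" using mK by (simp add: C_def add_nonneg_pos)
  ultimately show ?thesis using that by blast
qed

subsection \<open>Compactness\<close>


lemma test_functions_diff:
  assumes "\<phi> \<in> test_functions \<Omega>" "\<psi> \<in> test_functions \<Omega>"
  shows "(\<lambda>x. \<phi> x - \<psi> x) \<in> test_functions \<Omega>"
  using test_functions_add[OF assms(1) test_functions_cmult[OF assms(2), of "- 1"]] by simp

lemma test_functions_cell_estimate:
  assumes \<phi>: "\<phi> \<in> test_functions \<Omega>" and \<epsilon>: "\<epsilon> > 0"
  shows "(l2norm M \<phi>)\<^sup>2 \<le> 2 ^ DIM('a) * real DIM('a) * \<epsilon>\<^sup>2 * (hnorm \<phi>)\<^sup>2
     + (\<Sum>k\<in>cell \<epsilon> ` \<Omega>. (\<integral>x. indicator {y. cell \<epsilon> y = k} x * \<phi> x \<partial>lborel)\<^sup>2) / \<epsilon> ^ DIM('a)"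
  unfolding test_function_l2(3)[OF \<phi>] hnorm_test[OF \<phi>] test_function_l2(4)[OF \<phi>]
  by (rule C1_compact_cell_estimate[OF test_functions_C1_compact[OF \<phi>] \<epsilon> finite_cells[OF bounded_domain \<epsilon>]])
    (use test_function_support(1)[OF \<phi>] in auto)

lemma test_functions_cell_integral_bound:
  assumes \<phi>: "\<phi> \<in> test_functions \<Omega>"
  shows "\<bar>\<integral>x. indicator {y. cell \<epsilon> y = k} x * \<phi> x \<partial>lborel\<bar> \<le> sqrt (measure M (space M)) * l2norm M \<phi>"
proof -
  have b: "(\<lambda>x. \<bar>\<phi> x\<bar>) \<in> borel_measurable borel"
    using test_function_borel(1)[OF \<phi>] by measurable
  have "\<bar>\<integral>x. indicator {y. cell \<epsilon> y = k} x * \<phi> x \<partial>lborel\<bar> \<le> (\<integral>x. \<bar>indicator {y. cell \<epsilon> y = k} x * \<phi> x\<bar> \<partial>lborel)"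
    using integral_norm_bound[of lborel "\<lambda>x. indicator {y. cell \<epsilon> y = k} x * \<phi> x"] by simp
  also have "\<dots> \<le> (\<integral>x. \<bar>\<phi> x\<bar> \<partial>lborel)"
    by (rule integral_mono_AE')
      (use C1_compact_integrable(3)[OF test_functions_C1_compact[OF \<phi>]] in \<open>auto simp: indicator_def\<close>)
  also have "\<dots> = (\<integral>x. \<bar>\<phi> x\<bar> \<partial>M)"
    by (rule integral_M_eq_lborel(1)[OF b, symmetric]) (use test_function_support[OF \<phi>] in auto)
  also have "\<dots> \<le> sqrt (measure M (space M)) * l2norm M \<phi>"
    using M.square_integrable_imp_integrable(2)[OF test_function_l2(1)[OF \<phi>]] by simp
  finally show ?thesis .
qed

text \<open>Over all scales \<open>1 / (m + 1)\<close> there are countably many cell integrals, and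
  a diagonal subsequence makes each of them converge. The cell estimate then yields a Cauchy
  sequence in L2: a fine scale makes the gradient term small, after which only finitely many cell
  integrals remain.\<close>

lemma Rellich_test_functions:
  assumes \<phi>: "\<And>n. \<phi> n \<in> test_functions \<Omega>" and B: "\<And>n. hnorm (\<phi> n) \<le> B"
  obtains r :: "nat \<Rightarrow> nat" and v where "strict_mono r" "square_integrable M v"
    "(\<lambda>n. l2norm M (\<lambda>x. \<phi> (r n) x - v x)) \<longlonglongrightarrow> 0"
proof -
  obtain CP where CP: "CP > 0" "\<forall>u\<in>H10 \<Omega>. l2norm M u \<le> CP * hnorm u"
    by (rule H10_Poincare)
  define \<epsilon> where "\<epsilon> m = inverse (real (Suc m))" for m
  have \<epsilon>: "\<epsilon> m > 0" for m by (simp add: \<epsilon>_def)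
  define K where "K m = cell (\<epsilon> m) ` \<Omega>" for m
  have K: "finite (K m)" for m unfolding K_def by (rule finite_cells[OF bounded_domain \<epsilon>])
  define y where "y m k n = (\<integral>x. indicator {z. cell (\<epsilon> m) z = k} x * \<phi> n x \<partial>lborel)" for m k n
  \<comment> \<open>Pairs of a scale and one of its cells, enumerated for the diagonal
    argument.\<close>
  define I where "I = Sigma UNIV K"
  have "countable I" unfolding I_def using K by (intro countable_SIGMA) (auto intro: countable_finite)
  have I_ne: "I \<noteq> {}" unfolding I_def K_def using nonempty by auto
  define e where "e = from_nat_into I"
  have e_surj: "\<exists>j. e j = i" if "i \<in> I" for i
    unfolding e_def using from_nat_into_surj[OF \<open>countable I\<close> that] .
  have y_bound: "\<bar>y m k n\<bar> \<le> sqrt (measure M (space M)) * (CP * B)" for m k n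
  proof -
    have "\<bar>y m k n\<bar> \<le> sqrt (measure M (space M)) * l2norm M (\<phi> n)"
      unfolding y_def by (rule test_functions_cell_integral_bound[OF \<phi>])
    also have "l2norm M (\<phi> n) \<le> CP * hnorm (\<phi> n)" using CP(2) H10_test[OF \<phi>] by blast
    also have "CP * hnorm (\<phi> n) \<le> CP * B" using B CP(1) by simp
    finally show ?thesis by (simp add: mult_left_mono)
  qed
  obtain r :: "nat \<Rightarrow> nat" where r: "strict_mono r" "\<And>j. convergent (\<lambda>n. y (fst (e j)) (snd (e j)) (r n))"
    using diagonal_subsequence[of "\<lambda>j n. y (fst (e j)) (snd (e j)) n"] y_bound by metis
  have conv: "Cauchy (\<lambda>n. y m k (r n))" if "k \<in> K m" for m k
  proof -
    have "(m, k) \<in> I" using that by (simp add: I_def)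
    then obtain j where "e j = (m, k)" using e_surj by blast
    then show ?thesis using r(2)[of j] by (simp add: convergent_Cauchy)
  qed
  have Cauchy: "\<exists>N. \<forall>i\<ge>N. \<forall>j\<ge>N. l2norm M (\<lambda>x. \<phi> (r i) x - \<phi> (r j) x) < d" if d: "d > 0" for d
  proof -
    \<comment> \<open>\<open>2 * B\<close> bounds the Dirichlet norm of the difference of two
      members of the sequence.\<close>
    define c where "c = 2 ^ DIM('a) * real DIM('a) * (2 * B)\<^sup>2"
    have c: "c \<ge> 0" by (simp add: c_def)
    obtain m where m: "c * (\<epsilon> m)\<^sup>2 < d\<^sup>2 / 2"
    proof -
      have "(\<lambda>m. c * (\<epsilon> m)\<^sup>2) \<longlonglongrightarrow> c * 0\<^sup>2"
        unfolding \<epsilon>_def by (intro tendsto_intros LIMSEQ_inverse_real_of_nat)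
      then have "\<forall>\<^sub>F m in sequentially. c * (\<epsilon> m)\<^sup>2 < d\<^sup>2 / 2"
        using d by (intro order_tendstoD) auto
      then show ?thesis using that by (auto simp: eventually_sequentially)
    qed
    define E where "E = \<epsilon> m ^ DIM('a)"
    have E: "E > 0" using \<epsilon> by (simp add: E_def)
    \<comment> \<open>Tolerance for each of the \<open>card (K m)\<close> squared differences, so
      that their sum divided by \<open>E\<close> is at most \<open>d\<^sup>2 / 2\<close>; the
      summand 1 keeps the denominator positive.\<close>
    define \<eta> where "\<eta> = d\<^sup>2 / 2 * E / (real (card (K m)) + 1)"
    have \<eta>: "\<eta> > 0" using d E by (simp add: \<eta>_def add_nonneg_pos)
    have "\<forall>k\<in>K m. \<exists>N. \<forall>i\<ge>N. \<forall>j\<ge>N. \<bar>y m k (r i) - y m k (r j)\<bar> < sqrt \<eta>"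
      using conv \<eta> unfolding Cauchy_def dist_real_def by (meson real_sqrt_gt_zero)
    then obtain N where N: "\<And>k i j. k \<in> K m \<Longrightarrow> i \<ge> N k \<Longrightarrow> j \<ge> N k \<Longrightarrow> \<bar>y m k (r i) - y m k (r j)\<bar> < sqrt \<eta>"
      by metis
    define N0 where "N0 = (\<Sum>k\<in>K m. N k)"
    have N0: "N k \<le> N0" if "k \<in> K m" for k
      unfolding N0_def using K that by (intro member_le_sum) auto
    show ?thesis
    proof (intro exI[of _ N0] allI impI)
      fix i j assume ij: "i \<ge> N0" "j \<ge> N0"
      define \<psi> where "\<psi> = (\<lambda>x. \<phi> (r i) x - \<phi> (r j) x)"
      have \<psi>: "\<psi> \<in> test_functions \<Omega>" unfolding \<psi>_def by (rule test_functions_diff[OF \<phi> \<phi>])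
      have "hnorm \<psi> \<le> hnorm (\<phi> (r i)) + hnorm (\<phi> (r j))"
        using hnorm_triangle[OF H1_test(1)[OF \<phi>[of "r i"]] H1_cmult(1)[OF H1_test(1)[OF \<phi>[of "r j"]], of "- 1"]]
          hnorm_cmult[OF H1_test(1)[OF \<phi>[of "r j"]], of "- 1"] by (simp add: \<psi>_def)
      also have "\<dots> \<le> 2 * B" using B[of "r i"] B[of "r j"] by simp
      finally have "(hnorm \<psi>)\<^sup>2 \<le> (2 * B)\<^sup>2" by (rule power_mono) simp
      then have 1: "2 ^ DIM('a) * real DIM('a) * (\<epsilon> m)\<^sup>2 * (hnorm \<psi>)\<^sup>2 \<le> 2 ^ DIM('a) * real DIM('a) * (\<epsilon> m)\<^sup>2 * (2 * B)\<^sup>2"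
        by (rule mult_left_mono) simp
      have cellint: "(\<integral>x. indicator {z. cell (\<epsilon> m) z = k} x * \<psi> x \<partial>lborel) = y m k (r i) - y m k (r j)" for k
      proof -
        have "integrable lborel (\<lambda>x. indicator {z. cell (\<epsilon> m) z = k} x * \<phi> n x)" for n
          using integrable_mult_indicator[OF _ C1_compact_integrable(1)[OF test_functions_C1_compact[OF \<phi>[of n]]], of "{z. cell (\<epsilon> m) z = k}"]
          by simp
        then show ?thesis by (simp add: y_def \<psi>_def right_diff_distrib)
      qed
      have "(\<Sum>k\<in>K m. (y m k (r i) - y m k (r j))\<^sup>2) \<le> (\<Sum>k\<in>K m. \<eta>)"
      proof (rule sum_mono)
        fix k assume k: "k \<in> K m"
        have "\<bar>y m k (r i) - y m k (r j)\<bar>\<^sup>2 \<le> (sqrt \<eta>)\<^sup>2"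
          using N[OF k, of i j] N0[OF k] ij by (intro power_mono) auto
        then show "(y m k (r i) - y m k (r j))\<^sup>2 \<le> \<eta>" using \<eta> by simp
      qed
      also have "\<dots> \<le> (real (card (K m)) + 1) * \<eta>" using \<eta> by simp
      also have "\<dots> = d\<^sup>2 / 2 * E"
      proof -
        have "real (card (K m)) + 1 \<noteq> 0" by linarith
        then show ?thesis unfolding \<eta>_def times_divide_eq_right by (rule nonzero_mult_div_cancel_left)
      qed
      finally have "(\<Sum>k\<in>K m. (y m k (r i) - y m k (r j))\<^sup>2) / E \<le> d\<^sup>2 / 2" using E by (simp add: pos_divide_le_eq)
      moreover have "2 ^ DIM('a) * real DIM('a) * (\<epsilon> m)\<^sup>2 * (2 * B)\<^sup>2 = c * (\<epsilon> m)\<^sup>2" by (simp add: c_def mult_ac)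
      ultimately have "(l2norm M \<psi>)\<^sup>2 < d\<^sup>2"
        using test_functions_cell_estimate[OF \<psi> \<epsilon>[of m]] 1 m unfolding cellint K_def[symmetric] E_def[symmetric] by linarith
      then show "l2norm M (\<lambda>x. \<phi> (r i) x - \<phi> (r j) x) < d"
        unfolding \<psi>_def by (rule power2_less_imp_less) (use d in simp)
    qed
  qed
  obtain v where "square_integrable M v" "(\<lambda>n. l2norm M (\<lambda>x. \<phi> (r n) x - v x)) \<longlonglongrightarrow> 0"
    by (rule M.l2_complete[where f = "\<lambda>n. \<phi> (r n)", OF test_function_l2(1)[OF \<phi>] Cauchy])
  with r(1) show ?thesis by (rule that)
qed

text \<open>The cell estimate is available for C1 functions, so each \<open>u n\<close> is first
  exchanged for a test function at distance below \<open>1 / (n + 1)\<close>.\<close>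

lemma Rellich:
  assumes u: "\<And>n. u n \<in> H10 \<Omega>" and B: "\<And>n. hnorm (u n) \<le> B"
  obtains r :: "nat \<Rightarrow> nat" and v where "strict_mono r" "square_integrable M v"
    "(\<lambda>n. l2norm M (\<lambda>x. u (r n) x - v x)) \<longlonglongrightarrow> 0"
proof -
  have "\<exists>\<phi>\<in>test_functions \<Omega>. l2norm M (\<lambda>x. u n x - \<phi> x) < inverse (real (Suc n)) \<and> hnorm (\<lambda>x. u n x - \<phi> x) < inverse (real (Suc n))" for n
    using u[of n] unfolding H10_iff by simp
  then obtain \<phi> where \<phi>: "\<And>n. \<phi> n \<in> test_functions \<Omega>" "\<And>n. l2norm M (\<lambda>x. u n x - \<phi> n x) < inverse (real (Suc n))"
    "\<And>n. hnorm (\<lambda>x. u n x - \<phi> n x) < inverse (real (Suc n))"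
    by metis
  have \<phi>B: "hnorm (\<phi> n) \<le> B + 1" for n
  proof -
    have "inverse (real (Suc n)) \<le> 1" by (simp add: field_simps)
    then show ?thesis
      using hnorm_le_diff[OF H10_imp_H1[OF u[of n]] H1_test(1)[OF \<phi>(1)[of n]]] \<phi>(3)[of n] B[of n] by linarith
  qed
  obtain r v where r: "strict_mono r" "square_integrable M v" "(\<lambda>n. l2norm M (\<lambda>x. \<phi> (r n) x - v x)) \<longlonglongrightarrow> 0"
    by (rule Rellich_test_functions[OF \<phi>(1) \<phi>B])
  have "(\<lambda>n. l2norm M (\<lambda>x. u (r n) x - v x)) \<longlonglongrightarrow> 0"
  proof (rule Lim_null_comparison)
    show "\<forall>\<^sub>F n in sequentially. norm (l2norm M (\<lambda>x. u (r n) x - v x)) \<le> inverse (real (Suc (r n))) + l2norm M (\<lambda>x. \<phi> (r n) x - v x)"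
    proof (rule always_eventually, rule allI)
      fix n
      show "norm (l2norm M (\<lambda>x. u (r n) x - v x)) \<le> inverse (real (Suc (r n))) + l2norm M (\<lambda>x. \<phi> (r n) x - v x)"
        using l2norm_triangle_diff[OF H1D(1)[OF H10_imp_H1[OF u[of "r n"]]] test_function_l2(1)[OF \<phi>(1)[of "r n"]] r(2)] \<phi>(2)[of "r n"]
        by simp
    qed
    have "(\<lambda>n. inverse (real (Suc (r n)))) \<longlonglongrightarrow> 0"
      using LIMSEQ_subseq_LIMSEQ[OF LIMSEQ_inverse_real_of_nat r(1)] by (simp add: o_def)
    from tendsto_add[OF this r(3)]
    show "(\<lambda>n. inverse (real (Suc (r n))) + l2norm M (\<lambda>x. \<phi> (r n) x - v x)) \<longlonglongrightarrow> 0" by simp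
  qed
  with r(1,2) show ?thesis by (rule that)
qed

text \<open>Near-minimisers of the Dirichlet integral over the shrinking convex sets
  \<open>{w. \<parallel>w - v\<parallel>\<^sub>2 \<le> 1 / (n + 1)}\<close> form a Cauchy sequence by the parallelogram law; this replaces
  weak compactness.\<close>

lemma l2_limit_in_H10:
  assumes u: "\<And>n. u n \<in> H10 \<Omega>" and B: "\<And>n. hnorm (u n) \<le> B"
    and v: "square_integrable M v" and lim: "(\<lambda>n. l2norm M (\<lambda>x. u n x - v x)) \<longlonglongrightarrow> 0"
  shows "v \<in> H10 \<Omega>"
proof -
  define \<epsilon> where "\<epsilon> n = inverse (real (Suc n))" for n
  have \<epsilon>: "\<epsilon> n > 0" for n by (simp add: \<epsilon>_def)
  have \<epsilon>_lim: "\<epsilon> \<longlonglongrightarrow> 0" unfolding \<epsilon>_def by (rule LIMSEQ_inverse_real_of_nat)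
  have \<epsilon>_mono: "\<epsilon> m \<le> \<epsilon> n" if "n \<le> m" for m n using that by (simp add: \<epsilon>_def field_simps)
  define C where "C n = {w \<in> H10 \<Omega>. l2norm M (\<lambda>x. w x - v x) \<le> \<epsilon> n}" for n
  \<comment> \<open>Infima over shrinking sets: \<open>d\<close> increases and stays below
    \<open>B\<^sup>2\<close>, hence converges, and its increments become small.\<close>
  define d where "d n = Inf ((\<lambda>w. (hnorm w)\<^sup>2) ` C n)" for n
  have bdd: "bdd_below ((\<lambda>w. (hnorm w)\<^sup>2) ` C n)" for n by (rule bdd_belowI[of _ 0]) auto
  have inC: "\<exists>k. u k \<in> C n" for n
  proof -
    have "\<forall>\<^sub>F k in sequentially. l2norm M (\<lambda>x. u k x - v x) < \<epsilon> n"
      using lim \<epsilon> by (rule order_tendstoD)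
    then show ?thesis using u by (auto simp: eventually_sequentially C_def intro: less_imp_le)
  qed
  have ne: "C n \<noteq> {}" for n using inC[of n] by blast
  have d_le: "d n \<le> (hnorm w)\<^sup>2" if "w \<in> C n" for n w
    unfolding d_def using that bdd by (intro cInf_lower) auto
  have dB: "d n \<le> B\<^sup>2" for n
  proof -
    obtain k where "u k \<in> C n" using inC by blast
    then have "d n \<le> (hnorm (u k))\<^sup>2" by (rule d_le)
    also have "\<dots> \<le> B\<^sup>2" using B by (intro power_mono) auto
    finally show ?thesis .
  qed
  have C_mono: "C m \<subseteq> C n" if "n \<le> m" for m n using \<epsilon>_mono[OF that] by (auto simp: C_def)
  have "incseq d"
    unfolding incseq_def d_def using C_mono ne bdd by (auto intro!: cInf_superset_mono)
  then obtain dl where dl: "d \<longlonglongrightarrow> dl" using incseq_convergent[of d "B\<^sup>2"] dB by blast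
  have "\<exists>w\<in>C n. (hnorm w)\<^sup>2 < d n + \<epsilon> n" for n
    using cInf_lessD[of "(\<lambda>w. (hnorm w)\<^sup>2) ` C n" "d n + \<epsilon> n"] ne \<epsilon>[of n] by (auto simp: d_def)
  then obtain w where w: "\<And>n. w n \<in> C n" "\<And>n. (hnorm (w n))\<^sup>2 < d n + \<epsilon> n" by metis
  have wH: "w n \<in> H10 \<Omega>" for n using w(1)[of n] by (simp add: C_def)
  have wl: "l2norm M (\<lambda>x. w n x - v x) \<le> \<epsilon> n" for n using w(1)[of n] by (simp add: C_def)
  note w1 = H10_imp_H1[OF wH]
  \<comment> \<open>The midpoint of \<open>w n\<close> and \<open>w m\<close> stays in the convex
    set \<open>C n\<close>, so its energy is at least \<open>d n\<close>; the parallelogram law then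
    bounds the distance by the increment of \<open>d\<close>.\<close>
  have par: "(l2norm M (\<lambda>x. wgrad (w n) x - wgrad (w m) x))\<^sup>2 \<le> 2 * d m - 2 * d n + 4 * \<epsilon> n" if nm: "n \<le> m" for n m
  proof -
    define z where "z x = (1/2) * (w n x + w m x)" for x
    have z: "z \<in> H10 \<Omega>" unfolding z_def by (intro H10_cmult H10_add wH)
    have "z \<in> C n"
    proof -
      have eq: "(\<lambda>x. z x - v x) = (\<lambda>x. (1/2) *\<^sub>R ((w n x - v x) + (w m x - v x)))"
        by (auto simp: z_def field_simps)
      have "l2norm M (\<lambda>x. (w n x - v x) + (w m x - v x)) \<le> \<epsilon> n + \<epsilon> n"
        using l2norm_triangle[OF square_integrable_diff[OF H1D(1)[OF w1] v] square_integrable_diff[OF H1D(1)[OF w1] v], of n m]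
          wl[of n] wl[of m] \<epsilon>_mono[OF nm] by linarith
      then have "l2norm M (\<lambda>x. z x - v x) \<le> \<epsilon> n" unfolding eq l2norm_scaleR by simp
      with z show ?thesis by (simp add: C_def)
    qed
    then have "d n \<le> (hnorm z)\<^sup>2" by (rule d_le)
    also have "hnorm z = (1/2) * hnorm (\<lambda>x. w n x + w m x)"
      unfolding z_def using hnorm_cmult[OF H1_add(1)[OF w1 w1], of "1/2"] by simp
    finally have mid: "4 * d n \<le> (hnorm (\<lambda>x. w n x + w m x))\<^sup>2" by (simp add: power_mult_distrib power_divide)
    have "(l2norm M (\<lambda>x. wgrad (w n) x - wgrad (w m) x))\<^sup>2 = 2 * (hnorm (w n))\<^sup>2 + 2 * (hnorm (w m))\<^sup>2 - (hnorm (\<lambda>x. w n x + w m x))\<^sup>2"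
      using l2norm_parallelogram[OF H1D(2)[OF w1] H1D(2)[OF w1], of n m] by (simp add: hnorm_add_eq[OF w1 w1] hnorm_eq)
    then show ?thesis using mid w(2)[of n] w(2)[of m] \<epsilon>_mono[OF nm] by linarith
  qed
  have Cauchy: "\<exists>N. \<forall>m\<ge>N. \<forall>n\<ge>N. l2norm M (\<lambda>x. wgrad (w m) x - wgrad (w n) x) < e" if e: "e > 0" for e
  proof -
    have "(\<lambda>n. 2 * dl - 2 * d n + 4 * \<epsilon> n) \<longlonglongrightarrow> 2 * dl - 2 * dl + 4 * 0"
      by (intro tendsto_intros dl \<epsilon>_lim)
    then have "\<forall>\<^sub>F n in sequentially. 2 * dl - 2 * d n + 4 * \<epsilon> n < e\<^sup>2"
      using e by (intro order_tendstoD) auto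
    then obtain N where N: "\<And>n. n \<ge> N \<Longrightarrow> 2 * dl - 2 * d n + 4 * \<epsilon> n < e\<^sup>2"
      by (auto simp: eventually_sequentially)
    have *: "l2norm M (\<lambda>x. wgrad (w n) x - wgrad (w m) x) < e" if "N \<le> n" "n \<le> m" for n m
    proof -
      have "d m \<le> dl" using \<open>incseq d\<close> dl by (rule incseq_le)
      then have "(l2norm M (\<lambda>x. wgrad (w n) x - wgrad (w m) x))\<^sup>2 < e\<^sup>2"
        using par[OF that(2)] N[OF that(1)] by linarith
      then show ?thesis by (rule power2_less_imp_less) (use e in simp)
    qed
    show ?thesis
    proof (intro exI[of _ N] allI impI)
      fix m n assume "m \<ge> N" "n \<ge> N"
      then show "l2norm M (\<lambda>x. wgrad (w m) x - wgrad (w n) x) < e"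
        using *[of n m] *[of m n] l2norm_minus_commute[of M "wgrad (w m)" "wgrad (w n)"]
        by (cases "n \<le> m") auto
    qed
  qed
  obtain G where G: "square_integrable M G" "(\<lambda>n. l2norm M (\<lambda>x. wgrad (w n) x - G x)) \<longlonglongrightarrow> 0"
    by (rule M.l2_complete[where f = "\<lambda>n. wgrad (w n)", OF H1D(2)[OF w1] Cauchy])
  have wv: "(\<lambda>n. l2norm M (\<lambda>x. w n x - v x)) \<longlonglongrightarrow> 0"
    by (rule Lim_null_comparison[OF always_eventually \<epsilon>_lim]) (use wl in auto)
  have hw: "has_weak_gradient \<Omega> v G"
    by (rule has_weak_gradient_limit[OF w1 v G(1) wv G(2)])
  have vH1: "v \<in> H1 \<Omega>" and vG: "AE x in M. wgrad v x = G x" using H1I[OF v G(1) hw] by auto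
  have "hnorm (\<lambda>x. v x - w n x) = l2norm M (\<lambda>x. wgrad (w n) x - G x)" for n
  proof -
    have "hnorm (\<lambda>x. v x - w n x) = l2norm M (\<lambda>x. wgrad (w n) x - wgrad v x)"
      unfolding hnorm_diff_eq[OF vH1 w1] by (rule l2norm_minus_commute)
    also have "\<dots> = l2norm M (\<lambda>x. wgrad (w n) x - G x)"
      by (rule l2norm_cong_AE) (use vG H1_measurable[OF w1[of n]] H1_measurable[OF vH1] square_integrableD[OF G(1)] in auto)
    finally show ?thesis .
  qed
  then have hl: "(\<lambda>n. hnorm (\<lambda>x. v x - w n x)) \<longlonglongrightarrow> 0" using G(2) by simp
  have ll: "(\<lambda>n. l2norm M (\<lambda>x. v x - w n x)) \<longlonglongrightarrow> 0" using wv by (simp add: l2norm_minus_commute[of M v])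
  show ?thesis
  proof (rule H10_closed[OF vH1])
    fix e :: real assume "e > 0"
    then have "\<forall>\<^sub>F n in sequentially. l2norm M (\<lambda>x. v x - w n x) < e \<and> hnorm (\<lambda>x. v x - w n x) < e"
      using order_tendstoD(2)[OF ll] order_tendstoD(2)[OF hl] by (intro eventually_conj) auto
    then show "\<exists>w\<in>H10 \<Omega>. l2norm M (\<lambda>x. v x - w x) < e \<and> hnorm (\<lambda>x. v x - w x) < e"
      using wH by (auto simp: eventually_sequentially)
  qed
qed

text \<open>Integration by parts moves both derivatives onto the test function:
  \<open>\<theta>\<close> is its Laplacian. Thus L2 convergence alone controls the Dirichlet product
  with a test function.\<close>

lemma hinner_test:
  assumes \<psi>: "\<psi> \<in> test_functions \<Omega>"
  obtains \<theta> where "square_integrable M \<theta>" "\<forall>u\<in>H1 \<Omega>. hinner u \<psi> = - l2inner M u \<theta>"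
proof -
  define D where "D i x = frechet_derivative \<psi> (at x) i" for i x
  define D2 where "D2 i x = frechet_derivative (D i) (at x) i" for i x
  have D: "D i \<in> test_functions \<Omega>" if "i \<in> Basis" for i
    unfolding D_def using test_functions_deriv[OF \<psi> that] .
  have D2: "D2 i \<in> test_functions \<Omega>" if "i \<in> Basis" for i
    unfolding D2_def using test_functions_deriv[OF D[OF that] that] .
  have s: "square_integrable M (\<lambda>x. \<Sum>i\<in>J. D2 i x)" if "J \<subseteq> Basis" for J
    using finite_subset[OF that finite_Basis] that
  proof (induction J rule: finite_induct)
    case empty
    show ?case by (simp add: square_integrable_def)
  next
    case (insert j J)
    then show ?case using test_function_l2(1)[OF D2] by (auto intro!: square_integrable_add)
  qed
  have "hinner u \<psi> = - l2inner M u (\<lambda>x. \<Sum>i\<in>Basis. D2 i x)" if u: "u \<in> H1 \<Omega>" for u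
  proof -
    have l: "locally_integrable \<Omega> u" "locally_integrable \<Omega> (wgrad u)"
      using H1D(3)[OF u] by (auto simp: has_weak_gradient_def)
    have "hinner u \<psi> = l2inner M (wgrad u) (grad \<psi>)"
      unfolding hinner_def
      by (rule l2inner_cong_AE)
        (use H1_measurable[OF u] H1_measurable[OF H1_test(1)[OF \<psi>]] H1_test(2)[OF \<psi>] test_function_l2(2)[OF \<psi>] in \<open>auto simp: square_integrable_def\<close>)
    also have "\<dots> = (\<integral>x. (\<Sum>i\<in>Basis. (wgrad u x \<bullet> i) * D i x) \<partial>M)"
      unfolding l2inner_def
    proof (rule Bochner_Integration.integral_cong[OF refl])
      fix x
      have "wgrad u x \<bullet> grad \<psi> x = (\<Sum>i\<in>Basis. (wgrad u x \<bullet> i) * (grad \<psi> x \<bullet> i))" by (rule euclidean_inner)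
      also have "\<dots> = (\<Sum>i\<in>Basis. (wgrad u x \<bullet> i) * D i x)" by (intro sum.cong) (auto simp: grad_inner_Basis D_def)
      finally show "wgrad u x \<bullet> grad \<psi> x = (\<Sum>i\<in>Basis. (wgrad u x \<bullet> i) * D i x)" .
    qed
    also have "\<dots> = (\<Sum>i\<in>Basis. \<integral>x. (wgrad u x \<bullet> i) * D i x \<partial>M)"
      by (rule Bochner_Integration.integral_sum) (rule integrable_inner_mult_test[OF l(2) D])
    also have "\<dots> = (\<Sum>i\<in>Basis. - (\<integral>x. u x * D2 i x \<partial>M))"
    proof (rule sum.cong[OF refl])
      fix i :: 'a assume i: "i \<in> Basis"
      have "(\<integral>x. u x * D2 i x \<partial>M) = - (\<integral>x. (wgrad u x \<bullet> i) * D i x \<partial>M)"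
        unfolding D2_def using H1D(3)[OF u] D[OF i] i unfolding has_weak_gradient_def by blast
      then show "(\<integral>x. (wgrad u x \<bullet> i) * D i x \<partial>M) = - (\<integral>x. u x * D2 i x \<partial>M)" by simp
    qed
    also have "\<dots> = - (\<integral>x. (\<Sum>i\<in>Basis. u x * D2 i x) \<partial>M)"
      by (subst Bochner_Integration.integral_sum) (auto simp: sum_negf intro: integrable_mult_test[OF l(1) D2])
    also have "\<dots> = - l2inner M u (\<lambda>x. \<Sum>i\<in>Basis. D2 i x)"
      by (simp add: l2inner_def sum_distrib_left)
    finally show ?thesis .
  qed
  then show ?thesis using that s[of Basis] by blast
qed

text \<open>Against test functions L2 convergence suffices; a general w is replaced by a test
  function, and the bound on the Dirichlet norms controls the error.\<close>

lemma weak_convergence: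
  assumes u: "\<And>n. u n \<in> H10 \<Omega>" and B: "\<And>n. hnorm (u n) \<le> B"
    and v: "v \<in> H10 \<Omega>" and lim: "(\<lambda>n. l2norm M (\<lambda>x. u n x - v x)) \<longlonglongrightarrow> 0"
    and w: "w \<in> H10 \<Omega>"
  shows "(\<lambda>n. hinner (\<lambda>x. u n x - v x) w) \<longlonglongrightarrow> 0"
proof (rule LIMSEQ_I)
  fix e :: real assume e: "e > 0"
  define z where "z = (\<lambda>n x. u n x - v x)"
  have z: "z n \<in> H1 \<Omega>" for n unfolding z_def using u v by (intro H1_diff H10_imp_H1)
  define Bz where "Bz = \<bar>B\<bar> + hnorm v + 1"
  have Bz: "Bz > 0" by (simp add: Bz_def add_nonneg_pos)
  have zB: "hnorm (z n) \<le> Bz" for n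
  proof -
    have "hnorm (z n) \<le> hnorm (u n) + hnorm v"
      using hnorm_triangle[OF H10_imp_H1[OF u[of n]] H1_cmult(1)[OF H10_imp_H1[OF v], of "- 1"]]
        hnorm_cmult[OF H10_imp_H1[OF v], of "- 1"] by (simp add: z_def)
    then show ?thesis using B[of n] by (simp add: Bz_def)
  qed
  have "e / (2 * Bz) > 0" using e Bz by simp
  then obtain \<psi> where \<psi>: "\<psi> \<in> test_functions \<Omega>" "hnorm (\<lambda>x. w x - \<psi> x) < e / (2 * Bz)"
    using w unfolding H10_iff by blast
  obtain \<theta> where \<theta>: "square_integrable M \<theta>" "\<forall>u\<in>H1 \<Omega>. hinner u \<psi> = - l2inner M u \<theta>"
    by (rule hinner_test[OF \<psi>(1)])
  have "(\<lambda>n. l2norm M (z n) * l2norm M \<theta>) \<longlonglongrightarrow> 0 * l2norm M \<theta>"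
    unfolding z_def by (intro tendsto_intros lim)
  then have "\<forall>\<^sub>F n in sequentially. l2norm M (z n) * l2norm M \<theta> < e / 2"
    using e by (intro order_tendstoD) auto
  then obtain N where N: "\<And>n. n \<ge> N \<Longrightarrow> l2norm M (z n) * l2norm M \<theta> < e / 2"
    by (auto simp: eventually_sequentially)
  show "\<exists>no. \<forall>n\<ge>no. norm (hinner (\<lambda>x. u n x - v x) w - 0) < e"
  proof (intro exI[of _ N] allI impI)
    fix n assume n: "n \<ge> N"
    note w1 = H10_imp_H1[OF w] and p1 = H1_test(1)[OF \<psi>(1)]
    have "hinner (z n) w = hinner (z n) (\<lambda>x. w x - \<psi> x) + hinner (z n) \<psi>"
      using hinner_diff_right[OF w1 p1 z] by simp
    moreover have "\<bar>hinner (z n) \<psi>\<bar> < e / 2"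
      using l2_Cauchy_Schwarz[OF H1D(1)[OF z] \<theta>(1), of n] \<theta>(2) z N[OF n] by (auto intro: le_less_trans)
    moreover have "\<bar>hinner (z n) (\<lambda>x. w x - \<psi> x)\<bar> \<le> e / 2"
    proof -
      have "\<bar>hinner (z n) (\<lambda>x. w x - \<psi> x)\<bar> \<le> hnorm (z n) * hnorm (\<lambda>x. w x - \<psi> x)"
        by (rule hinner_Cauchy_Schwarz[OF z H1_diff(1)[OF w1 p1]])
      also have "\<dots> \<le> Bz * (e / (2 * Bz))"
        using zB[of n] \<psi>(2) Bz by (intro mult_mono) auto
      also have "\<dots> = e / 2" using Bz by simp
      finally show ?thesis .
    qed
    ultimately have "\<bar>hinner (z n) w\<bar> < e" by linarith
    then show "norm (hinner (\<lambda>x. u n x - v x) w - 0) < e" by (simp add: z_def)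
  qed
qed

end

subsection \<open>The critical nonlinearity\<close>

text \<open>The odd power, which is the derivative of
  \<open>\<bar>s\<bar> powr (r + 1) / (r + 1)\<close>. It occurs with \<open>r = p - 1\<close> in
  the critical term and with \<open>r = \<gamma> - 1\<close> in the nonlocal term.\<close>

definition spowr :: "real \<Rightarrow> real \<Rightarrow> real" where
  "spowr r s = sgn s * \<bar>s\<bar> powr r"

lemma abs_spowr: "\<bar>spowr r s\<bar> = \<bar>s\<bar> powr r"
  by (cases "s = 0") (auto simp: spowr_def abs_mult)

lemma spowr_nonneg: "s \<ge> 0 \<Longrightarrow> spowr r s = s powr r"
  by (cases "s = 0") (auto simp: spowr_def)

lemma tendsto_abs_powr_0:
  assumes "r > 0"
  shows "((\<lambda>h::real. \<bar>h\<bar> powr r) \<longlongrightarrow> 0) (at 0)"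
proof -
  have "((\<lambda>h::real. \<bar>h\<bar> powr r) \<longlongrightarrow> \<bar>0\<bar> powr r) (at 0)"
    using assms by (intro tendsto_powr' tendsto_intros) auto
  then show ?thesis using assms by simp
qed

text \<open>At 0 the difference quotient is \<open>\<bar>h\<bar> powr (r - 1)\<close>, which tends
  to 0 because \<open>r > 1\<close>; elsewhere the power rule holds on a half-line.\<close>

lemma spowr_DERIV:
  assumes r: "r > 1"
  shows "(spowr r has_real_derivative r * \<bar>s\<bar> powr (r - 1)) (at s)"
proof -
  consider "s > 0" | "s < 0" | "s = 0" by linarith
  then show ?thesis
  proof cases
    case 1
    have "((\<lambda>x. x powr r) has_real_derivative r * \<bar>s\<bar> powr (r - 1)) (at s)"
      using 1 by (auto intro!: derivative_eq_intros simp: field_simps powr_diff)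
    then show ?thesis
      by (rule has_field_derivative_transform_within_open[OF _ open_greaterThan[of 0]])
        (use 1 in \<open>auto simp: spowr_def\<close>)
  next
    case 2
    have "((\<lambda>x. - ((- x) powr r)) has_real_derivative r * \<bar>s\<bar> powr (r - 1)) (at s)"
      using 2 by (auto intro!: derivative_eq_intros simp: field_simps powr_diff)
    then show ?thesis
      by (rule has_field_derivative_transform_within_open[OF _ open_lessThan[of 0]])
        (use 2 in \<open>auto simp: spowr_def\<close>)
  next
    case 3
    have "((\<lambda>h. (spowr r h - spowr r 0) / (h - 0)) \<longlongrightarrow> 0) (at 0)"
    proof (rule Lim_transform_eventually)
      show "((\<lambda>h::real. \<bar>h\<bar> powr (r - 1)) \<longlongrightarrow> 0) (at 0)"
        using r by (intro tendsto_abs_powr_0) simp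
      have "\<bar>h\<bar> powr (r - 1) = (spowr r h - spowr r 0) / (h - 0)" if "h \<noteq> 0" for h :: real
        using that by (cases "h > 0") (auto simp: spowr_def powr_diff field_simps)
      then show "\<forall>\<^sub>F h in at 0. \<bar>h\<bar> powr (r - 1) = (spowr r h - spowr r 0) / (h - 0)"
        by (auto simp: eventually_at_filter)
    qed
    then show ?thesis using 3 r by (simp add: has_field_derivative_iff)
  qed
qed

lemma abs_powr_DERIV:
  assumes q: "q > 1"
  shows "((\<lambda>s. \<bar>s\<bar> powr q / q) has_real_derivative spowr (q - 1) s) (at s)"
proof -
  consider "s > 0" | "s < 0" | "s = 0" by linarith
  then show ?thesis
  proof cases
    case 1
    have "((\<lambda>x. x powr q / q) has_real_derivative spowr (q - 1) s) (at s)"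
      using 1 q by (auto intro!: derivative_eq_intros simp: field_simps powr_diff spowr_def)
    then show ?thesis
      by (rule has_field_derivative_transform_within_open[OF _ open_greaterThan[of 0]])
        (use 1 in auto)
  next
    case 2
    have "((\<lambda>x. (- x) powr q / q) has_real_derivative spowr (q - 1) s) (at s)"
      using 2 q by (auto intro!: derivative_eq_intros simp: field_simps powr_diff spowr_def)
    then show ?thesis
      by (rule has_field_derivative_transform_within_open[OF _ open_lessThan[of 0]])
        (use 2 in auto)
  next
    case 3
    have "((\<lambda>h. (\<bar>h\<bar> powr q / q - \<bar>0\<bar> powr q / q) / (h - 0)) \<longlongrightarrow> 0) (at 0)"
    proof (rule Lim_null_comparison)
      show "((\<lambda>h::real. \<bar>h\<bar> powr (q - 1) / q) \<longlongrightarrow> 0) (at 0)"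
        using tendsto_divide[OF tendsto_abs_powr_0[of "q - 1"] tendsto_const[of q]] q by simp
      have "norm ((\<bar>h\<bar> powr q / q - \<bar>0\<bar> powr q / q) / (h - 0)) \<le> \<bar>h\<bar> powr (q - 1) / q" if "h \<noteq> 0" for h :: real
        using that q by (simp add: powr_diff abs_mult mult.commute)
      then show "\<forall>\<^sub>F h in at 0. norm ((\<bar>h\<bar> powr q / q - \<bar>0\<bar> powr q / q) / (h - 0)) \<le> \<bar>h\<bar> powr (q - 1) / q"
        by (auto simp: eventually_at_filter)
    qed
    then show ?thesis using 3 q by (simp add: has_field_derivative_iff spowr_def)
  qed
qed

text \<open>Mean value estimate on the interval of radius
  \<open>\<bar>s\<bar> + \<bar>t\<bar>\<close> about 0, where the derivative is largest at the
  ends.\<close>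

lemma spowr_increment:
  assumes p: "p > 2"
  shows "\<bar>spowr (p - 1) (s + t) - spowr (p - 1) s\<bar> \<le> (p - 1) * (\<bar>s\<bar> + \<bar>t\<bar>) powr (p - 2) * \<bar>t\<bar>"
proof -
  define R where "R = \<bar>s\<bar> + \<bar>t\<bar>"
  have "norm (spowr (p - 1) (s + t) - spowr (p - 1) s) \<le> (p - 1) * R powr (p - 2) * norm (s + t - s)"
  proof (rule field_differentiable_bound[of "{- R..R}"])
    fix x assume "x \<in> {- R..R}"
    then have "\<bar>x\<bar> powr (p - 2) \<le> R powr (p - 2)" using p by (intro powr_mono2) auto
    then show "norm ((p - 1) * \<bar>x\<bar> powr (p - 1 - 1)) \<le> (p - 1) * R powr (p - 2)"
      using p by (simp add: abs_mult)
    show "(spowr (p - 1) has_field_derivative (p - 1) * \<bar>x\<bar> powr (p - 1 - 1)) (at x within {- R..R})"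
      using p by (intro has_field_derivative_at_within[OF spowr_DERIV]) simp
  qed (auto simp: R_def)
  then show ?thesis by (simp add: R_def)
qed

lemma abs_powr_remainder:
  assumes p: "p > 2"
  shows "\<bar>\<bar>s + t\<bar> powr p / p - \<bar>s\<bar> powr p / p - spowr (p - 1) s * t\<bar>
    \<le> (p - 1) * ((\<bar>s\<bar> + \<bar>t\<bar>) powr (p - 2) * \<bar>t\<bar> * \<bar>t\<bar>)"
proof -
  define T where "T = \<bar>t\<bar>"
  \<comment> \<open>Subtracting the tangent term makes the derivative of \<open>F\<close> an
    increment of \<open>spowr\<close>, which the previous estimate controls on the interval.\<close>
  define F where "F x = \<bar>x\<bar> powr p / p - spowr (p - 1) s * x" for x
  have "norm (F (s + t) - F s) \<le> ((p - 1) * (\<bar>s\<bar> + T) powr (p - 2) * T) * norm (s + t - s)"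
  proof (rule field_differentiable_bound[of "{s - T..s + T}"])
    fix x assume x: "x \<in> {s - T..s + T}"
    have xs: "\<bar>x - s\<bar> \<le> T" using x by auto
    have "norm (spowr (p - 1) x - spowr (p - 1) s) \<le> (p - 1) * (\<bar>s\<bar> + \<bar>x - s\<bar>) powr (p - 2) * \<bar>x - s\<bar>"
      using spowr_increment[OF p, of s "x - s"] by simp
    also have "\<dots> \<le> (p - 1) * (\<bar>s\<bar> + T) powr (p - 2) * T"
      using p xs by (intro mult_mono powr_mono2) auto
    finally show "norm (spowr (p - 1) x - spowr (p - 1) s) \<le> (p - 1) * (\<bar>s\<bar> + T) powr (p - 2) * T" .
    show "(F has_field_derivative spowr (p - 1) x - spowr (p - 1) s) (at x within {s - T..s + T})"
      unfolding F_def using p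
      by (intro has_field_derivative_at_within[OF DERIV_diff[OF abs_powr_DERIV DERIV_cmult_Id]]) simp
  qed (auto simp: T_def)
  moreover have "F (s + t) - F s = \<bar>s + t\<bar> powr p / p - \<bar>s\<bar> powr p / p - spowr (p - 1) s * t"
    unfolding F_def by (simp add: distrib_left)
  ultimately show ?thesis by (simp add: T_def mult.assoc)
qed

text \<open>The exponents add up to p, so replacing all three numbers by their maximum m gives
  \<open>m powr p\<close>, which is one of the summands on the right.\<close>

lemma three_term_Young:
  fixes x y z :: real
  assumes "x \<ge> 0" "y \<ge> 0" "z \<ge> 0" "p > 2"
  shows "x powr (p - 2) * y * z \<le> x powr p + y powr p + z powr p"
proof -
  define m where "m = max x (max y z)"
  have m: "m \<ge> 0" "x \<le> m" "y \<le> m" "z \<le> m" using assms by (auto simp: m_def)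
  have "x powr (p - 2) * y * z \<le> m powr (p - 2) * m * m"
    using assms m by (intro mult_mono powr_mono2 mult_nonneg_nonneg) auto
  also have "\<dots> = m powr p"
  proof (cases "m = 0")
    case False
    then have "m powr p = m powr (p - 2) * m powr 2" by (simp only: powr_add[symmetric]) simp
    then show ?thesis using False m by (simp add: power2_eq_square)
  qed (use assms in simp)
  also have "\<dots> \<le> x powr p + y powr p + z powr p"
    by (auto simp: m_def max_def)
  finally show ?thesis .
qed

lemma two_term_Young:
  fixes x y :: real
  assumes "x \<ge> 0" "y \<ge> 0" "p > 2"
  shows "x powr (p - 1) * y \<le> x powr p + y powr p"
proof -
  define m where "m = max x y"
  have m: "m \<ge> 0" "x \<le> m" "y \<le> m" using assms by (auto simp: m_def)
  have "x powr (p - 1) * y \<le> m powr (p - 1) * m"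
    using assms m by (intro mult_mono powr_mono2) auto
  also have "\<dots> = m powr p"
  proof (cases "m = 0")
    case False
    then have "m powr p = m powr (p - 1) * m powr 1" by (simp only: powr_add[symmetric]) simp
    then show ?thesis using False m by simp
  qed (use assms in simp)
  also have "\<dots> \<le> x powr p + y powr p"
    by (auto simp: m_def max_def)
  finally show ?thesis .
qed

lemma powr_sum_le:
  fixes x y :: real
  assumes "x \<ge> 0" "y \<ge> 0" "p > 0"
  shows "(x + y) powr p \<le> 2 powr p * (x powr p + y powr p)"
proof -
  have "(x + y) powr p \<le> (2 * max x y) powr p" using assms by (intro powr_mono2) auto
  also have "\<dots> = 2 powr p * (max x y) powr p" using assms by (simp add: powr_mult)
  also have "\<dots> \<le> 2 powr p * (x powr p + y powr p)"
    by (intro mult_left_mono) (auto simp: max_def)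
  finally show ?thesis .
qed

text \<open>Allows estimates to be normalised by any \<open>t > a\<close> instead of a norm a that
  may vanish.\<close>

lemma le_mult_of_greater:
  fixes X c a :: real
  assumes "\<And>t. t > a \<Longrightarrow> X \<le> c * t"
  shows "X \<le> c * a"
proof (rule LIMSEQ_le_const)
  have "(\<lambda>n. c * (a + inverse (real (Suc n)))) \<longlonglongrightarrow> c * (a + 0)"
    by (intro tendsto_intros LIMSEQ_inverse_real_of_nat)
  then show "(\<lambda>n. c * (a + inverse (real (Suc n)))) \<longlonglongrightarrow> c * a" by simp
  have "X \<le> c * (a + inverse (real (Suc n)))" for n by (rule assms) simp
  then show "\<exists>N. \<forall>n\<ge>N. X \<le> c * (a + inverse (real (Suc n)))" by blast
qed

lemma borel_measurable_spowr [measurable]: "spowr r \<in> borel_measurable borel"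
  unfolding spowr_def by measurable

context sobolev_domain
begin

section \<open>Integral bounds for the critical term\<close>

definition Sp where "Sp = sobolev_const \<Omega> powr (- p / 2)"

lemma Sp_pos: "Sp > 0"
  using sobolev_const_pos by (simp add: Sp_def)

lemma H10_powr_bound: "u \<in> H10 \<Omega> \<Longrightarrow> (\<integral>x. \<bar>u x\<bar> powr p \<partial>M) \<le> Sp * hnorm u powr p"
  using H10_Sobolev_const by (simp add: Sp_def)

lemma H10_measurable [measurable_dest]: "u \<in> H10 \<Omega> \<Longrightarrow> u \<in> borel_measurable M"
  using H1_measurable H10_imp_H1 by blast

text \<open>These integrands bound the increments of the nonlinearity; Young's inequality reduces
  them to p-th powers.\<close>

lemma trilinear_integrable:
  assumes u: "u \<in> H10 \<Omega>" and v: "v \<in> H10 \<Omega>" and w: "w \<in> H10 \<Omega>"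
  shows "integrable M (\<lambda>x. (\<bar>u x\<bar> + \<bar>v x\<bar>) powr (p - 2) * \<bar>v x\<bar> * \<bar>w x\<bar>)"
    "integrable M (\<lambda>x. (\<bar>u x\<bar> + \<bar>v x\<bar>) powr p)"
proof -
  have [measurable]: "u \<in> borel_measurable M" "v \<in> borel_measurable M" "w \<in> borel_measurable M"
    using u v w by (auto intro: H10_measurable)
  show i: "integrable M (\<lambda>x. (\<bar>u x\<bar> + \<bar>v x\<bar>) powr p)"
  proof (rule Bochner_Integration.integrable_bound)
    show "integrable M (\<lambda>x. 2 powr p * (\<bar>u x\<bar> powr p + \<bar>v x\<bar> powr p))"
      using u v by (intro integrable_mult_right Bochner_Integration.integrable_add H10_integrable_powr)
    show "AE x in M. norm ((\<bar>u x\<bar> + \<bar>v x\<bar>) powr p) \<le> norm (2 powr p * (\<bar>u x\<bar> powr p + \<bar>v x\<bar> powr p))"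
      using powr_sum_le[of "\<bar>u _\<bar>" "\<bar>v _\<bar>" p] p_gt_2 by (intro AE_I2) auto
  qed measurable
  show "integrable M (\<lambda>x. (\<bar>u x\<bar> + \<bar>v x\<bar>) powr (p - 2) * \<bar>v x\<bar> * \<bar>w x\<bar>)"
  proof (rule Bochner_Integration.integrable_bound)
    show "integrable M (\<lambda>x. (\<bar>u x\<bar> + \<bar>v x\<bar>) powr p + \<bar>v x\<bar> powr p + \<bar>w x\<bar> powr p)"
      using u v w i by (intro Bochner_Integration.integrable_add H10_integrable_powr)
    show "AE x in M. norm ((\<bar>u x\<bar> + \<bar>v x\<bar>) powr (p - 2) * \<bar>v x\<bar> * \<bar>w x\<bar>)
      \<le> norm ((\<bar>u x\<bar> + \<bar>v x\<bar>) powr p + \<bar>v x\<bar> powr p + \<bar>w x\<bar> powr p)"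
    proof (rule AE_I2)
      fix x
      show "norm ((\<bar>u x\<bar> + \<bar>v x\<bar>) powr (p - 2) * \<bar>v x\<bar> * \<bar>w x\<bar>)
        \<le> norm ((\<bar>u x\<bar> + \<bar>v x\<bar>) powr p + \<bar>v x\<bar> powr p + \<bar>w x\<bar> powr p)"
        using three_term_Young[of "\<bar>u x\<bar> + \<bar>v x\<bar>" "\<bar>v x\<bar>" "\<bar>w x\<bar>" p] p_gt_2 by (simp add: abs_mult)
    qed
  qed measurable
qed

text \<open>Hoelder's inequality is replaced by the pointwise Young inequality applied to \<open>v / \<tau>\<close> and
  \<open>w / \<sigma>\<close> with \<open>\<tau>\<close>, \<open>\<sigma>\<close> close to the norms of \<open>v\<close> and \<open>w\<close>.\<close>

lemma trilinear_bound:
  assumes u: "u \<in> H10 \<Omega>"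
  obtains K where "K \<ge> 0" "\<forall>v\<in>H10 \<Omega>. hnorm v \<le> 1 \<longrightarrow> (\<forall>w\<in>H10 \<Omega>.
     (\<integral>x. (\<bar>u x\<bar> + \<bar>v x\<bar>) powr (p - 2) * \<bar>v x\<bar> * \<bar>w x\<bar> \<partial>M) \<le> K * hnorm v * hnorm w)"
proof -
  \<comment> \<open>Bound for the three integrals left by Young's inequality: the first part comes
    from \<open>(\<bar>u\<bar> + \<bar>v\<bar>) powr p\<close> with \<open>hnorm v \<le> 1\<close>,
    and the normalised v and w contribute at most \<open>Sp\<close> each.\<close>
  define K where "K = 2 powr p * (Sp * hnorm u powr p + Sp) + 2 * Sp"
  have K: "K \<ge> 0" using Sp_pos by (simp add: K_def)
  have "(\<integral>x. (\<bar>u x\<bar> + \<bar>v x\<bar>) powr (p - 2) * \<bar>v x\<bar> * \<bar>w x\<bar> \<partial>M) \<le> K * hnorm v * hnorm w"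
    if v: "v \<in> H10 \<Omega>" "hnorm v \<le> 1" and w: "w \<in> H10 \<Omega>" for v w
  proof -
    define X where "X = (\<integral>x. (\<bar>u x\<bar> + \<bar>v x\<bar>) powr (p - 2) * \<bar>v x\<bar> * \<bar>w x\<bar> \<partial>M)"
    have scaled: "X \<le> K * \<tau> * \<sigma>" if \<tau>: "\<tau> > hnorm v" and \<sigma>: "\<sigma> > hnorm w" for \<tau> \<sigma>
    proof -
      have pos: "\<tau> > 0" "\<sigma> > 0" using \<tau> \<sigma> hnorm_nonneg le_less_trans by blast+
      define v' where "v' = (\<lambda>x. (1 / \<tau>) * v x)"
      define w' where "w' = (\<lambda>x. (1 / \<sigma>) * w x)"
      have v': "v' \<in> H10 \<Omega>" and w': "w' \<in> H10 \<Omega>" unfolding v'_def w'_def by (intro H10_cmult v w)+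
      have "hnorm v' = \<bar>1 / \<tau>\<bar> * hnorm v" "hnorm w' = \<bar>1 / \<sigma>\<bar> * hnorm w"
        unfolding v'_def w'_def by (rule hnorm_cmult[OF H10_imp_H1], fact v w)+
      then have "hnorm v' \<le> 1" "hnorm w' \<le> 1"
        using pos \<tau> \<sigma> by simp_all
      then have le1: "hnorm v' powr p \<le> 1" "hnorm w' powr p \<le> 1" "hnorm v powr p \<le> 1"
        using powr_mono2[of p _ 1] p_gt_2 v(2) by auto
      have b: "(\<integral>x. \<bar>v' x\<bar> powr p \<partial>M) \<le> Sp" "(\<integral>x. \<bar>w' x\<bar> powr p \<partial>M) \<le> Sp" "(\<integral>x. \<bar>v x\<bar> powr p \<partial>M) \<le> Sp"
        using H10_powr_bound[OF v'] H10_powr_bound[OF w'] H10_powr_bound[OF v(1)] le1 Sp_pos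
        by (auto intro: order_trans[OF _ mult_left_le])
      have "X / (\<tau> * \<sigma>) = (\<integral>x. ((\<bar>u x\<bar> + \<bar>v x\<bar>) powr (p - 2) * \<bar>v x\<bar> * \<bar>w x\<bar>) / (\<tau> * \<sigma>) \<partial>M)"
        by (simp add: X_def)
      also have "\<dots> \<le> (\<integral>x. (\<bar>u x\<bar> + \<bar>v x\<bar>) powr p + \<bar>v' x\<bar> powr p + \<bar>w' x\<bar> powr p \<partial>M)"
      proof (rule integral_mono)
        show "integrable M (\<lambda>x. ((\<bar>u x\<bar> + \<bar>v x\<bar>) powr (p - 2) * \<bar>v x\<bar> * \<bar>w x\<bar>) / (\<tau> * \<sigma>))"
          by (intro integrable_divide trilinear_integrable u v w)
        show "integrable M (\<lambda>x. (\<bar>u x\<bar> + \<bar>v x\<bar>) powr p + \<bar>v' x\<bar> powr p + \<bar>w' x\<bar> powr p)"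
          by (intro Bochner_Integration.integrable_add trilinear_integrable(2)[OF u v(1) w] H10_integrable_powr v' w')
        fix x
        have "((\<bar>u x\<bar> + \<bar>v x\<bar>) powr (p - 2) * \<bar>v x\<bar> * \<bar>w x\<bar>) / (\<tau> * \<sigma>) = (\<bar>u x\<bar> + \<bar>v x\<bar>) powr (p - 2) * \<bar>v' x\<bar> * \<bar>w' x\<bar>"
          using pos by (simp add: v'_def w'_def abs_mult)
        also have "\<dots> \<le> (\<bar>u x\<bar> + \<bar>v x\<bar>) powr p + \<bar>v' x\<bar> powr p + \<bar>w' x\<bar> powr p"
          using p_gt_2 by (intro three_term_Young) auto
        finally show "((\<bar>u x\<bar> + \<bar>v x\<bar>) powr (p - 2) * \<bar>v x\<bar> * \<bar>w x\<bar>) / (\<tau> * \<sigma>) \<le> \<dots>" .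
      qed
      also have "\<dots> = (\<integral>x. (\<bar>u x\<bar> + \<bar>v x\<bar>) powr p \<partial>M) + (\<integral>x. \<bar>v' x\<bar> powr p \<partial>M) + (\<integral>x. \<bar>w' x\<bar> powr p \<partial>M)"
        using trilinear_integrable(2)[OF u v(1) w] H10_integrable_powr[OF v'] H10_integrable_powr[OF w'] by simp
      also have "(\<integral>x. (\<bar>u x\<bar> + \<bar>v x\<bar>) powr p \<partial>M) \<le> (\<integral>x. 2 powr p * (\<bar>u x\<bar> powr p + \<bar>v x\<bar> powr p) \<partial>M)"
        by (intro integral_mono trilinear_integrable(2)[OF u v(1) w] integrable_mult_right
            Bochner_Integration.integrable_add H10_integrable_powr u v powr_sum_le) (use p_gt_2 in auto)
      also have "\<dots> = 2 powr p * ((\<integral>x. \<bar>u x\<bar> powr p \<partial>M) + (\<integral>x. \<bar>v x\<bar> powr p \<partial>M))"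
        using H10_integrable_powr[OF u] H10_integrable_powr[OF v(1)] by simp
      also have "\<dots> \<le> 2 powr p * (Sp * hnorm u powr p + Sp)"
        using H10_powr_bound[OF u] b(3) by (intro mult_left_mono add_mono) auto
      finally have "X / (\<tau> * \<sigma>) \<le> K" using b by (simp add: K_def)
      then show ?thesis using pos by (simp add: pos_divide_le_eq mult.assoc)
    qed
    \<comment> \<open>First \<open>\<sigma>\<close> tends to \<open>hnorm w\<close>, then
      \<open>\<tau>\<close> to \<open>hnorm v\<close>.\<close>
    have X\<tau>: "X \<le> K * \<tau> * hnorm w" if "\<tau> > hnorm v" for \<tau>
      using scaled[OF that] by (rule le_mult_of_greater)
    have "X \<le> (K * hnorm w) * \<tau>" if "\<tau> > hnorm v" for \<tau>
      using X\<tau>[OF that] by (simp only: mult_ac)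
    then have "X \<le> (K * hnorm w) * hnorm v" by (rule le_mult_of_greater)
    then show ?thesis by (simp add: X_def mult_ac)
  qed
  with K show ?thesis using that by blast
qed

definition nlin where "nlin u w = (\<integral>x. spowr (p - 1) (u x) * w x \<partial>M)"

lemma nlin_integrable:
  assumes u: "u \<in> H10 \<Omega>" and w: "w \<in> H10 \<Omega>"
  shows "integrable M (\<lambda>x. spowr (p - 1) (u x) * w x)"
proof (rule Bochner_Integration.integrable_bound)
  show "(\<lambda>x. spowr (p - 1) (u x) * w x) \<in> borel_measurable M"
    using H10_measurable[OF u] H10_measurable[OF w] by measurable
  show "integrable M (\<lambda>x. \<bar>u x\<bar> powr p + \<bar>w x\<bar> powr p)"
    using u w by (intro Bochner_Integration.integrable_add H10_integrable_powr)
  show "AE x in M. norm (spowr (p - 1) (u x) * w x) \<le> norm (\<bar>u x\<bar> powr p + \<bar>w x\<bar> powr p)"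
  proof (rule AE_I2)
    fix x show "norm (spowr (p - 1) (u x) * w x) \<le> norm (\<bar>u x\<bar> powr p + \<bar>w x\<bar> powr p)"
      using two_term_Young[of "\<bar>u x\<bar>" "\<bar>w x\<bar>" p] p_gt_2 by (simp add: abs_mult abs_spowr)
  qed
qed

lemma nlin_add:
  assumes "u \<in> H10 \<Omega>" "v \<in> H10 \<Omega>" "w \<in> H10 \<Omega>"
  shows "nlin u (\<lambda>x. v x + w x) = nlin u v + nlin u w"
  using nlin_integrable[OF assms(1,2)] nlin_integrable[OF assms(1,3)]
  by (simp add: nlin_def distrib_left)

lemma nlin_cmult: "nlin u (\<lambda>x. c * w x) = c * nlin u w"
  by (simp add: nlin_def mult.left_commute)

text \<open>Young's inequality for u and a normalised w. The constant is not homogeneous in u;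
  boundedness in w is what the dual space asks for.\<close>

lemma nlin_bound:
  assumes u: "u \<in> H10 \<Omega>" and w: "w \<in> H10 \<Omega>"
  shows "\<bar>nlin u w\<bar> \<le> (Sp * hnorm u powr p + Sp) * hnorm w"
proof (rule le_mult_of_greater)
  fix \<sigma> assume \<sigma>: "\<sigma> > hnorm w"
  then have pos: "\<sigma> > 0" using hnorm_nonneg le_less_trans by blast
  define w' where "w' = (\<lambda>x. (1 / \<sigma>) * w x)"
  have w': "w' \<in> H10 \<Omega>" unfolding w'_def by (rule H10_cmult[OF w])
  have "hnorm w' = \<bar>1 / \<sigma>\<bar> * hnorm w"
    unfolding w'_def by (rule hnorm_cmult[OF H10_imp_H1[OF w]])
  then have "hnorm w' \<le> 1" using pos \<sigma> by simp
  then have "hnorm w' powr p \<le> 1" using powr_mono2[of p _ 1] p_gt_2 by auto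
  then have b: "(\<integral>x. \<bar>w' x\<bar> powr p \<partial>M) \<le> Sp"
    using H10_powr_bound[OF w'] Sp_pos by (auto intro: order_trans[OF _ mult_left_le])
  have "\<bar>nlin u w'\<bar> \<le> (\<integral>x. \<bar>spowr (p - 1) (u x) * w' x\<bar> \<partial>M)"
    unfolding nlin_def using integral_norm_bound[of M "\<lambda>x. spowr (p - 1) (u x) * w' x"] by simp
  also have "\<dots> \<le> (\<integral>x. \<bar>u x\<bar> powr p + \<bar>w' x\<bar> powr p \<partial>M)"
  proof (rule integral_mono)
    show "integrable M (\<lambda>x. \<bar>spowr (p - 1) (u x) * w' x\<bar>)" by (rule integrable_abs[OF nlin_integrable[OF u w']])
    show "integrable M (\<lambda>x. \<bar>u x\<bar> powr p + \<bar>w' x\<bar> powr p)"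
      using u w' by (intro Bochner_Integration.integrable_add H10_integrable_powr)
    fix x show "\<bar>spowr (p - 1) (u x) * w' x\<bar> \<le> \<bar>u x\<bar> powr p + \<bar>w' x\<bar> powr p"
      using two_term_Young[of "\<bar>u x\<bar>" "\<bar>w' x\<bar>" p] p_gt_2 by (simp add: abs_mult abs_spowr)
  qed
  also have "\<dots> = (\<integral>x. \<bar>u x\<bar> powr p \<partial>M) + (\<integral>x. \<bar>w' x\<bar> powr p \<partial>M)"
    using H10_integrable_powr[OF u] H10_integrable_powr[OF w'] by simp
  also have "\<dots> \<le> Sp * hnorm u powr p + Sp"
    using H10_powr_bound[OF u] b by simp
  finally have "\<bar>nlin u w'\<bar> \<le> Sp * hnorm u powr p + Sp" .
  moreover have "nlin u w' = nlin u w / \<sigma>" unfolding w'_def nlin_cmult by simp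
  ultimately show "\<bar>nlin u w\<bar> \<le> (Sp * hnorm u powr p + Sp) * \<sigma>"
    using pos by (simp add: pos_divide_le_eq)
qed

text \<open>One constant serves two purposes: the quadratic remainder gives differentiability of the
  critical term, the Lipschitz bound gives continuity of its derivative.\<close>

lemma nlin_estimates:
  assumes u: "u \<in> H10 \<Omega>"
  obtains K where "K \<ge> 0"
    "\<forall>v\<in>H10 \<Omega>. hnorm v \<le> 1 \<longrightarrow> (\<forall>w\<in>H10 \<Omega>. \<bar>nlin (\<lambda>x. u x + v x) w - nlin u w\<bar> \<le> K * hnorm v * hnorm w)"
    "\<forall>v\<in>H10 \<Omega>. hnorm v \<le> 1 \<longrightarrow>
      \<bar>(\<integral>x. \<bar>u x + v x\<bar> powr p \<partial>M) / p - (\<integral>x. \<bar>u x\<bar> powr p \<partial>M) / p - nlin u v\<bar> \<le> K * (hnorm v)\<^sup>2"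
proof -
  obtain K0 where K0: "K0 \<ge> 0" "\<forall>v\<in>H10 \<Omega>. hnorm v \<le> 1 \<longrightarrow> (\<forall>w\<in>H10 \<Omega>.
     (\<integral>x. (\<bar>u x\<bar> + \<bar>v x\<bar>) powr (p - 2) * \<bar>v x\<bar> * \<bar>w x\<bar> \<partial>M) \<le> K0 * hnorm v * hnorm w)"
    by (rule trilinear_bound[OF u])
  define K where "K = (p - 1) * K0"
  have 1: "\<bar>nlin (\<lambda>x. u x + v x) w - nlin u w\<bar> \<le> K * hnorm v * hnorm w"
    if v: "v \<in> H10 \<Omega>" "hnorm v \<le> 1" and w: "w \<in> H10 \<Omega>" for v w
  proof -
    have uv: "(\<lambda>x. u x + v x) \<in> H10 \<Omega>" by (rule H10_add[OF u v(1)])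
    have "\<bar>nlin (\<lambda>x. u x + v x) w - nlin u w\<bar> = \<bar>\<integral>x. spowr (p - 1) (u x + v x) * w x - spowr (p - 1) (u x) * w x \<partial>M\<bar>"
      using nlin_integrable[OF uv w] nlin_integrable[OF u w] by (simp add: nlin_def)
    also have "\<dots> \<le> (\<integral>x. (p - 1) * ((\<bar>u x\<bar> + \<bar>v x\<bar>) powr (p - 2) * \<bar>v x\<bar> * \<bar>w x\<bar>) \<partial>M)"
    proof (rule integral_abs_bound_integral)
      show "integrable M (\<lambda>x. spowr (p - 1) (u x + v x) * w x - spowr (p - 1) (u x) * w x)"
        by (intro Bochner_Integration.integrable_diff nlin_integrable uv u w)
      show "integrable M (\<lambda>x. (p - 1) * ((\<bar>u x\<bar> + \<bar>v x\<bar>) powr (p - 2) * \<bar>v x\<bar> * \<bar>w x\<bar>))"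
        by (intro integrable_mult_right trilinear_integrable u v w)
      fix x
      have "\<bar>spowr (p - 1) (u x + v x) - spowr (p - 1) (u x)\<bar> * \<bar>w x\<bar>
          \<le> ((p - 1) * (\<bar>u x\<bar> + \<bar>v x\<bar>) powr (p - 2) * \<bar>v x\<bar>) * \<bar>w x\<bar>"
        by (rule mult_right_mono[OF spowr_increment[OF p_gt_2]]) simp
      then show "\<bar>spowr (p - 1) (u x + v x) * w x - spowr (p - 1) (u x) * w x\<bar>
          \<le> (p - 1) * ((\<bar>u x\<bar> + \<bar>v x\<bar>) powr (p - 2) * \<bar>v x\<bar> * \<bar>w x\<bar>)"
        by (simp add: abs_mult[symmetric] left_diff_distrib mult.assoc)
    qed
    also have "\<dots> = (p - 1) * (\<integral>x. (\<bar>u x\<bar> + \<bar>v x\<bar>) powr (p - 2) * \<bar>v x\<bar> * \<bar>w x\<bar> \<partial>M)" by simp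
    also have "\<dots> \<le> (p - 1) * (K0 * hnorm v * hnorm w)"
      using K0(2) v w p_gt_2 by (intro mult_left_mono) auto
    finally show ?thesis by (simp add: K_def mult.assoc)
  qed
  have 2: "\<bar>(\<integral>x. \<bar>u x + v x\<bar> powr p \<partial>M) / p - (\<integral>x. \<bar>u x\<bar> powr p \<partial>M) / p - nlin u v\<bar> \<le> K * (hnorm v)\<^sup>2"
    if v: "v \<in> H10 \<Omega>" "hnorm v \<le> 1" for v
  proof -
    have uv: "(\<lambda>x. u x + v x) \<in> H10 \<Omega>" by (rule H10_add[OF u v(1)])
    note i = H10_integrable_powr[OF uv] H10_integrable_powr[OF u] nlin_integrable[OF u v(1)]
    have "\<bar>(\<integral>x. \<bar>u x + v x\<bar> powr p \<partial>M) / p - (\<integral>x. \<bar>u x\<bar> powr p \<partial>M) / p - nlin u v\<bar>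
        = \<bar>\<integral>x. \<bar>u x + v x\<bar> powr p / p - \<bar>u x\<bar> powr p / p - spowr (p - 1) (u x) * v x \<partial>M\<bar>"
      using i by (simp add: nlin_def)
    also have "\<dots> \<le> (\<integral>x. (p - 1) * ((\<bar>u x\<bar> + \<bar>v x\<bar>) powr (p - 2) * \<bar>v x\<bar> * \<bar>v x\<bar>) \<partial>M)"
    proof (rule integral_abs_bound_integral)
      show "integrable M (\<lambda>x. \<bar>u x + v x\<bar> powr p / p - \<bar>u x\<bar> powr p / p - spowr (p - 1) (u x) * v x)"
        using i by (intro Bochner_Integration.integrable_diff integrable_divide)
      show "integrable M (\<lambda>x. (p - 1) * ((\<bar>u x\<bar> + \<bar>v x\<bar>) powr (p - 2) * \<bar>v x\<bar> * \<bar>v x\<bar>))"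
        by (intro integrable_mult_right trilinear_integrable u v)
    qed (rule abs_powr_remainder[OF p_gt_2])
    also have "\<dots> = (p - 1) * (\<integral>x. (\<bar>u x\<bar> + \<bar>v x\<bar>) powr (p - 2) * \<bar>v x\<bar> * \<bar>v x\<bar> \<partial>M)" by simp
    also have "\<dots> \<le> (p - 1) * (K0 * hnorm v * hnorm v)"
      using K0(2) v p_gt_2 by (intro mult_left_mono) auto
    finally show ?thesis by (simp add: K_def mult.assoc power2_eq_square)
  qed
  have "K \<ge> 0" using K0(1) p_gt_2 by (simp add: K_def)
  then show ?thesis using that 1 2 by blast
qed

end

subsection \<open>Differentiability of the functional\<close>

lemma abs_sum5_le:
  fixes x1 x2 x3 x4 x5 :: real
  assumes "\<bar>x1\<bar> \<le> b1" "\<bar>x2\<bar> \<le> b2" "\<bar>x3\<bar> \<le> b3" "\<bar>x4\<bar> \<le> b4" "\<bar>x5\<bar> \<le> b5"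
  shows "\<bar>x1 + x2 + x3 - x4 - x5\<bar> \<le> b1 + b2 + b3 + b4 + b5"
  using assms by linarith

context sobolev_domain
begin

section \<open>The dual norm and uniqueness of derivatives\<close>

lemma H10_zero: "(\<lambda>x. 0) \<in> H10 \<Omega>" "hnorm (\<lambda>x. 0) = 0"
proof -
  obtain \<phi> where \<phi>: "\<phi> \<in> test_functions \<Omega>" using not_AE_zero_test by blast
  show "(\<lambda>x. 0) \<in> H10 \<Omega>" using H10_cmult[OF H10_test[OF \<phi>], of 0] by simp
  show "hnorm (\<lambda>x. 0) = 0" using hnorm_cmult[OF H1_test(1)[OF \<phi>], of 0] by simp
qed

lemma H10_dualD:
  assumes "L \<in> H10_dual \<Omega>"
  shows "u \<in> H10 \<Omega> \<Longrightarrow> v \<in> H10 \<Omega> \<Longrightarrow> L (\<lambda>x. u x + v x) = L u + L v"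
    "u \<in> H10 \<Omega> \<Longrightarrow> L (\<lambda>x. c * u x) = c * L u"
    "\<exists>K. \<forall>u\<in>H10 \<Omega>. \<bar>L u\<bar> \<le> K * hnorm u"
  using assms by (auto simp: H10_dual_def)

lemma H10_dual_norm_le:
  assumes "\<And>v. v \<in> H10 \<Omega> \<Longrightarrow> hnorm v \<le> 1 \<Longrightarrow> \<bar>L v\<bar> \<le> B"
  shows "H10_dual_norm \<Omega> L \<le> B"
  unfolding H10_dual_norm_def
proof (rule cSup_least)
  show "{\<bar>L v\<bar> |v. v \<in> H10 \<Omega> \<and> hnorm v \<le> 1} \<noteq> {}" using H10_zero by force
qed (use assms in auto)

text \<open>By scaling into the unit ball. The bound K of the functional keeps the supremum finite,
  and it also settles vectors of norm zero.\<close>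

lemma H10_dual_norm_bound:
  assumes L: "L \<in> H10_dual \<Omega>" and v: "v \<in> H10 \<Omega>"
  shows "\<bar>L v\<bar> \<le> H10_dual_norm \<Omega> L * hnorm v"
proof -
  obtain K where K: "\<forall>u\<in>H10 \<Omega>. \<bar>L u\<bar> \<le> K * hnorm u" using H10_dualD(3)[OF L] by blast
  show ?thesis
  proof (cases "hnorm v = 0")
    case True
    then show ?thesis using K v by fastforce
  next
    case False
    then have h: "hnorm v > 0" by (simp add: order_less_le)
    define w where "w = (\<lambda>x. (1 / hnorm v) * v x)"
    have w: "w \<in> H10 \<Omega>" unfolding w_def by (rule H10_cmult[OF v])
    have "hnorm w = \<bar>1 / hnorm v\<bar> * hnorm v" unfolding w_def by (rule hnorm_cmult[OF H10_imp_H1[OF v]])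
    then have hw: "hnorm w \<le> 1" using h by simp
    have "bdd_above {\<bar>L v\<bar> |v. v \<in> H10 \<Omega> \<and> hnorm v \<le> 1}"
    proof (rule bdd_aboveI[of _ "\<bar>K\<bar>"])
      fix y assume "y \<in> {\<bar>L v\<bar> |v. v \<in> H10 \<Omega> \<and> hnorm v \<le> 1}"
      then obtain z where z: "y = \<bar>L z\<bar>" "z \<in> H10 \<Omega>" "hnorm z \<le> 1" by blast
      have "\<bar>L z\<bar> \<le> K * hnorm z" using K z by blast
      also have "\<dots> \<le> \<bar>K\<bar> * hnorm z" by (intro mult_right_mono) auto
      also have "\<dots> \<le> \<bar>K\<bar>" using z(3) by (simp add: mult_left_le)
      finally show "y \<le> \<bar>K\<bar>" by (simp add: z(1))
    qed
    then have "\<bar>L w\<bar> \<le> H10_dual_norm \<Omega> L"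
      unfolding H10_dual_norm_def using w hw by (intro cSup_upper) auto
    moreover have "L w = L v / hnorm v" unfolding w_def using H10_dualD(2)[OF L v, of "1 / hnorm v"] by simp
    ultimately show ?thesis using h by (simp add: pos_divide_le_eq)
  qed
qed

text \<open>Both remainder estimates are compared at \<open>t * v\<close> for a t so small that both
  apply, and homogeneity cancels t. Uniqueness is confined to \<open>H10\<close>, since the
  functionals are unconstrained elsewhere.\<close>

lemma H10_has_derivative_unique:
  assumes L: "H10_has_derivative \<Omega> J L u" and L': "H10_has_derivative \<Omega> J L' u" and v: "v \<in> H10 \<Omega>"
  shows "L v = L' v"
proof -
  have d: "L \<in> H10_dual \<Omega>" "L' \<in> H10_dual \<Omega>" using L L' by (auto simp: H10_has_derivative_def)
  have le: "\<bar>L v - L' v\<bar> \<le> (2 * hnorm v) * \<epsilon>" if \<epsilon>: "\<epsilon> > 0" for \<epsilon>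
  proof -
    obtain \<delta>1 where \<delta>1: "\<delta>1 > 0" "\<forall>v\<in>H10 \<Omega>. hnorm v < \<delta>1 \<longrightarrow> \<bar>J (\<lambda>x. u x + v x) - J u - L v\<bar> \<le> \<epsilon> * hnorm v"
      using L \<epsilon> unfolding H10_has_derivative_def by blast
    obtain \<delta>2 where \<delta>2: "\<delta>2 > 0" "\<forall>v\<in>H10 \<Omega>. hnorm v < \<delta>2 \<longrightarrow> \<bar>J (\<lambda>x. u x + v x) - J u - L' v\<bar> \<le> \<epsilon> * hnorm v"
      using L' \<epsilon> unfolding H10_has_derivative_def by blast
    \<comment> \<open>The summand 1 covers the case \<open>hnorm v = 0\<close>.\<close>
    define t where "t = min \<delta>1 \<delta>2 / (hnorm v + 1)"
    have h1: "hnorm v + 1 > 0" using hnorm_nonneg[of v] by linarith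
    have t: "t > 0" using \<delta>1 \<delta>2 h1 by (simp add: t_def)
    define w where "w = (\<lambda>x. t * v x)"
    have w: "w \<in> H10 \<Omega>" unfolding w_def by (rule H10_cmult[OF v])
    have hw: "hnorm w = t * hnorm v" unfolding w_def using t by (simp add: hnorm_cmult[OF H10_imp_H1[OF v]])
    have "t * hnorm v < t * (hnorm v + 1)" using t by simp
    also have "\<dots> = min \<delta>1 \<delta>2" using h1 by (simp add: t_def)
    finally have "hnorm w < \<delta>1" "hnorm w < \<delta>2" by (simp_all add: hw)
    then have "\<bar>J (\<lambda>x. u x + w x) - J u - L w\<bar> \<le> \<epsilon> * hnorm w" "\<bar>J (\<lambda>x. u x + w x) - J u - L' w\<bar> \<le> \<epsilon> * hnorm w"
      using \<delta>1 \<delta>2 w by auto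
    then have "\<bar>L w - L' w\<bar> \<le> 2 * (\<epsilon> * hnorm w)" by linarith
    moreover have "L w - L' w = t * (L v - L' v)"
      unfolding w_def using H10_dualD(2)[OF d(1) v] H10_dualD(2)[OF d(2) v] by (simp add: right_diff_distrib)
    ultimately have "t * \<bar>L v - L' v\<bar> \<le> t * ((2 * hnorm v) * \<epsilon>)"
      using t by (simp add: abs_mult hw mult_ac)
    then show ?thesis using t by simp
  qed
  have "\<bar>L v - L' v\<bar> \<le> (2 * hnorm v) * 0" by (rule le_mult_of_greater) (use le in blast)
  then show ?thesis by simp
qed

text \<open>The way from the \<open>SOME\<close> in \<open>H10_derivative\<close> to explicit
  formulas.\<close>

lemma H10_derivative_eq:
  assumes "H10_has_derivative \<Omega> J L u" "v \<in> H10 \<Omega>"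
  shows "H10_derivative \<Omega> J u v = L v"
proof (rule H10_has_derivative_unique[OF _ assms])
  show "H10_has_derivative \<Omega> J (H10_derivative \<Omega> J u) u"
    unfolding H10_derivative_def using assms(1) by (rule someI[where P = "\<lambda>L. H10_has_derivative \<Omega> J L u"])
qed

lemma H10_derivative_dual:
  assumes "H10_has_derivative \<Omega> J L u"
  shows "H10_derivative \<Omega> J u \<in> H10_dual \<Omega>"
proof -
  have "H10_has_derivative \<Omega> J (H10_derivative \<Omega> J u) u"
    unfolding H10_derivative_def using assms(1) by (rule someI[where P = "\<lambda>L. H10_has_derivative \<Omega> J L u"])
  then show ?thesis by (simp add: H10_has_derivative_def)
qed

section \<open>The derivative of the Kirchhoff functional\<close>

lemma kirchhoff_eq:
  "kirchhoff_functional \<Omega> a b \<gamma> lam u = a / 2 * (hnorm u)\<^sup>2 + b / (2 * \<gamma>) * ((hnorm u)\<^sup>2) powr \<gamma>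
     - lam / 2 * (l2norm M u)\<^sup>2 - (\<integral>x. \<bar>u x\<bar> powr p \<partial>M) / p"
  by (simp add: kirchhoff_functional_def dirichlet_integral_eq l2norm_squared p_def)

definition kderiv where
  "kderiv a b \<gamma> lam u v =
     (a + b * ((hnorm u)\<^sup>2) powr (\<gamma> - 1)) * hinner u v - lam * l2inner M u v - nlin u v"

lemma H10_l2inner_bound:
  obtains C where "C \<ge> 0" "\<forall>u\<in>H10 \<Omega>. \<forall>v\<in>H10 \<Omega>. \<bar>l2inner M u v\<bar> \<le> C * hnorm u * hnorm v"
    "\<forall>u\<in>H10 \<Omega>. (l2norm M u)\<^sup>2 \<le> C * (hnorm u)\<^sup>2"
proof -
  obtain C where C: "C > 0" "\<forall>u\<in>H10 \<Omega>. l2norm M u \<le> C * hnorm u"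
    by (rule H10_Poincare)
  show ?thesis
  proof (rule that[of "C\<^sup>2"])
    show "\<forall>u\<in>H10 \<Omega>. \<forall>v\<in>H10 \<Omega>. \<bar>l2inner M u v\<bar> \<le> C\<^sup>2 * hnorm u * hnorm v"
    proof (intro ballI)
      fix u v assume u: "u \<in> H10 \<Omega>" and v: "v \<in> H10 \<Omega>"
      have "\<bar>l2inner M u v\<bar> \<le> l2norm M u * l2norm M v"
        by (rule l2_Cauchy_Schwarz[OF H1D(1)[OF H10_imp_H1[OF u]] H1D(1)[OF H10_imp_H1[OF v]]])
      also have "\<dots> \<le> (C * hnorm u) * (C * hnorm v)"
        using C u v by (intro mult_mono) auto
      finally show "\<bar>l2inner M u v\<bar> \<le> C\<^sup>2 * hnorm u * hnorm v" by (simp add: power2_eq_square mult_ac)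
    qed
    show "\<forall>u\<in>H10 \<Omega>. (l2norm M u)\<^sup>2 \<le> C\<^sup>2 * (hnorm u)\<^sup>2"
    proof
      fix u assume "u \<in> H10 \<Omega>"
      then have "(l2norm M u)\<^sup>2 \<le> (C * hnorm u)\<^sup>2" using C by (intro power_mono) auto
      then show "(l2norm M u)\<^sup>2 \<le> C\<^sup>2 * (hnorm u)\<^sup>2" by (simp add: power_mult_distrib)
    qed
  qed simp
qed

lemma kderiv_dual:
  assumes u: "u \<in> H10 \<Omega>"
  shows "kderiv a b \<gamma> lam u \<in> H10_dual \<Omega>"
proof -
  obtain C where C: "C \<ge> 0" "\<forall>u\<in>H10 \<Omega>. \<forall>v\<in>H10 \<Omega>. \<bar>l2inner M u v\<bar> \<le> C * hnorm u * hnorm v"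
    "\<forall>u\<in>H10 \<Omega>. (l2norm M u)\<^sup>2 \<le> C * (hnorm u)\<^sup>2"
    by (rule H10_l2inner_bound)
  define A where "A = a + b * ((hnorm u)\<^sup>2) powr (\<gamma> - 1)"
  have k: "kderiv a b \<gamma> lam u v = A * hinner u v - lam * l2inner M u v - nlin u v" for v
    by (simp add: kderiv_def A_def)
  show ?thesis
    unfolding H10_dual_def
  proof (intro CollectI conjI ballI allI exI)
    fix v w assume v: "v \<in> H10 \<Omega>" and w: "w \<in> H10 \<Omega>"
    show "kderiv a b \<gamma> lam u (\<lambda>x. v x + w x) = kderiv a b \<gamma> lam u v + kderiv a b \<gamma> lam u w"
      using hinner_add_right[OF H10_imp_H1[OF v] H10_imp_H1[OF w] H10_imp_H1[OF u]] nlin_add[OF u v w]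
        l2inner_add_right[OF H1D(1)[OF H10_imp_H1[OF v]] H1D(1)[OF H10_imp_H1[OF w]] H1D(1)[OF H10_imp_H1[OF u]]]
      by (simp add: k algebra_simps)
  next
    fix c v assume v: "v \<in> H10 \<Omega>"
    show "kderiv a b \<gamma> lam u (\<lambda>x. c * v x) = c * kderiv a b \<gamma> lam u v"
      using hinner_cmult_right[OF H10_imp_H1[OF v] H10_imp_H1[OF u], of c] nlin_cmult[of u c v]
        l2inner_scaleR_right[of M u c v]
      by (simp add: k algebra_simps)
  next
    fix v assume v: "v \<in> H10 \<Omega>"
    have "\<bar>A * hinner u v\<bar> \<le> \<bar>A\<bar> * (hnorm u * hnorm v)"
      unfolding abs_mult by (intro mult_left_mono hinner_Cauchy_Schwarz H10_imp_H1 u v) simp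
    moreover have "\<bar>lam * l2inner M u v\<bar> \<le> \<bar>lam\<bar> * (C * hnorm u * hnorm v)"
      unfolding abs_mult using C(2) u v by (intro mult_left_mono) auto
    moreover have "\<bar>nlin u v\<bar> \<le> (Sp * hnorm u powr p + Sp) * hnorm v" by (rule nlin_bound[OF u v])
    ultimately have "\<bar>kderiv a b \<gamma> lam u v\<bar> \<le> \<bar>A\<bar> * (hnorm u * hnorm v) + \<bar>lam\<bar> * (C * hnorm u * hnorm v) + (Sp * hnorm u powr p + Sp) * hnorm v"
      unfolding k by linarith
    also have "\<dots> = (\<bar>A\<bar> * hnorm u + \<bar>lam\<bar> * C * hnorm u + (Sp * hnorm u powr p + Sp)) * hnorm v"
      by (simp only: distrib_right mult.assoc)
    finally show "\<bar>kderiv a b \<gamma> lam u v\<bar> \<le> (\<bar>A\<bar> * hnorm u + \<bar>lam\<bar> * C * hnorm u + (Sp * hnorm u powr p + Sp)) * hnorm v" .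
  qed
qed

text \<open>An exact identity that isolates the remainders. The nonlocal term is expanded in the
  full increment \<open>d\<close> of the squared norm, whereas the derivative pairs only with
  \<open>2 * hinner u v\<close>; the discrepancy is the summand with
  \<open>spowr (\<gamma> - 1) D * (hnorm v)\<^sup>2\<close>.\<close>

lemma kirchhoff_expansion:
  assumes u: "u \<in> H10 \<Omega>" and v: "v \<in> H10 \<Omega>" and \<gamma>: "\<gamma> > 0"
  defines "D \<equiv> (hnorm u)\<^sup>2" and "d \<equiv> 2 * hinner u v + (hnorm v)\<^sup>2"
  shows "kirchhoff_functional \<Omega> a b \<gamma> lam (\<lambda>x. u x + v x) - kirchhoff_functional \<Omega> a b \<gamma> lam u - kderiv a b \<gamma> lam u v
    = a / 2 * (hnorm v)\<^sup>2 + b / 2 * (\<bar>D + d\<bar> powr \<gamma> / \<gamma> - \<bar>D\<bar> powr \<gamma> / \<gamma> - spowr (\<gamma> - 1) D * d)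
      + b / 2 * (spowr (\<gamma> - 1) D * (hnorm v)\<^sup>2) - lam / 2 * (l2norm M v)\<^sup>2
      - ((\<integral>x. \<bar>u x + v x\<bar> powr p \<partial>M) / p - (\<integral>x. \<bar>u x\<bar> powr p \<partial>M) / p - nlin u v)"
proof -
  have hD: "(hnorm (\<lambda>x. u x + v x))\<^sup>2 = D + d"
    using hnorm_add_squared[OF H10_imp_H1[OF u] H10_imp_H1[OF v]] by (simp add: D_def d_def)
  have D0: "D \<ge> 0" by (simp add: D_def)
  have Dd: "D + d \<ge> 0" unfolding hD[symmetric] by simp
  have l: "(l2norm M (\<lambda>x. u x + v x))\<^sup>2 = (l2norm M u)\<^sup>2 + 2 * l2inner M u v + (l2norm M v)\<^sup>2"
    by (rule l2norm_add_squared[OF H1D(1)[OF H10_imp_H1[OF u]] H1D(1)[OF H10_imp_H1[OF v]]])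
  have sp: "spowr (\<gamma> - 1) D = D powr (\<gamma> - 1)" using D0 by (rule spowr_nonneg)
  have b: "b / (2 * \<gamma>) * X = b / 2 * (X / \<gamma>)" for X by simp
  have hi: "hinner u v = (d - (hnorm v)\<^sup>2) / 2" by (simp add: d_def)
  show ?thesis
    unfolding kirchhoff_eq kderiv_def hD l sp b D_def[symmetric] abs_of_nonneg[OF D0] abs_of_nonneg[OF Dd] hi
    by (simp add: algebra_simps add_divide_distrib diff_divide_distrib)
qed

lemma kirchhoff_has_derivative:
  assumes u: "u \<in> H10 \<Omega>" and b: "b > 0" and \<gamma>: "\<gamma> > 1"
  shows "H10_has_derivative \<Omega> (kirchhoff_functional \<Omega> a b \<gamma> lam) (kderiv a b \<gamma> lam u) u"
  unfolding H10_has_derivative_def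
proof (intro conjI kderiv_dual u allI impI)
  fix \<epsilon> :: real assume \<epsilon>: "\<epsilon> > 0"
  obtain C where C: "C \<ge> 0" "\<forall>u\<in>H10 \<Omega>. \<forall>v\<in>H10 \<Omega>. \<bar>l2inner M u v\<bar> \<le> C * hnorm u * hnorm v"
    "\<forall>u\<in>H10 \<Omega>. (l2norm M u)\<^sup>2 \<le> C * (hnorm u)\<^sup>2"
    by (rule H10_l2inner_bound)
  obtain K where K: "K \<ge> 0"
    "\<forall>v\<in>H10 \<Omega>. hnorm v \<le> 1 \<longrightarrow> (\<forall>w\<in>H10 \<Omega>. \<bar>nlin (\<lambda>x. u x + v x) w - nlin u w\<bar> \<le> K * hnorm v * hnorm w)"
    "\<forall>v\<in>H10 \<Omega>. hnorm v \<le> 1 \<longrightarrow>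
      \<bar>(\<integral>x. \<bar>u x + v x\<bar> powr p \<partial>M) / p - (\<integral>x. \<bar>u x\<bar> powr p \<partial>M) / p - nlin u v\<bar> \<le> K * (hnorm v)\<^sup>2"
    by (rule nlin_estimates[OF u])
  define D where "D = (hnorm u)\<^sup>2"
  define E where "E = spowr (\<gamma> - 1) D"
  \<comment> \<open>Chosen so that the increment of the squared norm is at most
    \<open>c1 * h\<close> as long as \<open>h \<le> 1\<close>.\<close>
  define c1 where "c1 = 2 * hnorm u + 1"
  have c1: "c1 > 0" using hnorm_nonneg[of u] by (simp add: c1_def add_nonneg_pos)
  \<comment> \<open>Collects the coefficients of the terms that are quadratic in the norm of
    v.\<close>
  define c0 where "c0 = \<bar>a\<bar> / 2 + b / 2 * \<bar>E\<bar> + \<bar>lam\<bar> / 2 * C + K"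
  have c0: "c0 \<ge> 0" using b C(1) K(1) by (simp add: c0_def)
  \<comment> \<open>Makes the remainder of the nonlocal term at most
    \<open>\<epsilon> / 2 * h\<close> once the factors \<open>b / 2\<close> and \<open>c1\<close>
    are included.\<close>
  define \<eta> where "\<eta> = \<epsilon> / (b * c1)"
  have \<eta>: "\<eta> > 0" using \<epsilon> b c1 by (simp add: \<eta>_def)
  have "((\<lambda>s. \<bar>s\<bar> powr \<gamma> / \<gamma>) has_derivative (*) E) (at D)"
    using abs_powr_DERIV[OF \<gamma>, of D] by (simp add: has_field_derivative_def E_def)
  then obtain r where r: "r > 0" "\<And>s. norm (s - D) < r \<Longrightarrow> norm (\<bar>s\<bar> powr \<gamma> / \<gamma> - \<bar>D\<bar> powr \<gamma> / \<gamma> - E * (s - D)) \<le> \<eta> * norm (s - D)"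
    using \<eta> unfolding has_derivative_at_alt by blast
  define \<delta> where "\<delta> = min 1 (min (r / c1) (\<epsilon> / (2 * (c0 + 1))))"
  show "\<exists>\<delta>>0. \<forall>v\<in>H10 \<Omega>. hnorm v < \<delta> \<longrightarrow>
    \<bar>kirchhoff_functional \<Omega> a b \<gamma> lam (\<lambda>x. u x + v x) - kirchhoff_functional \<Omega> a b \<gamma> lam u - kderiv a b \<gamma> lam u v\<bar> \<le> \<epsilon> * hnorm v"
  proof (intro exI[of _ \<delta>] conjI ballI impI)
    show "\<delta> > 0" using r(1) c1 \<epsilon> c0 by (simp add: \<delta>_def)
    fix v assume v: "v \<in> H10 \<Omega>" and hv: "hnorm v < \<delta>"
    define h where "h = hnorm v"
    have h0: "h \<ge> 0" by (simp add: h_def)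
    have h1: "h \<le> 1" and hr: "h < r / c1" and h\<epsilon>: "h < \<epsilon> / (2 * (c0 + 1))"
      using hv by (auto simp: \<delta>_def h_def)
    have h2: "h\<^sup>2 \<le> h" using h0 h1 by (simp add: power2_eq_square mult_left_le)
    define d where "d = 2 * hinner u v + h\<^sup>2"
    have d_le: "\<bar>d\<bar> \<le> c1 * h"
    proof -
      have "\<bar>hinner u v\<bar> \<le> hnorm u * h"
        unfolding h_def by (rule hinner_Cauchy_Schwarz[OF H10_imp_H1[OF u] H10_imp_H1[OF v]])
      moreover have "c1 * h = 2 * (hnorm u * h) + h" by (simp add: c1_def algebra_simps)
      moreover have "0 \<le> h\<^sup>2" by simp
      ultimately show ?thesis using h2 unfolding d_def by linarith
    qed
    also have "\<dots> < r" using hr c1 by (simp add: field_simps)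
    finally have "norm (D + d - D) < r" by simp
    from r(2)[OF this] have R: "\<bar>\<bar>D + d\<bar> powr \<gamma> / \<gamma> - \<bar>D\<bar> powr \<gamma> / \<gamma> - E * d\<bar> \<le> \<eta> * \<bar>d\<bar>" by simp
    define R where "R = \<bar>D + d\<bar> powr \<gamma> / \<gamma> - \<bar>D\<bar> powr \<gamma> / \<gamma> - E * d"
    have "\<bar>R\<bar> \<le> \<eta> * \<bar>d\<bar>" using R by (simp add: R_def)
    also have "\<dots> \<le> \<eta> * (c1 * h)" using d_le \<eta> by (intro mult_left_mono) auto
    finally have "b / 2 * \<bar>R\<bar> \<le> b / 2 * (\<eta> * (c1 * h))" using b by (intro mult_left_mono) auto
    also have "\<dots> = \<epsilon> / 2 * h" using b c1 by (simp add: \<eta>_def)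
    finally have t2: "\<bar>b / 2 * R\<bar> \<le> \<epsilon> / 2 * h" using b by (simp add: abs_mult)
    define P where "P = (\<integral>x. \<bar>u x + v x\<bar> powr p \<partial>M) / p - (\<integral>x. \<bar>u x\<bar> powr p \<partial>M) / p - nlin u v"
    have t5: "\<bar>P\<bar> \<le> K * h\<^sup>2" using K(3) v h1 by (simp add: P_def h_def)
    have t1: "\<bar>a / 2 * h\<^sup>2\<bar> \<le> \<bar>a\<bar> / 2 * h\<^sup>2" by (simp add: abs_mult)
    have t3: "\<bar>b / 2 * (E * h\<^sup>2)\<bar> \<le> b / 2 * \<bar>E\<bar> * h\<^sup>2" using b by (simp add: abs_mult)
    have t4: "\<bar>lam / 2 * (l2norm M v)\<^sup>2\<bar> \<le> \<bar>lam\<bar> / 2 * C * h\<^sup>2"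
    proof -
      have "\<bar>lam / 2 * (l2norm M v)\<^sup>2\<bar> = \<bar>lam\<bar> / 2 * (l2norm M v)\<^sup>2" by (simp add: abs_mult)
      also have "\<dots> \<le> \<bar>lam\<bar> / 2 * (C * h\<^sup>2)" using C(3) v by (intro mult_left_mono) (auto simp: h_def)
      finally show ?thesis by (simp add: mult.assoc)
    qed
    have "kirchhoff_functional \<Omega> a b \<gamma> lam (\<lambda>x. u x + v x) - kirchhoff_functional \<Omega> a b \<gamma> lam u - kderiv a b \<gamma> lam u v
      = a / 2 * h\<^sup>2 + b / 2 * R + b / 2 * (E * h\<^sup>2) - lam / 2 * (l2norm M v)\<^sup>2 - P"
      unfolding R_def E_def P_def D_def d_def h_def using \<gamma> by (intro kirchhoff_expansion u v) simp
    also have "\<bar>\<dots>\<bar> \<le> \<bar>a\<bar> / 2 * h\<^sup>2 + \<epsilon> / 2 * h + b / 2 * \<bar>E\<bar> * h\<^sup>2 + \<bar>lam\<bar> / 2 * C * h\<^sup>2 + K * h\<^sup>2"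
      by (rule abs_sum5_le[OF t1 t2 t3 t4 t5])
    also have "\<dots> = c0 * h\<^sup>2 + \<epsilon> / 2 * h" by (simp add: c0_def algebra_simps)
    also have "\<dots> \<le> \<epsilon> / 2 * h + \<epsilon> / 2 * h"
    proof -
      have "(c0 + 1) * h \<le> \<epsilon> / 2" using h\<epsilon> c0 by (simp add: field_simps)
      then have "(c0 + 1) * h * h \<le> \<epsilon> / 2 * h" using h0 by (rule mult_right_mono)
      moreover have "c0 * h\<^sup>2 \<le> (c0 + 1) * h * h" by (simp add: power2_eq_square algebra_simps)
      ultimately show ?thesis by linarith
    qed
    also have "\<dots> = \<epsilon> * hnorm v" by (simp add: h_def)
    finally show "\<bar>kirchhoff_functional \<Omega> a b \<gamma> lam (\<lambda>x. u x + v x) - kirchhoff_functional \<Omega> a b \<gamma> lam u - kderiv a b \<gamma> lam u v\<bar> \<le> \<epsilon> * hnorm v" .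
  qed
qed

lemma kirchhoff_derivative:
  assumes "u \<in> H10 \<Omega>" "b > 0" "\<gamma> > 1" "v \<in> H10 \<Omega>"
  shows "H10_derivative \<Omega> (kirchhoff_functional \<Omega> a b \<gamma> lam) u v = kderiv a b \<gamma> lam u v"
  by (rule H10_derivative_eq[OF kirchhoff_has_derivative[OF assms(1-3)] assms(4)])

text \<open>The change of the nonlocal coefficient is kept as a separate factor:
  \<open>D powr (\<gamma> - 1)\<close> is only continuous, not Lipschitz, at 0 when
  \<open>\<gamma> < 2\<close>.\<close>

lemma kderiv_increment_bound:
  assumes u: "u \<in> H10 \<Omega>" and b: "b > 0"
  obtains K where "K \<ge> 0" "\<forall>w\<in>H10 \<Omega>. \<forall>v\<in>H10 \<Omega>. hnorm (\<lambda>x. w x - u x) \<le> 1 \<and> hnorm v \<le> 1 \<longrightarrow>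
     \<bar>kderiv a b \<gamma> lam w v - kderiv a b \<gamma> lam u v\<bar>
     \<le> K * hnorm (\<lambda>x. w x - u x) + (K + hnorm (\<lambda>x. w x - u x)) * \<bar>((hnorm w)\<^sup>2) powr (\<gamma> - 1) - ((hnorm u)\<^sup>2) powr (\<gamma> - 1)\<bar> * b"
proof -
  obtain C where C: "C \<ge> 0" "\<forall>u\<in>H10 \<Omega>. \<forall>v\<in>H10 \<Omega>. \<bar>l2inner M u v\<bar> \<le> C * hnorm u * hnorm v"
    "\<forall>u\<in>H10 \<Omega>. (l2norm M u)\<^sup>2 \<le> C * (hnorm u)\<^sup>2"
    by (rule H10_l2inner_bound)
  obtain K0 where K0: "K0 \<ge> 0"
    "\<forall>v\<in>H10 \<Omega>. hnorm v \<le> 1 \<longrightarrow> (\<forall>w\<in>H10 \<Omega>. \<bar>nlin (\<lambda>x. u x + v x) w - nlin u w\<bar> \<le> K0 * hnorm v * hnorm w)"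
    "\<forall>v\<in>H10 \<Omega>. hnorm v \<le> 1 \<longrightarrow>
      \<bar>(\<integral>x. \<bar>u x + v x\<bar> powr p \<partial>M) / p - (\<integral>x. \<bar>u x\<bar> powr p \<partial>M) / p - nlin u v\<bar> \<le> K0 * (hnorm v)\<^sup>2"
    by (rule nlin_estimates[OF u])
  define \<Phi> where "\<Phi> w = ((hnorm w)\<^sup>2) powr (\<gamma> - 1)" for w
  define A where "A = \<bar>a + b * \<Phi> u\<bar>"
  define K where "K = A + \<bar>lam\<bar> * C + K0 + hnorm u"
  have K: "K \<ge> 0" "hnorm u \<le> K" using C(1) K0(1) by (auto simp: K_def A_def)
  have "\<bar>kderiv a b \<gamma> lam w v - kderiv a b \<gamma> lam u v\<bar> \<le> K * hnorm (\<lambda>x. w x - u x) + (K + hnorm (\<lambda>x. w x - u x)) * \<bar>\<Phi> w - \<Phi> u\<bar> * b"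
    if w: "w \<in> H10 \<Omega>" and v: "v \<in> H10 \<Omega>" and t1: "hnorm (\<lambda>x. w x - u x) \<le> 1" and v1: "hnorm v \<le> 1" for w v
  proof -
    define t where "t = (\<lambda>x. w x - u x)"
    have t: "t \<in> H10 \<Omega>" unfolding t_def by (rule H10_diff[OF w u])
    note hu = H10_imp_H1[OF u] and hw = H10_imp_H1[OF w] and hv = H10_imp_H1[OF v] and ht = H10_imp_H1[OF t]
    have ih: "hinner w v = hinner u v + hinner t v" unfolding t_def using hinner_diff_left[OF hw hu hv] by simp
    have il: "l2inner M w v = l2inner M u v + l2inner M t v"
      unfolding t_def using l2inner_diff_left[OF H1D(1)[OF hw] H1D(1)[OF hu] H1D(1)[OF hv]] by simp
    have n: "\<bar>nlin w v - nlin u v\<bar> \<le> K0 * hnorm t * hnorm v"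
      using K0(2)[rule_format, of t v] t v t1 by (simp add: t_def)
    have eq: "kderiv a b \<gamma> lam w v - kderiv a b \<gamma> lam u v
      = (a + b * \<Phi> u) * hinner t v + b * (\<Phi> w - \<Phi> u) * hinner u v + b * (\<Phi> w - \<Phi> u) * hinner t v
        - lam * l2inner M t v - (nlin w v - nlin u v)"
      unfolding kderiv_def ih il \<Phi>_def by (simp add: algebra_simps)
    have le: "x * hnorm v \<le> x" if "x \<ge> 0" for x using v1 that by (simp add: mult_left_le)
    have b1: "\<bar>hinner t v\<bar> \<le> hnorm t"
      using hinner_Cauchy_Schwarz[OF ht hv] le[of "hnorm t"] by simp
    have b2: "\<bar>hinner u v\<bar> \<le> hnorm u"
      using hinner_Cauchy_Schwarz[OF hu hv] le[of "hnorm u"] by simp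
    have b3: "\<bar>l2inner M t v\<bar> \<le> C * hnorm t"
      using C(2)[rule_format, OF t v] le[of "C * hnorm t"] C(1) by simp
    have b4: "\<bar>nlin w v - nlin u v\<bar> \<le> K0 * hnorm t"
      using n le[of "K0 * hnorm t"] K0(1) by simp
    have s1: "\<bar>(a + b * \<Phi> u) * hinner t v\<bar> \<le> A * hnorm t"
      unfolding abs_mult A_def by (intro mult_left_mono b1) simp
    have s2: "\<bar>b * (\<Phi> w - \<Phi> u) * hinner u v\<bar> \<le> b * \<bar>\<Phi> w - \<Phi> u\<bar> * K"
      unfolding abs_mult using b b2 K by (intro mult_mono) auto
    have s3: "\<bar>b * (\<Phi> w - \<Phi> u) * hinner t v\<bar> \<le> b * \<bar>\<Phi> w - \<Phi> u\<bar> * hnorm t"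
      unfolding abs_mult using b b1 by (intro mult_mono) auto
    have s4: "\<bar>lam * l2inner M t v\<bar> \<le> \<bar>lam\<bar> * (C * hnorm t)"
      unfolding abs_mult by (intro mult_left_mono b3) simp
    have "\<bar>kderiv a b \<gamma> lam w v - kderiv a b \<gamma> lam u v\<bar>
      \<le> A * hnorm t + b * \<bar>\<Phi> w - \<Phi> u\<bar> * K + b * \<bar>\<Phi> w - \<Phi> u\<bar> * hnorm t + \<bar>lam\<bar> * (C * hnorm t) + K0 * hnorm t"
      unfolding eq by (rule abs_sum5_le[OF s1 s2 s3 s4 b4])
    also have "\<dots> = (A + \<bar>lam\<bar> * C + K0) * hnorm t + (K + hnorm t) * \<bar>\<Phi> w - \<Phi> u\<bar> * b"
      by (simp add: algebra_simps)
    also have "\<dots> \<le> K * hnorm t + (K + hnorm t) * \<bar>\<Phi> w - \<Phi> u\<bar> * b"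
      by (intro add_right_mono mult_right_mono) (auto simp: K_def)
    finally show ?thesis by (simp add: t_def)
  qed
  then show ?thesis using that[OF K(1)] unfolding \<Phi>_def by blast
qed

lemma kirchhoff_C1:
  assumes b: "b > 0" and \<gamma>: "\<gamma> > 1"
  shows "H10_C1 \<Omega> (kirchhoff_functional \<Omega> a b \<gamma> lam)"
  unfolding H10_C1_def
proof (intro conjI ballI allI impI)
  fix u assume u: "u \<in> H10 \<Omega>"
  show "\<exists>L. H10_has_derivative \<Omega> (kirchhoff_functional \<Omega> a b \<gamma> lam) L u"
    using kirchhoff_has_derivative[OF u b \<gamma>] by blast
  fix \<epsilon> :: real assume \<epsilon>: "\<epsilon> > 0"
  obtain K where K: "K \<ge> 0" "\<forall>w\<in>H10 \<Omega>. \<forall>v\<in>H10 \<Omega>. hnorm (\<lambda>x. w x - u x) \<le> 1 \<and> hnorm v \<le> 1 \<longrightarrow>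
     \<bar>kderiv a b \<gamma> lam w v - kderiv a b \<gamma> lam u v\<bar>
     \<le> K * hnorm (\<lambda>x. w x - u x) + (K + hnorm (\<lambda>x. w x - u x)) * \<bar>((hnorm w)\<^sup>2) powr (\<gamma> - 1) - ((hnorm u)\<^sup>2) powr (\<gamma> - 1)\<bar> * b"
    by (rule kderiv_increment_bound[OF u b])
  \<comment> \<open>So that \<open>(K + 1) * b * \<eta> = \<epsilon> / 4\<close>; another quarter is
    spent on the Lipschitz part.\<close>
  define \<eta> where "\<eta> = \<epsilon> / (4 * ((K + 1) * b))"
  have Kb: "(K + 1) * b > 0" using K(1) b by simp
  have \<eta>: "\<eta> > 0" using \<epsilon> Kb by (simp add: \<eta>_def)
  have "isCont (\<lambda>x. (x\<^sup>2) powr (\<gamma> - 1)) (hnorm u)"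
    unfolding isCont_def using \<gamma> by (intro tendsto_powr' tendsto_intros) auto
  then obtain r where r: "r > 0" "\<And>x. \<bar>x - hnorm u\<bar> < r \<Longrightarrow> \<bar>(x\<^sup>2) powr (\<gamma> - 1) - ((hnorm u)\<^sup>2) powr (\<gamma> - 1)\<bar> < \<eta>"
    using \<eta> unfolding continuous_at_eps_delta dist_real_def by blast
  define \<delta> where "\<delta> = min 1 (min r (\<epsilon> / (4 * (K + 1))))"
  show "\<exists>\<delta>>0. \<forall>w\<in>H10 \<Omega>. hnorm (\<lambda>x. w x - u x) < \<delta> \<longrightarrow>
    H10_dual_norm \<Omega> (\<lambda>v. H10_derivative \<Omega> (kirchhoff_functional \<Omega> a b \<gamma> lam) w v - H10_derivative \<Omega> (kirchhoff_functional \<Omega> a b \<gamma> lam) u v) < \<epsilon>"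
  proof (intro exI[of _ \<delta>] conjI ballI impI)
    show "\<delta> > 0" using r(1) \<epsilon> K(1) by (simp add: \<delta>_def)
    fix w assume w: "w \<in> H10 \<Omega>" and hw: "hnorm (\<lambda>x. w x - u x) < \<delta>"
    define h where "h = hnorm (\<lambda>x. w x - u x)"
    have h: "0 \<le> h" "h \<le> 1" "h < r" "h < \<epsilon> / (4 * (K + 1))" using hw by (auto simp: h_def \<delta>_def)
    define q where "q = \<bar>((hnorm w)\<^sup>2) powr (\<gamma> - 1) - ((hnorm u)\<^sup>2) powr (\<gamma> - 1)\<bar>"
    have "\<bar>hnorm w - hnorm u\<bar> \<le> h"
      unfolding h_def by (rule hnorm_le_diff[OF H10_imp_H1[OF w] H10_imp_H1[OF u]])
    with h have q: "q < \<eta>" unfolding q_def by (intro r(2)) simp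
    have q0: "q \<ge> 0" by (simp add: q_def)
    have "H10_dual_norm \<Omega> (\<lambda>v. H10_derivative \<Omega> (kirchhoff_functional \<Omega> a b \<gamma> lam) w v - H10_derivative \<Omega> (kirchhoff_functional \<Omega> a b \<gamma> lam) u v)
      \<le> K * h + (K + h) * q * b"
    proof (rule H10_dual_norm_le)
      fix v assume v: "v \<in> H10 \<Omega>" "hnorm v \<le> 1"
      show "\<bar>H10_derivative \<Omega> (kirchhoff_functional \<Omega> a b \<gamma> lam) w v - H10_derivative \<Omega> (kirchhoff_functional \<Omega> a b \<gamma> lam) u v\<bar>
        \<le> K * h + (K + h) * q * b"
        unfolding kirchhoff_derivative[OF w b \<gamma> v(1)] kirchhoff_derivative[OF u b \<gamma> v(1)]
        using K(2) w v h(2) by (simp add: h_def q_def)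
    qed
    also have "\<dots> \<le> (K + 1) * h + (K + 1) * b * q"
    proof (rule add_mono)
      show "K * h \<le> (K + 1) * h" using h(1) by (simp add: mult_right_mono)
      have "(K + h) * (q * b) \<le> (K + 1) * (q * b)" using h q0 b by (intro mult_right_mono) auto
      then show "(K + h) * q * b \<le> (K + 1) * b * q" by (simp add: mult_ac)
    qed
    also have "\<dots> < \<epsilon> / 4 + \<epsilon> / 4"
    proof (rule add_strict_mono)
      show "(K + 1) * h < \<epsilon> / 4" using h(4) K(1) by (simp add: field_simps)
      show "(K + 1) * b * q < \<epsilon> / 4" using q Kb unfolding \<eta>_def by (simp add: field_simps)
    qed
    also have "\<dots> < \<epsilon>" using \<epsilon> by simp
    finally show "H10_dual_norm \<Omega> (\<lambda>v. H10_derivative \<Omega> (kirchhoff_functional \<Omega> a b \<gamma> lam) w v - H10_derivative \<Omega> (kirchhoff_functional \<Omega> a b \<gamma> lam) u v) < \<epsilon>" .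
  qed
qed

end

subsection \<open>The Palais--Smale condition\<close>

text \<open>Applied with \<open>q = p / 2\<close>. Young's inequality bounds \<open>a + Y\<close>
  from below by \<open>W\<close>, and the weights \<open>\<theta>\<close>, \<open>\<theta>'\<close>
  are those for which \<open>W\<close> carries the same power \<open>X powr (q - 1)\<close> as the
  left side. What remains is free of X: it is the root of order \<open>\<gamma> - 1\<close> of the
  hypothesis.\<close>

lemma threshold_inequality:
  fixes a b \<gamma> q S X :: real
  assumes a: "a \<ge> 0" and b: "b > 0" and q: "q > 1" and \<gamma>: "\<gamma> > q" and S: "S > 0" and X: "X > 0"
    and hyp: "a powr (\<gamma> - q) * b powr (q - 1)
         > (\<gamma> - q) powr (\<gamma> - q) * (q - 1) powr (q - 1) / (\<gamma> - 1) powr (\<gamma> - 1) * S powr (- q * (\<gamma> - 1))"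
  shows "S powr (- q) * X powr q < (a + b * X powr (\<gamma> - 1)) * X"
proof -
  have g1: "\<gamma> - 1 > 0" "\<gamma> - q > 0" "q - 1 > 0" using q \<gamma> by auto
  \<comment> \<open>\<open>0 powr x\<close> is 0, so \<open>a = 0\<close> would make the left side
    of \<open>hyp\<close> vanish, while its right side is nonnegative.\<close>
  have "a \<noteq> 0"
  proof
    assume "a = 0"
    with hyp have "(\<gamma> - q) powr (\<gamma> - q) * (q - 1) powr (q - 1) / (\<gamma> - 1) powr (\<gamma> - 1) * S powr (- q * (\<gamma> - 1)) < 0"
      by simp
    moreover have "0 \<le> (\<gamma> - q) powr (\<gamma> - q) * (q - 1) powr (q - 1) / (\<gamma> - 1) powr (\<gamma> - 1) * S powr (- q * (\<gamma> - 1))"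
      by simp
    ultimately show False by linarith
  qed
  with a have a0: "a > 0" by simp
  define \<theta> where "\<theta> = (\<gamma> - q) / (\<gamma> - 1)"
  define \<theta>' where "\<theta>' = (q - 1) / (\<gamma> - 1)"
  have \<theta>: "\<theta> > 0" "\<theta>' > 0" "\<theta> + \<theta>' = 1"
    using g1 by (auto simp: \<theta>_def \<theta>'_def add_divide_distrib[symmetric])
  define Y where "Y = b * X powr (\<gamma> - 1)"
  have Y: "Y > 0" using b X by (simp add: Y_def)
  define W where "W = (a / \<theta>) powr \<theta> * (Y / \<theta>') powr \<theta>'"
  have W0: "W > 0" using a0 Y \<theta> by (simp add: W_def)
  have "W \<le> \<theta> * (a / \<theta>) + \<theta>' * (Y / \<theta>')"
    unfolding W_def using a0 Y \<theta> by (intro Youngs_inequality_0) auto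
  also have "\<dots> = a + Y" using \<theta> by simp
  finally have WaY: "W \<le> a + Y" .
  \<comment> \<open>In logarithms the comparison is linear, and multiplication by
    \<open>\<gamma> - 1\<close> clears the denominators of the weights.\<close>
  define A B G H F L T where "A = ln a" and "B = ln b" and "G = ln (\<gamma> - q)" and "H = ln (q - 1)"
    and "F = ln (\<gamma> - 1)" and "L = ln S" and "T = ln X"
  have "ln (a powr (\<gamma> - q) * b powr (q - 1))
      > ln ((\<gamma> - q) powr (\<gamma> - q) * (q - 1) powr (q - 1) / (\<gamma> - 1) powr (\<gamma> - 1) * S powr (- q * (\<gamma> - 1)))"
    using hyp a0 b g1 S by (subst ln_less_cancel_iff) auto
  moreover have "ln (a powr (\<gamma> - q) * b powr (q - 1)) = (\<gamma> - q) * A + (q - 1) * B"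
    using a0 b by (simp add: ln_mult ln_powr A_def B_def)
  moreover have "ln ((\<gamma> - q) powr (\<gamma> - q) * (q - 1) powr (q - 1) / (\<gamma> - 1) powr (\<gamma> - 1) * S powr (- q * (\<gamma> - 1)))
      = (\<gamma> - q) * G + (q - 1) * H - (\<gamma> - 1) * F - q * (\<gamma> - 1) * L"
    using g1 S by (simp add: ln_mult ln_div ln_powr G_def H_def F_def L_def)
  ultimately have lnh: "(\<gamma> - q) * G + (q - 1) * H - (\<gamma> - 1) * F - q * (\<gamma> - 1) * L < (\<gamma> - q) * A + (q - 1) * B" by simp
  have "ln W = \<theta> * (A - (G - F)) + \<theta>' * (B + (\<gamma> - 1) * T - (H - F))"
    using a0 b X g1 \<theta> unfolding W_def Y_def
    by (simp add: ln_mult ln_div ln_powr \<theta>_def \<theta>'_def A_def B_def G_def H_def F_def T_def diff_diff_eq2)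
  then have "(\<gamma> - 1) * ln W = (\<gamma> - q) * (A - (G - F)) + (q - 1) * (B + (\<gamma> - 1) * T - (H - F))"
    using g1 by (simp add: \<theta>_def \<theta>'_def distrib_left)
  also have "\<dots> = ((\<gamma> - q) * A + (q - 1) * B) - ((\<gamma> - q) * G + (q - 1) * H - (\<gamma> - 1) * F) + (q - 1) * (\<gamma> - 1) * T"
    by (simp add: algebra_simps)
  also have "\<dots> > - q * (\<gamma> - 1) * L + (q - 1) * (\<gamma> - 1) * T" using lnh by simp
  finally have "(\<gamma> - 1) * (- q * L + (q - 1) * T) < (\<gamma> - 1) * ln W" by (simp add: algebra_simps)
  then have "- q * L + (q - 1) * T < ln W" using g1 by simp
  moreover have "ln (S powr (- q) * X powr (q - 1)) = - q * L + (q - 1) * T"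
    using S X by (simp add: ln_mult ln_powr L_def T_def)
  ultimately have "ln (S powr (- q) * X powr (q - 1)) < ln W" by simp
  then have "S powr (- q) * X powr (q - 1) < W" using S X W0 by (subst (asm) ln_less_cancel_iff) auto
  with WaY have "S powr (- q) * X powr (q - 1) < a + Y" by simp
  then have "S powr (- q) * X powr (q - 1) * X < (a + Y) * X" using X by simp
  moreover have "X powr (q - 1) * X = X powr q" using X by (simp add: powr_diff)
  ultimately show ?thesis by (simp add: Y_def mult.assoc)
qed

text \<open>After division by \<open>D powr \<gamma>\<close> the lower-order terms tend to 0 as D
  grows, because \<open>\<gamma>\<close> exceeds both 1 and q.\<close>

lemma coercive_bound:
  fixes \<beta> A B c \<gamma> q :: real
  assumes \<beta>: "\<beta> > 0" and q: "q > 1" and \<gamma>: "\<gamma> > q"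
  obtains R where "\<forall>D\<ge>0. \<beta> * D powr \<gamma> - A * D - B * D powr q \<le> c \<longrightarrow> D \<le> R"
proof -
  have 1: "((\<lambda>D::real. A * D powr (1 - \<gamma>) + B * D powr (q - \<gamma>)) \<longlongrightarrow> A * 0 + B * 0) at_top"
    using q \<gamma> by (intro tendsto_intros tendsto_neg_powr filterlim_ident) auto
  have "\<forall>\<^sub>F D in at_top. A * D powr (1 - \<gamma>) + B * D powr (q - \<gamma>) < \<beta> / 2"
    using order_tendstoD(2)[OF 1, of "\<beta> / 2"] \<beta> by simp
  moreover have "filterlim (\<lambda>D::real. D powr \<gamma>) at_top at_top"
    using q \<gamma> by (intro real_powr_at_top) auto
  then have "\<forall>\<^sub>F D in at_top. D powr \<gamma> > 2 * \<bar>c\<bar> / \<beta>"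
    by (simp add: filterlim_at_top_dense)
  moreover have "\<forall>\<^sub>F D::real in at_top. D > 0" by (rule eventually_gt_at_top)
  ultimately have "\<forall>\<^sub>F D::real in at_top. \<beta> * D powr \<gamma> - A * D - B * D powr q > c"
  proof eventually_elim
    case (elim D)
    have "D powr \<gamma> * D powr (1 - \<gamma>) = D" "D powr \<gamma> * D powr (q - \<gamma>) = D powr q"
      using elim(3) by (simp_all flip: powr_add)
    then have "\<beta> * D powr \<gamma> - A * D - B * D powr q = D powr \<gamma> * (\<beta> - (A * D powr (1 - \<gamma>) + B * D powr (q - \<gamma>)))"
      by (simp add: right_diff_distrib distrib_left mult.commute mult.left_commute)
    moreover have "D powr \<gamma> * (\<beta> - (A * D powr (1 - \<gamma>) + B * D powr (q - \<gamma>))) \<ge> D powr \<gamma> * (\<beta> / 2)"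
      using elim(1) by (intro mult_left_mono) auto
    moreover have "D powr \<gamma> * (\<beta> / 2) > \<bar>c\<bar>" using elim(2) \<beta> by (simp add: field_simps)
    ultimately show ?case by linarith
  qed
  then obtain R where R: "\<And>D. D \<ge> R \<Longrightarrow> \<beta> * D powr \<gamma> - A * D - B * D powr q > c"
    by (auto simp: eventually_at_top_linorder)
  show ?thesis
  proof (rule that[of R], intro allI impI)
    fix D assume "D \<ge> 0" "\<beta> * D powr \<gamma> - A * D - B * D powr q \<le> c"
    then show "D \<le> R" using R[of D] by linarith
  qed
qed

text \<open>Split at \<open>\<bar>w\<bar> = R * \<bar>u\<bar>\<close>. A large R makes the
  coefficient of \<open>\<bar>w\<bar> powr p\<close> small, while the large coefficient falls on u,
  which later is a fixed function and serves as majorant.\<close>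

lemma mixed_term_bound:
  fixes u w p R :: real
  assumes p: "p > 2" and R: "R \<ge> 1"
  shows "(\<bar>w\<bar> + \<bar>u\<bar>) powr (p - 2) * \<bar>u\<bar> * \<bar>w\<bar>
    \<le> 2 powr (p - 2) / R * \<bar>w\<bar> powr p + (R + 1) powr (p - 2) * R * \<bar>u\<bar> powr p"
proof -
  have pw: "x powr (p - 2) * x * x = x powr p" if "x \<ge> 0" for x :: real
  proof (cases "x = 0")
    case False
    then have "x powr p = x powr (p - 2) * x powr 2" by (simp only: powr_add[symmetric]) simp
    then show ?thesis using False that by (simp add: power2_eq_square)
  qed (use p in simp)
  show ?thesis
  proof (cases "\<bar>w\<bar> \<le> R * \<bar>u\<bar>")
    case True
    have "(\<bar>w\<bar> + \<bar>u\<bar>) powr (p - 2) * \<bar>u\<bar> * \<bar>w\<bar> \<le> ((R + 1) * \<bar>u\<bar>) powr (p - 2) * \<bar>u\<bar> * (R * \<bar>u\<bar>)"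
      using True p R by (intro mult_mono powr_mono2) (auto simp: algebra_simps)
    also have "\<dots> = (R + 1) powr (p - 2) * R * (\<bar>u\<bar> powr (p - 2) * \<bar>u\<bar> * \<bar>u\<bar>)"
      using R by (simp add: powr_mult)
    also have "\<dots> = (R + 1) powr (p - 2) * R * \<bar>u\<bar> powr p" by (simp add: pw)
    also have "\<dots> \<le> 2 powr (p - 2) / R * \<bar>w\<bar> powr p + (R + 1) powr (p - 2) * R * \<bar>u\<bar> powr p"
      using R by simp
    finally show ?thesis .
  next
    case False
    have uw: "\<bar>u\<bar> \<le> \<bar>w\<bar> / R" using False R by (simp add: field_simps)
    have "\<bar>w\<bar> / R \<le> \<bar>w\<bar>" using mult_right_mono[OF R, of "\<bar>w\<bar>"] R by (simp add: divide_le_eq mult.commute)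
    with uw have "(\<bar>w\<bar> + \<bar>u\<bar>) powr (p - 2) * \<bar>u\<bar> * \<bar>w\<bar> \<le> (2 * \<bar>w\<bar>) powr (p - 2) * (\<bar>w\<bar> / R) * \<bar>w\<bar>"
      using p R by (intro mult_mono powr_mono2) auto
    also have "\<dots> = 2 powr (p - 2) / R * (\<bar>w\<bar> powr (p - 2) * \<bar>w\<bar> * \<bar>w\<bar>)"
      by (simp add: powr_mult)
    also have "\<dots> = 2 powr (p - 2) / R * \<bar>w\<bar> powr p" by (simp add: pw)
    also have "\<dots> \<le> 2 powr (p - 2) / R * \<bar>w\<bar> powr p + (R + 1) powr (p - 2) * R * \<bar>u\<bar> powr p"
      using R by simp
    finally show ?thesis .
  qed
qed

section \<open>Passage to the limit along a Palais--Smale sequence\<close>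

context sobolev_domain
begin

text \<open>The mechanism of the Brezis--Lieb lemma: up to a small multiple of \<open>\<bar>w n\<bar> powr p\<close>, the
  integrand is dominated by a multiple of \<open>\<bar>u\<bar> powr p\<close>.\<close>

lemma mixed_term_tendsto_0:
  assumes u: "u \<in> H10 \<Omega>" and w: "\<And>n. w n \<in> H10 \<Omega>" and B: "\<And>n. hnorm (w n) \<le> B"
    and lim: "AE x in M. (\<lambda>n. w n x) \<longlonglongrightarrow> 0"
  shows "(\<lambda>n. \<integral>x. (\<bar>w n x\<bar> + \<bar>u x\<bar>) powr (p - 2) * \<bar>u x\<bar> * \<bar>w n x\<bar> \<partial>M) \<longlonglongrightarrow> 0"
proof (rule LIMSEQ_I)
  fix e :: real assume e: "e > 0"
  define g where "g n x = (\<bar>w n x\<bar> + \<bar>u x\<bar>) powr (p - 2) * \<bar>u x\<bar> * \<bar>w n x\<bar>" for n x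
  have [measurable]: "u \<in> borel_measurable M" "w n \<in> borel_measurable M" for n
    using u w by (auto intro: H10_measurable)
  have gi: "integrable M (g n)" for n
    unfolding g_def by (rule trilinear_integrable(1)[OF w u w])
  have g0: "g n x \<ge> 0" for n x by (simp add: g_def)
  define W where "W = Sp * \<bar>B\<bar> powr p + 1"
  have W: "W > 0" using Sp_pos by (simp add: W_def add_nonneg_pos)
  have wW: "(\<integral>x. \<bar>w n x\<bar> powr p \<partial>M) \<le> W" for n
  proof -
    have "hnorm (w n) powr p \<le> \<bar>B\<bar> powr p" using B[of n] p_gt_2 by (intro powr_mono2) auto
    then have "Sp * hnorm (w n) powr p \<le> Sp * \<bar>B\<bar> powr p" using Sp_pos by (intro mult_left_mono) auto
    then show ?thesis using H10_powr_bound[OF w[of n]] by (simp add: W_def)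
  qed
  \<comment> \<open>Large enough that \<open>\<theta> * W < e / 2\<close>: the part not covered by
    the majorant has a small integral, uniformly in n.\<close>
  define R where "R = 1 + 2 powr (p - 2) * (2 * W) / e"
  have R: "R \<ge> 1" using e W by (simp add: R_def)
  define \<theta> where "\<theta> = 2 powr (p - 2) / R"
  have \<theta>: "\<theta> \<ge> 0" using R by (simp add: \<theta>_def)
  have "2 powr (p - 2) * (2 * W) < e * R" using e by (simp add: R_def distrib_left)
  then have \<theta>W: "\<theta> * W < e / 2" using R by (simp add: \<theta>_def field_simps)
  define K where "K = (R + 1) powr (p - 2) * R"
  \<comment> \<open>The positive part of the excess is dominated by
    \<open>K * \<bar>u\<bar> powr p\<close> and tends to 0 pointwise, so dominated convergence
    applies to it.\<close>
  define f where "f n x = max 0 (g n x - \<theta> * \<bar>w n x\<bar> powr p)" for n x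
  have fm: "f n \<in> borel_measurable M" for n unfolding f_def g_def by measurable
  have "(\<lambda>n. \<integral>x. f n x \<partial>M) \<longlonglongrightarrow> (\<integral>x. 0 \<partial>M)"
  proof (rule integral_dominated_convergence[where w = "\<lambda>x. K * \<bar>u x\<bar> powr p"])
    show "integrable M (\<lambda>x. K * \<bar>u x\<bar> powr p)" by (intro integrable_mult_right H10_integrable_powr u)
    show "AE x in M. norm (f n x) \<le> K * \<bar>u x\<bar> powr p" for n
    proof (rule AE_I2)
      fix x
      have "K * \<bar>u x\<bar> powr p \<ge> 0" using R by (simp add: K_def)
      moreover have "g n x \<le> \<theta> * \<bar>w n x\<bar> powr p + K * \<bar>u x\<bar> powr p"
        unfolding g_def \<theta>_def K_def by (rule mixed_term_bound[OF p_gt_2 R])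
      ultimately show "norm (f n x) \<le> K * \<bar>u x\<bar> powr p" by (simp add: f_def)
    qed
    show "AE x in M. (\<lambda>n. f n x) \<longlonglongrightarrow> 0"
      using lim
    proof eventually_elim
      case (elim x)
      have "(\<lambda>n. f n x) \<longlonglongrightarrow> max 0 ((\<bar>0\<bar> + \<bar>u x\<bar>) powr (p - 2) * \<bar>u x\<bar> * \<bar>0\<bar> - \<theta> * \<bar>0\<bar> powr p)"
        unfolding f_def g_def using p_gt_2
        by (intro tendsto_max tendsto_diff tendsto_mult tendsto_powr' tendsto_add tendsto_rabs tendsto_const elim) auto
      then show ?case using p_gt_2 by simp
    qed
  qed (use fm in simp_all)
  then have "(\<lambda>n. \<integral>x. f n x \<partial>M) \<longlonglongrightarrow> 0" by simp
  then have "\<forall>\<^sub>F n in sequentially. (\<integral>x. f n x \<partial>M) < e / 2" using e by (intro order_tendstoD) auto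
  then obtain N where N: "\<And>n. n \<ge> N \<Longrightarrow> (\<integral>x. f n x \<partial>M) < e / 2" by (auto simp: eventually_sequentially)
  have fi: "integrable M (f n)" for n
    unfolding f_def by (intro integrable_max integrable_zero Bochner_Integration.integrable_diff gi integrable_mult_right H10_integrable_powr w)
  have "(\<integral>x. g n x \<partial>M) < e" if n: "n \<ge> N" for n
  proof -
    have "(\<integral>x. g n x \<partial>M) \<le> (\<integral>x. f n x + \<theta> * \<bar>w n x\<bar> powr p \<partial>M)"
      by (intro integral_mono gi Bochner_Integration.integrable_add fi integrable_mult_right H10_integrable_powr w)
        (simp add: f_def)
    also have "\<dots> = (\<integral>x. f n x \<partial>M) + \<theta> * (\<integral>x. \<bar>w n x\<bar> powr p \<partial>M)"
      using fi[of n] H10_integrable_powr[OF w[of n]] by simp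
    also have "\<dots> \<le> (\<integral>x. f n x \<partial>M) + \<theta> * W"
      using wW[of n] \<theta> by (intro add_left_mono mult_left_mono)
    also have "\<dots> < e" using N[OF n] \<theta>W by linarith
    finally show ?thesis .
  qed
  moreover have "(\<integral>x. g n x \<partial>M) \<ge> 0" for n using g0 by (intro integral_nonneg_AE AE_I2) auto
  ultimately show "\<exists>no. \<forall>n\<ge>no. norm ((\<integral>x. (\<bar>w n x\<bar> + \<bar>u x\<bar>) powr (p - 2) * \<bar>u x\<bar> * \<bar>w n x\<bar> \<partial>M) - 0) < e"
    unfolding g_def by (intro exI[of _ N]) auto
qed

text \<open>Moving the argument from \<open>w + u\<close> to \<open>w\<close> costs an increment of
  \<open>spowr\<close>, which yields the mixed term; at \<open>w\<close> the integrand is exactly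
  \<open>\<bar>w\<bar> powr p\<close>. An upper bound is enough, since the derivative identity will
  supply the limit of the left side.\<close>

lemma nlin_le_powr_plus_mixed:
  assumes u: "u \<in> H10 \<Omega>" and w: "w \<in> H10 \<Omega>"
  shows "nlin (\<lambda>x. w x + u x) w \<le> (\<integral>x. \<bar>w x\<bar> powr p \<partial>M)
    + (p - 1) * (\<integral>x. (\<bar>w x\<bar> + \<bar>u x\<bar>) powr (p - 2) * \<bar>u x\<bar> * \<bar>w x\<bar> \<partial>M)"
proof -
  have wu: "(\<lambda>x. w x + u x) \<in> H10 \<Omega>" by (rule H10_add[OF w u])
  note i = H10_integrable_powr[OF w] trilinear_integrable(1)[OF w u w]
  have "nlin (\<lambda>x. w x + u x) w
      \<le> (\<integral>x. \<bar>w x\<bar> powr p + (p - 1) * ((\<bar>w x\<bar> + \<bar>u x\<bar>) powr (p - 2) * \<bar>u x\<bar> * \<bar>w x\<bar>) \<partial>M)"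
    unfolding nlin_def
  proof (rule integral_mono)
    show "integrable M (\<lambda>x. spowr (p - 1) (w x + u x) * w x)" by (rule nlin_integrable[OF wu w])
    show "integrable M (\<lambda>x. \<bar>w x\<bar> powr p + (p - 1) * ((\<bar>w x\<bar> + \<bar>u x\<bar>) powr (p - 2) * \<bar>u x\<bar> * \<bar>w x\<bar>))"
      using i by (intro Bochner_Integration.integrable_add integrable_mult_right)
    fix x
    have "spowr (p - 1) (w x) * w x = \<bar>w x\<bar> powr p"
      by (cases "w x = 0") (auto simp: spowr_def powr_diff sgn_if)
    moreover have "(spowr (p - 1) (w x + u x) - spowr (p - 1) (w x)) * w x
        \<le> \<bar>spowr (p - 1) (w x + u x) - spowr (p - 1) (w x)\<bar> * \<bar>w x\<bar>"
      by (metis abs_ge_self abs_mult)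
    moreover have "\<bar>spowr (p - 1) (w x + u x) - spowr (p - 1) (w x)\<bar> * \<bar>w x\<bar>
        \<le> ((p - 1) * (\<bar>w x\<bar> + \<bar>u x\<bar>) powr (p - 2) * \<bar>u x\<bar>) * \<bar>w x\<bar>"
      by (rule mult_right_mono[OF spowr_increment[OF p_gt_2]]) simp
    ultimately show "spowr (p - 1) (w x + u x) * w x
        \<le> \<bar>w x\<bar> powr p + (p - 1) * ((\<bar>w x\<bar> + \<bar>u x\<bar>) powr (p - 2) * \<bar>u x\<bar> * \<bar>w x\<bar>)"
      by (simp add: left_diff_distrib mult.assoc)
  qed
  also have "\<dots> = (\<integral>x. \<bar>w x\<bar> powr p \<partial>M)
    + (p - 1) * (\<integral>x. (\<bar>w x\<bar> + \<bar>u x\<bar>) powr (p - 2) * \<bar>u x\<bar> * \<bar>w x\<bar> \<partial>M)"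
    using i by simp
  finally show ?thesis .
qed

text \<open>In the variable \<open>D = (hnorm u)\<^sup>2\<close> the term
  \<open>D powr \<gamma>\<close> dominates both the linear term and the Sobolev bound
  \<open>D powr (p / 2)\<close>; the term with a is dropped by its sign. Palais--Smale sequences are
  thus bounded by their energies alone.\<close>

lemma kirchhoff_sublevel_bounded:
  assumes a: "a \<ge> 0" and b: "b > 0" and \<gamma>: "\<gamma> > p / 2" and lam: "lam > 0"
  obtains R where "\<forall>u\<in>H10 \<Omega>. kirchhoff_functional \<Omega> a b \<gamma> lam u \<le> c \<longrightarrow> hnorm u \<le> R"
proof -
  obtain C where C: "C \<ge> 0" "\<forall>u\<in>H10 \<Omega>. \<forall>v\<in>H10 \<Omega>. \<bar>l2inner M u v\<bar> \<le> C * hnorm u * hnorm v"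
    "\<forall>u\<in>H10 \<Omega>. (l2norm M u)\<^sup>2 \<le> C * (hnorm u)\<^sup>2"
    by (rule H10_l2inner_bound)
  have g: "\<gamma> > 0" "p / 2 > 1" using \<gamma> p_gt_2 by auto
  obtain R where R: "\<forall>D\<ge>0. b / (2 * \<gamma>) * D powr \<gamma> - (lam / 2 * C) * D - (Sp / p) * D powr (p / 2) \<le> c \<longrightarrow> D \<le> R"
    by (rule coercive_bound[of "b / (2 * \<gamma>)" "p / 2" \<gamma> "lam / 2 * C" "Sp / p" c]) (use b g \<gamma> in auto)
  have "hnorm u \<le> sqrt R" if u: "u \<in> H10 \<Omega>" and J: "kirchhoff_functional \<Omega> a b \<gamma> lam u \<le> c" for u
  proof -
    define D where "D = (hnorm u)\<^sup>2"
    have D: "D \<ge> 0" by (simp add: D_def)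
    have "lam / 2 * (l2norm M u)\<^sup>2 \<le> lam / 2 * (C * D)"
      using C(3) u lam by (intro mult_left_mono) (auto simp: D_def)
    moreover have "(\<integral>x. \<bar>u x\<bar> powr p \<partial>M) / p \<le> Sp * D powr (p / 2) / p"
      using H10_powr_bound[OF u] p_gt_2 by (intro divide_right_mono) (auto simp: D_def powr_hnorm)
    moreover have "0 \<le> a / 2 * D" using a D by simp
    moreover have "(lam / 2 * C) * D = lam / 2 * (C * D)" "(Sp / p) * D powr (p / 2) = Sp * D powr (p / 2) / p" by simp_all
    ultimately have "b / (2 * \<gamma>) * D powr \<gamma> - (lam / 2 * C) * D - (Sp / p) * D powr (p / 2) \<le> c"
      using J unfolding kirchhoff_eq D_def[symmetric] by linarith
    with R D have "D \<le> R" by blast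
    then show ?thesis unfolding D_def by (rule real_le_rsqrt)
  qed
  then show ?thesis using that by blast
qed

text \<open>The size condition on a and b enters through \<open>threshold\<close> alone, which is
  contradicted unless the norms of \<open>u j - v\<close> tend to 0 along the subsequence.\<close>

lemma kirchhoff_PS:
  assumes a: "a \<ge> 0" and b: "b > 0" and \<gamma>: "\<gamma> > p / 2" and lam: "lam > 0"
    and threshold: "\<And>X. X > 0 \<Longrightarrow> Sp * X powr (p / 2) < (a + b * X powr (\<gamma> - 1)) * X"
  shows "PS_condition \<Omega> (kirchhoff_functional \<Omega> a b \<gamma> lam) c"
  unfolding PS_condition_def
proof (intro conjI allI impI)
  define J where "J = kirchhoff_functional \<Omega> a b \<gamma> lam"
  have \<gamma>1: "\<gamma> > 1" using \<gamma> p_gt_2 by simp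
  show "H10_C1 \<Omega> (kirchhoff_functional \<Omega> a b \<gamma> lam)" by (rule kirchhoff_C1[OF b \<gamma>1])
  fix u :: "nat \<Rightarrow> 'a \<Rightarrow> real"
  assume PS: "(\<forall>j. u j \<in> H10 \<Omega>) \<and> (\<lambda>j. kirchhoff_functional \<Omega> a b \<gamma> lam (u j)) \<longlonglongrightarrow> c
    \<and> (\<lambda>j. H10_dual_norm \<Omega> (H10_derivative \<Omega> (kirchhoff_functional \<Omega> a b \<gamma> lam) (u j))) \<longlonglongrightarrow> 0"
  have u: "u j \<in> H10 \<Omega>" for j using PS by blast
  have "Bseq (\<lambda>j. J (u j))" using PS by (auto simp: J_def intro: convergent_imp_Bseq convergentI)
  then obtain c1 where c1: "\<And>j. J (u j) \<le> c1" by (auto simp: Bseq_def abs_le_iff)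
  obtain R where R: "\<forall>u\<in>H10 \<Omega>. kirchhoff_functional \<Omega> a b \<gamma> lam u \<le> c1 \<longrightarrow> hnorm u \<le> R"
    by (rule kirchhoff_sublevel_bounded[OF a b \<gamma> lam])
  have uR: "hnorm (u j) \<le> R" for j using R u c1 by (auto simp: J_def)
  obtain r1 v where r1: "strict_mono r1" and v2: "square_integrable M v" "(\<lambda>n. l2norm M (\<lambda>x. u (r1 n) x - v x)) \<longlonglongrightarrow> 0"
    by (rule Rellich[OF u uR])
  have v: "v \<in> H10 \<Omega>" by (rule l2_limit_in_H10[where u = "\<lambda>n. u (r1 n)", OF u uR v2])
  obtain r2 :: "nat \<Rightarrow> nat" where r2: "strict_mono r2" "AE x in M. (\<lambda>n. u (r1 (r2 n)) x) \<longlonglongrightarrow> v x"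
    by (rule l2_AE_subseq[where f = "\<lambda>n. u (r1 n)", OF H1D(1)[OF H10_imp_H1[OF u]] v2])
  \<comment> \<open>Strong convergence is still open. A third subsequence makes the distances to v
    converge to some \<open>X0\<close>, whose vanishing is the aim.\<close>
  define d where "d n = hnorm (\<lambda>x. u (r1 (r2 n)) x - v x)" for n
  have dB: "d n \<le> R + hnorm v" for n
    using hnorm_triangle[OF H10_imp_H1[OF u[of "r1 (r2 n)"]] H1_cmult(1)[OF H10_imp_H1[OF v], of "- 1"]]
      hnorm_cmult[OF H10_imp_H1[OF v], of "- 1"] uR[of "r1 (r2 n)"] by (simp add: d_def)
  have "bounded (range d)"
    using dB by (auto simp: bounded_iff d_def intro!: exI[of _ "R + hnorm v"])
  then obtain X0 r3 where r3: "strict_mono r3" "(d \<circ> r3) \<longlonglongrightarrow> X0"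
    using bounded_imp_convergent_subsequence by blast
  define r where "r = r1 \<circ> r2 \<circ> r3"
  have r: "strict_mono r" unfolding r_def by (intro strict_mono_o r1 r2 r3)
  define U where "U = (\<lambda>n. u (r n))"
  define w where "w = (\<lambda>n x. U n x - v x)"
  have U: "U n \<in> H10 \<Omega>" and UR: "hnorm (U n) \<le> R" for n by (simp_all add: U_def u uR)
  have w: "w n \<in> H10 \<Omega>" for n unfolding w_def by (rule H10_diff[OF U v])
  note U1 = H10_imp_H1[OF U] and v1 = H10_imp_H1[OF v] and w1 = H10_imp_H1[OF w]
  have wd: "hnorm (w n) = (d \<circ> r3) n" for n by (simp add: w_def U_def r_def d_def)
  have w_lim: "(\<lambda>n. hnorm (w n)) \<longlonglongrightarrow> X0" using r3(2) unfolding wd o_def .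
  have wB: "hnorm (w n) \<le> R + hnorm v" for n using dB by (simp add: wd)
  have r23: "strict_mono (r2 \<circ> r3)" by (intro strict_mono_o r2 r3)
  have w_l2: "(\<lambda>n. l2norm M (w n)) \<longlonglongrightarrow> 0"
    using LIMSEQ_subseq_LIMSEQ[OF v2(2) r23] by (simp add: o_def w_def U_def r_def)
  have w_AE: "AE x in M. (\<lambda>n. w n x) \<longlonglongrightarrow> 0"
    using r2(2)
  proof eventually_elim
    case (elim x)
    have "(\<lambda>n. U n x) \<longlonglongrightarrow> v x"
      using LIMSEQ_subseq_LIMSEQ[OF elim r3(1)] by (simp add: o_def U_def r_def)
    then show ?case unfolding w_def by (simp add: LIM_zero_iff)
  qed
  have weak: "(\<lambda>n. hinner (w n) v) \<longlonglongrightarrow> 0"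
    unfolding w_def using weak_convergence[where u = U, OF U UR v _ v] w_l2 by (simp add: w_def)
  have U_eq: "U n = (\<lambda>x. w n x + v x)" for n by (simp add: w_def)
  have X0: "X0 \<ge> 0" using w_lim by (rule LIMSEQ_le_const) auto
  define X where "X = X0\<^sup>2"
  define dv where "dv = (hnorm v)\<^sup>2"
  have X_lim: "(\<lambda>n. (hnorm (w n))\<^sup>2) \<longlonglongrightarrow> X" unfolding X_def by (intro tendsto_power w_lim)
  \<comment> \<open>Weak convergence removes the cross term, so the squared norms split in the
    limit.\<close>
  have D_lim: "(\<lambda>n. (hnorm (U n))\<^sup>2) \<longlonglongrightarrow> X + dv"
  proof -
    have "(\<lambda>n. (hnorm (w n))\<^sup>2 + 2 * hinner (w n) v + (hnorm v)\<^sup>2) \<longlonglongrightarrow> X + 2 * 0 + dv"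
      unfolding dv_def by (intro tendsto_intros X_lim weak)
    then show ?thesis unfolding U_eq hnorm_add_squared[OF w1 v1] by simp
  qed
  have ip_lim: "(\<lambda>n. hinner (U n) (w n)) \<longlonglongrightarrow> X"
  proof -
    have "hinner (U n) (w n) = (hnorm (w n))\<^sup>2 + hinner (w n) v" for n
      unfolding U_eq using hinner_add_left[OF w1 v1 w1, of n n] by (simp add: hinner_self hinner_commute[of v])
    then show ?thesis using tendsto_add[OF X_lim weak] by simp
  qed
  obtain CP where CP: "CP > 0" "\<forall>u\<in>H10 \<Omega>. l2norm M u \<le> CP * hnorm u"
    by (rule H10_Poincare)
  have l2_lim: "(\<lambda>n. l2inner M (U n) (w n)) \<longlonglongrightarrow> 0"
  proof (rule Lim_null_comparison)
    show "\<forall>\<^sub>F n in sequentially. norm (l2inner M (U n) (w n)) \<le> CP * R * l2norm M (w n)"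
    proof (rule always_eventually, rule allI)
      fix n
      have "\<bar>l2inner M (U n) (w n)\<bar> \<le> l2norm M (U n) * l2norm M (w n)"
        by (rule l2_Cauchy_Schwarz[OF H1D(1)[OF U1] H1D(1)[OF w1]])
      also have "\<dots> \<le> CP * R * l2norm M (w n)"
      proof (rule mult_right_mono)
        have "l2norm M (U n) \<le> CP * hnorm (U n)" using CP(2) U by blast
        also have "\<dots> \<le> CP * R" using UR CP(1) by simp
        finally show "l2norm M (U n) \<le> CP * R" .
      qed simp
      finally show "norm (l2inner M (U n) (w n)) \<le> CP * R * l2norm M (w n)" by simp
    qed
    show "(\<lambda>n. CP * R * l2norm M (w n)) \<longlonglongrightarrow> 0" using tendsto_mult_right_zero[OF w_l2] by simp
  qed
  \<comment> \<open>The derivatives tend to 0 in the dual norm while the directions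
    \<open>w n\<close> stay bounded.\<close>
  have k_lim: "(\<lambda>n. kderiv a b \<gamma> lam (U n) (w n)) \<longlonglongrightarrow> 0"
  proof (rule Lim_null_comparison)
    show "\<forall>\<^sub>F n in sequentially. norm (kderiv a b \<gamma> lam (U n) (w n)) \<le> \<bar>H10_dual_norm \<Omega> (H10_derivative \<Omega> J (U n))\<bar> * (R + hnorm v)"
    proof (rule always_eventually, rule allI)
      fix n
      have "H10_derivative \<Omega> J (U n) \<in> H10_dual \<Omega>"
        unfolding J_def by (rule H10_derivative_dual[OF kirchhoff_has_derivative[OF U b \<gamma>1]])
      from H10_dual_norm_bound[OF this w[of n]]
      have "\<bar>kderiv a b \<gamma> lam (U n) (w n)\<bar> \<le> H10_dual_norm \<Omega> (H10_derivative \<Omega> J (U n)) * hnorm (w n)"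
        unfolding J_def kirchhoff_derivative[OF U b \<gamma>1 w] .
      also have "\<dots> \<le> \<bar>H10_dual_norm \<Omega> (H10_derivative \<Omega> J (U n))\<bar> * (R + hnorm v)"
        using wB[of n] by (intro mult_mono) auto
      finally show "norm (kderiv a b \<gamma> lam (U n) (w n)) \<le> \<bar>H10_dual_norm \<Omega> (H10_derivative \<Omega> J (U n))\<bar> * (R + hnorm v)" by simp
    qed
    have "(\<lambda>n. H10_dual_norm \<Omega> (H10_derivative \<Omega> J (U n))) \<longlonglongrightarrow> 0"
      using LIMSEQ_subseq_LIMSEQ[OF conjunct2[OF conjunct2[OF PS]] r] by (simp add: o_def U_def J_def)
    from tendsto_mult_left_zero[OF tendsto_rabs_zero[OF this]]
    show "(\<lambda>n. \<bar>H10_dual_norm \<Omega> (H10_derivative \<Omega> J (U n))\<bar> * (R + hnorm v)) \<longlonglongrightarrow> 0" .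
  qed
  \<comment> \<open>The critical term is found by solving the formula for the derivative; every
    other term in it has a known limit.\<close>
  have nlin_lim: "(\<lambda>n. nlin (U n) (w n)) \<longlonglongrightarrow> (a + b * (X + dv) powr (\<gamma> - 1)) * X"
  proof -
    have "(\<lambda>n. (a + b * ((hnorm (U n))\<^sup>2) powr (\<gamma> - 1)) * hinner (U n) (w n) - lam * l2inner M (U n) (w n) - kderiv a b \<gamma> lam (U n) (w n))
      \<longlonglongrightarrow> (a + b * (X + dv) powr (\<gamma> - 1)) * X - lam * 0 - 0"
      using \<gamma>1 by (intro tendsto_diff tendsto_mult tendsto_add tendsto_const tendsto_powr' D_lim ip_lim l2_lim k_lim) auto
    then show ?thesis by (simp add: kderiv_def)
  qed
  have upper_lim: "(\<lambda>n. Sp * hnorm (w n) powr p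
      + (p - 1) * (\<integral>x. (\<bar>w n x\<bar> + \<bar>v x\<bar>) powr (p - 2) * \<bar>v x\<bar> * \<bar>w n x\<bar> \<partial>M)) \<longlonglongrightarrow> Sp * X0 powr p + (p - 1) * 0"
    using p_gt_2 by (intro tendsto_add tendsto_mult tendsto_const tendsto_powr' w_lim mixed_term_tendsto_0[OF v w wB w_AE]) auto
  have "nlin (U n) (w n) \<le> Sp * hnorm (w n) powr p
      + (p - 1) * (\<integral>x. (\<bar>w n x\<bar> + \<bar>v x\<bar>) powr (p - 2) * \<bar>v x\<bar> * \<bar>w n x\<bar> \<partial>M)" for n
    using nlin_le_powr_plus_mixed[OF v w, of n] H10_powr_bound[OF w[of n]] unfolding U_eq by linarith
  then have "(a + b * (X + dv) powr (\<gamma> - 1)) * X \<le> Sp * X0 powr p + (p - 1) * 0"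
    by (intro LIMSEQ_le[OF nlin_lim upper_lim]) blast
  moreover have "X0 powr p = X powr (p / 2)"
  proof (cases "X0 = 0")
    case False
    with X0 have "X0\<^sup>2 = X0 powr 2" by simp
    then show ?thesis unfolding X_def by (simp only: powr_powr) simp
  qed (simp add: X_def)
  ultimately have le: "(a + b * (X + dv) powr (\<gamma> - 1)) * X \<le> Sp * X powr (p / 2)" by simp
  have "\<not> X > 0"
  proof
    assume Xpos: "X > 0"
    \<comment> \<open>The share of v in the nonlocal coefficient only enlarges the left side of
      \<open>le\<close>; discarding it by monotonicity contradicts the threshold at X.\<close>
    have "X powr (\<gamma> - 1) \<le> (X + dv) powr (\<gamma> - 1)"
      using Xpos \<gamma>1 by (intro powr_mono2) (auto simp: dv_def)
    then have "(a + b * X powr (\<gamma> - 1)) * X \<le> (a + b * (X + dv) powr (\<gamma> - 1)) * X"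
      using Xpos b by (intro mult_right_mono add_left_mono mult_left_mono) auto
    with le threshold[OF Xpos] show False by linarith
  qed
  then have "X0 = 0" by (simp add: X_def)
  with w_lim have "(\<lambda>n. hnorm (\<lambda>x. u (r n) x - v x)) \<longlonglongrightarrow> 0" by (simp add: w_def U_def)
  with v r show "\<exists>w\<in>H10 \<Omega>. \<exists>r. strict_mono r \<and> (\<lambda>j. hnorm (\<lambda>x. u (r j) x - w x)) \<longlonglongrightarrow> 0"
    by blast
qed

end

theorem theorem1p3:
  fixes \<Omega> :: "'a::euclidean_space set" and a b \<gamma> :: real
  assumes "DIM('a) \<ge> 3"
    and "open \<Omega>" and "connected \<Omega>" and "\<Omega> \<noteq> {}" and "bounded \<Omega>"
    and "a \<ge> 0" and "b > 0"
    and "\<gamma> > crit_exp DIM('a) / 2"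
    and "a powr (\<gamma> - crit_exp DIM('a) / 2) * b powr (crit_exp DIM('a) / 2 - 1)
         > (\<gamma> - crit_exp DIM('a) / 2) powr (\<gamma> - crit_exp DIM('a) / 2)
           * (crit_exp DIM('a) / 2 - 1) powr (crit_exp DIM('a) / 2 - 1)
           / (\<gamma> - 1) powr (\<gamma> - 1)
           * sobolev_const \<Omega> powr (- (crit_exp DIM('a) / 2) * (\<gamma> - 1))"
  shows "\<forall>lam>0. \<forall>c. PS_condition \<Omega> (kirchhoff_functional \<Omega> a b \<gamma> lam) c"
proof (intro allI impI)
  interpret sobolev_domain \<Omega> by unfold_locales (use assms in auto)
  fix lam c :: real assume lam: "lam > 0"
  have q: "p / 2 > 1" using p_gt_2 by simp
  show "PS_condition \<Omega> (kirchhoff_functional \<Omega> a b \<gamma> lam) c"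
  proof (rule kirchhoff_PS[OF assms(6,7) _ lam])
    show "\<gamma> > p / 2" using assms(8) by (simp add: p_def)
    fix X :: real assume X: "X > 0"
    \<comment> \<open>\<open>Sp\<close> is \<open>S powr (- q)\<close> for \<open>q = p / 2\<close>,
      so the two forms of the threshold coincide.\<close>
    show "Sp * X powr (p / 2) < (a + b * X powr (\<gamma> - 1)) * X"
      using threshold_inequality[OF assms(6,7) q _ sobolev_const_pos X] assms(8,9)
      by (simp add: p_def Sp_def)
  qed
qed

end
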